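(* Let $A$ be an irreducible affine Cartan matrix which is not of type $B_n^{(1)}, C_n^{(1)}, F_4^{(1)}, G_2^{(1)}$. Let $\mathcal A_{\tilde W}$ be the associated double affine Artin group, and let $\tilde{\mathcal A}$ be the quotient of the triple group $\mathcal A$ by the relations saying that $\mathcal C:=\mathcal T_{01}\mathcal T_{02}\mathcal T_{03}\mathcal T_{s_\theta}$ is central. Then the groups $\mathcal A_{\tilde W}$ and $\tilde{\mathcal A}$ are isomorphic.
   Context: $A=(a_{jk})_{0\le j,k\le n}$ is an irreducible affine Cartan matrix, labelled as in Kac's book, node $0$ being the affine node; types $B_n^{(1)}, C_n^{(1)}, F_4^{(1)}, G_2^{(1)}$ are excluded. In the Dynkin diagram $S(A)$ distinct nodes $i,j$ are connected by $a_{ij}a_{ji}$ laces. The braid relation between elements $x,y$ attached to distinct nodes $i,j$ is $xyx\cdots=yxy\cdots$ with $m_{ij}$ factors on each side, $m_{ij}=2,3,4,6$ for $0,1,2,3$ laces (no relation for $4$ laces, which happens only when $n=1$). The single lace Coxeter relation is $xyx=yxy$. Root data. $(a_0,\dots,a_n)$, $(a_0^\vee,\dots,a_n^\vee)$ are Kac's numerical labels of $S(A)$ and $S(A^t)$ ($a_0=1$ except $a_0=2$ for $A_{2n}^{(2)}$). Let $\alpha_0,\dots,\alpha_n$ be the simple roots, $\delta=\sum_j a_j\alpha_j$, $\theta=\delta-a_0\alpha_0$, $d_j=a_j/a_j^\vee$; on the real span of the $\alpha_j$ take the bilinear form $(\alpha_j,\alpha_k)=d_j^{-1}a_{jk}$,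 and put $\alpha_j^\vee=d_j\alpha_j$, $s_j(x)=x-(x,\alpha_j^\vee)\alpha_j$. The $s_0,\dots,s_n$ generate the affine Weyl group $W$, and $s_1,\dots,s_n$ the finite Weyl group $\mathring W$; $s_\theta\in\mathring W$ is the reflection in $\theta$. The lattice $\mathring Q$ is $\bigoplus_{j=1}^n\mathbb Z\alpha_j$, except for $A_{2n}^{(2)}$ where it is the weight lattice of the finite root system, i.e. $\bigoplus_{j=1}^{n-1}\mathbb Z\alpha_j\oplus\mathbb Z\tfrac12\alpha_n$. Put $Q=\mathring Q\oplus\mathbb Z a_0^{-1}\delta$. Put $\hat\alpha_i^\vee=\alpha_i^\vee$ for all $i$, except $\hat\alpha_n^\vee=2\alpha_n^\vee$ (the coroot of $\frac12\alpha_n$) for $A_{2n}^{(2)}$. Artin groups. The affine Artin group $\mathcal A_W$ has generators $T_0,\dots,T_n$ and the braid relations for all pairs of distinct nodes. The double affine Artin group $\mathcal A_{\tilde W}$ is generated by $\mathcal A_W$, the lattice $\mathcal Q_X=\{X_\beta:\beta\in\mathring Q\}$ (with $X_\beta X_\gamma=X_{\beta+\gamma}$) and an element $X_{a_0^{-1}\delta}$, with $X_{\beta+k a_0^{-1}\delta}:=X_\beta X_{a_0^{-1}\delta}^k$, subject to, for all $0\le i\le n$ and $\beta\in\mathring Q$: (i) $X_{a_0^{-1}\delta}$ is central; (ii) $T_iX_\beta=X_\beta T_i$ if $(\beta,\hat\alpha_i^\vee)=0$; (iii) $T_iX_\beta T_i=X_{s_i(\beta)}$ if $(\beta,\hat\alpha_i^\vee)=-1$.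 Triple group. $\mathcal A$ has generators $\mathcal T_i$, one for each node $i\ne0$, and $\mathcal T_{01},\mathcal T_{02},\mathcal T_{03}$ attached to node $0$; put $\mathcal D=\mathcal T_{01}\mathcal T_{02}\mathcal T_{03}$. Relations: a) the braid relation for each pair of generators attached to distinct nodes; b) if node $0$ is connected with a node $\alpha$ by a single lace, each of $\mathcal T_{01},\mathcal T_{02},\mathcal T_{03},\mathcal T_{01}\mathcal T_{02}\mathcal T_{01}^{-1},\mathcal T_{03}^{-1}\mathcal T_{02}\mathcal T_{03}$ satisfies the single lace Coxeter relation with $\mathcal D^k\mathcal T_\alpha\mathcal D^{-k}$ for all $k\in\mathbb Z$ (for every such $\alpha$); c) if node $0$ is connected with a node $\alpha$ by two laces, $\mathcal T_{0i}\mathcal T_\alpha^{-1}\mathcal T_{0j}\mathcal T_\alpha=\mathcal T_\alpha^{-1}\mathcal T_{0j}\mathcal T_\alpha\mathcal T_{0i}$ for $1\le i<j\le3$. For a reduced decomposition $s_\theta=s_{j_1}\cdots s_{j_m}$ in $\mathring W$, $\mathcal T_{s_\theta}:=\mathcal T_{j_1}\cdots\mathcal T_{j_m}$ (independent of the decomposition). *)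

theory Defs
  imports Complex_Main "HOL-Algebra.Group"
begin

section \<open>Groups given by generators and relations\<close>

text \<open>A letter \<open>(g, True)\<close> stands for the generator \<open>g\<close>, and \<open>(g, False)\<close> for its inverse.
  A relation \<open>u = v\<close> is a pair of words.\<close>

type_synonym 'g gword = "('g \<times> bool) list"

definition words_over :: "'g set \<Rightarrow> 'g gword set" where
  "words_over S = lists (S \<times> UNIV)"

definition word_gen :: "'g \<Rightarrow> 'g gword" where
  "word_gen g = [(g, True)]"

definition word_inv :: "'g gword \<Rightarrow> 'g gword" where
  "word_inv w = rev (map (\<lambda>(g, b). (g, \<not> b)) w)"

definition word_pow :: "'g gword \<Rightarrow> int \<Rightarrow> 'g gword" where
  "word_pow w k =
    (if k \<ge> 0 then concat (replicate (nat k) w)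
     else concat (replicate (nat (- k)) (word_inv w)))"

inductive word_cong :: "'g set \<Rightarrow> ('g gword \<times> 'g gword) set \<Rightarrow> 'g gword \<Rightarrow> 'g gword \<Rightarrow> bool"
  for S :: "'g set" and R :: "('g gword \<times> 'g gword) set" where
  refl: "w \<in> words_over S \<Longrightarrow> word_cong S R w w"
| sym: "word_cong S R u v \<Longrightarrow> word_cong S R v u"
| trans: "word_cong S R u v \<Longrightarrow> word_cong S R v w \<Longrightarrow> word_cong S R u w"
| mult: "word_cong S R u u' \<Longrightarrow> word_cong S R v v' \<Longrightarrow> word_cong S R (u @ v) (u' @ v')"
| cancel: "g \<in> S \<Longrightarrow> word_cong S R [(g, b), (g, \<not> b)] []"
| rel: "(u, v) \<in> R \<Longrightarrow> u \<in> words_over S \<Longrightarrow> v \<in> words_over S \<Longrightarrow> word_cong S R u v"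

definition presented_group :: "'g set \<Rightarrow> ('g gword \<times> 'g gword) set \<Rightarrow> 'g gword set monoid" where
  "presented_group S R =
    \<lparr>carrier = words_over S // {(u, v). word_cong S R u v},
     mult = (\<lambda>C D. \<Union>u\<in>C. \<Union>v\<in>D. {w. word_cong S R (u @ v) w}),
     one = {w. word_cong S R [] w}\<rparr>"

text \<open>The relations expressing that (the class of) \<open>c\<close> is central.\<close>

definition central_rels :: "'g set \<Rightarrow> 'g gword \<Rightarrow> ('g gword \<times> 'g gword) set" where
  "central_rels S c = {(c @ w, w @ c) | w. w \<in> words_over S}"

lemma words_over_Nil [simp]: "[] \<in> words_over S"
  by (simp add: words_over_def)

lemma words_over_append [simp]:
  "u @ v \<in> words_over S \<longleftrightarrow> u \<in> words_over S \<and> v \<in> words_over S"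
  by (auto simp: words_over_def)

lemma word_cong_words:
  "word_cong S R u v \<Longrightarrow> u \<in> words_over S \<and> v \<in> words_over S"
  by (induction rule: word_cong.induct) (auto simp: words_over_def)

lemma word_inv_words: "w \<in> words_over S \<Longrightarrow> word_inv w \<in> words_over S"
  by (auto simp: words_over_def word_inv_def)

lemma word_cong_inv_left:
  "w \<in> words_over S \<Longrightarrow> word_cong S R (word_inv w @ w) []"
proof (induction w)
  case Nil
  then show ?case by (simp add: word_inv_def word_cong.refl)
next
  case (Cons x w)
  obtain g b where x: "x = (g, b)" by (cases x)
  have g: "g \<in> S" and w: "w \<in> words_over S"
    using Cons.prems by (auto simp: words_over_def x)
  have "word_cong S R [(g, \<not> b), (g, b)] []"
    using word_cong.cancel[OF g, of R "\<not> b"] by simp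
  then have "word_cong S R (word_inv w @ [(g, \<not> b), (g, b)] @ w) (word_inv w @ [] @ w)"
    by (intro word_cong.mult word_cong.refl word_inv_words w)
  then have "word_cong S R (word_inv w @ [(g, \<not> b), (g, b)] @ w) []"
    using Cons.IH[OF w] word_cong.trans by fastforce
  then show ?case by (simp add: word_inv_def x)
qed

lemma equiv_word_cong: "equiv (words_over S) {(u, v). word_cong S R u v}"
  by (rule equivI)
    (auto simp: refl_on_def sym_def trans_def intro: word_cong.intros dest: word_cong_words)

lemma presented_group_mult:
  assumes "u \<in> words_over S" "v \<in> words_over S"
  shows "{w. word_cong S R u w} \<otimes>\<^bsub>presented_group S R\<^esub> {w. word_cong S R v w}
    = {w. word_cong S R (u @ v) w}"
  using assms by (auto simp: presented_group_def intro: word_cong.intros)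

lemma group_presented_group: "group (presented_group S R)"
proof -
  let ?G = "presented_group S R"
  let ?c = "\<lambda>u. {w. word_cong S R u w}"
  have car: "C \<in> carrier ?G \<longleftrightarrow> (\<exists>u\<in>words_over S. C = ?c u)" for C
    by (auto simp: presented_group_def quotient_def)
  have one: "\<one>\<^bsub>?G\<^esub> = ?c []" by (simp add: presented_group_def)
  show ?thesis
  proof (rule groupI)
    show "C \<otimes>\<^bsub>?G\<^esub> D \<in> carrier ?G" if "C \<in> carrier ?G" "D \<in> carrier ?G" for C D
      using that by (fastforce simp: car presented_group_mult)
    show "\<one>\<^bsub>?G\<^esub> \<in> carrier ?G" unfolding car one by (rule bexI[of _ "[]"]) auto
    show "C \<otimes>\<^bsub>?G\<^esub> D \<otimes>\<^bsub>?G\<^esub> E = C \<otimes>\<^bsub>?G\<^esub> (D \<otimes>\<^bsub>?G\<^esub> E)"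
      if "C \<in> carrier ?G" "D \<in> carrier ?G" "E \<in> carrier ?G" for C D E
      using that by (auto simp: car presented_group_mult)
    show "\<one>\<^bsub>?G\<^esub> \<otimes>\<^bsub>?G\<^esub> C = C" if "C \<in> carrier ?G" for C
      using that by (auto simp: car one presented_group_mult)
    show "\<exists>D\<in>carrier ?G. D \<otimes>\<^bsub>?G\<^esub> C = \<one>\<^bsub>?G\<^esub>" if C: "C \<in> carrier ?G" for C
    proof -
      obtain u where u: "u \<in> words_over S" "C = ?c u" using C car by blast
      have "?c (word_inv u @ u) = ?c []"
        using word_cong_inv_left[OF u(1), of R] by (blast intro: word_cong.sym word_cong.trans)
      then have "?c (word_inv u) \<otimes>\<^bsub>?G\<^esub> C = \<one>\<^bsub>?G\<^esub>"
        using u word_inv_words[OF u(1)] by (simp only: one presented_group_mult)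
      moreover have "?c (word_inv u) \<in> carrier ?G"
        unfolding car using word_inv_words[OF u(1)] by blast
      ultimately show ?thesis by blast
    qed
  qed
qed


section \<open>Irreducible affine Cartan matrices\<close>

text \<open>Matrices have index set \<open>{0..n}\<close>; entries outside this range are irrelevant.
  The affine condition is Kac's (Aff): corank one, a positive null vector, and \<open>A v \<ge> 0\<close>
  implies \<open>A v = 0\<close>.\<close>

definition mat_vec :: "nat \<Rightarrow> (nat \<Rightarrow> nat \<Rightarrow> int) \<Rightarrow> (nat \<Rightarrow> real) \<Rightarrow> nat \<Rightarrow> real" where
  "mat_vec n A v i = (\<Sum>j\<le>n. of_int (A i j) * v j)"

definition generalized_Cartan_matrix :: "nat \<Rightarrow> (nat \<Rightarrow> nat \<Rightarrow> int) \<Rightarrow> bool" where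
  "generalized_Cartan_matrix n A \<longleftrightarrow>
    (\<forall>i\<le>n. A i i = 2) \<and>
    (\<forall>i\<le>n. \<forall>j\<le>n. i \<noteq> j \<longrightarrow> A i j \<le> 0 \<and> (A i j = 0 \<longleftrightarrow> A j i = 0))"

definition irreducible_matrix :: "nat \<Rightarrow> (nat \<Rightarrow> nat \<Rightarrow> int) \<Rightarrow> bool" where
  "irreducible_matrix n A \<longleftrightarrow>
    \<not> (\<exists>I. I \<noteq> {} \<and> I \<subset> {..n} \<and> (\<forall>i\<in>I. \<forall>j\<in>{..n} - I. A i j = 0 \<and> A j i = 0))"

definition affine_matrix :: "nat \<Rightarrow> (nat \<Rightarrow> nat \<Rightarrow> int) \<Rightarrow> bool" where
  "affine_matrix n A \<longleftrightarrow>
    (\<exists>u. (\<forall>j\<le>n. u j > 0) \<and> (\<forall>i\<le>n. mat_vec n A u i = 0) \<and>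
      (\<forall>v. (\<forall>i\<le>n. mat_vec n A v i = 0) \<longrightarrow> (\<exists>c. \<forall>j\<le>n. v j = c * u j))) \<and>
    (\<forall>v. (\<forall>i\<le>n. mat_vec n A v i \<ge> 0) \<longrightarrow> (\<forall>i\<le>n. mat_vec n A v i = 0))"

definition irreducible_affine_Cartan_matrix :: "nat \<Rightarrow> (nat \<Rightarrow> nat \<Rightarrow> int) \<Rightarrow> bool" where
  "irreducible_affine_Cartan_matrix n A \<longleftrightarrow>
    generalized_Cartan_matrix n A \<and> irreducible_matrix n A \<and> affine_matrix n A"

text \<open>The types in Kac's tables Aff 1, Aff 2, Aff 3. The names \<open>A1\<close>, \<dots>, \<open>G1\<close> are the untwisted
  ones. \<open>A2_even n\<close> is \<open>A\<^sub>2\<^sub>n\<^sup>(\<^sup>2\<^sup>)\<close>, \<open>A2_odd n\<close> is \<open>A\<^sub>2\<^sub>n\<^sub>-\<^sub>1\<^sup>(\<^sup>2\<^sup>)\<close>, \<open>D2 n\<close> is \<open>D\<^sub>n\<^sub>+\<^sub>1\<^sup>(\<^sup>2\<^sup>)\<close>,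
  \<open>E2\<close> is \<open>E\<^sub>6\<^sup>(\<^sup>2\<^sup>)\<close> and \<open>D3\<close> is \<open>D\<^sub>4\<^sup>(\<^sup>3\<^sup>)\<close>.\<close>

datatype affine_type =
    A1 nat | B1 nat | C1 nat | D1 nat | E6_1 | E7_1 | E8_1 | F4_1 | G2_1
  | A2_even nat | A2_odd nat | D2 nat | E2 | D3

fun type_rank :: "affine_type \<Rightarrow> nat" where
  "type_rank (A1 n) = n"
| "type_rank (B1 n) = n"
| "type_rank (C1 n) = n"
| "type_rank (D1 n) = n"
| "type_rank E6_1 = 6"
| "type_rank E7_1 = 7"
| "type_rank E8_1 = 8"
| "type_rank F4_1 = 4"
| "type_rank G2_1 = 2"
| "type_rank (A2_even n) = n"
| "type_rank (A2_odd n) = n"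
| "type_rank (D2 n) = n"
| "type_rank E2 = 4"
| "type_rank D3 = 2"

fun valid_type :: "affine_type \<Rightarrow> bool" where
  "valid_type (A1 n) \<longleftrightarrow> n \<ge> 1"
| "valid_type (B1 n) \<longleftrightarrow> n \<ge> 3"
| "valid_type (C1 n) \<longleftrightarrow> n \<ge> 2"
| "valid_type (D1 n) \<longleftrightarrow> n \<ge> 4"
| "valid_type (A2_even n) \<longleftrightarrow> n \<ge> 1"
| "valid_type (A2_odd n) \<longleftrightarrow> n \<ge> 3"
| "valid_type (D2 n) \<longleftrightarrow> n \<ge> 2"
| "valid_type _ \<longleftrightarrow> True"

text \<open>Dynkin diagrams in Kac's labelling: an edge \<open>(i, j, p, q)\<close> means \<open>a\<^sub>i\<^sub>j = -p\<close> and \<open>a\<^sub>j\<^sub>i = -q\<close>.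
  Kac's arrow points to \<open>i\<close> if \<open>p > q\<close>, and to \<open>j\<close> if \<open>q > p\<close>.\<close>

definition diagram_path :: "nat \<Rightarrow> nat \<Rightarrow> (nat \<times> nat \<times> nat \<times> nat) set" where
  "diagram_path i j = {(k, Suc k, 1, 1) | k. i \<le> k \<and> k < j}"

fun kac_diagram :: "affine_type \<Rightarrow> (nat \<times> nat \<times> nat \<times> nat) set" where
  "kac_diagram (A1 n) =
    (if n = 1 then {(0, 1, 2, 2)} else diagram_path 0 n \<union> {(n, 0, 1, 1)})"
| "kac_diagram (B1 n) = {(0, 2, 1, 1)} \<union> diagram_path 1 (n - 1) \<union> {(n - 1, n, 1, 2)}"
| "kac_diagram (C1 n) = {(0, 1, 1, 2)} \<union> diagram_path 1 (n - 1) \<union> {(n - 1, n, 2, 1)}"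
| "kac_diagram (D1 n) = {(0, 2, 1, 1)} \<union> diagram_path 1 (n - 1) \<union> {(n - 2, n, 1, 1)}"
| "kac_diagram E6_1 = diagram_path 1 5 \<union> {(3, 6, 1, 1), (6, 0, 1, 1)}"
| "kac_diagram E7_1 = diagram_path 0 6 \<union> {(3, 7, 1, 1)}"
| "kac_diagram E8_1 = diagram_path 0 7 \<union> {(5, 8, 1, 1)}"
| "kac_diagram F4_1 = diagram_path 0 2 \<union> {(2, 3, 1, 2), (3, 4, 1, 1)}"
| "kac_diagram G2_1 = {(0, 1, 1, 1), (1, 2, 1, 3)}"
| "kac_diagram (A2_even n) =
    (if n = 1 then {(0, 1, 4, 1)}
     else {(0, 1, 2, 1)} \<union> diagram_path 1 (n - 1) \<union> {(n - 1, n, 2, 1)})"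
| "kac_diagram (A2_odd n) = {(0, 2, 1, 1)} \<union> diagram_path 1 (n - 1) \<union> {(n - 1, n, 2, 1)}"
| "kac_diagram (D2 n) = {(0, 1, 2, 1)} \<union> diagram_path 1 (n - 1) \<union> {(n - 1, n, 1, 2)}"
| "kac_diagram E2 = diagram_path 0 2 \<union> {(2, 3, 2, 1), (3, 4, 1, 1)}"
| "kac_diagram D3 = {(0, 1, 1, 1), (1, 2, 3, 1)}"

definition has_kac_type :: "nat \<Rightarrow> (nat \<Rightarrow> nat \<Rightarrow> int) \<Rightarrow> affine_type \<Rightarrow> bool" where
  "has_kac_type n A X \<longleftrightarrow>
    valid_type X \<and> n = type_rank X \<and> (\<forall>i\<le>n. A i i = 2) \<and>
    (\<forall>(i, j, p, q) \<in> kac_diagram X. A i j = - int p \<and> A j i = - int q) \<and>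
    (\<forall>i\<le>n. \<forall>j\<le>n. i \<noteq> j \<and>
      \<not> (\<exists>p q. (i, j, p, q) \<in> kac_diagram X \<or> (j, i, p, q) \<in> kac_diagram X) \<longrightarrow> A i j = 0)"

definition kac_labelled :: "nat \<Rightarrow> (nat \<Rightarrow> nat \<Rightarrow> int) \<Rightarrow> bool" where
  "kac_labelled n A \<longleftrightarrow> (\<exists>X. has_kac_type n A X)"

definition is_A2_even :: "nat \<Rightarrow> (nat \<Rightarrow> nat \<Rightarrow> int) \<Rightarrow> bool" where
  "is_A2_even n A \<longleftrightarrow> has_kac_type n A (A2_even n)"

definition laces :: "(nat \<Rightarrow> nat \<Rightarrow> int) \<Rightarrow> nat \<Rightarrow> nat \<Rightarrow> int" where
  "laces A i j = A i j * A j i"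


section \<open>Root data\<close>

text \<open>The unique vector of coprime positive integers in the kernel of \<open>A\<close>
  (extended by \<open>0\<close> outside \<open>{0..n}\<close>).\<close>

definition numerical_labels :: "nat \<Rightarrow> (nat \<Rightarrow> nat \<Rightarrow> int) \<Rightarrow> nat \<Rightarrow> nat" where
  "numerical_labels n A =
    (THE a. (\<forall>j. a j > 0 \<longleftrightarrow> j \<le> n) \<and> Gcd (a ` {..n}) = 1 \<and>
      (\<forall>i\<le>n. (\<Sum>j\<le>n. A i j * int (a j)) = 0))"

definition dual_labels :: "nat \<Rightarrow> (nat \<Rightarrow> nat \<Rightarrow> int) \<Rightarrow> nat \<Rightarrow> nat" where
  "dual_labels n A = numerical_labels n (\<lambda>i j. A j i)"

definition d_coeff :: "nat \<Rightarrow> (nat \<Rightarrow> nat \<Rightarrow> int) \<Rightarrow> nat \<Rightarrow> real" where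
  "d_coeff n A j = real (numerical_labels n A j) / real (dual_labels n A j)"

text \<open>Elements of the real span of \<open>\<alpha>\<^sub>0, \<dots>, \<alpha>\<^sub>n\<close> are represented by their coordinates
  with respect to the \<open>\<alpha>\<^sub>j\<close>.\<close>

type_synonym rvec = "nat \<Rightarrow> real"

definition root_space :: "nat \<Rightarrow> rvec set" where
  "root_space n = {x. \<forall>j>n. x j = 0}"

definition vadd :: "rvec \<Rightarrow> rvec \<Rightarrow> rvec" where
  "vadd x y = (\<lambda>j. x j + y j)"

definition vscale :: "real \<Rightarrow> rvec \<Rightarrow> rvec" where
  "vscale c x = (\<lambda>j. c * x j)"

definition root_form :: "nat \<Rightarrow> (nat \<Rightarrow> nat \<Rightarrow> int) \<Rightarrow> rvec \<Rightarrow> rvec \<Rightarrow> real" where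
  "root_form n A x y = (\<Sum>j\<le>n. \<Sum>k\<le>n. x j * y k * (inverse (d_coeff n A j) * of_int (A j k)))"

definition simple_root :: "nat \<Rightarrow> rvec" where
  "simple_root j = (\<lambda>k. if k = j then 1 else 0)"

definition simple_coroot :: "nat \<Rightarrow> (nat \<Rightarrow> nat \<Rightarrow> int) \<Rightarrow> nat \<Rightarrow> rvec" where
  "simple_coroot n A j = vscale (d_coeff n A j) (simple_root j)"

definition hat_coroot :: "nat \<Rightarrow> (nat \<Rightarrow> nat \<Rightarrow> int) \<Rightarrow> nat \<Rightarrow> rvec" where
  "hat_coroot n A i =
    (if is_A2_even n A \<and> i = n then vscale 2 (simple_coroot n A n) else simple_coroot n A i)"

definition simple_refl :: "nat \<Rightarrow> (nat \<Rightarrow> nat \<Rightarrow> int) \<Rightarrow> nat \<Rightarrow> rvec \<Rightarrow> rvec" where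
  "simple_refl n A j x = vadd x (vscale (- root_form n A x (simple_coroot n A j)) (simple_root j))"

definition delta_vec :: "nat \<Rightarrow> (nat \<Rightarrow> nat \<Rightarrow> int) \<Rightarrow> rvec" where
  "delta_vec n A = (\<lambda>j. if j \<le> n then real (numerical_labels n A j) else 0)"

definition reduced_delta :: "nat \<Rightarrow> (nat \<Rightarrow> nat \<Rightarrow> int) \<Rightarrow> rvec" where
  "reduced_delta n A = vscale (inverse (real (numerical_labels n A 0))) (delta_vec n A)"

definition theta_vec :: "nat \<Rightarrow> (nat \<Rightarrow> nat \<Rightarrow> int) \<Rightarrow> rvec" where
  "theta_vec n A =
    vadd (delta_vec n A) (vscale (- real (numerical_labels n A 0)) (simple_root 0))"

definition theta_refl :: "nat \<Rightarrow> (nat \<Rightarrow> nat \<Rightarrow> int) \<Rightarrow> rvec \<Rightarrow> rvec" where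
  "theta_refl n A x =
    vadd x (vscale (- (2 * root_form n A x (theta_vec n A)
                        / root_form n A (theta_vec n A) (theta_vec n A))) (theta_vec n A))"

definition finite_lattice :: "nat \<Rightarrow> (nat \<Rightarrow> nat \<Rightarrow> int) \<Rightarrow> rvec set" where
  "finite_lattice n A =
    {\<beta>. (\<forall>j. j = 0 \<or> j > n \<longrightarrow> \<beta> j = 0) \<and>
        (\<forall>j\<in>{1..n}. if is_A2_even n A \<and> j = n then 2 * \<beta> j \<in> \<int> else \<beta> j \<in> \<int>)}"

text \<open>Decompositions into simple reflections of the finite Weyl group; the affine Weyl group acts
  faithfully on \<^term>\<open>root_space n\<close>, so its elements are identified with linear maps of this space.\<close>

definition theta_decomposition :: "nat \<Rightarrow> (nat \<Rightarrow> nat \<Rightarrow> int) \<Rightarrow> nat list \<Rightarrow> bool" where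
  "theta_decomposition n A js \<longleftrightarrow>
    set js \<subseteq> {1..n} \<and> (\<forall>x\<in>root_space n. foldr (simple_refl n A) js x = theta_refl n A x)"

definition reduced_theta_decomposition :: "nat \<Rightarrow> (nat \<Rightarrow> nat \<Rightarrow> int) \<Rightarrow> nat list \<Rightarrow> bool" where
  "reduced_theta_decomposition n A js \<longleftrightarrow>
    theta_decomposition n A js \<and>
    (\<forall>ks. theta_decomposition n A ks \<longrightarrow> length js \<le> length ks)"


section \<open>Braid relations\<close>

fun alternating :: "nat \<Rightarrow> 'g gword \<Rightarrow> 'g gword \<Rightarrow> 'g gword" where
  "alternating 0 x y = []"
| "alternating (Suc m) x y = x @ alternating m y x"

definition braid_length :: "(nat \<Rightarrow> nat \<Rightarrow> int) \<Rightarrow> nat \<Rightarrow> nat \<Rightarrow> nat option" where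
  "braid_length A i j =
    (if laces A i j = 0 then Some 2 else if laces A i j = 1 then Some 3
     else if laces A i j = 2 then Some 4 else if laces A i j = 3 then Some 6 else None)"

text \<open>Each generator \<open>g\<close> is attached to the node \<open>node g\<close>.\<close>

definition braid_rels ::
    "(nat \<Rightarrow> nat \<Rightarrow> int) \<Rightarrow> ('g \<Rightarrow> nat) \<Rightarrow> 'g set \<Rightarrow> ('g gword \<times> 'g gword) set" where
  "braid_rels A node S =
    {(alternating m (word_gen g) (word_gen h), alternating m (word_gen h) (word_gen g)) | g h m.
      g \<in> S \<and> h \<in> S \<and> node g \<noteq> node h \<and> braid_length A (node g) (node h) = Some m}"


section \<open>The double affine Artin group\<close>

text \<open>\<open>DX \<beta>\<close> is the generator attached to \<open>\<beta>\<close> in the finite lattice; \<open>DXdelta\<close> is the one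
  attached to \<open>\<delta>/a\<^sub>0\<close>.\<close>

datatype daa_gen = DT nat | DX rvec | DXdelta

fun DT_node :: "daa_gen \<Rightarrow> nat" where
  "DT_node (DT i) = i"
| "DT_node _ = undefined"

definition affine_artin_gens :: "nat \<Rightarrow> daa_gen set" where
  "affine_artin_gens n = DT ` {..n}"

definition affine_artin_rels :: "nat \<Rightarrow> (nat \<Rightarrow> nat \<Rightarrow> int) \<Rightarrow> (daa_gen gword \<times> daa_gen gword) set" where
  "affine_artin_rels n A = braid_rels A DT_node (affine_artin_gens n)"

definition daa_gens :: "nat \<Rightarrow> (nat \<Rightarrow> nat \<Rightarrow> int) \<Rightarrow> daa_gen set" where
  "daa_gens n A = affine_artin_gens n \<union> DX ` finite_lattice n A \<union> {DXdelta}"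

definition lattice_rels :: "nat \<Rightarrow> (nat \<Rightarrow> nat \<Rightarrow> int) \<Rightarrow> (daa_gen gword \<times> daa_gen gword) set" where
  "lattice_rels n A =
    {(word_gen (DX \<beta>) @ word_gen (DX \<gamma>), word_gen (DX (vadd \<beta> \<gamma>))) | \<beta> \<gamma>.
      \<beta> \<in> finite_lattice n A \<and> \<gamma> \<in> finite_lattice n A}"

definition X_word :: "rvec \<Rightarrow> int \<Rightarrow> daa_gen gword" where
  "X_word \<beta> k = word_gen (DX \<beta>) @ word_pow (word_gen DXdelta) k"

definition daa_commute_rels :: "nat \<Rightarrow> (nat \<Rightarrow> nat \<Rightarrow> int) \<Rightarrow> (daa_gen gword \<times> daa_gen gword) set" where
  "daa_commute_rels n A =
    {(word_gen (DT i) @ word_gen (DX \<beta>), word_gen (DX \<beta>) @ word_gen (DT i)) | i \<beta>.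
      i \<le> n \<and> \<beta> \<in> finite_lattice n A \<and> root_form n A \<beta> (hat_coroot n A i) = 0}"

text \<open>\<open>s\<^sub>i(\<beta>)\<close> lies in the lattice \<open>Q\<close>; \<open>\<gamma>\<close> and \<open>k\<close> below are its components in
  the direct sum of the finite lattice and the integer multiples of \<open>\<delta>/a\<^sub>0\<close>.\<close>

definition daa_reflect_rels :: "nat \<Rightarrow> (nat \<Rightarrow> nat \<Rightarrow> int) \<Rightarrow> (daa_gen gword \<times> daa_gen gword) set" where
  "daa_reflect_rels n A =
    {(word_gen (DT i) @ word_gen (DX \<beta>) @ word_gen (DT i), X_word \<gamma> k) | i \<beta> \<gamma> k.
      i \<le> n \<and> \<beta> \<in> finite_lattice n A \<and> root_form n A \<beta> (hat_coroot n A i) = -1 \<and>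
      \<gamma> \<in> finite_lattice n A \<and>
      simple_refl n A i \<beta> = vadd \<gamma> (vscale (of_int k) (reduced_delta n A))}"

definition double_affine_Artin_group ::
    "nat \<Rightarrow> (nat \<Rightarrow> nat \<Rightarrow> int) \<Rightarrow> daa_gen gword set monoid" where
  "double_affine_Artin_group n A =
    presented_group (daa_gens n A)
      (affine_artin_rels n A \<union> lattice_rels n A
       \<union> central_rels (daa_gens n A) (word_gen DXdelta)
       \<union> daa_commute_rels n A \<union> daa_reflect_rels n A)"


section \<open>The triple group\<close>

text \<open>\<open>TN i\<close> is attached to the node \<open>i \<noteq> 0\<close>; \<open>TZ 1\<close>, \<open>TZ 2\<close>, \<open>TZ 3\<close> are attached to the
  affine node.\<close>

datatype triple_gen = TN nat | TZ nat

fun triple_node :: "triple_gen \<Rightarrow> nat" where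
  "triple_node (TN i) = i"
| "triple_node (TZ _) = 0"

definition triple_gens :: "nat \<Rightarrow> triple_gen set" where
  "triple_gens n = TN ` {1..n} \<union> TZ ` {1..3}"

abbreviation tn :: "nat \<Rightarrow> triple_gen gword" where
  "tn i \<equiv> word_gen (TN i)"

abbreviation tz :: "nat \<Rightarrow> triple_gen gword" where
  "tz i \<equiv> word_gen (TZ i)"

definition D_word :: "triple_gen gword" where
  "D_word = tz 1 @ tz 2 @ tz 3"

definition single_lace_elements :: "triple_gen gword set" where
  "single_lace_elements =
    {tz 1, tz 2, tz 3, tz 1 @ tz 2 @ word_inv (tz 1), word_inv (tz 3) @ tz 2 @ tz 3}"

definition single_lace_rels :: "nat \<Rightarrow> (nat \<Rightarrow> nat \<Rightarrow> int) \<Rightarrow> (triple_gen gword \<times> triple_gen gword) set" where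
  "single_lace_rels n A =
    {(x @ y @ x, y @ x @ y) | x y i k.
      i \<in> {1..n} \<and> laces A 0 i = 1 \<and> x \<in> single_lace_elements \<and>
      y = word_pow D_word k @ tn i @ word_pow D_word (- k)}"

definition double_lace_rels :: "nat \<Rightarrow> (nat \<Rightarrow> nat \<Rightarrow> int) \<Rightarrow> (triple_gen gword \<times> triple_gen gword) set" where
  "double_lace_rels n A =
    {(tz i @ word_inv (tn l) @ tz j @ tn l, word_inv (tn l) @ tz j @ tn l @ tz i) | i j l.
      l \<in> {1..n} \<and> laces A 0 l = 2 \<and> 1 \<le> i \<and> i < j \<and> j \<le> 3}"

definition triple_rels :: "nat \<Rightarrow> (nat \<Rightarrow> nat \<Rightarrow> int) \<Rightarrow> (triple_gen gword \<times> triple_gen gword) set" where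
  "triple_rels n A =
    braid_rels A triple_node (triple_gens n) \<union> single_lace_rels n A \<union> double_lace_rels n A"

definition triple_group :: "nat \<Rightarrow> (nat \<Rightarrow> nat \<Rightarrow> int) \<Rightarrow> triple_gen gword set monoid" where
  "triple_group n A = presented_group (triple_gens n) (triple_rels n A)"

definition C_word :: "nat list \<Rightarrow> triple_gen gword" where
  "C_word js = tz 1 @ tz 2 @ tz 3 @ concat (map tn js)"

text \<open>The quotient of the triple group by the relations saying that \<open>\<C>\<close> is central, where
  \<open>\<T>\<close> of \<open>s\<^sub>\<theta>\<close> is computed from the decomposition \<open>js\<close> of \<open>s\<^sub>\<theta>\<close>.\<close>

definition triple_group_quotient ::
    "nat \<Rightarrow> (nat \<Rightarrow> nat \<Rightarrow> int) \<Rightarrow> nat list \<Rightarrow> triple_gen gword set monoid" where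
  "triple_group_quotient n A js =
    presented_group (triple_gens n)
      (triple_rels n A \<union> central_rels (triple_gens n) (C_word js))"

end

theory Submission
  imports Defs "HOL-Library.Function_Algebras"
begin

text \<open>Invert a letter of a word in the simple reflections whenever the affine root it crosses has
  negative gradient. Since the signs change at most once around a rank two residue, this defines a
  section of the affine Weyl group in its Artin group, and on translations it yields Bernstein's
  elements \<open>X\<^sub>\<beta>\<close>. Thus the relations of the double affine Artin group that do not involve \<open>T\<^sub>0\<close> come from
  an affine Artin group, generated by \<open>T\<^sub>1, \<dots>, T\<^sub>n\<close> and \<open>X\<^sub>\<theta> T\<^sup>-\<^sup>1\<close> with \<open>T\<close> that of \<open>s\<^sub>\<theta>\<close>.

  The isomorphism sends the three generators at the affine node to \<open>T\<^sub>0\<close>, \<open>T\<^sub>0\<^sup>-\<^sup>1 X\<^bsub>\<alpha>\<^sub>0\<^esub>\<close> and \<open>X\<^sub>\<theta> T\<^sup>-\<^sup>1\<close>,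
  and \<open>\<C>\<close> to \<open>X\<^sub>\<delta>\<close>. What remains are the relations between \<open>T\<^sub>0\<close> and the \<open>X\<^sub>\<beta>\<close>: rank two computations
  give them for few \<open>\<beta>\<close>, and conjugation by \<open>T\<^sub>i\<close> with \<open>i\<close> not joined to the affine node
  propagates them to generators of the lattice. After rescaling \<open>\<alpha>\<^sub>n\<close> the presentations for
  \<open>A\<^sub>2\<^sub>n\<^sup>(\<^sup>2\<^sup>)\<close> become those for \<open>D\<^sub>n\<^sub>+\<^sub>1\<^sup>(\<^sup>2\<^sup>)\<close>.\<close>

section \<open>Noncommutative multiplicative groups\<close>

text \<open>The usual route to the elements of the lattice writes a vector as a difference of
  dominant ones and needs lengths of translations to add. Here the signs of the section depend on a
  root only modulo \<delta>, and translations fix roots modulo \<delta>, so the section is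
  multiplicative on translations at once. In the code, \<open>tau\<close> keeps a letter where
  \<open>psi\<close> is negative and inverts it where \<open>psi\<close> is positive. The
  construction reaches only the lattice spanned by the orbit of \<theta>. In the types treated
  \<theta> has minimal length and its orbit spans everything. In the excluded types some simple root
  is shorter than \<theta>, the span is a proper sublattice, and a symmetrizer \<open>e\<close> with
  \<open>e 0 = 1\<close> would not be integral. The infinitely many single lace relations reduce to
  finitely many: conjugation by the product of the three affine generators is, up to the central
  \<open>X\<close> of \<delta>, conjugation by the inverse of \<open>T\<close> of the reflection in
  \<theta>, and this preserves a set of conjugates of the generators at the neighbours of node
  0.\<close>

class mgroup = monoid_mult + inverse +
  assumes left_inverse': "inverse a * a = 1"
begin

lemma mult_left_cancel': "a * b = a * c \<longleftrightarrow> b = c"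
  by (metis left_inverse' mult_assoc mult_1_left)

lemma right_inverse': "a * inverse a = 1"
  by (metis left_inverse' mult_assoc mult_1_left mult_1_right)

lemma inverse_inverse': "inverse (inverse a) = a"
  by (metis left_inverse' right_inverse' mult_assoc mult_1_left mult_1_right)

lemma inverse_mult': "inverse (a * b) = inverse b * inverse a"
  by (metis left_inverse' right_inverse' mult_assoc mult_1_left mult_1_right)

lemma inverse_one': "inverse 1 = 1"
  by (metis right_inverse' mult_1_left)

lemma inverse_cancel_left': "inverse a * (a * b) = b"
  by (metis left_inverse' mult_assoc mult_1_left)

lemma cancel_inverse_left': "a * (inverse a * b) = b"
  by (metis right_inverse' mult_assoc mult_1_left)

lemmas group_simps = mult_assoc inverse_mult' inverse_inverse' inverse_one' left_inverse' right_inverse'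
  inverse_cancel_left' cancel_inverse_left' mult_1_left mult_1_right mult_left_cancel'

lemma eq_inverse_mult: "a = inverse b * c \<longleftrightarrow> b * a = c"
  by (metis cancel_inverse_left' inverse_cancel_left')

lemma eq_mult_inverse: "a = c * inverse b \<longleftrightarrow> a * b = c"
  by (metis left_inverse' right_inverse' mult_assoc mult_1_right)

lemma mult_right_cancel': "b * a = c * a \<longleftrightarrow> b = c"
  by (metis right_inverse' mult_assoc mult_1_right)

definition commutes :: "'a \<Rightarrow> 'a \<Rightarrow> bool" where
  "commutes a b \<longleftrightarrow> a * b = b * a"

lemma commutes_sym: "commutes a b \<Longrightarrow> commutes b a"
  by (simp add: commutes_def)

lemma commutes_one [simp]: "commutes a 1"
  by (simp add: commutes_def)

lemma commutes_refl [simp]: "commutes a a"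
  by (simp add: commutes_def)

lemma commutes_mult: "commutes a b \<Longrightarrow> commutes a c \<Longrightarrow> commutes a (b * c)"
  unfolding commutes_def by (metis mult_assoc)

lemma commutes_inverse: "commutes a b \<Longrightarrow> commutes a (inverse b)"
  unfolding commutes_def by (metis eq_inverse_mult eq_mult_inverse mult_assoc)

lemma commutes_mult': "commutes b a \<Longrightarrow> commutes c a \<Longrightarrow> commutes (b * c) a"
  by (meson commutes_mult commutes_sym)

lemma commutes_inverse': "commutes a b \<Longrightarrow> commutes (inverse a) b"
  by (meson commutes_inverse commutes_sym)

lemma commutes_prod_list: "(\<And>b. b \<in> set bs \<Longrightarrow> commutes a b) \<Longrightarrow> commutes a (prod_list bs)"
  by (induction bs) (auto intro: commutes_mult)

lemma commutes_prod_list': "(\<And>b. b \<in> set bs \<Longrightarrow> commutes b a) \<Longrightarrow> commutes (prod_list bs) a"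
  by (metis commutes_prod_list commutes_sym)

definition braids :: "'a \<Rightarrow> 'a \<Rightarrow> bool" where
  "braids a b \<longleftrightarrow> a * b * a = b * a * b"

lemma braids_conj: "braids (g * a * inverse g) (g * b * inverse g) \<longleftrightarrow> braids a b"
  unfolding braids_def by (simp add: group_simps) (metis mult_assoc mult_right_cancel')

lemma braids_commuting_conj: "commutes g a \<Longrightarrow> braids a b \<Longrightarrow> braids a (g * b * inverse g)"
  using braids_conj[of g a b]
  by (metis commutes_def eq_mult_inverse)

fun alt_prod :: "nat \<Rightarrow> 'a \<Rightarrow> 'a \<Rightarrow> 'a" where
  "alt_prod 0 a b = 1"
| "alt_prod (Suc m) a b = a * alt_prod m b a"

definition zpow :: "'a \<Rightarrow> int \<Rightarrow> 'a" where
  "zpow a k = (if k \<ge> 0 then a ^ nat k else inverse a ^ nat (- k))"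

lemma power_commutes_inverse: "a ^ k * inverse a ^ k = 1"
proof (induction k)
  case (Suc k)
  have "a ^ Suc k * inverse a ^ Suc k = a ^ k * (a * (inverse a * inverse a ^ k))"
    by (simp only: power_Suc2 power_Suc mult_assoc power_commutes)
       (metis mult_assoc power_commutes)
  then show ?case using Suc by (simp add: group_simps)
qed (simp)

lemma zpow_minus: "zpow a (- k) = inverse (zpow a k)"
proof -
  have *: "inverse (a ^ m) = inverse a ^ m" for m
    by (metis eq_mult_inverse inverse_inverse' mult_1_left power_commutes_inverse)
  show ?thesis
  proof (cases "k = 0")
    case False
    then show ?thesis by (auto simp: zpow_def *[symmetric] inverse_inverse')
  qed (simp add: zpow_def inverse_one')
qed

lemma zpow_0 [simp]: "zpow a 0 = 1" and zpow_1 [simp]: "zpow a 1 = a"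
  by (simp_all add: zpow_def)

end

text \<open>By Cayley's theorem a group with a carrier set embeds into this group, which is an instance
  of \<^class>\<open>mgroup\<close>; so relations in presented groups can be computed in \<^class>\<open>mgroup\<close>.\<close>

typedef 'a bijection = "{f :: 'a \<Rightarrow> 'a. bij f}"
  using bij_id by blast

setup_lifting type_definition_bijection

instantiation bijection :: (type) mgroup
begin
lift_definition one_bijection :: "'a bijection" is id by (rule bij_id)
lift_definition times_bijection :: "'a bijection \<Rightarrow> 'a bijection \<Rightarrow> 'a bijection" is "\<lambda>f g. f \<circ> g"
  by (rule bij_comp)
lift_definition inverse_bijection :: "'a bijection \<Rightarrow> 'a bijection" is "inv_into UNIV"
  by (rule bij_imp_bij_inv)
definition divide_bijection :: "'a bijection \<Rightarrow> 'a bijection \<Rightarrow> 'a bijection" where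
  "divide_bijection f g = f * inverse g"
instance
  by standard (transfer; auto simp: fun_eq_iff bij_is_inj)+
end

text \<open>Extended by the identity off the carrier, so that it is a bijection of the whole
  type.\<close>

definition (in monoid) left_translation :: "'a \<Rightarrow> 'a \<Rightarrow> 'a" where
  "left_translation x = (\<lambda>y. if y \<in> carrier G then x \<otimes> y else y)"

context group
begin

lemma bij_left_translation:
  assumes "x \<in> carrier G"
  shows "bij (left_translation x)"
proof (rule o_bij)
  show "left_translation (inv x) \<circ> left_translation x = id"
    using assms by (auto simp: left_translation_def fun_eq_iff m_assoc[symmetric])
  show "left_translation x \<circ> left_translation (inv x) = id"
    using assms by (auto simp: left_translation_def fun_eq_iff m_assoc[symmetric])
qed

definition cayley :: "'a \<Rightarrow> 'a bijection" where
  "cayley x = Abs_bijection (left_translation x)"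

lemma Rep_cayley: "x \<in> carrier G \<Longrightarrow> Rep_bijection (cayley x) = left_translation x"
  by (simp add: cayley_def Abs_bijection_inverse bij_left_translation)

lemma cayley_mult: "x \<in> carrier G \<Longrightarrow> y \<in> carrier G \<Longrightarrow> cayley (x \<otimes> y) = cayley x * cayley y"
  by (rule Rep_bijection_inject[THEN iffD1])
     (auto simp: times_bijection.rep_eq Rep_cayley left_translation_def fun_eq_iff m_assoc)

lemma cayley_one: "cayley \<one> = 1"
  by (rule Rep_bijection_inject[THEN iffD1])
     (auto simp: one_bijection.rep_eq Rep_cayley left_translation_def fun_eq_iff)

lemma cayley_inv: "x \<in> carrier G \<Longrightarrow> cayley (inv x) = inverse (cayley x)"
  using cayley_mult[of "inv x" x] eq_mult_inverse[of "cayley (inv x)" 1 "cayley x"]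
  by (simp add: cayley_one)

lemma cayley_inj: "x \<in> carrier G \<Longrightarrow> y \<in> carrier G \<Longrightarrow> cayley x = cayley y \<longleftrightarrow> x = y"
  by (metis Rep_cayley left_translation_def one_closed r_one)

end

section \<open>Evaluation of words and isomorphism of presented groups\<close>

definition ev :: "('g \<Rightarrow> 'a :: mgroup) \<Rightarrow> 'g gword \<Rightarrow> 'a" where
  "ev f w = prod_list (map (\<lambda>(g, b). if b then f g else inverse (f g)) w)"

lemma ev_Nil [simp]: "ev f [] = 1"
  and ev_append [simp]: "ev f (u @ v) = ev f u * ev f v"
  and ev_Cons: "ev f ((g, b) # w) = (if b then f g else inverse (f g)) * ev f w"
  and ev_gen [simp]: "ev f (word_gen g) = f g"
  by (auto simp: ev_def word_gen_def)

lemma ev_inv [simp]: "ev f (word_inv w) = inverse (ev f w)"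
proof (induction w)
  case (Cons x w)
  have "word_inv (x # w) = word_inv w @ word_inv [x]" by (simp add: word_inv_def)
  then show ?case using Cons
    by (cases x) (auto simp: ev_Cons inverse_mult' word_inv_def inverse_inverse')
qed (simp add: word_inv_def inverse_one')

lemma ev_pow [simp]: "ev f (word_pow w k) = zpow (ev f w) k"
proof -
  have "ev f (concat (replicate m w)) = ev f w ^ m" for m w by (induction m) auto
  then show ?thesis by (simp add: word_pow_def zpow_def)
qed

lemma ev_alternating [simp]: "ev f (alternating m x y) = alt_prod m (ev f x) (ev f y)"
  by (induction m x y rule: alternating.induct) auto

lemma ev_cong: "(\<And>g. g \<in> S \<Longrightarrow> f g = f' g) \<Longrightarrow> w \<in> words_over S \<Longrightarrow> ev f w = ev f' w"
  unfolding ev_def words_over_def by (rule arg_cong[where f = prod_list]) (auto simp: in_lists_conv_set)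

lemma commutes_ev: "(\<And>g. g \<in> S \<Longrightarrow> commutes a (f g)) \<Longrightarrow> w \<in> words_over S \<Longrightarrow> commutes a (ev f w)"
  unfolding ev_def words_over_def
  by (rule commutes_prod_list) (force simp: in_lists_conv_set intro: commutes_inverse)

definition subst_word :: "('g \<Rightarrow> 'h gword) \<Rightarrow> 'g gword \<Rightarrow> 'h gword" where
  "subst_word F w = concat (map (\<lambda>(g, b). if b then F g else word_inv (F g)) w)"

lemma ev_subst_word: "ev f (subst_word F w) = ev (\<lambda>g. ev f (F g)) w"
  by (induction w) (auto simp: subst_word_def ev_Cons)

lemma subst_word_append: "subst_word F (u @ v) = subst_word F u @ subst_word F v"
  by (simp add: subst_word_def)

lemma subst_word_words:
  "(\<And>g. g \<in> S \<Longrightarrow> F g \<in> words_over S') \<Longrightarrow> w \<in> words_over S \<Longrightarrow> subst_word F w \<in> words_over S'"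
proof (induction w)
  case (Cons x w)
  obtain g b where x: "x = (g, b)" by (cases x)
  then have "g \<in> S" "w \<in> words_over S" using Cons.prems by (auto simp: words_over_def)
  then have "(if b then F g else word_inv (F g)) \<in> words_over S'" "subst_word F w \<in> words_over S'"
    using Cons word_inv_words by auto
  then show ?case by (simp add: subst_word_def x)
qed (simp add: subst_word_def)

text \<open>Pairs with a word outside \<open>words_over S\<close> are ignored because the rule
  \<open>rel\<close> of \<open>word_cong\<close> ignores them too.\<close>

definition satisfies :: "'g set \<Rightarrow> ('g gword \<times> 'g gword) set \<Rightarrow> ('g \<Rightarrow> 'a :: mgroup) \<Rightarrow> bool" where
  "satisfies S R f \<longleftrightarrow> (\<forall>(u, v) \<in> R. u \<in> words_over S \<longrightarrow> v \<in> words_over S \<longrightarrow> ev f u = ev f v)"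

lemma word_cong_ev:
  assumes "satisfies S R f"
  shows "word_cong S R u v \<Longrightarrow> ev f u = ev f v"
proof (induction rule: word_cong.induct)
  case (cancel g b)
  then show ?case by (cases b) (simp_all add: ev_Cons left_inverse' right_inverse')
next
  case (rel u v)
  then show ?case using assms unfolding satisfies_def by blast
qed auto

text \<open>The universal solution of the relations, realised by permutations. By
  \<open>word_cong_iff_ev_canonical\<close> two words are congruent exactly when they take the same
  value here, which turns congruence into computation in an \<open>mgroup\<close>.\<close>

definition canonical :: "'g set \<Rightarrow> ('g gword \<times> 'g gword) set \<Rightarrow> 'g \<Rightarrow> 'g gword set bijection" where
  "canonical S R g = group.cayley (presented_group S R) {w. word_cong S R (word_gen g) w}"

lemma word_class_eq_iff:
  assumes "u \<in> words_over S"
  shows "{w. word_cong S R u w} = {w. word_cong S R v w} \<longleftrightarrow> word_cong S R u v"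
  using assms by (blast intro: word_cong.intros)

lemma ev_canonical:
  assumes "w \<in> words_over S"
  shows "ev (canonical S R) w = group.cayley (presented_group S R) {v. word_cong S R w v}"
  using assms
proof (induction w)
  interpret group "presented_group S R" by (rule group_presented_group)
  case Nil
  then show ?case using cayley_one by (simp add: presented_group_def)
next
  interpret group "presented_group S R" by (rule group_presented_group)
  have car: "{v. word_cong S R u v} \<in> carrier (presented_group S R)" if "u \<in> words_over S" for u
    using that by (auto simp: presented_group_def quotient_def)
  case (Cons x w)
  obtain g b where x: "x = (g, b)" by (cases x)
  have g: "g \<in> S" and w: "w \<in> words_over S" using Cons.prems by (auto simp: words_over_def x)
  have gb: "[(g, b')] \<in> words_over S" for b' using g by (simp add: words_over_def)
  let ?c = "\<lambda>u. {v. word_cong S R u v}"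
  have "?c [(g, False)] \<otimes>\<^bsub>presented_group S R\<^esub> ?c [(g, True)] = \<one>\<^bsub>presented_group S R\<^esub>"
    using presented_group_mult[OF gb gb, of R False True] word_class_eq_iff[of "[(g, False), (g, True)]" S R "[]"]
      word_cong.cancel[OF g, of R False] gb by (simp add: presented_group_def words_over_def)
  then have "?c [(g, False)] = inv\<^bsub>presented_group S R\<^esub> (?c [(g, True)])"
    using car gb by (metis inv_equality)
  then have "(if b then canonical S R g else inverse (canonical S R g)) = cayley (?c [(g, b)])"
    using car[OF gb] by (simp add: canonical_def word_gen_def cayley_inv)
  then have "ev (canonical S R) (x # w) = cayley (?c [(g, b)]) * cayley (?c w)"
    using Cons.IH[OF w] by (simp add: x ev_Cons)
  also have "\<dots> = cayley (?c [(g, b)] \<otimes>\<^bsub>presented_group S R\<^esub> ?c w)"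
    using car gb w by (simp add: cayley_mult)
  also have "\<dots> = cayley (?c (x # w))"
    using presented_group_mult[OF gb w, of R b] by (simp add: x)
  finally show ?case .
qed

lemma word_cong_iff_ev_canonical:
  assumes "u \<in> words_over S" "v \<in> words_over S"
  shows "word_cong S R u v \<longleftrightarrow> ev (canonical S R) u = ev (canonical S R) v"
proof -
  interpret group "presented_group S R" by (rule group_presented_group)
  have "{w. word_cong S R u w} \<in> carrier (presented_group S R)" if "u \<in> words_over S" for u
    using that by (auto simp: presented_group_def quotient_def)
  then show ?thesis
    using assms by (simp add: ev_canonical cayley_inj word_class_eq_iff)
qed

lemma satisfies_canonical: "satisfies S R (canonical S R)"
  unfolding satisfies_def by (auto simp: word_cong_iff_ev_canonical[symmetric] intro: word_cong.rel)

text \<open>Words assigned to the generators on either side give mutually inverse homomorphisms.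
  Apart from well-formedness, all hypotheses are equations between values in permutation groups, so
  no congruence of words has to be derived rule by rule.\<close>

lemma presented_group_isoI:
  fixes F :: "'g \<Rightarrow> 'h gword" and H :: "'h \<Rightarrow> 'g gword"
    and S :: "'g set" and R and S' :: "'h set" and R'
  defines "\<phi> \<equiv> \<lambda>g. ev (canonical S' R') (F g)" and "\<psi> \<equiv> \<lambda>h. ev (canonical S R) (H h)"
  assumes F: "\<And>g. g \<in> S \<Longrightarrow> F g \<in> words_over S'" and H: "\<And>h. h \<in> S' \<Longrightarrow> H h \<in> words_over S"
    and \<phi>: "satisfies S R \<phi>" and \<psi>: "satisfies S' R' \<psi>"
    and HF: "\<And>g. g \<in> S \<Longrightarrow> ev \<psi> (F g) = canonical S R g"
    and FH: "\<And>h. h \<in> S' \<Longrightarrow> ev \<phi> (H h) = canonical S' R' h"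
  shows "presented_group S R \<cong> presented_group S' R'"
proof -
  let ?G = "presented_group S R" and ?G' = "presented_group S' R'"
  let ?c = "\<lambda>u. {v. word_cong S R u v}" and ?c' = "\<lambda>u. {v. word_cong S' R' u v}"
  have car: "C \<in> carrier ?G \<longleftrightarrow> (\<exists>u\<in>words_over S. C = ?c u)" for C
    by (auto simp: presented_group_def quotient_def)
  have car': "C \<in> carrier ?G' \<longleftrightarrow> (\<exists>u\<in>words_over S'. C = ?c' u)" for C
    by (auto simp: presented_group_def quotient_def)
  have F': "subst_word F w \<in> words_over S'" if "w \<in> words_over S" for w
    using F that by (rule subst_word_words)
  have H': "subst_word H w \<in> words_over S" if "w \<in> words_over S'" for w
    using H that by (rule subst_word_words)
  have evF: "ev (canonical S' R') (subst_word F w) = ev \<phi> w" for w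
    by (simp add: ev_subst_word \<phi>_def)
  have evH: "ev (canonical S R) (subst_word H w) = ev \<psi> w" for w
    by (simp add: ev_subst_word \<psi>_def)
  have retract: "word_cong S R (subst_word H (subst_word F w)) w" if w: "w \<in> words_over S" for w
  proof -
    have "ev (canonical S R) (subst_word H (subst_word F w)) = ev (\<lambda>g. ev \<psi> (F g)) w"
      unfolding evH by (rule ev_subst_word)
    also have "\<dots> = ev (canonical S R) w" using HF w by (intro ev_cong)
    finally show ?thesis using w F' H' by (simp add: word_cong_iff_ev_canonical)
  qed
  have coretract: "word_cong S' R' (subst_word F (subst_word H w)) w" if w: "w \<in> words_over S'" for w
  proof -
    have "ev (canonical S' R') (subst_word F (subst_word H w)) = ev (\<lambda>g. ev \<phi> (H g)) w"
      unfolding evF by (rule ev_subst_word)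
    also have "\<dots> = ev (canonical S' R') w" using FH w by (intro ev_cong)
    finally show ?thesis using w F' H' by (simp add: word_cong_iff_ev_canonical)
  qed
  have congF: "word_cong S' R' (subst_word F u) (subst_word F v)" if "word_cong S R u v" for u v
    using that word_cong_words[OF that] F' word_cong_ev[OF \<phi> that]
    by (simp add: word_cong_iff_ev_canonical evF)
  have congH: "word_cong S R (subst_word H u) (subst_word H v)" if "word_cong S' R' u v" for u v
    using that word_cong_words[OF that] H' word_cong_ev[OF \<psi> that]
    by (simp add: word_cong_iff_ev_canonical evH)
  \<comment> \<open>All representatives of a class lead to the same class, so this union is a single
    class.\<close>
  define f where "f C = (\<Union>u\<in>C. ?c' (subst_word F u))" for C
  have f: "f (?c u) = ?c' (subst_word F u)" if u: "u \<in> words_over S" for u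
  proof -
    have "?c' (subst_word F v) = ?c' (subst_word F u)" if "v \<in> ?c u" for v
      using congF[of u v] that F'[OF u] word_class_eq_iff[of "subst_word F u" S' R' "subst_word F v"] by simp
    moreover have "u \<in> ?c u" using word_cong.refl[OF u] by blast
    ultimately show ?thesis unfolding f_def by blast
  qed
  have "f \<in> hom ?G ?G'"
  proof (rule homI)
    fix C D assume "C \<in> carrier ?G" "D \<in> carrier ?G"
    then obtain u v where u: "u \<in> words_over S" "C = ?c u" and v: "v \<in> words_over S" "D = ?c v"
      unfolding car by (elim bexE)
    show "f C \<in> carrier ?G'" unfolding u(2) f[OF u(1)] car' by (rule bexI[OF HOL.refl F'[OF u(1)]])
    have "C \<otimes>\<^bsub>?G\<^esub> D = ?c (u @ v)" unfolding u(2) v(2) by (rule presented_group_mult[OF u(1) v(1)])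
    then have "f (C \<otimes>\<^bsub>?G\<^esub> D) = ?c' (subst_word F u @ subst_word F v)"
      using f[of "u @ v"] u v by (simp only: words_over_append simp_thms subst_word_append)
    then show "f (C \<otimes>\<^bsub>?G\<^esub> D) = f C \<otimes>\<^bsub>?G'\<^esub> f D"
      unfolding u(2) v(2) f[OF u(1)] f[OF v(1)] using presented_group_mult[OF F'[OF u(1)] F'[OF v(1)]] by simp
  qed
  moreover have "inj_on f (carrier ?G)"
  proof (rule inj_onI)
    fix C D assume "C \<in> carrier ?G" "D \<in> carrier ?G" and eq: "f C = f D"
    then obtain u v where u: "u \<in> words_over S" "C = ?c u" and v: "v \<in> words_over S" "D = ?c v"
      unfolding car by (elim bexE)
    then have "word_cong S' R' (subst_word F u) (subst_word F v)"
      using eq by (simp add: f word_class_eq_iff F')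
    then have "word_cong S R (subst_word H (subst_word F u)) (subst_word H (subst_word F v))"
      by (rule congH)
    then have "word_cong S R u v"
      using retract[OF u(1)] retract[OF v(1)] by (meson word_cong.sym word_cong.trans)
    then show "C = D" using u v by (simp add: word_class_eq_iff)
  qed
  moreover have "f ` carrier ?G = carrier ?G'"
  proof
    show "f ` carrier ?G \<subseteq> carrier ?G'"
    proof
      fix D assume "D \<in> f ` carrier ?G"
      then obtain C where "C \<in> carrier ?G" and D: "D = f C" by blast
      then obtain u where u: "u \<in> words_over S" "C = ?c u" unfolding car by (elim bexE)
      show "D \<in> carrier ?G'"
        unfolding D u(2) f[OF u(1)] car' by (rule bexI[OF HOL.refl F'[OF u(1)]])
    qed
    show "carrier ?G' \<subseteq> f ` carrier ?G"
    proof
      fix C assume "C \<in> carrier ?G'"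
      then obtain w where w: "w \<in> words_over S'" "C = ?c' w" unfolding car' by (elim bexE)
      have "?c' w = ?c' (subst_word F (subst_word H w))"
        unfolding word_class_eq_iff[OF w(1)] by (rule word_cong.sym[OF coretract[OF w(1)]])
      then have C: "C = f (?c (subst_word H w))"
        unfolding w(2) f[OF H'[OF w(1)]] .
      have "?c (subst_word H w) \<in> carrier ?G"
        unfolding car by (rule bexI[OF HOL.refl H'[OF w(1)]])
      then show "C \<in> f ` carrier ?G" unfolding C by (rule imageI)
    qed
  qed
  ultimately show ?thesis by (auto simp: is_iso_def iso_def bij_betw_def)
qed

section \<open>The integral root system of an affine Cartan matrix\<close>

type_synonym ivec = "nat \<Rightarrow> int"

definition smul :: "int \<Rightarrow> ivec \<Rightarrow> ivec" where
  "smul c x = (\<lambda>j. c * x j)"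

definition al :: "nat \<Rightarrow> ivec" where
  "al i = (\<lambda>j. if j = i then 1 else 0)"

lemma smul_apply [simp]: "smul c x j = c * x j"
  by (simp add: smul_def)

lemma al_apply: "al i j = (if j = i then 1 else 0)"
  by (simp add: al_def)

text \<open>Off the diagonal the terms come in equal pairs. This supplies the factor 2 in the norm
  estimate of \<open>root_pos_or_neg\<close>.\<close>

lemma even_sum_symmetric:
  fixes f :: "nat \<Rightarrow> nat \<Rightarrow> int"
  assumes "\<And>i j. i \<le> n \<Longrightarrow> j \<le> n \<Longrightarrow> f i j = f j i" "\<And>i. i \<le> n \<Longrightarrow> even (f i i)"
  shows "even (\<Sum>i\<le>n. \<Sum>j\<le>n. f i j)"
  using assms
proof (induction n)
  case (Suc n)
  have "(\<Sum>i\<le>n. f i (Suc n)) = (\<Sum>i\<le>n. f (Suc n) i)"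
    using Suc.prems(1) by (intro sum.cong) auto
  then have "(\<Sum>i\<le>Suc n. \<Sum>j\<le>Suc n. f i j)
      = (\<Sum>i\<le>n. \<Sum>j\<le>n. f i j) + 2 * (\<Sum>i\<le>n. f (Suc n) i) + f (Suc n) (Suc n)"
    by (simp add: sum.distrib)
  then show ?case using Suc by simp
qed simp

text \<open>\<open>e j\<close> is half the norm of the simple root at j, and \<open>a\<close> is
  \<delta>, normalised at node 0. Since \<open>e\<close> is integral and positive,
  \<open>e_0\<close> says that no simple root is shorter than \<open>al 0\<close>; this is what
  fails for the four excluded types.\<close>

locale affine_root_datum =
  fixes n :: nat and A :: "nat \<Rightarrow> nat \<Rightarrow> int" and e a :: "nat \<Rightarrow> int"
  assumes diag: "i \<le> n \<Longrightarrow> A i i = 2"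
    and offdiag: "i \<le> n \<Longrightarrow> j \<le> n \<Longrightarrow> i \<noteq> j \<Longrightarrow> A i j \<le> 0"
    and e_pos: "j \<le> n \<Longrightarrow> e j > 0"
    and symm: "i \<le> n \<Longrightarrow> j \<le> n \<Longrightarrow> e i * A i j = e j * A j i"
    and a_pos: "j \<le> n \<Longrightarrow> a j > 0"
    and a_supp: "j > n \<Longrightarrow> a j = 0"
    and null: "i \<le> n \<Longrightarrow> (\<Sum>j\<le>n. A i j * a j) = 0"
    and irreducible: "irreducible_matrix n A"
    and e_0: "e 0 = 1" and a_0: "a 0 = 1"
begin

text \<open>The pairing with the simple coroot at node i.\<close>

definition pr :: "nat \<Rightarrow> ivec \<Rightarrow> int" where
  "pr i x = (\<Sum>j\<le>n. A i j * x j)"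

definition srefl :: "nat \<Rightarrow> ivec \<Rightarrow> ivec" where
  "srefl i x = x - smul (pr i x) (al i)"

definition B :: "ivec \<Rightarrow> ivec \<Rightarrow> int" where
  "B x y = (\<Sum>i\<le>n. e i * x i * pr i y)"

lemma pr_add: "pr i (x + y) = pr i x + pr i y"
  and pr_diff: "pr i (x - y) = pr i x - pr i y"
  and pr_minus: "pr i (- x) = - pr i x"
  and pr_smul: "pr i (smul c x) = c * pr i x"
  and pr_zero: "pr i 0 = 0"
  by (auto simp: pr_def algebra_simps sum.distrib sum_subtractf sum_negf sum_distrib_left)

lemma pr_al: "j \<le> n \<Longrightarrow> pr i (al j) = A i j"
  by (simp add: pr_def al_apply if_distrib sum.delta cong: if_cong)

lemma pr_a: "i \<le> n \<Longrightarrow> pr i a = 0"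
  using null by (simp add: pr_def)

lemmas pr_simps = pr_add pr_diff pr_minus pr_smul pr_zero pr_al pr_a

lemma B_expand: "B x y = (\<Sum>i\<le>n. \<Sum>j\<le>n. e i * A i j * x i * y j)"
  by (simp add: B_def pr_def sum_distrib_left algebra_simps)

lemma B_sym: "B x y = B y x"
proof -
  have "B x y = (\<Sum>j\<le>n. \<Sum>i\<le>n. e i * A i j * x i * y j)"
    unfolding B_expand by (rule sum.swap)
  also have "\<dots> = B y x"
    unfolding B_expand using symm by (intro sum.cong HOL.refl) (auto simp: algebra_simps)
  finally show ?thesis .
qed

lemma B_add_right: "B x (y + z) = B x y + B x z"
  and B_diff_right: "B x (y - z) = B x y - B x z"
  and B_minus_right: "B x (- y) = - B x y"
  and B_smul_right: "B x (smul c y) = c * B x y"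
  and B_add_left: "B (x + y) z = B x z + B y z"
  and B_diff_left: "B (x - y) z = B x z - B y z"
  and B_minus_left: "B (- x) y = - B x y"
  and B_smul_left: "B (smul c x) y = c * B x y"
  by (simp_all add: B_def pr_simps distrib_left distrib_right left_diff_distrib right_diff_distrib
      sum.distrib sum_subtractf sum_negf sum_distrib_left mult.left_commute mult.assoc)

lemma B_al_left: "i \<le> n \<Longrightarrow> B (al i) x = e i * pr i x"
proof -
  assume "i \<le> n"
  have "B (al i) x = (\<Sum>j\<le>n. if j = i then e i * pr i x else 0)"
    unfolding B_def by (intro sum.cong) (auto simp: al_apply)
  then show ?thesis using \<open>i \<le> n\<close> by simp
qed

lemma B_al_right: "i \<le> n \<Longrightarrow> B x (al i) = e i * pr i x"
  using B_al_left B_sym by metis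

lemma B_a: "B x a = 0" "B a x = 0"
proof -
  show "B x a = 0" unfolding B_def by (intro sum.neutral) (simp add: pr_a)
  then show "B a x = 0" by (simp add: B_sym)
qed

lemmas B_simps = B_add_right B_diff_right B_minus_right B_smul_right
  B_add_left B_diff_left B_minus_left B_smul_left B_al_left B_al_right B_a

text \<open>With \<open>y\<^sub>j = x\<^sub>j / a\<^sub>j\<close> the form is a sum of the nonnegative terms
  \<open>- e\<^sub>j A\<^sub>j\<^sub>k a\<^sub>j a\<^sub>k (y\<^sub>j - y\<^sub>k)\<^sup>2\<close>.\<close>

lemma B_semidefinite:
  shows "B x x \<ge> 0" and "B x x = 0 \<Longrightarrow> j \<le> n \<Longrightarrow> k \<le> n \<Longrightarrow> x j * a k = x k * a j"
proof -
  define y :: "nat \<Rightarrow> real" where "y j = of_int (x j) / of_int (a j)" for j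
  define w :: "nat \<Rightarrow> nat \<Rightarrow> real" where "w j k = of_int (e j * A j k * a j * a k)" for j k
  have x: "of_int (x j) = y j * of_int (a j)" if "j \<le> n" for j
    using a_pos[OF that] by (simp add: y_def)
  have w_sym: "w j k = w k j" if "j \<le> n" "k \<le> n" for j k
    using symm[OF that] by (simp add: w_def mult.commute)
  have row: "(\<Sum>k\<le>n. w j k) = 0" if "j \<le> n" for j
  proof -
    have "(\<Sum>k\<le>n. w j k) = of_int (e j * a j * (\<Sum>k\<le>n. A j k * a k))"
      by (simp add: w_def sum_distrib_left algebra_simps)
    then show ?thesis using null[OF that] by simp
  qed
  have col: "(\<Sum>j\<le>n. w j k) = 0" if "k \<le> n" for k
    using row[OF that] w_sym that by (metis (no_types, lifting) atMost_iff sum.cong)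
  have Bw: "of_int (B x x) = (\<Sum>j\<le>n. \<Sum>k\<le>n. w j k * y j * y k)"
    unfolding B_expand of_int_sum by (intro sum.cong HOL.refl) (auto simp: w_def x algebra_simps)
  have "(\<Sum>j\<le>n. \<Sum>k\<le>n. w j k * (y j - y k)^2)
      = (\<Sum>j\<le>n. \<Sum>k\<le>n. w j k * (y j)^2) + (\<Sum>j\<le>n. \<Sum>k\<le>n. w j k * (y k)^2)
        - 2 * (\<Sum>j\<le>n. \<Sum>k\<le>n. w j k * y j * y k)"
    by (simp add: power2_diff sum.distrib sum_subtractf sum_distrib_left algebra_simps)
  also have "(\<Sum>j\<le>n. \<Sum>k\<le>n. w j k * (y j)^2) = 0"
    using row by (simp add: sum_distrib_right[symmetric])
  also have "(\<Sum>j\<le>n. \<Sum>k\<le>n. w j k * (y k)^2) = (\<Sum>k\<le>n. \<Sum>j\<le>n. w j k * (y k)^2)"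
    by (rule sum.swap)
  also have "\<dots> = 0"
    using col by (simp add: sum_distrib_right[symmetric])
  finally have key: "2 * of_int (B x x) = (\<Sum>j\<le>n. \<Sum>k\<le>n. - w j k * (y j - y k)^2)"
    by (simp add: Bw sum_negf)
  have nonneg: "- w j k * (y j - y k)^2 \<ge> 0" if "j \<le> n" "k \<le> n" for j k
  proof (cases "j = k")
    case False
    have "e j * A j k * a j * a k \<le> 0"
      using offdiag[OF that False] e_pos[OF that(1)] a_pos[OF that(1)] a_pos[OF that(2)]
      by (simp add: mult_le_0_iff zero_le_mult_iff mult_nonneg_nonpos)
    then have "w j k \<le> 0" unfolding w_def by linarith
    then show ?thesis by (simp add: mult_nonpos_nonneg)
  qed simp
  have "2 * of_int (B x x) \<ge> (0::real)"
    unfolding key using nonneg by (intro sum_nonneg) auto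
  then show "B x x \<ge> 0" by linarith
  assume 0: "B x x = 0" and "j \<le> n" "k \<le> n"
  have inner: "(\<Sum>k\<le>n. - w j k * (y j - y k)^2) \<ge> 0" if "j \<le> n" for j
    using nonneg that by (intro sum_nonneg) auto
  have "(\<Sum>k\<le>n. - w j k * (y j - y k)^2) = 0" if "j \<le> n" for j
    using key 0 inner sum_nonneg_eq_0_iff[of "{..n}" "\<lambda>j. \<Sum>k\<le>n. - w j k * (y j - y k)^2"] that by auto
  then have zero: "- w j k * (y j - y k)^2 = 0" if "j \<le> n" "k \<le> n" for j k
    using nonneg that sum_nonneg_eq_0_iff[of "{..n}" "\<lambda>k. - w j k * (y j - y k)^2"] by auto
  \<comment> \<open>An edge forces equal values of \<open>y\<close> at its ends, so no edge leaves
    this level set.\<close>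
  define I where "I = {j. j \<le> n \<and> y j = y 0}"
  have adj: "A i j = 0 \<and> A j i = 0" if "i \<in> I" "j \<in> {..n} - I" for i j
  proof -
    have ij: "i \<le> n" "j \<le> n" "y i \<noteq> y j" using that by (auto simp: I_def)
    then have "w i j = 0" "w j i = 0" using zero[of i j] zero[of j i] by auto
    then show ?thesis
      using ij e_pos[of i] e_pos[of j] a_pos[of i] a_pos[of j] by (auto simp: w_def)
  qed
  have "I = {..n}"
  proof (rule ccontr)
    assume "I \<noteq> {..n}"
    then have "I \<noteq> {} \<and> I \<subset> {..n} \<and> (\<forall>i\<in>I. \<forall>j\<in>{..n} - I. A i j = 0 \<and> A j i = 0)"
      using adj by (auto simp: I_def)
    then show False using irreducible unfolding irreducible_matrix_def by blast
  qed
  then have "j \<in> I" "k \<in> I" using \<open>j \<le> n\<close> \<open>k \<le> n\<close> by auto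
  then have "y j = y k" by (simp add: I_def)
  then have "of_int (x j * a k) = (of_int (x k * a j) :: real)"
    using a_pos[OF \<open>j \<le> n\<close>] a_pos[OF \<open>k \<le> n\<close>] by (simp add: y_def field_simps)
  then show "x j * a k = x k * a j" using of_int_eq_iff by blast
qed

text \<open>A vector of norm zero is proportional to \<open>a\<close>, whose coordinates up to n are
  all positive.\<close>

lemma B_zero_if_coordinate_zero:
  assumes "B x x = 0" "i \<le> n" "x i = 0" "\<forall>j>n. x j = 0"
  shows "x = 0"
proof
  fix j
  show "x j = 0 j"
    using B_semidefinite(2)[OF assms(1), of j i] a_pos[OF assms(2)] assms by (cases "j \<le> n") auto
qed

text \<open>Divisibility says that the coroot \<open>2b / B b b\<close> lies in the coroot lattice. This property of the
  real roots is invariant under reflections and under translation by multiples of \<open>\<delta>\<close>.\<close>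

definition roots :: "ivec set" where
  "roots = {b. (\<forall>j>n. b j = 0) \<and> (\<exists>c>0. B b b = 2 * c \<and> (\<forall>k\<le>n. c dvd e k * b k))}"

definition pos :: "ivec \<Rightarrow> bool" where
  "pos b \<longleftrightarrow> b \<noteq> 0 \<and> (\<forall>j. b j \<ge> 0)"

lemma pos_not_minus: "pos b \<Longrightarrow> \<not> pos (- b)"
  by (auto simp: pos_def fun_eq_iff) (metis linorder_not_less neg_less_0_iff_less order.order_iff_strict verit_la_disequality)

lemma al_in_roots: "i \<le> n \<Longrightarrow> al i \<in> roots"
  unfolding roots_def using e_pos[of i] diag[of i]
  by (auto simp: B_simps pr_simps al_apply intro!: exI[of _ "e i"])

lemma pos_al: "pos (al i)"
  by (auto simp: pos_def al_apply fun_eq_iff)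

lemma minus_in_roots: "b \<in> roots \<Longrightarrow> - b \<in> roots"
  unfolding roots_def by (auto simp: B_simps)

lemma root_nonzero: "b \<in> roots \<Longrightarrow> b \<noteq> 0"
  by (auto simp: roots_def B_def)

text \<open>Writing \<open>b = p - m\<close> with \<open>p, m \<ge> 0\<close> of disjoint support, both \<open>B p p\<close> and \<open>B m m\<close> are
  multiples of \<open>B b b\<close>, while \<open>B p m \<le> 0\<close>.\<close>

lemma root_pos_or_neg:
  assumes "b \<in> roots"
  shows "pos b \<or> pos (- b)"
proof (rule ccontr)
  assume neither: "\<not> (pos b \<or> pos (- b))"
  obtain c where c: "c > 0" "B b b = 2 * c" "\<And>k. k \<le> n \<Longrightarrow> c dvd e k * b k"
    and supp: "\<And>j. j > n \<Longrightarrow> b j = 0"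
    using assms by (auto simp: roots_def)
  have "b \<noteq> 0" using root_nonzero assms by blast
  then obtain i k where i: "b i < 0" and k: "b k > 0"
    using neither by (auto simp: pos_def not_le)
  define p where "p = (\<lambda>j. max (b j) 0)"
  define m where "m = (\<lambda>j. max (- b j) 0)"
  have norm: "B q q \<ge> 2 * c" if q: "\<And>j. q j = b j \<or> q j = - b j \<or> q j = 0" and "q \<noteq> 0"
    and z: "z \<le> n" "q z = 0" for q z
  proof -
    have supp': "\<forall>j>n. q j = 0" using q supp by (metis neg_0_equal_iff_equal)
    have "c dvd e j * q j" if "j \<le> n" for j using c(3)[OF that] q[of j] by auto
    \<comment> \<open>\<open>r\<close> gives the coordinates of q / c in the simple coroots. The
      terms r_i A_ij q_j are symmetric in i and j with even diagonal, so \<open>B q q\<close> is a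
      multiple of 2 c.\<close>
    then obtain r where r: "\<And>j. j \<le> n \<Longrightarrow> e j * q j = c * r j" unfolding dvd_def by metis
    have "B q q = (\<Sum>i\<le>n. \<Sum>j\<le>n. c * (r i * A i j * q j))"
      unfolding B_expand
    proof (rule sum.cong[OF HOL.refl], rule sum.cong[OF HOL.refl])
      fix i j assume "i \<in> {..n}" "j \<in> {..n}"
      then have "(e i * q i) * (A i j * q j) = (c * r i) * (A i j * q j)" using r by simp
      then show "e i * A i j * q i * q j = c * (r i * A i j * q j)" by (simp add: algebra_simps)
    qed
    also have "\<dots> = c * (\<Sum>i\<le>n. \<Sum>j\<le>n. r i * A i j * q j)" by (simp add: sum_distrib_left)
    finally have Bq: "B q q = c * (\<Sum>i\<le>n. \<Sum>j\<le>n. r i * A i j * q j)" .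
    have "r i * A i j * q j = r j * A j i * q i" if "i \<le> n" "j \<le> n" for i j
    proof -
      have "c * (r i * A i j * q j) = (e i * q i) * A i j * q j" using r[OF that(1)] by simp
      also have "\<dots> = (e i * A i j) * q i * q j" by simp
      also have "\<dots> = (e j * A j i) * q i * q j" using symm that by simp
      also have "\<dots> = (e j * q j) * A j i * q i" by simp
      also have "\<dots> = c * (r j * A j i * q i)" using r[OF that(2)] by simp
      finally show ?thesis using c(1) by simp
    qed
    moreover have "even (r i * A i i * q i)" if "i \<le> n" for i using diag[OF that] by simp
    ultimately have "even (\<Sum>i\<le>n. \<Sum>j\<le>n. r i * A i j * q j)"
      by (rule even_sum_symmetric)
    then obtain s where s: "B q q = 2 * c * s" using Bq by (auto elim!: evenE)
    have "B q q \<noteq> 0" using B_zero_if_coordinate_zero[OF _ z supp'] \<open>q \<noteq> 0\<close> by blast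
    then have "2 * c * s > 0" using s B_semidefinite(1)[of q] by linarith
    then have "s \<ge> 1" using c(1) by (simp add: zero_less_mult_iff)
    then show ?thesis using s c(1) by simp
  qed
  have ik: "i \<le> n" "k \<le> n" using i k supp by (metis less_irrefl not_le)+
  have "B p p \<ge> 2 * c"
    by (rule norm[of p i]) (use i k ik in \<open>auto simp: p_def fun_eq_iff max_def not_le\<close>)
  moreover have "B m m \<ge> 2 * c"
    by (rule norm[of m k]) (use i k ik in \<open>auto simp: m_def fun_eq_iff max_def not_le\<close>)
  moreover have "B p m \<le> 0"
    unfolding B_expand
  proof (intro sum_nonpos)
    fix i j assume ij: "i \<in> {..n}" "j \<in> {..n}"
    show "e i * A i j * p i * m j \<le> 0"
    proof (cases "i = j")
      case False
      then have "e i * A i j \<le> 0" using ij offdiag[of i j] e_pos[of i] by (simp add: mult_le_0_iff)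
      then show ?thesis by (simp add: p_def m_def mult_nonpos_nonneg)
    qed (auto simp: p_def m_def max_def)
  qed
  moreover have "b = p - m" by (auto simp: p_def m_def fun_eq_iff max_def)
  then have "B b b = B p p - 2 * B p m + B m m"
    using B_sym[of m p] by (simp add: B_simps)
  ultimately show False using c by simp
qed

lemma B_refl: "i \<le> n \<Longrightarrow> B (srefl i x) (srefl i y) = B x y"
  by (simp add: srefl_def B_simps diag pr_simps algebra_simps)

lemma refl_refl: "i \<le> n \<Longrightarrow> srefl i (srefl i x) = x"
  by (simp add: srefl_def fun_eq_iff pr_simps diag)

lemma refl_add: "srefl i (x + y) = srefl i x + srefl i y"
  and refl_diff: "srefl i (x - y) = srefl i x - srefl i y"
  and refl_minus: "srefl i (- x) = - srefl i x"
  and refl_smul: "srefl i (smul c x) = smul c (srefl i x)"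
  and refl_a: "i \<le> n \<Longrightarrow> srefl i a = a"
  and refl_al: "i \<le> n \<Longrightarrow> srefl i (al i) = - al i"
  by (auto simp: srefl_def fun_eq_iff pr_simps algebra_simps diag)

lemma refl_in_roots:
  assumes "b \<in> roots" "i \<le> n" shows "srefl i b \<in> roots"
proof -
  obtain c where c: "c > 0" "B b b = 2 * c" "\<And>k. k \<le> n \<Longrightarrow> c dvd e k * b k"
    and supp: "\<And>j. j > n \<Longrightarrow> b j = 0"
    using assms by (auto simp: roots_def)
  have "e i * pr i b = (\<Sum>k\<le>n. A k i * (e k * b k))"
    unfolding pr_def sum_distrib_left using symm assms(2) by (intro sum.cong) (auto simp: algebra_simps)
  then have "c dvd e i * pr i b" using c(3) by (auto intro: dvd_sum)
  then have "c dvd e k * srefl i b k" if "k \<le> n" for k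
    using c(3)[OF that] by (auto simp: srefl_def al_apply right_diff_distrib dvd_diff)
  then show ?thesis
    using c(1,2) supp assms(2) unfolding roots_def
    by (auto simp: B_refl) (auto simp: srefl_def al_apply)
qed

text \<open>If b is m times \<open>al i\<close>, then c is \<open>e i\<close> times the square of m,
  and it divides \<open>e i\<close> times m only for m = 1 or m = -1.\<close>

lemma root_multiple_of_al:
  assumes "b \<in> roots" "i \<le> n" "\<And>j. j \<noteq> i \<Longrightarrow> b j = 0"
  shows "b = al i \<or> b = - al i"
proof -
  obtain c where c: "c > 0" "B b b = 2 * c" "c dvd e i * b i"
    using assms by (auto simp: roots_def)
  have b: "b = smul (b i) (al i)" using assms(3) by (auto simp: fun_eq_iff al_apply)
  have "B b b = b i * b i * (2 * e i)"
    by (subst (1 2) b) (simp add: B_simps pr_simps assms(2) diag)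
  then have ce: "c = e i * (b i * b i)" using c by simp
  then have "e i * (b i * b i) dvd e i * b i" using c by simp
  then have "b i * b i dvd b i" using e_pos[OF assms(2)] by simp
  moreover have "b i \<noteq> 0" using ce c(1) by auto
  ultimately have "b i dvd 1" using dvd_mult_cancel_left[of "b i" "b i" 1] by simp
  then have "b i = 1 \<or> b i = -1" by (auto simp: abs_if split: if_splits)
  then show ?thesis using assms(3) by (auto simp: fun_eq_iff al_apply)
qed

text \<open>Some nonzero coordinate away from i survives the reflection, and a root with one
  positive coordinate is positive.\<close>

lemma pos_refl:
  assumes "b \<in> roots" "pos b" "i \<le> n" "b \<noteq> al i"
  shows "pos (srefl i b)"
proof -
  obtain j where j: "j \<noteq> i" "b j \<noteq> 0"
    using root_multiple_of_al[OF assms(1,3)] assms(2,4) pos_not_minus pos_al by (metis minus_minus)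
  then have "srefl i b j > 0" using assms(2) by (auto simp: srefl_def al_apply pos_def less_le)
  then have "\<not> pos (- srefl i b)" by (auto simp: pos_def) (meson not_less)
  then show ?thesis using root_pos_or_neg[OF refl_in_roots[OF assms(1,3)]] by blast
qed

section \<open>Words in the simple reflections\<close>

definition act :: "nat list \<Rightarrow> ivec \<Rightarrow> ivec" where
  "act w = foldr srefl w"

lemma act_Nil [simp]: "act [] x = x"
  and act_Cons [simp]: "act (i # w) x = srefl i (act w x)"
  and act_append [simp]: "act (u @ v) x = act u (act v x)"
  by (simp_all add: act_def)

lemma act_add: "act w (x + y) = act w x + act w y"
  and act_diff: "act w (x - y) = act w x - act w y"
  and act_minus: "act w (- x) = - act w x"
  and act_smul: "act w (smul c x) = smul c (act w x)"
  by (induction w) (auto simp: refl_add refl_diff refl_minus refl_smul)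

lemma act_a: "set w \<subseteq> {..n} \<Longrightarrow> act w a = a"
  by (induction w) (auto simp: refl_a)

lemma act_rev: "set w \<subseteq> {..n} \<Longrightarrow> act (rev w) (act w x) = x"
  by (induction w) (auto simp: refl_refl)

lemma act_rev': "set w \<subseteq> {..n} \<Longrightarrow> act w (act (rev w) x) = x"
  using act_rev[of "rev w"] by simp

lemma B_act: "set w \<subseteq> {..n} \<Longrightarrow> B (act w x) (act w y) = B x y"
  by (induction w) (auto simp: B_refl)

lemma act_in_roots: "set w \<subseteq> {..n} \<Longrightarrow> b \<in> roots \<Longrightarrow> act w b \<in> roots"
  by (induction w) (auto simp: refl_in_roots)

lemma act_al_in_roots: "set w \<subseteq> {..n} \<Longrightarrow> i \<le> n \<Longrightarrow> act w (al i) \<in> roots"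
  by (simp add: act_in_roots al_in_roots)

lemma act_refl: "set w \<subseteq> {..n} \<Longrightarrow> act w (srefl i x) = act w x - smul (pr i x) (act w (al i))"
  by (simp add: srefl_def act_diff act_smul)

text \<open>Conjugating the reflection in \<open>al i\<close> by w gives the reflection in its
  image. Invariance of the form yields \<open>e i = e j\<close>, which turns equal values of the
  form into equal pairings.\<close>

lemma act_al_eq_al:
  assumes "set w \<subseteq> {..n}" "i \<le> n" "j \<le> n" "act w (al i) = al j"
  shows "act (w @ [i]) = act (j # w)"
proof
  fix x
  have "B (act w (al i)) (act w (al i)) = B (al i) (al i)" using B_act assms by blast
  then have e: "e i = e j" using assms by (simp add: B_simps pr_simps diag)
  have "e j * pr j (act w x) = B (act w (al i)) (act w x)" using assms by (simp add: B_simps)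
  also have "\<dots> = B (al i) x" using assms(1) by (rule B_act)
  also have "\<dots> = e i * pr i x" using assms by (simp add: B_simps)
  finally have "pr j (act w x) = pr i x" using e e_pos[OF assms(2)] by simp
  then show "act (w @ [i]) x = act (j # w) x"
    using assms by (simp add: act_refl) (simp add: srefl_def)
qed

text \<open>Stated through the signs of the crossed roots, which is what the signed section
  inspects. \<open>reduced_minimal\<close> and \<open>deletion\<close> identify it with minimal
  length.\<close>

definition reduced :: "nat list \<Rightarrow> bool" where
  "reduced w \<longleftrightarrow> (\<forall>u i v. w = u @ i # v \<longrightarrow> pos (act u (al i)))"

lemma reduced_Nil [simp]: "reduced []"
  by (simp add: reduced_def)

lemma reduced_snoc: "reduced (w @ [i]) \<longleftrightarrow> reduced w \<and> pos (act w (al i))"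
proof
  assume r: "reduced (w @ [i])"
  show "reduced w \<and> pos (act w (al i))"
    using r unfolding reduced_def by (metis append.assoc append_Cons)
next
  assume r: "reduced w \<and> pos (act w (al i))"
  show "reduced (w @ [i])"
    unfolding reduced_def
  proof (intro allI impI)
    fix u j v assume eq: "w @ [i] = u @ j # v"
    show "pos (act u (al j))"
    proof (cases v rule: rev_cases)
      case Nil then show ?thesis using eq r by simp
    next
      case (snoc v' k)
      then have "w = u @ j # v'" using eq by (metis append_Cons append_assoc butlast_snoc)
      then show ?thesis using r by (simp add: reduced_def)
    qed
  qed
qed

lemma reduced_prefix: "reduced (u @ v) \<Longrightarrow> reduced u"
  unfolding reduced_def by (metis append.assoc append_Cons)

text \<open>Applying the letters of w to \<open>al i\<close> from the right, the sign turns at some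
  letter j. By \<open>pos_refl\<close> the root there is exactly \<open>al j\<close>, so that j and
  the appended i cancel.\<close>

lemma exchange:
  assumes "set w \<subseteq> {..n}" "i \<le> n" "pos (- act w (al i))"
  shows "\<exists>u j v. w = u @ j # v \<and> act (w @ [i]) = act (u @ v)"
  using assms
proof (induction w)
  case Nil
  then show ?case using pos_not_minus[OF pos_al[of i]] by (simp add: fun_Compl_def)
next
  case (Cons j w)
  show ?case
  proof (cases "pos (- act w (al i))")
    case True
    then obtain u k v where "w = u @ k # v" "act (w @ [i]) = act (u @ v)"
      using Cons.IH[OF _ Cons.prems(2) True] Cons.prems(1) by fastforce
    then have "j # w = (j # u) @ k # v" "act ((j # w) @ [i]) = act ((j # u) @ v)"
      by simp (metis \<open>act (w @ [i]) = act (u @ v)\<close> append_Cons act_Cons ext)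
    then show ?thesis by blast
  next
    case False
    then have p: "pos (act w (al i))"
      using root_pos_or_neg act_al_in_roots Cons.prems by auto
    have "act w (al i) = al j"
      using pos_refl[OF act_al_in_roots p, of j] Cons.prems(1,2) pos_not_minus
        Cons.prems(3)[unfolded act_Cons] by fastforce
    then have *: "act (w @ [i]) = act (j # w)" using act_al_eq_al Cons.prems by auto
    have "act ((j # w) @ [i]) = act ([] @ w)"
    proof
      fix x
      have "j \<le> n" using Cons.prems by simp
      then show "act ((j # w) @ [i]) x = act ([] @ w) x"
        using fun_cong[OF *, of x] by (simp add: refl_refl)
    qed
    then show ?thesis by (metis append_Nil)
  qed
qed

lemma deletion:
  assumes "set w \<subseteq> {..n}" "\<not> reduced w"
  shows "\<exists>w'. length w' + 2 = length w \<and> set w' \<subseteq> set w \<and> act w' = act w"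
proof -
  obtain x i y where w: "w = x @ i # y" and "\<not> pos (act x (al i))"
    using assms(2) by (auto simp: reduced_def)
  then have "pos (- act x (al i))"
    using root_pos_or_neg[OF act_al_in_roots, of x i] assms(1) by auto
  then obtain u j v where "x = u @ j # v" "act (x @ [i]) = act (u @ v)"
    using exchange[of x i] assms(1) w by auto
  then show ?thesis
    using w by (intro exI[of _ "u @ v @ y"]) (auto simp: fun_eq_iff)
qed

lemma reduced_exists:
  assumes "set w \<subseteq> {..n}"
  shows "\<exists>w'. reduced w' \<and> set w' \<subseteq> set w \<and> act w' = act w \<and> length w' \<le> length w"
  using assms
proof (induction "length w" arbitrary: w rule: less_induct)
  case less
  show ?case
  proof (cases "reduced w")
    case False
    then obtain w' where w': "length w' + 2 = length w" "set w' \<subseteq> set w" "act w' = act w"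
      using deletion less.prems by blast
    then obtain w'' where "reduced w''" "set w'' \<subseteq> set w'" "act w'' = act w'" "length w'' \<le> length w'"
      using less.hyps[of w'] less.prems by auto
    moreover have "length w'' \<le> length w" using calculation w' by linarith
    ultimately show ?thesis using w' by (metis subset_trans)
  qed auto
qed

text \<open>The last letter of u is a descent of v as well, so by \<open>exchange\<close> its
  removal from u is matched by deleting some letter of v.\<close>

lemma reduced_minimal:
  assumes "reduced u" "set u \<subseteq> {..n}" "set v \<subseteq> {..n}" "act v = act u"
  shows "length u \<le> length v"
  using assms
proof (induction u arbitrary: v rule: rev_induct)
  case (snoc i u)
  have "pos (act u (al i))" using snoc.prems reduced_snoc by blast
  then have "pos (- act v (al i))" using snoc.prems by (simp add: refl_al act_minus)
  then obtain x j y where v: "v = x @ j # y" "act (v @ [i]) = act (x @ y)"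
    using exchange[of v i] snoc.prems by auto
  have "act (x @ y) = act u"
    using v(2) snoc.prems by (simp add: fun_eq_iff refl_refl)
  moreover have "reduced u" "set u \<subseteq> {..n}" "set (x @ y) \<subseteq> {..n}"
    using snoc.prems v(1) by (auto simp: reduced_snoc)
  ultimately have "length u \<le> length (x @ y)" using snoc.IH by blast
  then show ?case using v(1) by simp
qed simp

lemma reduced_same_length:
  assumes "reduced u" "set u \<subseteq> {..n}" "reduced v" "set v \<subseteq> {..n}" "act v = act u"
  shows "length u = length v"
  using reduced_minimal assms by (metis le_antisym)

lemma reduced_if_same_length:
  assumes "reduced u" "set u \<subseteq> {..n}" "set v \<subseteq> {..n}" "act v = act u" "length v \<le> length u"
  shows "reduced v"
proof (rule ccontr)
  assume "\<not> reduced v"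
  then obtain w where "length w + 2 = length v" "set w \<subseteq> set v" "act w = act v"
    using deletion assms by blast
  then show False using reduced_minimal[of u w] assms by auto
qed

lemma act_rev_cong:
  assumes "set u \<subseteq> {..n}" "set v \<subseteq> {..n}" "act u = act v"
  shows "act (rev u) = act (rev v)"
  by (metis act_rev act_rev' assms ext)

lemma reduced_rev:
  assumes "reduced w" "set w \<subseteq> {..n}"
  shows "reduced (rev w)"
proof (rule ccontr)
  assume "\<not> reduced (rev w)"
  then obtain v where "length v + 2 = length w" "set v \<subseteq> set w" "act v = act (rev w)"
    using deletion[of "rev w"] assms by auto
  then show False
    using reduced_minimal[of w "rev v"] act_rev_cong[of v "rev w"] assms by auto
qed

lemma reduced_Cons:
  assumes "set w \<subseteq> {..n}" "i \<le> n"
  shows "reduced (i # w) \<longleftrightarrow> reduced w \<and> pos (act (rev w) (al i))"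
proof -
  have "reduced (i # w) \<longleftrightarrow> reduced (rev w @ [i])"
    using reduced_rev[of "i # w"] reduced_rev[of "rev w @ [i]"] assms by auto
  then show ?thesis using reduced_rev[of w] reduced_rev[of "rev w"] assms by (auto simp: reduced_snoc)
qed

end

section \<open>Matsumoto's theorem\<close>

fun alternate :: "nat \<Rightarrow> 'a \<Rightarrow> 'a \<Rightarrow> 'a list" where
  "alternate 0 s t = []"
| "alternate (Suc m) s t = s # alternate m t s"

lemma length_alternate [simp]: "length (alternate m s t) = m"
  by (induction m s t rule: alternate.induct) auto

lemma set_alternate: "set (alternate m s t) \<subseteq> {s, t}"
  by (induction m s t rule: alternate.induct) auto

lemma alternate_snoc: "alternate (Suc m) s t = alternate m s t @ [if even m then s else t]"
  by (induction m s t rule: alternate.induct) auto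

lemma rev_alternate: "rev (alternate m s t) = (if even m then alternate m t s else alternate m s t)"
proof (induction m arbitrary: s t)
  case (Suc m)
  have "rev (alternate (Suc m) s t) = rev (alternate m t s) @ [s]" by simp
  then show ?case
    using alternate_snoc[of m s t] alternate_snoc[of m t s] by (auto simp: Suc simp del: alternate.simps)
qed simp

lemma prod_list_alternate: "prod_list (map T (alternate m s t)) = alt_prod m (T s) (T t)"
  by (induction m s t rule: alternate.induct) auto

lemma braid_length_cases:
  assumes "braid_length A i j = Some m"
  obtains "m = 2" "A i j * A j i = 0" | "m = 3" "A i j * A j i = 1"
    | "m = 4" "A i j * A j i = 2" | "m = 6" "A i j * A j i = 3"
  using assms by (auto simp: braid_length_def laces_def split: if_splits)

lemma braid_length_sym: "braid_length A i j = braid_length A j i"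
proof -
  have "laces A i j = laces A j i" by (simp add: laces_def)
  then show ?thesis by (simp add: braid_length_def)
qed

lemma nonpos_mult_eq_small:
  fixes p q :: int
  assumes "p \<le> 0" "q \<le> 0"
  shows "p * q = 1 \<Longrightarrow> p = -1 \<and> q = -1"
    and "p * q = 2 \<Longrightarrow> p = -1 \<and> q = -2 \<or> p = -2 \<and> q = -1"
    and "p * q = 3 \<Longrightarrow> p = -1 \<and> q = -3 \<or> p = -3 \<and> q = -1"
proof -
  have *: "p \<ge> - c" if "p * q = c" "c > 0" for c
  proof (cases "q = 0")
    case False
    then have "(-p) * 1 \<le> (-p) * (-q)" using assms by (intro mult_left_mono) auto
    then show ?thesis using that by simp
  qed (use that in auto)
  show "p * q = 1 \<Longrightarrow> p = -1 \<and> q = -1"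
    using *[of 1] assms by (cases "p = 0"; cases "p = -1") auto
  show "p = -1 \<and> q = -2 \<or> p = -2 \<and> q = -1" if "p * q = 2"
  proof -
    have "p = 0 \<or> p = -1 \<or> p = -2" using *[of 2] assms that by auto
    then show ?thesis using that by auto
  qed
  show "p = -1 \<and> q = -3 \<or> p = -3 \<and> q = -1" if "p * q = 3"
  proof -
    have "p = 0 \<or> p = -1 \<or> p = -2 \<or> p = -3" using *[of 3] assms that by auto
    then show ?thesis using that by (auto; presburger)
  qed
qed

context affine_root_datum
begin

lemma A_zero_iff: "i \<le> n \<Longrightarrow> j \<le> n \<Longrightarrow> A i j = 0 \<longleftrightarrow> A j i = 0"
  using symm[of i j] e_pos[of i] e_pos[of j] by auto

lemma rank2_cases:
  assumes "i \<le> n" "j \<le> n" "i \<noteq> j" "braid_length A i j = Some m"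
  obtains "m = 2" "A i j = 0" "A j i = 0" | "m = 3" "A i j = -1" "A j i = -1"
    | "m = 4" "A i j = -1" "A j i = -2" | "m = 4" "A i j = -2" "A j i = -1"
    | "m = 6" "A i j = -1" "A j i = -3" | "m = 6" "A i j = -3" "A j i = -1"
  using assms(4)
proof (cases rule: braid_length_cases)
  case 1
  then show ?thesis using that(1) A_zero_iff assms by auto
next
  case 2
  then show ?thesis using that(2) nonpos_mult_eq_small(1) offdiag assms by metis
next
  case 3
  then show ?thesis using that(3,4) nonpos_mult_eq_small(2) offdiag assms by metis
next
  case 4
  then show ?thesis using that(5,6) nonpos_mult_eq_small(3) offdiag assms by metis
qed

lemma act_alternate:
  assumes "s \<le> n" "t \<le> n" "s \<noteq> t" "braid_length A s t = Some m"
  shows "act (alternate m s t) = act (alternate m t s)"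
proof
  fix x
  show "act (alternate m s t) x = act (alternate m t s) x"
    using assms
    by (cases rule: rank2_cases[OF assms])
       (simp_all add: eval_nat_numeral srefl_def pr_simps diag fun_eq_iff algebra_simps)
qed

text \<open>The crossed roots are the positive roots of a finite rank two system, computed in each
  of the six cases.\<close>

lemma rank2_root:
  assumes "s \<le> n" "t \<le> n" "s \<noteq> t" "braid_length A s t = Some m" "k < m"
  shows "\<exists>x\<ge>0. \<exists>y\<ge>0. act (take k (alternate m s t)) (al (alternate m s t ! k))
    = smul x (al s) + smul y (al t)"
proof -
  have comb: "srefl s (smul x (al s) + smul y (al t)) = smul (- x - A s t * y) (al s) + smul y (al t)"
      "srefl t (smul x (al s) + smul y (al t)) = smul x (al s) + smul (- y - A t s * x) (al t)" for x y
    using assms(1-3) by (auto simp: srefl_def pr_simps diag fun_eq_iff algebra_simps)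
  have base: "al s = smul 1 (al s) + smul 0 (al t)" "al t = smul 0 (al s) + smul 1 (al t)"
    by (auto simp: fun_eq_iff)
  define P where "P v \<longleftrightarrow> (\<exists>x\<ge>0. \<exists>y\<ge>0. v = smul x (al s) + smul y (al t))" for v
  have P: "P (smul x (al s) + smul y (al t))" if "x \<ge> 0" "y \<ge> 0" for x y
    using that by (auto simp: P_def)
  have *: "act w (al s) = act w (smul 1 (al s) + smul 0 (al t))"
      "act w (al t) = act w (smul 0 (al s) + smul 1 (al t))" for w
    using base by simp_all
  have "P (act (take k (alternate m s t)) (al (alternate m s t ! k)))"
    using rank2_cases[OF assms(1-4)] assms(5)
  proof cases
    case 1
    then have "k = 0 \<or> k = 1" using assms(5) by linarith
    then show ?thesis using 1 by (elim disjE) (simp_all add: eval_nat_numeral * comb P del: smul_def)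
  next
    case 2
    then have "k = 0 \<or> k = 1 \<or> k = 2" using assms(5) by linarith
    then show ?thesis using 2 by (elim disjE) (simp_all add: eval_nat_numeral * comb P)
  next
    case 3
    then have "k = 0 \<or> k = 1 \<or> k = 2 \<or> k = 3" using assms(5) by linarith
    then show ?thesis using 3 by (elim disjE) (simp_all add: eval_nat_numeral * comb P)
  next
    case 4
    then have "k = 0 \<or> k = 1 \<or> k = 2 \<or> k = 3" using assms(5) by linarith
    then show ?thesis using 4 by (elim disjE) (simp_all add: eval_nat_numeral * comb P)
  next
    case 5
    then have "k = 0 \<or> k = 1 \<or> k = 2 \<or> k = 3 \<or> k = 4 \<or> k = 5" using assms(5) by linarith
    then show ?thesis using 5 by (elim disjE) (simp_all add: eval_nat_numeral * comb P)
  next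
    case 6
    then have "k = 0 \<or> k = 1 \<or> k = 2 \<or> k = 3 \<or> k = 4 \<or> k = 5" using assms(5) by linarith
    then show ?thesis using 6 by (elim disjE) (simp_all add: eval_nat_numeral * comb P)
  qed
  then show ?thesis by (simp add: P_def)
qed

definition th :: ivec where
  "th = a - al 0"

lemma pr0_th: "pr 0 th = -2"
  by (simp add: th_def pr_simps diag)

text \<open>Modulo the radical, \<theta> is minus \<open>al 0\<close>, and
  \<open>e 0 = 1\<close>.\<close>

lemma B_th: "B x th = - pr 0 x"
  by (simp add: th_def B_simps e_0)

lemma norm_th: "B th th = 2"
  by (simp add: B_th pr0_th)

definition braid_invariant :: "nat set \<Rightarrow> (nat list \<Rightarrow> 'x) \<Rightarrow> bool" where
  "braid_invariant J f \<longleftrightarrow> (\<forall>p q s t m. set p \<subseteq> J \<and> set q \<subseteq> J \<and> s \<in> J \<and> t \<in> J \<and> s \<noteq> t \<and>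
    braid_length A s t = Some m \<longrightarrow> f (p @ alternate m s t @ q) = f (p @ alternate m t s @ q))"

lemma braid_invariant_append:
  assumes "braid_invariant J f" "set r \<subseteq> J"
  shows "braid_invariant J (\<lambda>w. f (w @ r))"
  unfolding braid_invariant_def
proof (intro allI impI)
  fix p q s t m
  assume "set p \<subseteq> J \<and> set q \<subseteq> J \<and> s \<in> J \<and> t \<in> J \<and> s \<noteq> t \<and> braid_length A s t = Some m"
  then have "f (p @ alternate m s t @ (q @ r)) = f (p @ alternate m t s @ (q @ r))"
    using assms unfolding braid_invariant_def by (metis set_append Un_least)
  then show "f ((p @ alternate m s t @ q) @ r) = f ((p @ alternate m t s @ q) @ r)" by simp
qed

lemma neg_combination:
  assumes "pos (- act u (al s))" "pos (- act u (al t))" "x \<ge> 0" "y \<ge> 0"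
    and "smul x (act u (al s)) + smul y (act u (al t)) \<in> roots"
  shows "pos (- (smul x (act u (al s)) + smul y (act u (al t))))"
proof -
  have "- (smul x (act u (al s)) + smul y (act u (al t))) \<noteq> 0"
    using root_nonzero[OF assms(5)] by (metis neg_0_equal_iff_equal)
  moreover have "(smul x (act u (al s)) + smul y (act u (al t))) j \<le> 0" for j
    using assms(1-4) by (simp add: pos_def mult_nonneg_nonpos add_nonpos_nonpos)
  ultimately show ?thesis
    unfolding pos_def by (auto simp: fun_Compl_def intro: add_nonpos_nonpos) (smt (verit))
qed

text \<open>If s and t are both descents of u, then u is z times the longest element of the dihedral
  group of s and t, with lengths adding up: each root crossed in the dihedral part is minus the
  u-image of a nonnegative combination of \<open>al s\<close> and \<open>al t\<close>.\<close>

lemma reduced_rank2: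
  assumes st: "s \<le> n" "t \<le> n" "s \<noteq> t" and m: "braid_length A s t = Some m"
    and u: "set u \<subseteq> {..n}" "pos (- act u (al s))" "pos (- act u (al t))"
    and z: "reduced z" "set z \<subseteq> {..n}" "act z = act (u @ alternate m s t)"
  shows "reduced (z @ rev (alternate m s t))"
proof -
  let ?L = "alternate m s t"
  have L: "set ?L \<subseteq> {..n}" using set_alternate[of m s t] st by auto
  have "k \<le> m \<Longrightarrow> reduced (z @ rev (drop k ?L))" for k
  proof (induction "m - k" arbitrary: k)
    case 0
    then show ?case using z by simp
  next
    case (Suc d)
    then have k: "k < m" by simp
    have drop: "rev (drop k ?L) = rev (drop (Suc k) ?L) @ [?L ! k]"
      using k by (simp add: Cons_nth_drop_Suc[symmetric])
    have take: "take (Suc k) ?L = take k ?L @ [?L ! k]" using k by (simp add: take_Suc_conv_app_nth)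
    have "?L ! k \<in> set ?L" using k by (intro nth_mem) simp
    then have in_n: "set (take (Suc k) ?L) \<subseteq> {..n}" "set (drop (Suc k) ?L) \<subseteq> {..n}" "?L ! k \<le> n"
      using L set_take_subset[of "Suc k" ?L] set_drop_subset[of "Suc k" ?L] by blast+
    have "act (z @ rev (drop (Suc k) ?L)) (al (?L ! k))
        = act u (act (take (Suc k) ?L) (act (drop (Suc k) ?L) (act (rev (drop (Suc k) ?L)) (al (?L ! k)))))"
      using z(3) act_append[of "take (Suc k) ?L" "drop (Suc k) ?L"]
      by (simp only: act_append append_take_drop_id)
    also have "\<dots> = act u (act (take (Suc k) ?L) (al (?L ! k)))" using in_n by (simp add: act_rev')
    also have "\<dots> = - act u (act (take k ?L) (al (?L ! k)))"
      using in_n by (simp add: take refl_al act_minus)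
    finally have eq: "act (z @ rev (drop (Suc k) ?L)) (al (?L ! k)) = - act u (act (take k ?L) (al (?L ! k)))" .
    obtain x y where xy: "x \<ge> 0" "y \<ge> 0" "act (take k ?L) (al (?L ! k)) = smul x (al s) + smul y (al t)"
      using rank2_root[OF st m k] by blast
    have "act u (act (take k ?L) (al (?L ! k))) \<in> roots"
      using act_al_in_roots[of "u @ take k ?L" "?L ! k"] u(1) L set_take_subset[of k ?L] in_n by auto
    then have "pos (- act u (act (take k ?L) (al (?L ! k))))"
      using neg_combination[OF u(2,3) xy(1,2)] by (simp add: xy(3) act_add act_smul)
    then have "pos (act (z @ rev (drop (Suc k) ?L)) (al (?L ! k)))" using eq by simp
    moreover have "reduced (z @ rev (drop (Suc k) ?L))" using Suc by auto
    ultimately show ?case unfolding drop using reduced_snoc[of "z @ rev (drop (Suc k) ?L)"] by simp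
  qed
  from this[of 0] show ?thesis by simp
qed

end

text \<open>\<open>js\<close> is a reduced word for the reflection in \<theta>. The assumption
  \<open>generated\<close> says that sums, negatives and reflections at pairing 1 or -1 lead from
  \<theta> to the whole lattice; these are the steps along which a lattice homomorphism obeying the
  relations is determined.\<close>

locale affine_datum = affine_root_datum +
  fixes js :: "nat list"
  assumes few_laces: "i \<le> n \<Longrightarrow> j \<le> n \<Longrightarrow> i \<noteq> j \<Longrightarrow> A i j * A j i \<le> 3 \<or> n = 1"
    and js_letters: "set js \<subseteq> {1..n}" and js_reduced: "reduced js"
    and js_act: "act js x = x - smul (B x th) th"
    and generated: "\<lbrakk>th \<in> M; \<And>x y. x \<in> M \<Longrightarrow> y \<in> M \<Longrightarrow> x + y \<in> M; \<And>x. x \<in> M \<Longrightarrow> - x \<in> M;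
      \<And>x i. x \<in> M \<Longrightarrow> i \<in> {1..n} \<Longrightarrow> pr i x = 1 \<or> pr i x = -1 \<Longrightarrow> srefl i x \<in> M;
      j \<in> {1..n}\<rbrakk> \<Longrightarrow> al j \<in> M"
    and n_pos: "n \<ge> 1"
begin

text \<open>Without a braid relation n is 1 and s, t are all the nodes. Then \<open>a\<close> is a
  positive combination of \<open>al s\<close> and \<open>al t\<close> and is fixed by u, so u cannot
  make both of them negative.\<close>

lemma two_descents_finite:
  assumes st: "s \<le> n" "t \<le> n" "s \<noteq> t"
    and u: "set u \<subseteq> {..n}" "pos (- act u (al s))" "pos (- act u (al t))"
  shows "\<exists>m. braid_length A s t = Some m"
proof (rule ccontr)
  assume "\<not> ?thesis"
  then have none: "braid_length A s t = None" by auto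
  have "A s t * A t s \<ge> 0" using offdiag st by (simp add: mult_nonpos_nonpos)
  moreover have "A s t * A t s \<noteq> 0" "A s t * A t s \<noteq> 1" "A s t * A t s \<noteq> 2" "A s t * A t s \<noteq> 3"
    using none by (auto simp: braid_length_def laces_def split: if_splits)
  ultimately have n: "n = 1" using few_laces[OF st] by linarith
  have "a = smul (a s) (al s) + smul (a t) (al t)"
  proof
    fix j show "a j = (smul (a s) (al s) + smul (a t) (al t)) j"
      using st n a_supp[of j] by (auto simp: al_apply)
  qed
  then have "a = smul (a s) (act u (al s)) + smul (a t) (act u (al t))"
    using act_a[OF u(1)] by (metis act_add act_smul)
  then have "a 0 = a s * act u (al s) 0 + a t * act u (al t) 0"
    by (metis plus_fun_apply smul_apply)
  moreover have "act u (al s) 0 \<le> 0" "act u (al t) 0 \<le> 0" using u by (auto simp: pos_def)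
  ultimately show False using a_0 a_pos[OF st(1)] a_pos[OF st(2)]
    by (smt (verit) mult_nonneg_nonpos)
qed

text \<open>The induction on length runs over all invariants f at once, so that a common last letter
  can be absorbed into f. If the last letters s and t differ, both are descents, and u and v are
  compared with words ending in the two alternating words of s and t.\<close>

theorem matsumoto:
  fixes f :: "nat list \<Rightarrow> 'x"
  assumes "J \<subseteq> {..n}" "braid_invariant J f" "reduced u" "reduced v" "set u \<subseteq> J" "set v \<subseteq> J" "act u = act v"
  shows "f u = f v"
  using assms(2-)
proof (induction "length u" arbitrary: u v f rule: less_induct)
  case less
  note J = subset_trans[OF _ assms(1)]
  have len: "length u = length v"
    using reduced_same_length[of u v] less.prems J by auto
  have same_last: "g (u' @ [i]) = g (v' @ [i])"
    if "reduced (u' @ [i])" "reduced (v' @ [i])" "set (u' @ [i]) \<subseteq> J" "set (v' @ [i]) \<subseteq> J"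
      "act (u' @ [i]) = act (v' @ [i])" "length u' < length u" "braid_invariant J g"
    for u' v' i and g :: "nat list \<Rightarrow> 'x"
  proof (rule less.hyps[of u' "\<lambda>w. g (w @ [i])" v'])
    have "i \<le> n" using that(3) assms(1) by auto
    show "act u' = act v'"
    proof
      fix x
      have "act u' x = act (u' @ [i]) (srefl i x)" using \<open>i \<le> n\<close> by (simp add: refl_refl)
      also have "\<dots> = act v' x" using \<open>i \<le> n\<close> that(5) by (simp only:) (simp add: refl_refl)
      finally show "act u' x = act v' x" .
    qed
  qed (use that reduced_snoc braid_invariant_append[of J g "[i]"] in auto)
  show ?case
  proof (cases u rule: rev_cases)
    case Nil
    then show ?thesis using len by simp
  next
    case u: (snoc u' s)
    then obtain v' t where v: "v = v' @ [t]" using len by (cases v rule: rev_cases) auto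
    show ?thesis
    proof (cases "s = t")
      case True
      then show ?thesis using same_last[of u' s v' f] less.prems u v by auto
    next
      case False
      have st: "s \<in> J" "t \<in> J" using less.prems u v by auto
      then have stn: "s \<le> n" "t \<le> n" using assms(1) by auto
      have un: "set u \<subseteq> {..n}" using less.prems J by auto
      have ds: "pos (- act u (al s))"
        using less.prems(2) stn by (simp add: u reduced_snoc refl_al act_minus)
      have dt: "pos (- act u (al t))"
        using less.prems(3,6) stn by (simp add: v reduced_snoc refl_al act_minus)
      obtain m where m: "braid_length A s t = Some m"
        using two_descents_finite[OF stn False un ds dt] by blast
      then have m': "braid_length A t s = Some m" by (simp add: braid_length_sym)
      obtain k where k: "m = Suc k" using m by (cases m) (auto elim: braid_length_cases)
      have alt_J: "set (alternate m s t) \<subseteq> J" "set (alternate m t s) \<subseteq> J"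
        "set (alternate k t s) \<subseteq> J" "set (alternate k s t) \<subseteq> J"
        using set_alternate[of m s t] set_alternate[of m t s]
          set_alternate[of k s t] set_alternate[of k t s] st by auto
      have "set (u @ alternate m s t) \<subseteq> {..n}" using less.prems(4) alt_J assms(1) by auto
      then obtain z where z: "reduced z" "set z \<subseteq> set (u @ alternate m s t)"
          "act z = act (u @ alternate m s t)"
        using reduced_exists by blast
      have zJ: "set z \<subseteq> J" using z(2) less.prems(4) alt_J by auto
      have z': "act z = act (u @ alternate m t s)"
        using z(3) act_alternate[OF stn False m] by (simp add: fun_eq_iff)
      have r1: "reduced (z @ rev (alternate m s t))"
        using reduced_rank2[OF stn False m un ds dt z(1) J[OF zJ] z(3)] .
      have r2: "reduced (z @ rev (alternate m t s))"
        using reduced_rank2[OF stn(2,1) _ m' un dt ds z(1) J[OF zJ] z'] False by simp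
      have altn: "set (alternate m s t) \<subseteq> {..n}" "set (alternate m t s) \<subseteq> {..n}"
        using alt_J assms(1) by auto
      have a1: "act (z @ rev (alternate m s t)) = act u"
        by (rule ext) (simp add: z(3) act_rev'[OF altn(1)])
      have a2: "act (z @ rev (alternate m t s)) = act v"
        by (rule ext) (simp add: z' act_rev'[OF altn(2)] less.prems(6))
      have "f u = f (z @ rev (alternate m s t))"
        using same_last[of u' s "z @ rev (alternate k t s)" f] less.prems u k r1 a1 zJ alt_J by auto
      also have "\<dots> = f (z @ rev (alternate m t s))"
      proof -
        have "f (z @ alternate m s t @ []) = f (z @ alternate m t s @ [])"
          using less.prems(1)[unfolded braid_invariant_def, rule_format, of z "[]" s t m] zJ st False m by simp
        then show ?thesis by (simp add: rev_alternate)
      qed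
      also have "\<dots> = f v"
        using same_last[of "z @ rev (alternate k s t)" t v' f] less.prems v k r2 a2 zJ alt_J
          reduced_same_length[OF r2 _ less.prems(3) _ a2[symmetric]] len J stn
        by (auto simp: subset_trans[OF _ assms(1)])
      finally show ?thesis .
    qed
  qed
qed


lemma first_descent:
  "\<not> reduced w \<Longrightarrow> \<exists>x i y. w = x @ i # y \<and> reduced x \<and> \<not> pos (act x (al i))"
proof (induction w rule: rev_induct)
  case (snoc i w)
  then show ?case
  proof (cases "reduced w")
    case True
    then show ?thesis using snoc.prems by (auto simp: reduced_snoc)
  next
    case False
    then obtain x j y where "w = x @ j # y" "reduced x" "\<not> pos (act x (al j))" using snoc.IH by blast
    then show ?thesis by (intro exI[of _ x] exI[of _ j] exI[of _ "y @ [i]"]) simp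
  qed
qed simp

text \<open>Up to the first descent i the prefix is reduced, and it has another reduced word ending
  in i. By \<open>matsumoto\<close> f does not distinguish the two, so the pair i i appears and can
  be cancelled. Thus every word can be replaced by a reduced one.\<close>

theorem tits:
  fixes f :: "nat list \<Rightarrow> 'x"
  assumes J: "J \<subseteq> {..n}" and braid: "braid_invariant J f"
    and cancel: "\<And>p q i. set p \<subseteq> J \<Longrightarrow> set q \<subseteq> J \<Longrightarrow> i \<in> J \<Longrightarrow> f (p @ [i, i] @ q) = f (p @ q)"
    and uv: "set u \<subseteq> J" "set v \<subseteq> J" "act u = act v"
  shows "f u = f v"
proof -
  have red: "\<exists>w'. reduced w' \<and> set w' \<subseteq> J \<and> act w' = act w \<and> f w' = f w" if "set w \<subseteq> J" for w
    using that
  proof (induction "length w" arbitrary: w rule: less_induct)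
    case less
    show ?case
    proof (cases "reduced w")
      case False
      then obtain x i y where w: "w = x @ i # y" and x: "reduced x" "\<not> pos (act x (al i))"
        using first_descent by blast
      have xJ: "set x \<subseteq> J" "set y \<subseteq> J" "i \<in> J" using less.prems w by auto
      then have xn: "set x \<subseteq> {..n}" "i \<le> n" using J by auto
      have "pos (- act x (al i))" using root_pos_or_neg[OF act_al_in_roots[OF xn]] x(2) by blast
      then obtain p j q where pq: "x = p @ j # q" "act (x @ [i]) = act (p @ q)"
        using exchange[OF xn] by blast
      have "set (p @ q) \<subseteq> {..n}" using xn pq(1) by auto
      then obtain z where z: "reduced z" "set z \<subseteq> set (p @ q)" "act z = act (p @ q)" "length z \<le> length (p @ q)"
        using reduced_exists by blast
      have zJ: "set z \<subseteq> J" using z(2) xJ pq(1) by auto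
      have zi: "act (z @ [i]) = act x"
      proof
        fix v
        show "act (z @ [i]) v = act x v"
          using fun_cong[OF pq(2), of "srefl i v"] xn(2) by (simp add: z(3) refl_refl)
      qed
      have "length (z @ [i]) \<le> length x" using z(4) pq(1) by simp
      then have "reduced (z @ [i])"
        using reduced_if_same_length[OF x(1) xn(1) _ zi] zJ xJ J by auto
      then have "f (x @ i # y) = f ((z @ [i]) @ i # y)"
        using matsumoto[OF J braid_invariant_append[OF braid, of "i # y"] x(1), of "z @ [i]"] xJ zJ zi by auto
      also have "\<dots> = f (z @ y)" using cancel[of z y i] zJ xJ by simp
      finally have fw: "f w = f (z @ y)" by (simp add: w)
      have act_eq: "act (z @ y) = act w"
        using fun_cong[OF zi] xn(2) by (simp add: w fun_eq_iff) (metis refl_refl xn(2))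
      have "length (z @ y) < length w" "set (z @ y) \<subseteq> J" using z(4) pq(1) w zJ xJ by auto
      then obtain w' where "reduced w'" "set w' \<subseteq> J" "act w' = act (z @ y)" "f w' = f (z @ y)"
        using less.hyps by blast
      then show ?thesis using fw act_eq by metis
    qed (use less.prems in auto)
  qed
  obtain u' v' where u': "reduced u'" "set u' \<subseteq> J" "act u' = act u" "f u' = f u"
    and v': "reduced v'" "set v' \<subseteq> J" "act v' = act v" "f v' = f v"
    using red uv by meson
  have "f u' = f v'" using matsumoto[OF J braid u'(1) v'(1) u'(2) v'(2)] u'(3) v'(3) uv(3) by simp
  then show ?thesis using u' v' by simp
qed

section \<open>Gradients and the semi-infinite section\<close>

text \<open>The height of the gradient of an affine root, that is, of its image modulo \<open>\<delta>\<close>.\<close>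

definition psi :: "ivec \<Rightarrow> int" where
  "psi b = (\<Sum>j\<le>n. b j - b 0 * a j)"

definition grad :: "ivec \<Rightarrow> ivec" where
  "grad b = b - smul (b 0) a"

lemma psi_add: "psi (x + y) = psi x + psi y"
  and psi_diff: "psi (x - y) = psi x - psi y"
  and psi_minus: "psi (- x) = - psi x"
  and psi_smul: "psi (smul c x) = c * psi x"
  and psi_a: "psi a = 0"
  by (simp_all add: psi_def a_0 algebra_simps sum.distrib sum_subtractf sum_negf sum_distrib_left)

lemmas psi_simps = psi_add psi_diff psi_minus psi_smul psi_a

lemma grad_in_roots:
  assumes "b \<in> roots" shows "grad b \<in> roots"
proof -
  obtain c where c: "c > 0" "B b b = 2 * c" "\<And>k. k \<le> n \<Longrightarrow> c dvd e k * b k"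
    and supp: "\<And>j. j > n \<Longrightarrow> b j = 0"
    using assms by (auto simp: roots_def)
  \<comment> \<open>Here \<open>e 0 = 1\<close> enters: divisibility of the coroot coordinate at
    node 0 is divisibility of \<open>b 0\<close> itself.\<close>
  have "c dvd b 0" using c(3)[of 0] e_0 by simp
  then have "c dvd e k * grad b k" if "k \<le> n" for k
    using c(3)[OF that] by (auto simp: grad_def right_diff_distrib intro!: dvd_diff dvd_mult)
  then show ?thesis
    using c(1,2) supp a_supp unfolding roots_def by (auto simp: grad_def B_simps)
qed

lemma psi_grad: "psi (grad b) = psi b"
  by (simp add: grad_def psi_simps)

lemma grad_0: "grad b 0 = 0"
  by (simp add: grad_def a_0)

lemma psi_eq_sum: "b 0 = 0 \<Longrightarrow> psi b = (\<Sum>j\<le>n. b j)"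
  by (simp add: psi_def)

lemma pos_imp_psi:
  assumes "b \<in> roots" "b 0 = 0" "pos b" shows "psi b > 0"
proof -
  obtain j where j: "b j > 0" using assms(3) by (auto simp: pos_def fun_eq_iff) (metis antisym_conv1)
  then have "j \<le> n" using assms(1) by (auto simp: roots_def) (metis less_irrefl not_le)
  then have "b j \<le> (\<Sum>j\<le>n. b j)"
    using assms(3) by (intro member_le_sum) (auto simp: pos_def)
  then show ?thesis using j assms(2) by (simp add: psi_eq_sum)
qed

lemma psi_pos_iff: "b \<in> roots \<Longrightarrow> psi b > 0 \<longleftrightarrow> pos (grad b)"
  and psi_nonzero: "b \<in> roots \<Longrightarrow> psi b \<noteq> 0"
proof -
  assume b: "b \<in> roots"
  note g = grad_in_roots[OF b]
  have "pos (grad b) \<Longrightarrow> psi b > 0" using pos_imp_psi[OF g grad_0] by (simp add: psi_grad)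
  moreover have "pos (- grad b) \<Longrightarrow> psi b < 0"
    using pos_imp_psi[OF minus_in_roots[OF g]] by (simp add: grad_0 psi_minus psi_grad)
  ultimately show "psi b > 0 \<longleftrightarrow> pos (grad b)" "psi b \<noteq> 0"
    using root_pos_or_neg[OF g] by fastforce+
qed

text \<open>The section applied to \<open>w\<close>, read after \<open>p\<close>; the letter is inverted if the gradient of the
  crossed root is negative.\<close>

fun tau :: "nat list \<Rightarrow> nat list \<Rightarrow> nat gword" where
  "tau p [] = []"
| "tau p (i # w) = (i, \<not> psi (act p (al i)) > 0) # tau (p @ [i]) w"

lemma tau_append: "tau p (u @ v) = tau p u @ tau (p @ u) v"
  by (induction u arbitrary: p) auto

lemma tau_cong: "(\<And>x. psi (act p x) = psi (act q x)) \<Longrightarrow> tau p w = tau q w"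
proof (induction w arbitrary: p q)
  case (Cons i w)
  have "psi (act (p @ [i]) x) = psi (act (q @ [i]) x)" for x using Cons.prems by simp
  then show ?case using Cons by (metis tau.simps(2))
qed simp

lemma tau_letters: "fst ` set (tau p w) = set w"
  by (induction w arbitrary: p) auto

end

text \<open>Signs along a rank two gallery change at most once.\<close>

context mgroup
begin

fun signed_alt :: "bool list \<Rightarrow> 'a \<Rightarrow> 'a \<Rightarrow> 'a" where
  "signed_alt [] a b = 1"
| "signed_alt (x # xs) a b = (if x then a else inverse a) * signed_alt xs b a"

lemma alt_prod_add:
  "alt_prod (k + l) a b = alt_prod k a b * (if even k then alt_prod l a b else alt_prod l b a)"
  by (induction k arbitrary: a b) (auto simp: mult_assoc)

lemma signed_alt_append: "signed_alt (xs @ ys) a b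
    = signed_alt xs a b * (if even (length xs) then signed_alt ys a b else signed_alt ys b a)"
  by (induction xs arbitrary: a b) (auto simp: mult_assoc)

lemma signed_alt_True: "signed_alt (replicate k True) a b = alt_prod k a b"
  by (induction k arbitrary: a b) auto

lemma signed_alt_False:
  "signed_alt (replicate k False) a b = inverse (if odd k then alt_prod k a b else alt_prod k b a)"
proof (induction k arbitrary: a b)
  case (Suc k)
  have "alt_prod (Suc k) a b = alt_prod k a b * (if even k then a else b)" for a b
    using alt_prod_add[of k 1 a b] by simp
  then show ?case using Suc by (auto simp: inverse_mult' simp del: alt_prod.simps(2))
qed (simp add: inverse_one')

text \<open>The two mixed words are P^-1 Q and Q' P'^-1. They agree because P Q' = Q P', which is
  the braid relation with one side cut after k letters and the other after l.\<close>

lemma signed_alt_one_change: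
  assumes "alt_prod (k + l) a b = alt_prod (k + l) b a"
  shows "signed_alt (replicate k False @ replicate l True) a b
    = signed_alt (replicate l True @ replicate k False) b a"
proof -
  define P where "P = (if odd k then alt_prod k a b else alt_prod k b a)"
  define Q where "Q = (if even k then alt_prod l a b else alt_prod l b a)"
  define Q' where "Q' = alt_prod l b a"
  define P' where "P' = (if odd k = even l then alt_prod k b a else alt_prod k a b)"
  have "Q * P' = (if even k then alt_prod (l + k) a b else alt_prod (l + k) b a)"
    by (auto simp: Q_def P'_def alt_prod_add)
  moreover have "P * Q' = (if odd k then alt_prod (k + l) a b else alt_prod (k + l) b a)"
    by (auto simp: P_def Q'_def alt_prod_add)
  ultimately have "P * Q' = Q * P'" using assms by (auto simp: add.commute)
  then have "inverse P * Q = Q' * inverse P'"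
    by (metis eq_inverse_mult eq_mult_inverse mult_assoc)
  moreover have "signed_alt (replicate k False @ replicate l True) a b = inverse P * Q"
    by (simp add: signed_alt_append signed_alt_True signed_alt_False P_def Q_def)
  moreover have "signed_alt (replicate l True @ replicate k False) b a = Q' * inverse P'"
    by (simp add: signed_alt_append signed_alt_True signed_alt_False P'_def Q'_def)
  ultimately show ?thesis by simp
qed

fun one_change :: "bool list \<Rightarrow> bool" where
  "one_change (x # y # zs) = (if x = y then one_change (y # zs) else (\<forall>z\<in>set zs. z = y))"
| "one_change _ = True"

lemma one_change_cases:
  "one_change xs \<Longrightarrow> \<exists>k l x. xs = replicate k x @ replicate l (\<not> x)"
proof (induction xs rule: one_change.induct)
  case (1 x y zs)
  show ?case
  proof (cases "x = y")
    case True
    then obtain k l v where *: "y # zs = replicate k v @ replicate l (\<not> v)" using 1 by auto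
    show ?thesis
    proof (cases k)
      case 0
      then obtain l' where "l = Suc l'" "y = (\<not> v)" using * by (cases l) auto
      then show ?thesis using * True 0
        by (intro exI[of _ "Suc l"] exI[of _ 0] exI[of _ y]) simp
    next
      case (Suc k')
      then have "x # y # zs = replicate (Suc k) v @ replicate l (\<not> v)" using * True by simp
      then show ?thesis by blast
    qed
  next
    case False
    then have "zs = replicate (length zs) y" using 1 by (simp add: replicate_length_same)
    then have "x # y # zs = replicate 1 x @ replicate (Suc (length zs)) (\<not> x)" using False by auto
    then show ?thesis by blast
  qed
qed (auto intro: exI[of _ 0] exI[of _ "1::nat"])

lemma signed_alt_rev:
  assumes "one_change xs" "alt_prod (length xs) a b = alt_prod (length xs) b a"
  shows "signed_alt xs a b = signed_alt (rev xs) b a"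
proof -
  obtain k l x where xs: "xs = replicate k x @ replicate l (\<not> x)" using one_change_cases assms(1) by blast
  show ?thesis
  proof (cases x)
    case True
    then show ?thesis using signed_alt_one_change[of l k b a] assms(2) by (simp add: xs add.commute)
  next
    case False
    then show ?thesis using signed_alt_one_change[of k l a b] assms(2) by (simp add: xs)
  qed
qed

end

context affine_datum
begin

lemma ev_tau_alternate:
  "ev T (tau p (alternate m s t)) = signed_alt (map snd (tau p (alternate m s t))) (T s) (T t)"
  by (induction m arbitrary: p s t) (auto simp: ev_Cons)

text \<open>The heights of the crossed gradients are linear in u and v, with coefficients given by
  the rank two system, and none of them vanishes. The opposite word crosses the same roots in
  reverse order.\<close>

lemma tau_alternate_signs:
  assumes st: "s \<le> n" "t \<le> n" "s \<noteq> t" and m: "braid_length A s t = Some m" and p: "set p \<subseteq> {..n}"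
  shows "one_change (map snd (tau p (alternate m s t)))"
    and "map snd (tau p (alternate m t s)) = rev (map snd (tau p (alternate m s t)))"
proof -
  define u where "u = psi (act p (al s))"
  define v where "v = psi (act p (al t))"
  have nz: "psi (act (p @ q) (al i)) \<noteq> 0" if "set q \<subseteq> {s, t}" "i \<in> {s, t}" for q i
    using that st p by (intro psi_nonzero act_al_in_roots) auto
  note simps = srefl_def pr_simps diag act_diff act_smul act_minus act_add psi_simps
    u_def[symmetric] v_def[symmetric] st
  \<comment> \<open>Six roots suffice in every case: the largest system, with m = 6, has exactly
    these as its positive roots.\<close>
  note nzs = nz[of "[]" s] nz[of "[]" t] nz[of "[s]" t] nz[of "[t]" s] nz[of "[s,t]" s] nz[of "[t,s]" t]
  have "one_change (map snd (tau p (alternate m s t))) \<and>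
    map snd (tau p (alternate m t s)) = rev (map snd (tau p (alternate m s t)))"
    using st m
  proof (cases rule: rank2_cases)
    case 1
    show ?thesis using nzs 1 by (simp add: simps eval_nat_numeral)
  next
    case 2
    show ?thesis using nzs 2 by (simp add: simps eval_nat_numeral) (smt (verit))
  next
    case 3
    show ?thesis using nzs 3 by (simp add: simps eval_nat_numeral) (smt (verit))
  next
    case 4
    show ?thesis using nzs 4 by (simp add: simps eval_nat_numeral) (smt (verit))
  next
    case 5
    show ?thesis using nzs 5 by (simp add: simps eval_nat_numeral) (smt (verit))
  next
    case 6
    show ?thesis using nzs 6 by (simp add: simps eval_nat_numeral) (smt (verit))
  qed
  then show "one_change (map snd (tau p (alternate m s t)))"
    "map snd (tau p (alternate m t s)) = rev (map snd (tau p (alternate m s t)))" by auto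
qed

lemma length_tau: "length (tau p w) = length w"
  by (induction w arbitrary: p) auto

lemma ev_tau_alternate_eq:
  fixes T :: "nat \<Rightarrow> 'a :: mgroup"
  assumes st: "s \<le> n" "t \<le> n" "s \<noteq> t" and m: "braid_length A s t = Some m" and p: "set p \<subseteq> {..n}"
    and braid: "alt_prod m (T s) (T t) = alt_prod m (T t) (T s)"
  shows "ev T (tau p (alternate m s t)) = ev T (tau p (alternate m t s))"
  unfolding ev_tau_alternate tau_alternate_signs(2)[OF assms(1-5)]
  using tau_alternate_signs(1)[OF assms(1-5)] braid
  by (intro signed_alt_rev) (simp_all add: length_tau)

definition braided :: "nat set \<Rightarrow> (nat \<Rightarrow> 'a :: mgroup) \<Rightarrow> bool" where
  "braided J T \<longleftrightarrow> (\<forall>i\<in>J. \<forall>j\<in>J. \<forall>m. i \<noteq> j \<longrightarrow> braid_length A i j = Some m \<longrightarrow>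
    alt_prod m (T i) (T j) = alt_prod m (T j) (T i))"

text \<open>The section is well defined on the affine Weyl group. By \<open>tits\<close> only two
  moves matter: a braid move, where the signs change at most once, and a pair i i, which crosses a
  root and then its negative and so contributes a generator and its inverse.\<close>

theorem ev_tau_act_eq:
  assumes T: "braided {..n} T" and uv: "set u \<subseteq> {..n}" "set v \<subseteq> {..n}" "act u = act v"
  shows "ev T (tau [] u) = ev T (tau [] v)"
proof (rule tits[OF subset_refl _ _ uv])
  show "braid_invariant {..n} (\<lambda>w. ev T (tau [] w))"
    unfolding braid_invariant_def
  proof (intro allI impI, elim conjE)
    fix p q s t m
    assume pq: "set p \<subseteq> {..n}" "set q \<subseteq> {..n}" and st: "s \<in> {..n}" "t \<in> {..n}" "s \<noteq> t"
      and m: "braid_length A s t = Some m"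
    have st': "s \<le> n" "t \<le> n" using st by auto
    have "ev T (tau p (alternate m s t)) = ev T (tau p (alternate m t s))"
      using T st m unfolding braided_def by (intro ev_tau_alternate_eq[OF st' st(3) m pq(1)]) auto
    moreover have "tau (p @ alternate m s t) q = tau (p @ alternate m t s) q"
      using act_alternate[OF st' st(3) m] by (intro tau_cong) simp
    ultimately show "ev T (tau [] (p @ alternate m s t @ q)) = ev T (tau [] (p @ alternate m t s @ q))"
      by (simp add: tau_append)
  qed
next
  fix p q i assume p: "set p \<subseteq> {..n}" "i \<in> {..n}"
  have "psi (act p (al i)) \<noteq> 0" using p by (intro psi_nonzero act_al_in_roots) auto
  then have "ev T (tau p [i, i]) = 1"
    using p by (auto simp: ev_Cons refl_al act_minus psi_minus left_inverse' right_inverse')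
  moreover have "tau (p @ [i, i]) q = tau p q"
    using p by (intro tau_cong) (simp add: refl_refl)
  ultimately show "ev T (tau [] (p @ [i, i] @ q)) = ev T (tau [] (p @ q))"
    by (simp only: tau_append append_Nil ev_append mult_1_left append_assoc)
qed

section \<open>Translations and the Bernstein elements\<close>

definition lat :: "ivec set" where
  "lat = {x. x 0 = 0 \<and> (\<forall>j>n. x j = 0)}"

text \<open>The usual formula for the translation by l on vectors of level zero, that is, on the
  span of the simple roots.\<close>

definition trans :: "ivec \<Rightarrow> ivec \<Rightarrow> ivec" where
  "trans l x = x - smul (B l x) a"

lemma lat_add: "x \<in> lat \<Longrightarrow> y \<in> lat \<Longrightarrow> x + y \<in> lat"
  and lat_diff: "x \<in> lat \<Longrightarrow> y \<in> lat \<Longrightarrow> x - y \<in> lat"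
  and lat_minus: "x \<in> lat \<Longrightarrow> - x \<in> lat"
  and lat_zero: "0 \<in> lat"
  and lat_smul: "x \<in> lat \<Longrightarrow> smul c x \<in> lat"
  and lat_al: "i \<in> {1..n} \<Longrightarrow> al i \<in> lat"
  and lat_srefl: "x \<in> lat \<Longrightarrow> i \<in> {1..n} \<Longrightarrow> srefl i x \<in> lat"
  and lat_th: "th \<in> lat"
  by (auto simp: lat_def al_apply srefl_def th_def a_0 a_supp)

lemma subgroup_smul:
  assumes "\<And>x y. x \<in> M \<Longrightarrow> y \<in> M \<Longrightarrow> x + y \<in> M" "\<And>x. x \<in> M \<Longrightarrow> - x \<in> M" "(x :: ivec) \<in> M"
  shows "smul c x \<in> M"
proof -
  have zero: "0 \<in> M" using assms(1)[OF assms(3) assms(2)[OF assms(3)]] by simp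
  have nat: "smul (int k) x \<in> M" for k
  proof (induction k)
    case 0
    have "smul (int 0) x = 0" by (simp add: fun_eq_iff)
    then show ?case using zero by metis
  next
    case (Suc k)
    have *: "smul (int (Suc k)) x = smul (int k) x + x" by (simp add: fun_eq_iff algebra_simps)
    show ?case unfolding * using assms(1)[OF Suc assms(3)] .
  qed
  show ?thesis
  proof (cases "c \<ge> 0")
    case True
    then show ?thesis using nat[of "nat c"] by simp
  next
    case False
    then have *: "smul c x = - smul (int (nat (- c))) x" by (simp add: fun_eq_iff)
    show ?thesis unfolding * by (rule assms(2)[OF nat])
  qed
qed

lemma lat_sum:
  assumes M: "\<And>x y. x \<in> M \<Longrightarrow> y \<in> M \<Longrightarrow> x + y \<in> M" "\<And>x. x \<in> M \<Longrightarrow> - x \<in> M"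
    and 0: "0 \<in> M" and al: "\<And>j. j \<in> {1..n} \<Longrightarrow> x j \<noteq> 0 \<Longrightarrow> al j \<in> M" and x: "x \<in> lat"
  shows "x \<in> M"
proof -
  have "k \<le> n \<Longrightarrow> (\<lambda>j. if j \<le> k then x j else 0) \<in> M" for k
  proof (induction k)
    case 0
    have "(\<lambda>j. if j \<le> 0 then x j else 0) = 0" using x by (auto simp: lat_def)
    then show ?case using \<open>0 \<in> M\<close> by simp
  next
    case (Suc k)
    have *: "(\<lambda>j. if j \<le> Suc k then x j else 0)
        = (\<lambda>j. if j \<le> k then x j else 0) + smul (x (Suc k)) (al (Suc k))"
      by (auto simp: fun_eq_iff al_apply le_Suc_eq)
    have "smul (x (Suc k)) (al (Suc k)) \<in> M"
    proof (cases "x (Suc k) = 0")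
      case True
      then have "smul (x (Suc k)) (al (Suc k)) = 0" by (simp add: fun_eq_iff)
      then show ?thesis using 0 by simp
    next
      case False
      then show ?thesis using Suc.prems by (intro subgroup_smul M al) auto
    qed
    then show ?case unfolding * using Suc by (intro M) auto
  qed
  from this[of n] show ?thesis
  proof -
    have "(\<lambda>j. if j \<le> n then x j else 0) = x" using x by (auto simp: lat_def fun_eq_iff)
    then show ?thesis using \<open>n \<le> n \<Longrightarrow> (\<lambda>j. if j \<le> n then x j else 0) \<in> M\<close> by simp
  qed
qed

text \<open>An induction rule made from \<open>generated\<close>. Reflections occur only at pairing
  1 or -1, where relation (iii) or its inverse form applies.\<close>

lemma lat_induct [consumes 1, case_names th add minus srefl]:
  assumes x: "x \<in> lat" and th: "P th"
    and add: "\<And>x y. x \<in> lat \<Longrightarrow> y \<in> lat \<Longrightarrow> P x \<Longrightarrow> P y \<Longrightarrow> P (x + y)"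
    and minus: "\<And>x. x \<in> lat \<Longrightarrow> P x \<Longrightarrow> P (- x)"
    and srefl: "\<And>x i. x \<in> lat \<Longrightarrow> P x \<Longrightarrow> i \<in> {1..n} \<Longrightarrow> pr i x = 1 \<or> pr i x = -1 \<Longrightarrow> P (srefl i x)"
  shows "P x"
proof -
  let ?M = "{x \<in> lat. P x}"
  have "x \<in> ?M"
  proof (rule lat_sum[OF _ _ _ _ x])
    fix j assume "j \<in> {1..n}"
    then show "al j \<in> ?M"
      by (rule generated[rotated -1]) (use th add minus srefl lat_th lat_add lat_minus lat_srefl in auto)
  next
    have "P (th + - th)" by (intro add minus th lat_th lat_minus)
    then show "0 \<in> ?M" by (simp add: lat_zero)
  qed (use add minus lat_add lat_minus in auto)
  then show ?thesis by simp
qed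

text \<open>\<open>al 0\<close> and \<theta> have sum \<open>a\<close>, so the product of their
  reflections is a translation.\<close>

lemma trans_th: "act (0 # js) x = trans th x"
  by (simp add: js_act srefl_def trans_def B_th B_sym[of th] pr_simps pr0_th fun_eq_iff)
     (simp add: th_def algebra_simps)

lemma translation_word:
  "l \<in> lat \<Longrightarrow> \<exists>w. set w \<subseteq> {..n} \<and> act w = trans l"
proof (induction rule: lat_induct)
  case th
  then show ?case using trans_th js_letters by (intro exI[of _ "0 # js"]) auto
next
  case (add x y)
  then obtain u v where "set u \<subseteq> {..n}" "act u = trans x" "set v \<subseteq> {..n}" "act v = trans y" by blast
  moreover have "trans x (trans y z) = trans (x + y) z" for z
    by (simp add: trans_def fun_eq_iff B_simps algebra_simps)
  ultimately have "act (u @ v) z = trans (x + y) z" for z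
    using \<open>act u = trans x\<close> \<open>act v = trans y\<close> by simp
  then have "set (u @ v) \<subseteq> {..n} \<and> act (u @ v) = trans (x + y)"
    using \<open>set u \<subseteq> {..n}\<close> \<open>set v \<subseteq> {..n}\<close> by auto
  then show ?case by blast
next
  case (minus x)
  then obtain u where u: "set u \<subseteq> {..n}" "act u = trans x" by blast
  have "act (rev u) y = trans (- x) y" for y
  proof -
    have "act (rev u) (trans x (trans (- x) y)) = trans (- x) y" using act_rev[OF u(1)] u(2) by metis
    moreover have "trans x (trans (- x) y) = y" by (simp add: trans_def B_simps fun_eq_iff)
    ultimately show ?thesis by simp
  qed
  then have "set (rev u) \<subseteq> {..n} \<and> act (rev u) = trans (- x)" using u(1) by (metis ext set_rev)
  then show ?case by blast
next
  case (srefl x i)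
  then obtain u where u: "set u \<subseteq> {..n}" "act u = trans x" by blast
  have i: "i \<le> n" using srefl by simp
  have "act (i # u @ [i]) y = trans (srefl i x) y" for y
  proof -
    have "B x (srefl i y) = B (srefl i x) y" using B_refl[OF i, of "srefl i x" y] i by (simp add: refl_refl)
    then show ?thesis using i by (simp add: u(2) refl_diff refl_smul refl_refl refl_a trans_def)
  qed
  then show ?case using u(1) i by (intro exI[of _ "i # u @ [i]"]) auto
qed

definition translation :: "ivec \<Rightarrow> nat list" where
  "translation l = (SOME w. reduced w \<and> set w \<subseteq> {..n} \<and> act w = trans l)"

lemma translation:
  assumes "l \<in> lat"
  shows "reduced (translation l)" "set (translation l) \<subseteq> {..n}" "act (translation l) = trans l"
proof -
  obtain w where w: "set w \<subseteq> {..n}" "act w = trans l" using translation_word assms by blast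
  then have "\<exists>w. reduced w \<and> set w \<subseteq> {..n} \<and> act w = trans l" using reduced_exists[OF w(1)] by auto
  from someI_ex[OF this]
  show "reduced (translation l)" "set (translation l) \<subseteq> {..n}" "act (translation l) = trans l"
    by (simp_all add: translation_def)
qed

text \<open>A word rather than a group element, so that it can also serve as the image of a lattice
  generator under \<open>to_triple\<close>.\<close>

definition xword :: "ivec \<Rightarrow> nat gword" where
  "xword l = tau [] (translation l)"

text \<open>A translation changes a root by a multiple of \<open>a\<close>, on which
  \<open>psi\<close> vanishes, so it alters no sign. This gives the additivity in
  \<open>xword_add\<close>.\<close>

lemma tau_translation: "l \<in> lat \<Longrightarrow> tau (translation l) w = tau [] w"
  by (rule tau_cong) (simp add: translation trans_def psi_simps)

end

context affine_datum
begin

lemma tau_eqI: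
  assumes "\<And>u j v. w = u @ j # v \<Longrightarrow> psi (act (p @ u) (al j)) > 0 \<longleftrightarrow> psi (act (q @ u) (al j)) > 0"
  shows "tau p w = tau q w"
  using assms
proof (induction w arbitrary: p q)
  case (Cons i w)
  have "tau (p @ [i]) w = tau (q @ [i]) w"
  proof (rule Cons.IH)
    fix u j v assume "w = u @ j # v"
    then have "i # w = (i # u) @ j # v" by simp
    from Cons.prems[OF this]
    show "psi (act ((p @ [i]) @ u) (al j)) > 0 \<longleftrightarrow> psi (act ((q @ [i]) @ u) (al j)) > 0" by simp
  qed
  then show ?case using Cons.prems[of "[]" i w] by simp
qed simp

lemma ev_tau_negative:
  assumes "\<And>u j v. w = u @ j # v \<Longrightarrow> \<not> psi (act (p @ u) (al j)) > 0"
  shows "ev T (tau p w) = prod_list (map T w)"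
  using assms
proof (induction w arbitrary: p)
  case (Cons i w)
  have "ev T (tau (p @ [i]) w) = prod_list (map T w)"
  proof (rule Cons.IH)
    fix u j v assume "w = u @ j # v"
    then have "i # w = (i # u) @ j # v" by simp
    from Cons.prems[OF this] show "\<not> psi (act ((p @ [i]) @ u) (al j)) > 0" by simp
  qed
  then show ?case using Cons.prems[of "[]" i w] by (simp add: ev_Cons)
qed simp

lemma crossing:
  assumes "reduced w" "set w \<subseteq> {..n}" "w = u @ i # v"
  shows "act u (al i) \<in> roots" "pos (act u (al i))" "pos (- act (rev w) (act u (al i)))"
proof -
  have uv: "set u \<subseteq> {..n}" "set v \<subseteq> {..n}" "i \<le> n" using assms by auto
  show "act u (al i) \<in> roots" using act_al_in_roots uv by blast
  show "pos (act u (al i))" using assms(1,3) unfolding reduced_def by blast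
  have "pos (act (rev v) (al i))"
    using reduced_rev[OF assms(1,2)] assms(3) unfolding reduced_def by auto
  moreover have "act (rev w) (act u (al i)) = - act (rev v) (al i)"
    using uv by (simp add: assms(3) act_rev refl_al act_minus)
  ultimately show "pos (- act (rev w) (act u (al i)))" by simp
qed

lemma act_lat: "set w \<subseteq> {1..n} \<Longrightarrow> x \<in> lat \<Longrightarrow> act w x \<in> lat"
  by (induction w) (auto intro!: lat_srefl)

lemma lat_psi_sign:
  assumes "b \<in> roots" "b \<in> lat"
  shows "psi b > 0 \<longleftrightarrow> pos b"
proof -
  have "grad b = b" using assms(2) by (simp add: grad_def lat_def fun_eq_iff)
  then show ?thesis using psi_pos_iff[OF assms(1)] by simp
qed

lemma js_act': "act js x = x + smul (pr 0 x) th"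
  by (simp add: js_act B_th fun_eq_iff)

lemma js_involution: "act js (act js x) = x"
  by (simp add: js_act' pr_simps pr0_th fun_eq_iff)

lemma js_letters_n: "set js \<subseteq> {..n}"
  using js_letters by auto

lemma act_rev_js: "act (rev js) x = act js x"
  by (metis act_rev[OF js_letters_n] js_involution)

lemma psi_th: "psi th > 0"
proof -
  have "th j \<ge> 0" for j using a_pos[of j] a_supp[of j] by (cases "j \<le> n") (auto simp: th_def al_apply a_0)
  then have "th 1 \<le> (\<Sum>j\<le>n. th j)" using n_pos by (intro member_le_sum) auto
  moreover have "th 1 > 0" using a_pos[of 1] n_pos by (simp add: th_def al_apply)
  ultimately show ?thesis using psi_eq_sum[of th] lat_th by (simp add: lat_def)
qed

lemma psi_al_0: "psi (al 0) < 0"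
proof -
  have "psi th = - psi (al 0)" by (simp add: th_def psi_simps)
  then show ?thesis using psi_th by simp
qed

lemma psi_al: "i \<in> {1..n} \<Longrightarrow> psi (al i) > 0"
  using lat_psi_sign[of "al i"] al_in_roots lat_al pos_al by auto

text \<open>A letter stays a plain generator when its gradient is negative. This holds for the
  initial 0. The letters of \<open>js\<close> cross positive finite roots made negative by the
  reflection in \<theta>, and after the prefix 0 their gradients are these negative images, since
  the reflections in \<open>al 0\<close> and \<theta> agree modulo \<open>a\<close>.\<close>

lemma xword_th:
  assumes "braided {..n} T"
  shows "ev T (xword th) = T 0 * prod_list (map T js)"
proof -
  have "ev T (xword th) = ev T (tau [] (0 # js))"
    unfolding xword_def using translation(2,3)[OF lat_th] trans_th js_letters_n
    by (intro ev_tau_act_eq[OF assms]) auto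
  also have "\<dots> = T 0 * ev T (tau [0] js)" using psi_al_0 by (simp add: ev_Cons)
  also have "ev T (tau [0] js) = prod_list (map T js)"
  proof (rule ev_tau_negative)
    fix u i v assume js: "js = u @ i # v"
    let ?b = "act u (al i)"
    note c = crossing[OF js_reduced js_letters_n js]
    have "i \<in> {1..n}" "set u \<subseteq> {1..n}" using js_letters js by auto
    then have lat: "?b \<in> lat" using act_lat lat_al by blast
    have neg: "psi (- act js ?b) > 0"
      using c(3) lat_psi_sign[of "- act js ?b"] js_letters js_letters_n lat
      by (simp add: act_rev_js minus_in_roots act_in_roots c(1) lat_minus act_lat)
    have "psi (srefl 0 ?b) = psi (act js ?b)"
      by (simp add: js_act' srefl_def psi_simps th_def)
    then show "\<not> psi (act ([0] @ u) (al i)) > 0" using neg by (simp add: psi_minus)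
  qed
  finally show ?thesis .
qed

lemma xword_add:
  assumes "braided {..n} T" "x \<in> lat" "y \<in> lat"
  shows "ev T (xword (x + y)) = ev T (xword x) * ev T (xword y)"
proof -
  have "trans x (trans y z) = trans (x + y) z" for z
    by (simp add: trans_def fun_eq_iff B_simps algebra_simps)
  then have "act (translation (x + y)) = act (translation x @ translation y)"
    by (intro ext) (simp add: translation assms lat_add)
  then have "ev T (xword (x + y)) = ev T (tau [] (translation x @ translation y))"
    unfolding xword_def using translation(2) assms lat_add by (intro ev_tau_act_eq) auto
  then show ?thesis by (simp add: tau_append tau_translation assms xword_def)
qed

text \<open>The value of the section at a translation followed by the reflection at i. The letter i
  behind a translation has positive gradient and is inverted.\<close>

lemma translation_snoc:
  assumes "braided {..n} T" "l \<in> lat" "i \<in> {1..n}" "set w \<subseteq> {..n}"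
    and "\<And>x. act w x = trans l (srefl i x)"
  shows "ev T (tau [] w) = ev T (xword l) * inverse (T i)"
proof -
  have "ev T (tau [] w) = ev T (tau [] (translation l @ [i]))"
    using assms translation[OF assms(2)] by (intro ev_tau_act_eq) (auto intro!: ext)
  also have "\<dots> = ev T (xword l) * ev T (tau [] [i])"
    using assms(2) by (simp only: tau_append append_Nil tau_translation xword_def ev_append)
  finally show ?thesis using psi_al[OF assms(3)] by (simp add: ev_Cons)
qed

lemma act_rev_translation: "l \<in> lat \<Longrightarrow> act (rev (translation l)) x = x + smul (B l x) a"
proof -
  assume l: "l \<in> lat"
  have "act (translation l) (x + smul (B l x) a) = x"
    by (simp add: translation l trans_def B_simps fun_eq_iff)
  then show ?thesis using act_rev[OF translation(2)[OF l]] by metis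
qed

text \<open>The reflection at i permutes the positive gradients other than \<open>al i\<close>, by
  \<open>pos_refl\<close>.\<close>

lemma psi_srefl_sign:
  assumes "b \<in> roots" "i \<in> {1..n}" "grad b \<noteq> al i" "grad b \<noteq> - al i"
  shows "psi (srefl i b) > 0 \<longleftrightarrow> psi b > 0"
proof -
  have i: "i \<le> n" "i \<noteq> 0" using assms(2) by auto
  have g: "grad (srefl i b) = srefl i (grad b)"
    using i by (simp add: grad_def refl_diff refl_smul refl_a) (simp add: srefl_def al_apply)
  have "pos (srefl i (grad b)) \<longleftrightarrow> pos (grad b)"
  proof
    assume "pos (grad b)"
    then show "pos (srefl i (grad b))"
      using pos_refl[OF grad_in_roots[OF assms(1)]] i assms by blast
  next
    assume p: "pos (srefl i (grad b))"
    have "srefl i (grad b) \<noteq> al i"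
      using assms(4) refl_refl[OF i(1), of "grad b"] refl_al[OF i(1)] by metis
    then have "pos (srefl i (srefl i (grad b)))"
      using pos_refl[OF refl_in_roots[OF grad_in_roots[OF assms(1)] i(1)] p i(1)] by blast
    then show "pos (grad b)" using i by (simp add: refl_refl)
  qed
  then show ?thesis using psi_pos_iff assms(1) refl_in_roots i g by metis
qed

text \<open>The reflection at i commutes with the translation. The translation fixes all roots of
  gradient \<open>al i\<close> or its negative, so a reduced word of it crosses none of them, and
  prefixing i leaves all its signs unchanged.\<close>

lemma xword_commute:
  assumes T: "braided {..n} T" and l: "l \<in> lat" and i: "i \<in> {1..n}" and pr: "pr i l = 0"
  shows "commutes (T i) (ev T (xword l))"
proof -
  let ?w = "translation l"
  note w = translation[OF l]
  have i': "i \<le> n" using i by simp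
  have "tau [i] ?w = tau [] ?w"
  proof (rule tau_eqI)
    fix u j v assume eq: "?w = u @ j # v"
    let ?b = "act u (al j)"
    note c = crossing[OF w(1,2) eq]
    have "B l ?b = 0" if "grad ?b = al i \<or> grad ?b = - al i"
    proof -
      have "B l ?b = B l (grad ?b)" by (simp add: grad_def B_simps)
      then show ?thesis using that pr i' by (auto simp: B_simps)
    qed
    moreover have "smul 0 a = 0" by (simp add: fun_eq_iff)
    ultimately have "grad ?b \<noteq> al i" "grad ?b \<noteq> - al i"
      using c(2,3) pos_not_minus[OF c(2)] by (auto simp: act_rev_translation[OF l])
    then show "psi (act ([i] @ u) (al j)) > 0 \<longleftrightarrow> psi (act ([] @ u) (al j)) > 0"
      using psi_srefl_sign[OF c(1) i] by simp
  qed
  then have 1: "ev T (tau [] (i # ?w)) = inverse (T i) * ev T (xword l)"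
    using psi_al[OF i] by (simp add: ev_Cons xword_def)
  have "srefl i l = l" using pr by (simp add: srefl_def fun_eq_iff)
  then have "B l (srefl i x) = B l x" for x using B_refl[OF i', of l x] by simp
  then have "act (i # ?w) x = trans l (srefl i x)" for x
    using w i' by (simp add: trans_def refl_diff refl_smul refl_a)
  then have "ev T (tau [] (i # ?w)) = ev T (xword l) * inverse (T i)"
    using w i' by (intro translation_snoc[OF T l i]) auto
  then have "commutes (inverse (T i)) (ev T (xword l))" using 1 by (simp add: commutes_def)
  then show ?thesis using commutes_inverse' inverse_inverse' by metis
qed

text \<open>Let y be a reduced word of the translation by l followed by the reflection at i. It
  crosses no root of gradient \<open>al i\<close> or its negative, so its value \<open>?Y\<close> is
  unchanged behind a prefix i. Then \<open>xword l\<close> has value \<open>?Y * T i\<close>, and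
  evaluating the word i y i in two ways gives the value at the reflected vector.\<close>

lemma xword_srefl:
  assumes T: "braided {..n} T" and l: "l \<in> lat" and i: "i \<in> {1..n}" and pr: "pr i l = 1"
  shows "ev T (xword (srefl i l)) = inverse (T i) * ev T (xword l) * inverse (T i)"
proof -
  let ?w = "translation l"
  note w = translation[OF l]
  have i': "i \<le> n" "i \<noteq> 0" using i by auto
  note e = e_pos[OF i'(1)]
  have wi: "act ?w (al i) = al i - smul (e i) a"
    using pr i' by (simp add: w trans_def B_simps)
  have root: "act ?w (al i) \<in> roots" using act_al_in_roots[OF w(2) i'(1)] .
  have "\<not> pos (act ?w (al i))" using e i' by (auto simp: wi pos_def al_apply a_0 intro!: exI[of _ 0])
  then have neg: "pos (- act ?w (al i))" using root_pos_or_neg[OF root] by blast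
  obtain p j q where pq: "?w = p @ j # q" "act (?w @ [i]) = act (p @ q)"
    using exchange[OF w(2) i'(1) neg] by blast
  have "set (p @ q) \<subseteq> {..n}" using w(2) pq(1) by auto
  then obtain y where y: "reduced y" "set y \<subseteq> {..n}" "act y = act (?w @ [i])"
    using reduced_exists pq(2) by (metis subset_trans)
  have act_y: "act y x = trans l (srefl i x)" for x by (simp add: y(3) w)
  have rev_y: "act (rev y) x = srefl i (x + smul (B l x) a)" for x
  proof -
    have "act y (srefl i (x + smul (B l x) a)) = x"
      using i' by (simp add: act_y refl_refl) (simp add: trans_def B_simps fun_eq_iff)
    then show ?thesis using act_rev[OF y(2)] by metis
  qed
  have shift: "tau [i] y = tau [] y"
  proof (rule tau_eqI)
    fix u j v assume eq: "y = u @ j # v"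
    let ?b = "act u (al j)"
    note c = crossing[OF y(1,2) eq]
    have k: "?b 0 \<ge> 0" using c(2) by (simp add: pos_def)
    have neg: "act (rev y) ?b k \<le> 0" for k using c(3) by (simp add: pos_def)
    have "B l ?b = B l (grad ?b)" by (simp add: grad_def B_simps)
    then have B: "B l ?b = (if grad ?b = al i then e i else - e i)" if "grad ?b = al i \<or> grad ?b = - al i"
      using that pr i' by (auto simp: B_simps)
    have "grad ?b \<noteq> al i"
    proof
      assume g: "grad ?b = al i"
      have "act (rev y) ?b 0 = ?b 0 + e i"
        using B g i' by (simp add: rev_y srefl_def al_apply a_0)
      then show False using neg[of 0] k e by simp
    qed
    moreover have "grad ?b \<noteq> - al i"
    proof
      assume g: "grad ?b = - al i"
      \<comment> \<open>Roots with this gradient differ from it by multiples of \<open>e i\<close>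
        times \<open>a\<close>. Since \<open>?b\<close> is positive, \<open>?b 0\<close> is then at
        least \<open>e i\<close>, which is what the shift by the translation takes away.\<close>
      obtain d where d: "B ?b ?b = 2 * d" "\<And>k. k \<le> n \<Longrightarrow> d dvd e k * ?b k"
        using c(1) by (auto simp: roots_def)
      have "B ?b ?b = B (grad ?b) (grad ?b)" by (simp add: grad_def B_simps)
      then have "d = e i" using d(1) g i' by (simp add: B_simps pr_simps diag)
      then have dvd: "e i dvd ?b 0" using d(2)[of 0] e_0 by simp
      have b: "?b k = - al i k + ?b 0 * a k" for k
        using fun_cong[OF g, of k] by (simp add: grad_def)
      have "?b 0 \<noteq> 0"
      proof
        assume "?b 0 = 0"
        then have "?b i = -1" using b[of i] by (simp add: al_apply)
        then show False using c(2) by (auto simp: pos_def) (metis not_one_le_zero neg_0_le_iff_le)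
      qed
      then have "e i \<le> ?b 0" using dvd k zdvd_imp_le by simp
      moreover have "act (rev y) ?b i = 1 + (?b 0 - e i) * a i"
      proof -
        have "- al i \<noteq> al i" by (auto simp: fun_eq_iff al_apply)
        then have "B l ?b = - e i" using B g by simp
        then have "?b + smul (B l ?b) a = grad ?b + smul (?b 0 - e i) a"
          by (simp add: grad_def fun_eq_iff left_diff_distrib)
        then have "act (rev y) ?b = srefl i (grad ?b + smul (?b 0 - e i) a)"
          unfolding rev_y by (rule arg_cong)
        also have "\<dots> = al i + smul (?b 0 - e i) a"
          using i' by (simp add: g refl_diff refl_add refl_smul refl_a refl_minus refl_al fun_eq_iff)
        finally show ?thesis by (simp add: al_apply)
      qed
      ultimately show False using neg[of i] a_pos[OF i'(1)] by (smt (verit) mult_nonneg_nonneg)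
    qed
    ultimately show "psi (act ([i] @ u) (al j)) > 0 \<longleftrightarrow> psi (act ([] @ u) (al j)) > 0"
      using psi_srefl_sign[OF c(1) i] by simp
  qed
  have yi: "act y (al i) = - al i + smul (e i) a"
    using i' pr by (simp add: act_y refl_al trans_def B_simps fun_eq_iff)
  let ?Y = "ev T (tau [] y)"
  have "act (y @ [i]) x = act ?w x" for x using i' by (simp add: act_y refl_refl w)
  then have "ev T (xword l) = ev T (tau [] (y @ [i]))"
    unfolding xword_def using w(2) y(2) i' by (intro ev_tau_act_eq[OF T]) auto
  \<comment> \<open>The last letter crosses a root of gradient minus \<open>al i\<close> and is
    kept; behind the prefix i the gradient becomes \<open>al i\<close> and the letter is
    inverted.\<close>
  then have X: "ev T (xword l) = ?Y * T i"
    using psi_al[OF i] by (simp add: tau_append ev_Cons yi psi_simps)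
  have l': "srefl i l \<in> lat" using lat_srefl l i by blast
  have "act (i # y @ [i]) x = trans (srefl i l) (srefl i x)" for x
  proof -
    have "B (srefl i l) (srefl i x) = B l x" using B_refl i' by blast
    then show ?thesis using i' by (simp add: act_y trans_def refl_diff refl_smul refl_a refl_refl)
  qed
  then have "ev T (tau [] (i # y @ [i])) = ev T (xword (srefl i l)) * inverse (T i)"
    using y(2) i' by (intro translation_snoc[OF T l' i]) auto
  moreover have "ev T (tau [] (i # y @ [i])) = inverse (T i) * ?Y * inverse (T i)"
    using psi_al[OF i] shift i'
    by (simp add: tau_append ev_Cons yi refl_add refl_diff refl_minus refl_smul refl_a refl_al psi_simps mult.assoc)
  ultimately have "ev T (xword (srefl i l)) = inverse (T i) * ?Y"
    by (simp add: mult_right_cancel')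
  then show ?thesis using X by (simp add: group_simps)
qed

text \<open>Apart from the braid relations, these are the relations of the double affine Artin group
  that involve neither \<open>T 0\<close> nor \<delta>. The reflection rule at pairing 1 is relation
  (iii) read at the reflected vector.\<close>

definition bernstein :: "(nat \<Rightarrow> 'a :: mgroup) \<Rightarrow> (ivec \<Rightarrow> 'a) \<Rightarrow> bool" where
  "bernstein T X \<longleftrightarrow> (\<forall>x\<in>lat. \<forall>y\<in>lat. X (x + y) = X x * X y) \<and>
    (\<forall>i\<in>{1..n}. \<forall>x\<in>lat. (pr i x = 0 \<longrightarrow> commutes (T i) (X x)) \<and>
      (pr i x = 1 \<longrightarrow> X (srefl i x) = inverse (T i) * X x * inverse (T i)))"

text \<open>Allows the entry at node 0 to be exchanged: X is built with \<open>Z 3\<close> there and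
  then used with \<open>Z 1\<close>.\<close>

lemma bernstein_cong: "(\<And>i. i \<in> {1..n} \<Longrightarrow> T i = T' i) \<Longrightarrow> bernstein T X \<longleftrightarrow> bernstein T' X"
  by (auto simp: bernstein_def)

theorem bernstein_xword: "braided {..n} T \<Longrightarrow> bernstein T (\<lambda>x. ev T (xword x))"
  unfolding bernstein_def using xword_add xword_commute xword_srefl by blast

context
  fixes T :: "nat \<Rightarrow> 'a :: mgroup" and X
  assumes bern: "bernstein T X"
begin

lemma X_add: "x \<in> lat \<Longrightarrow> y \<in> lat \<Longrightarrow> X (x + y) = X x * X y"
  using bern by (auto simp: bernstein_def)

lemma X_0: "X 0 = 1"
proof -
  have "X 0 * X 0 = X 0 * 1" using X_add[of 0 0] lat_zero by simp
  then show ?thesis by (simp only: mult_left_cancel')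
qed

lemma X_minus: "x \<in> lat \<Longrightarrow> X (- x) = inverse (X x)"
proof -
  assume x: "x \<in> lat"
  then have "X (- x) * X x = 1" using X_add[of "- x" x] X_0 lat_minus by simp
  then show ?thesis using eq_mult_inverse[of "X (- x)" 1 "X x"] by simp
qed

lemma X_commutes: "x \<in> lat \<Longrightarrow> y \<in> lat \<Longrightarrow> commutes (X x) (X y)"
  by (metis X_add add.commute commutes_def)

lemma X_diff: "x \<in> lat \<Longrightarrow> y \<in> lat \<Longrightarrow> X (x - y) = X x * inverse (X y)"
  using X_add[of x "- y"] X_minus lat_minus by simp

lemma T_commutes_X: "i \<in> {1..n} \<Longrightarrow> x \<in> lat \<Longrightarrow> pr i x = 0 \<Longrightarrow> commutes (T i) (X x)"
  using bern by (auto simp: bernstein_def)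

lemma X_srefl: "i \<in> {1..n} \<Longrightarrow> x \<in> lat \<Longrightarrow> pr i x = 1 \<Longrightarrow> X (srefl i x) = inverse (T i) * X x * inverse (T i)"
  using bern by (auto simp: bernstein_def)

lemma X_srefl': "i \<in> {1..n} \<Longrightarrow> x \<in> lat \<Longrightarrow> pr i x = -1 \<Longrightarrow> X (srefl i x) = T i * X x * T i"
proof -
  assume *: "i \<in> {1..n}" "x \<in> lat" "pr i x = -1"
  then have "pr i (srefl i x) = 1" by (simp add: srefl_def pr_simps diag)
  then have "X x = inverse (T i) * X (srefl i x) * inverse (T i)"
    using X_srefl[of i "srefl i x"] * lat_srefl by (simp add: refl_refl)
  then show ?thesis by (simp add: group_simps)
qed

end

text \<open>Each step of \<open>lat_induct\<close> is forced by the relations.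
  \<open>daa_xword\<close> uses this to recognise a given X as the section.\<close>

theorem bernstein_unique:
  assumes "bernstein T X" "bernstein T X'" "X th = X' th" "x \<in> lat"
  shows "X x = X' x"
  using assms(4)
proof (induction rule: lat_induct)
  case (srefl x i)
  then show ?case
    using X_srefl[OF assms(1)] X_srefl[OF assms(2)] X_srefl'[OF assms(1)] X_srefl'[OF assms(2)] by auto
next
  case (add x y)
  then show ?case by (metis X_add[OF assms(1)] X_add[OF assms(2)])
next
  case (minus x)
  then show ?case by (metis X_minus[OF assms(1)] X_minus[OF assms(2)])
qed (rule assms(3))


section \<open>Braid words of finite Weyl group elements\<close>

abbreviation wprod :: "(nat \<Rightarrow> 'a :: mgroup) \<Rightarrow> nat list \<Rightarrow> 'a" where
  "wprod T w \<equiv> prod_list (map T w)"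

lemma wprod_eq:
  assumes "braided {1..n} T" "reduced u" "reduced v" "set u \<subseteq> {1..n}" "set v \<subseteq> {1..n}" "act u = act v"
  shows "wprod T u = wprod T v"
proof (rule matsumoto[OF _ _ assms(2-)])
  show "braid_invariant {1..n} (wprod T)"
    unfolding braid_invariant_def
  proof (intro allI impI, elim conjE)
    fix p q s t m
    assume "s \<in> {1..n}" "t \<in> {1..n}" "s \<noteq> t" "braid_length A s t = Some m"
    then have "alt_prod m (T s) (T t) = alt_prod m (T t) (T s)"
      using assms(1) unfolding braided_def by blast
    then show "wprod T (p @ alternate m s t @ q) = wprod T (p @ alternate m t s @ q)"
      by (simp add: prod_list_alternate)
  qed
qed auto

lemma act_js_fixes: "pr 0 x = 0 \<Longrightarrow> act js x = x"
  by (simp add: js_act' fun_eq_iff)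

text \<open>If w carries \<open>al i\<close> to \<open>al j\<close>, then w i and j w are reduced
  words of the same element. If it carries \<open>al i\<close> to minus \<open>al j\<close>, then w
  has a reduced word u i where u carries \<open>al i\<close> to \<open>al j\<close>.\<close>

lemma wprod_intertwines:
  assumes T: "braided {1..n} T" and w: "reduced w" "set w \<subseteq> {1..n}" and ij: "i \<in> {1..n}" "j \<in> {1..n}"
    and act: "act w (al i) = al j \<or> act w (al i) = - al j"
  shows "T j * wprod T w = wprod T w * T i"
proof -
  have pos: "T j * wprod T u = wprod T u * T i"
    if u: "reduced u" "set u \<subseteq> {1..n}" "act u (al i) = al j" for u
  proof -
    have un: "set u \<subseteq> {..n}" "i \<le> n" "j \<le> n" using u ij by auto
    have eq: "act (u @ [i]) = act (j # u)" using act_al_eq_al un u by blast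
    have r: "reduced (u @ [i])" using u pos_al by (simp add: reduced_snoc)
    have "reduced (j # u)" by (rule reduced_if_same_length[OF r]) (use un eq in auto)
    from wprod_eq[OF T r this _ _ eq] show ?thesis using u ij by simp
  qed
  show ?thesis
  proof (cases "act w (al i) = al j")
    case True
    then show ?thesis using pos w by blast
  next
    case False
    then have neg: "act w (al i) = - al j" using act by blast
    have wn: "set w \<subseteq> {..n}" "i \<le> n" "j \<le> n" using w ij by auto
    obtain p k q where pq: "w = p @ k # q" "act (w @ [i]) = act (p @ q)"
      using exchange[OF wn(1,2)] neg pos_al by (metis minus_minus)
    have "set (p @ q) \<subseteq> {..n}" using wn(1) pq(1) by auto
    then obtain u where u: "reduced u" "set u \<subseteq> set (p @ q)" "act u = act (w @ [i])" "length u \<le> length (p @ q)"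
      using reduced_exists pq(2) by metis
    have u1: "set u \<subseteq> {1..n}" using u(2) w(2) pq(1) by auto
    have "act u (al i) = al j" using u(3) neg wn by (simp add: refl_al act_minus)
    note * = pos[OF u(1) u1 this]
    have eq: "act w = act (u @ [i])"
      by (rule ext) (use u(3) wn in \<open>simp add: refl_refl\<close>)
    have "reduced (u @ [i])"
      by (rule reduced_if_same_length[OF w(1) wn(1)]) (use u u1 pq(1) eq ij in auto)
    then have "wprod T w = wprod T (u @ [i])"
      using wprod_eq[OF T w(1) _ w(2) _ eq] u1 ij by auto
    then show ?thesis using * by (simp add: mult.assoc[symmetric])
  qed
qed

text \<open>Chains of roots above \<open>al i\<close>: at pairing -1 the reflection adds exactly one
  simple root. The recorded word expresses both the reflection in the top root and its Bernstein
  element.\<close>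

inductive up :: "nat \<Rightarrow> nat list \<Rightarrow> ivec \<Rightarrow> bool" for i where
  base: "up i [] (al i)"
| step: "up i y b \<Longrightarrow> l \<in> {1..n} \<Longrightarrow> pr l b = -1 \<Longrightarrow> up i (l # y) (srefl l b)"

lemma up_facts:
  assumes "up i y b" "i \<in> {1..n}"
  shows "set y \<subseteq> {1..n}" "b = act y (al i)" "b \<in> lat" "pos b"
  using assms
proof (induction)
  case base
  { case 1 show ?case by simp
  next case 2 show ?case by simp
  next case 3 then show ?case by (rule lat_al)
  next case 4 show ?case by (rule pos_al) }
next
  case (step y b l)
  { case 1 then show ?case using step by simp
  next case 2 then show ?case using step by simp
  next case 3 then show ?case using step lat_srefl by blast
  next
    case 4
    then have "pos b" using step by simp
    moreover have "srefl l b = b + al l" using step(3) by (simp add: srefl_def fun_eq_iff)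
    moreover have "al l j \<ge> 0" for j by (simp add: al_apply)
    ultimately show ?case by (auto simp: pos_def fun_eq_iff al_apply add_nonneg_eq_0_iff)
  }
qed

lemma pos_combination:
  assumes "pos b" "c > 0" "k \<ge> 0"
  shows "pos (smul c b + smul k (al l))"
proof -
  obtain j where "b j > 0" using assms(1) by (auto simp: pos_def fun_eq_iff) (metis antisym_conv1)
  then have "smul c b j + smul k (al l) j > 0" using assms by (simp add: al_apply add_pos_nonneg)
  then have "smul c b + smul k (al l) \<noteq> 0" by (auto simp: fun_eq_iff intro!: exI[of _ j])
  then show ?thesis using assms by (auto simp: pos_def al_apply)
qed

text \<open>The palindromic word of the reflection in b, which has norm 2 because
  \<open>e i = 1\<close>. A step of the chain lengthens it at both ends, since the two roots to be
  tested are combinations of b and \<open>al l\<close> with nonnegative coefficients.\<close>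

lemma reflection_word:
  assumes "up i y b" "i \<in> {1..n}" "e i = 1"
  shows "reduced (y @ [i] @ rev y)" "act (y @ [i] @ rev y) x = x - smul (B x b) b"
proof -
  have "reduced (y @ [i] @ rev y) \<and> (\<forall>x. act (y @ [i] @ rev y) x = x - smul (B x b) b)"
    using assms
  proof (induction)
    case base
    have "reduced ([] @ [i])" unfolding reduced_snoc using pos_al by simp
    then show ?case using base by (simp add: srefl_def B_simps)
  next
    case (step y b l)
    let ?w = "y @ [i] @ rev y"
    have l: "l \<le> n" using step by simp
    have w: "reduced ?w" "act ?w x = x - smul (B x b) b" for x using step by auto
    have b: "pos b" "set y \<subseteq> {1..n}" using up_facts step by blast+
    have wn: "set ?w \<subseteq> {..n}" "set (?w @ [l]) \<subseteq> {..n}" using b(2) l step.prems by auto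
    have B: "B (al l) b = - e l" using step l by (simp add: B_simps)
    have e: "e l \<ge> 1" using e_pos[OF l] by simp
    have s: "srefl l b = b + al l" using step(3) by (simp add: srefl_def fun_eq_iff)
    have wl: "act ?w (al l) = smul (e l) b + smul 1 (al l)"
      unfolding w(2) B by (simp add: fun_eq_iff)
    have "pos (act ?w (al l))" unfolding wl using b(1) e by (intro pos_combination) auto
    then have r1: "reduced (?w @ [l])" using w(1) reduced_snoc by blast
    have "act (rev (?w @ [l])) (al l) = srefl l (act ?w (al l))" by simp
    also have "\<dots> = smul (e l) b + smul (e l - 1) (al l)"
      unfolding wl using l by (simp add: refl_add refl_smul s refl_al fun_eq_iff algebra_simps)
    finally have "pos (act (rev (?w @ [l])) (al l))"
      using pos_combination[OF b(1), of "e l" "e l - 1" l] e by simp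
    then have "reduced (l # ?w @ [l])" using reduced_Cons[OF wn(2) l] r1 by simp
    moreover have "act (l # ?w @ [l]) x = x - smul (B x (srefl l b)) (srefl l b)" for x
    proof -
      have "act (l # ?w @ [l]) x = srefl l (act ?w (srefl l x))" by simp
      also have "\<dots> = x - smul (B (srefl l x) b) (srefl l b)"
        unfolding w(2) using l by (simp add: refl_diff refl_smul refl_refl)
      also have "B (srefl l x) b = B x (srefl l b)"
        using B_refl[OF l, of x "srefl l b"] l by (simp add: refl_refl)
      finally show ?thesis .
    qed
    ultimately show ?case by simp
  qed
  then show "reduced (y @ [i] @ rev y)" "act (y @ [i] @ rev y) x = x - smul (B x b) b" by auto
qed

lemma bernstein_up:
  assumes "bernstein T X" "up i y b" "i \<in> {1..n}"
  shows "X b = wprod T y * X (al i) * wprod T (rev y)"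
  using assms(2)
proof induction
  case (step y b l)
  have "X (srefl l b) = T l * X b * T l"
    using X_srefl'[OF assms(1)] step up_facts(3)[OF step(1) assms(3)] by blast
  then show ?case using step by (simp add: mult.assoc)
qed simp

section \<open>Nodes not joined to the affine node\<close>

definition P :: "nat set" where
  "P = {p \<in> {1..n}. A 0 p = 0}"

lemma P_letters: "P \<subseteq> {1..n}"
  by (auto simp: P_def)

lemma P_zero: "p \<in> P \<Longrightarrow> A 0 p = 0 \<and> A p 0 = 0"
  using A_zero_iff[of 0 p] by (auto simp: P_def)

lemma pr_th_P: "p \<in> P \<Longrightarrow> pr p th = 0"
  using P_zero P_letters by (force simp: th_def pr_simps)

lemma pr_srefl: "i \<le> n \<Longrightarrow> pr j (srefl i x) = pr j x - pr i x * A j i"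
  by (simp add: srefl_def pr_simps)

lemma pr0_act_P: "set y \<subseteq> P \<Longrightarrow> pr 0 (act y x) = pr 0 x"
proof (induction y)
  case (Cons p y)
  then have "p \<in> P" by simp
  then have "p \<le> n" "A 0 p = 0" using P_zero P_letters by auto
  then show ?case using Cons by (simp add: pr_srefl)
qed simp

lemma pr0_al_P: "p \<in> P \<Longrightarrow> pr 0 (al p) = 0"
  by (auto simp: P_def pr_simps)

text \<open>The letters of y cross roots orthogonal to \<open>al 0\<close>, which w fixes, so they
  remain positive behind w.\<close>

lemma reduced_append_P:
  assumes "reduced w" "\<And>x. pr 0 x = 0 \<Longrightarrow> act w x = x" "reduced y" "set y \<subseteq> P"
  shows "reduced (w @ y)"
  using assms(3,4)
proof (induction y rule: rev_induct)
  case (snoc p y)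
  have "pr 0 (act y (al p)) = 0" using snoc.prems pr0_act_P pr0_al_P by simp
  then have "pos (act (w @ y) (al p))" using assms(2) snoc.prems by (simp add: reduced_snoc)
  then show ?case using snoc reduced_snoc[of "w @ y" p] by (simp add: reduced_snoc)
qed (simp add: assms)

context
  fixes T :: "nat \<Rightarrow> 'a :: mgroup"
  assumes T: "braided {1..n} T"
begin

lemma T_P_commutes_js: "p \<in> P \<Longrightarrow> commutes (T p) (wprod T js)"
  using wprod_intertwines[OF T js_reduced js_letters, of p p] act_js_fixes pr0_al_P P_letters
  by (auto simp: commutes_def)

lemma wprod_P_commutes_js: "set y \<subseteq> P \<Longrightarrow> commutes (wprod T y) (wprod T js)"
  using T_P_commutes_js by (intro commutes_prod_list') auto

text \<open>\<theta> is the reflection of \<open>th - al k\<close> at k, so the palindromic word of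
  the reflection in \<theta> can be chosen to begin and end with k.\<close>

lemma theta_factorization:
  assumes "up i y (th - al k)" "i \<in> {1..n}" "e i = 1" "k \<in> {1..n}" "pr k th = 1"
  shows "wprod T js = T k * wprod T (y @ [i] @ rev y) * T k"
proof -
  have "pr k (th - al k) = -1" using assms by (simp add: pr_simps diag)
  moreover have "srefl k (th - al k) = th"
    using assms by (simp add: refl_diff refl_al) (simp add: srefl_def fun_eq_iff)
  ultimately have u: "up i (k # y) th" using up.step[OF assms(1)] assms(4) by metis
  have "set y \<subseteq> {1..n}" using up_facts assms by blast
  then have "wprod T js = wprod T ((k # y) @ [i] @ rev (k # y))"
    using reflection_word[OF u assms(2,3)] js_reduced js_letters js_act assms
    by (intro wprod_eq[OF T]) (auto intro!: ext)
  then show ?thesis by (simp add: mult.assoc)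
qed

text \<open>The word y carries \<open>al i\<close> to \<open>th - al k\<close>, and the reflection
  in \<theta> carries this to minus \<open>al k\<close>. Since y uses only nodes of
  \<open>P\<close>, the product words are reduced and \<open>wprod_intertwines\<close>
  applies.\<close>

lemma theta_conjugation:
  assumes u: "up i y (th - al k)" and y: "set y \<subseteq> P" and i: "i \<in> {1..n}" and e: "e i = 1"
    and k: "k \<in> {1..n}" "pr 0 (al k) = -1"
  shows "T k * (wprod T js * wprod T y) = wprod T js * wprod T y * T i"
    and "T i * (wprod T (rev y) * wprod T js) = wprod T (rev y) * wprod T js * T k"
proof -
  have "reduced (y @ [i] @ rev y)" using reflection_word u i e by blast
  then have ry: "reduced y" by (rule reduced_prefix)
  have th_k: "act js (al k) = al k - th" using k by (simp add: js_act' fun_eq_iff)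
  have "act (js @ y) (al i) = act js (th - al k)"
    using up_facts(2)[OF u i] by simp
  also have "\<dots> = - al k"
    using k by (simp add: js_act' pr_simps pr0_th fun_eq_iff)
  finally have 1: "act (js @ y) (al i) = - al k" .
  have "reduced (js @ y)" using reduced_append_P[OF js_reduced act_js_fixes ry y] .
  from wprod_intertwines[OF T this _ i k(1)] 1
  show "T k * (wprod T js * wprod T y) = wprod T js * wprod T y * T i"
    using js_letters y P_letters by auto
  have "reduced (rev js @ y)"
    using reduced_append_P[of "rev js" y] reduced_rev[OF js_reduced js_letters_n] act_js_fixes ry y
    by (simp add: act_rev_js)
  then have r: "reduced (rev y @ js)"
    using reduced_rev[of "rev js @ y"] js_letters_n y P_letters by fastforce
  have yn: "set y \<subseteq> {..n}" using y P_letters by auto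
  have "act (rev y @ js) (al k) = act (rev y) (- (th - al k))" by (simp add: th_k)
  also have "\<dots> = - al i" unfolding act_minus using up_facts(2)[OF u i] act_rev[OF yn] by simp
  finally have 2: "act (rev y @ js) (al k) = - al i" .
  from wprod_intertwines[OF T r _ k(1) i] 2
  show "T i * (wprod T (rev y) * wprod T js) = wprod T (rev y) * wprod T js * T k"
    using js_letters y P_letters by auto
qed

end

section \<open>The two sets of relations in a group\<close>

text \<open>Here \<open>d\<close> is \<open>X\<^sub>\<delta>\<close>, and \<open>s\<^sub>0(x) = x + \<alpha>\<^sub>0 = (x - \<theta>) + \<delta>\<close> if \<open>pr 0 x = -1\<close>.\<close>

definition daa_relations :: "(nat \<Rightarrow> 'a :: mgroup) \<Rightarrow> (ivec \<Rightarrow> 'a) \<Rightarrow> 'a \<Rightarrow> bool" where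
  "daa_relations T X d \<longleftrightarrow> braided {..n} T \<and> bernstein T X \<and>
    (\<forall>i\<le>n. commutes d (T i)) \<and> (\<forall>x\<in>lat. commutes d (X x)) \<and>
    (\<forall>x\<in>lat. pr 0 x = 0 \<longrightarrow> commutes (T 0) (X x)) \<and>
    (\<forall>x\<in>lat. pr 0 x = -1 \<longrightarrow> T 0 * X x * T 0 = X (x - th) * d)"

text \<open>A braid relation involves at most one affine generator, so each \<open>Z k\<close> in
  turn is placed at node 0. The last two clauses say that
  \<open>Z 1 * Z 2 * Z 3 * wprod T js\<close> is central.\<close>

definition triple_relations :: "(nat \<Rightarrow> 'a :: mgroup) \<Rightarrow> (nat \<Rightarrow> 'a) \<Rightarrow> bool" where
  "triple_relations T Z \<longleftrightarrow>
    (\<forall>k\<in>{1,2,3}. braided {..n} (T(0 := Z k))) \<and>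
    (\<forall>i\<in>{1..n}. laces A 0 i = 1 \<longrightarrow>
      (\<forall>x\<in>{Z 1, Z 2, Z 3, Z 1 * Z 2 * inverse (Z 1), inverse (Z 3) * Z 2 * Z 3}. \<forall>k.
        braids x (zpow (Z 1 * Z 2 * Z 3) k * T i * inverse (zpow (Z 1 * Z 2 * Z 3) k)))) \<and>
    (\<forall>i\<in>{1..n}. laces A 0 i = 2 \<longrightarrow>
      (\<forall>j k. 1 \<le> j \<longrightarrow> j < k \<longrightarrow> k \<le> 3 \<longrightarrow> commutes (Z j) (inverse (T i) * Z k * T i))) \<and>
    (\<forall>i\<in>{1..n}. commutes (Z 1 * Z 2 * Z 3 * wprod T js) (T i)) \<and>
    (\<forall>k\<in>{1,2,3}. commutes (Z 1 * Z 2 * Z 3 * wprod T js) (Z k))"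

lemma braided_mono: "braided J T \<Longrightarrow> K \<subseteq> J \<Longrightarrow> braided K T"
  unfolding braided_def by blast

lemma braided_cong: "(\<And>i. i \<in> J \<Longrightarrow> T i = T' i) \<Longrightarrow> braided J T \<longleftrightarrow> braided J T'"
  by (auto simp: braided_def)

lemma braided_finite: "braided {..n} (T(0 := z)) \<Longrightarrow> braided {1..n} T"
  using braided_mono[of "{..n}" "T(0 := z)" "{1..n}"] braided_cong[of "{1..n}" "T(0 := z)" T] by auto

lemma braided_updateI:
  assumes "braided {1..n} T"
    and "\<And>i m. i \<in> {1..n} \<Longrightarrow> braid_length A 0 i = Some m \<Longrightarrow> alt_prod m z (T i) = alt_prod m (T i) z"
  shows "braided {..n} (T(0 := z))"
  unfolding braided_def
proof (intro ballI allI impI)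
  fix i j m assume ij: "i \<in> {..n}" "j \<in> {..n}" "i \<noteq> j" and m: "braid_length A i j = Some m"
  show "alt_prod m ((T(0 := z)) i) ((T(0 := z)) j) = alt_prod m ((T(0 := z)) j) ((T(0 := z)) i)"
    using assms(1)[unfolded braided_def, rule_format, of i j m] assms(2)[of j m] assms(2)[of i m]
      ij m braid_length_sym[of A i j]
    by (cases "i = 0"; cases "j = 0") auto
qed

lemma braid_length_P: "p \<in> P \<Longrightarrow> braid_length A 0 p = Some 2"
  using P_zero by (simp add: braid_length_def laces_def)

lemma braided_commutes:
  assumes "braided {..n} T" "p \<in> P"
  shows "commutes (T 0) (T p)"
proof -
  have "alt_prod 2 (T 0) (T p) = alt_prod 2 (T p) (T 0)"
    using assms(1)[unfolded braided_def, rule_format, of 0 p 2] braid_length_P[OF assms(2)] assms(2)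
    by (auto simp: P_def)
  then show ?thesis by (simp add: eval_nat_numeral commutes_def)
qed

lemma commutes_ev_word:
  assumes "\<And>i. i \<le> n \<Longrightarrow> commutes c (T i)" "x \<in> lat"
  shows "commutes c (ev T (xword x))"
proof (rule commutes_ev[of "{..n}"])
  have "fst ` set (xword x) \<subseteq> {..n}"
    using translation(2)[OF assms(2)] by (simp add: xword_def tau_letters)
  then show "xword x \<in> words_over {..n}" by (auto simp: words_over_def)
qed (use assms in auto)

lemma triple_imp_daa:
  fixes T :: "nat \<Rightarrow> 'a :: mgroup"
  defines "X \<equiv> \<lambda>Z x. ev (T(0 := Z (3::nat))) (xword x)" and "c \<equiv> \<lambda>Z. Z (1::nat) * Z 2 * Z 3 * wprod T js"
  assumes tr: "triple_relations T Z"
    and zero: "\<And>x. x \<in> lat \<Longrightarrow> pr 0 x = 0 \<Longrightarrow> commutes (Z 1) (X Z x)"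
    and one: "\<And>x. x \<in> lat \<Longrightarrow> pr 0 x = -1 \<Longrightarrow> Z 1 * X Z x * Z 1 = X Z (x - th) * c Z"
  shows "daa_relations (T(0 := Z 1)) (X Z) (c Z)"
proof -
  have br: "braided {..n} (T(0 := Z 1))" "braided {..n} (T(0 := Z 3))"
    using tr by (auto simp: triple_relations_def)
  have c: "commutes (c Z) ((T(0 := Z k)) i)" if "i \<le> n" "k \<in> {1, 2, 3}" for k i
    using tr that by (cases "i = 0") (auto simp: triple_relations_def c_def)
  have "bernstein (T(0 := Z 3)) (X Z)" unfolding X_def by (rule bernstein_xword[OF br(2)])
  then have "bernstein (T(0 := Z 1)) (X Z)"
    using bernstein_cong[of "T(0 := Z 1)" "T(0 := Z 3)"] by auto
  moreover have "commutes (c Z) (X Z x)" if "x \<in> lat" for x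
    unfolding X_def using c[of _ 3] that by (intro commutes_ev_word) auto
  ultimately show ?thesis
    unfolding daa_relations_def using br(1) c[of _ 1] zero one by auto
qed

lemma triple_X_th:
  assumes "triple_relations T Z"
  shows "ev (T(0 := Z 3)) (xword th) = Z 3 * wprod T js"
proof -
  have "map (T(0 := Z 3)) js = map T js" using js_letters by auto
  moreover have "braided {..n} (T(0 := Z 3))" using assms by (simp add: triple_relations_def)
  ultimately show ?thesis using xword_th[of "T(0 := Z 3)"] by (simp only: fun_upd_same)
qed

text \<open>With \<open>X th * inverse (wprod T js)\<close> at node 0 the section takes the value
  \<open>X th\<close> at \<theta>, so \<open>bernstein_unique\<close> applies.\<close>

lemma daa_xword:
  assumes "daa_relations T X d" "braided {..n} (T(0 := X th * inverse (wprod T js)))" "x \<in> lat"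
  shows "ev (T(0 := X th * inverse (wprod T js))) (xword x) = X x"
proof (rule bernstein_unique[OF _ _ _ assms(3)])
  let ?T = "T(0 := X th * inverse (wprod T js))"
  show "bernstein T X" using assms by (simp add: daa_relations_def)
  have "bernstein ?T (\<lambda>x. ev ?T (xword x))" by (rule bernstein_xword[OF assms(2)])
  then show "bernstein T (\<lambda>x. ev ?T (xword x))"
    using bernstein_cong[of T ?T] by auto
  have "map ?T js = map T js" using js_letters by auto
  then show "ev ?T (xword th) = X th"
    using xword_th[OF assms(2)] unfolding \<open>map ?T js = map T js\<close> fun_upd_same by (simp add: group_simps)
qed

end

section \<open>Nodes joined to the affine node by a single lace\<close>

context mgroup
begin

text \<open>For a node i joined to 0 by a single lace, a and b stand for \<open>T 0\<close> and
  \<open>T i\<close>, and U and V for the lattice elements of \<open>al 0\<close> and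
  \<open>al i\<close>. Both reflections lead to the element of \<open>al 0 + al i\<close>. Then
  \<open>inverse a * U\<close> is the second affine generator and \<open>U * inverse a\<close> its
  conjugate by the first.\<close>

lemma rank2_braids:
  assumes UV: "U * V = V * U" and b: "b * U * b = U * V" and a: "a * V * a = U * V"
    and ab: "a * b * a = b * a * b"
  shows "braids (U * inverse a) b" "braids (inverse a * U) b"
proof -
  have "b * U = U * V * inverse b" using b by (simp only: eq_mult_inverse)
  \<comment> \<open>The rules carry an arbitrary right factor z, so that \<open>simp only\<close>
    can apply them inside right-nested products.\<close>
  then have bU: "b * (U * z) = U * (V * (inverse b * z))" for z by (metis mult_assoc)
  have "U * b = inverse b * (U * V)" using b by (simp only: eq_inverse_mult mult_assoc)
  then have Ub: "U * (b * z) = inverse b * (U * (V * z))" for z by (metis mult_assoc)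
  have "V * a = inverse a * (U * V)" using a by (simp only: eq_inverse_mult mult_assoc)
  then have a1: "inverse a * (U * (V * z)) = V * (a * z)" for z by (metis mult_assoc)
  have "a * V = U * V * inverse a" using a by (simp only: eq_mult_inverse)
  then have a2: "U * (V * (inverse a * z)) = a * (V * z)" for z by (metis mult_assoc)
  have VU: "V * (U * z) = U * (V * z)" for z using UV by (metis mult_assoc)
  have "inverse b * (inverse a * b) = a * (inverse b * inverse a)"
    and "inverse a * (inverse b * a) = b * (inverse a * inverse b)"
    using ab by (metis eq_inverse_mult eq_mult_inverse mult_assoc inverse_mult')+
  then have c1: "inverse b * (inverse a * (b * z)) = a * (inverse b * (inverse a * z))"
    and c2: "inverse a * (inverse b * (a * z)) = b * (inverse a * (inverse b * z))" for z
    by (metis mult_assoc)+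
  have "U * (inverse a * (b * (U * (inverse a * 1)))) = b * (U * (inverse a * (b * 1)))"
    by (simp only: bU a1 c1)
  then show "braids (U * inverse a) b" by (simp add: braids_def mult_assoc)
  have "inverse a * (U * (b * (inverse a * (U * 1)))) = b * (inverse a * (U * (b * 1)))"
    by (simp only: Ub a2 c2 VU)
  then show "braids (inverse a * U) b" by (simp add: braids_def mult_assoc)
qed

text \<open>The Coxeter relation for \<open>Z 1 * Z 2 * inverse (Z 1)\<close>, which is
  \<open>U * inverse a\<close>, gives back the reflection relation between \<open>T 0\<close> and
  the lattice element of \<open>al i\<close>.\<close>

lemma rank2_braids_converse:
  assumes b: "b * U * b = U * V" and x: "braids (U * inverse a) b"
    and ab: "a * b * a = b * a * b"
  shows "a * V * a = U * V"
proof -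
  have "b * U = U * V * inverse b" using b by (simp only: eq_mult_inverse)
  then have bU: "b * (U * z) = U * (V * (inverse b * z))" for z by (metis mult_assoc)
  have "inverse b * (inverse a * b) = a * (inverse b * inverse a)"
    using ab by (metis eq_inverse_mult eq_mult_inverse mult_assoc inverse_mult')
  then have c1: "inverse b * (inverse a * (b * z)) = a * (inverse b * (inverse a * z))" for z
    by (metis mult_assoc)
  have "U * (inverse a * (b * (U * (inverse a * 1)))) = b * (U * (inverse a * (b * 1)))"
    using x by (simp add: braids_def mult_assoc)
  then have "U * (inverse a * (U * (V * (inverse b * (inverse a * 1)))))
      = U * (V * (a * (inverse b * (inverse a * 1))))"
    by (simp only: bU c1)
  then have "inverse a * (U * V) * (inverse b * inverse a) = V * a * (inverse b * inverse a)"
    by (simp add: mult_left_cancel' mult_assoc)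
  then have "inverse a * (U * V) = V * a" by (simp only: mult_right_cancel')
  then show ?thesis by (metis cancel_inverse_left' mult_assoc)
qed

lemma zpow_conj_closed:
  assumes "\<And>s. Q s \<Longrightarrow> Q (D * s * inverse D)" "\<And>s. Q s \<Longrightarrow> Q (inverse D * s * D)" "Q s"
  shows "Q (zpow D k * s * inverse (zpow D k))"
proof -
  have pow: "Q (g ^ m * s * inverse (g ^ m))" if "\<And>s. Q s \<Longrightarrow> Q (g * s * inverse g)" for g m
  proof (induction m)
    case (Suc m)
    from that[OF this] show ?case by (simp add: group_simps)
  qed (simp add: assms inverse_one')
  have "Q (inverse D * s * inverse (inverse D))" if "Q s" for s
    using assms(2)[OF that] by (simp add: inverse_inverse')
  then show ?thesis using pow[of D] pow[of "inverse D"] assms(1) by (simp add: zpow_def)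
qed

lemma braids_conj_eq: "braids x y \<longleftrightarrow> x * y * inverse x = inverse y * x * y"
  unfolding braids_def by (metis eq_inverse_mult eq_mult_inverse mult_assoc)

lemma alt_prod_3: "alt_prod 3 a b = a * b * a"
  and alt_prod_2: "alt_prod 2 a b = a * b"
  and alt_prod_4: "alt_prod 4 a b = a * b * a * b"
  by (simp_all add: eval_nat_numeral mult_assoc)

end

locale single_laced_datum = affine_datum +
  assumes single: "i \<in> {1..n} \<Longrightarrow> A 0 i = 0 \<or> A 0 i = -1"
begin

definition N :: "nat set" where
  "N = {i \<in> {1..n}. A 0 i = -1}"

lemma N_or_P: "i \<in> {1..n} \<longleftrightarrow> i \<in> N \<or> i \<in> P"
  using single by (auto simp: N_def P_def)

lemma N_letters: "i \<in> N \<Longrightarrow> i \<in> {1..n}"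
  by (simp add: N_def)

lemma N_data:
  assumes "i \<in> N" shows "e i = 1" "A i 0 = -1" "pr 0 (al i) = -1" "pr i th = 1" "laces A 0 i = 1"
proof -
  have i: "i \<le> n" "i \<noteq> 0" "A 0 i = -1" using assms by (auto simp: N_def)
  have "e i * A i 0 = -1" using symm[of i 0] i e_0 by simp
  then show e: "e i = 1" using e_pos[OF i(1)] by (simp add: zmult_eq_neg1_iff)
  then show Ai: "A i 0 = -1" using symm[of i 0] i e_0 by simp
  show "pr 0 (al i) = -1" using i by (simp add: pr_simps)
  show "pr i th = 1" using Ai i by (simp add: th_def pr_simps)
  show "laces A 0 i = 1" using Ai i by (simp add: laces_def)
qed

lemma braid_length_N: "i \<in> N \<Longrightarrow> braid_length A 0 i = Some 3"
  using N_data(5) by (simp add: braid_length_def)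

lemma laces_N: "i \<in> {1..n} \<Longrightarrow> laces A 0 i = 1 \<Longrightarrow> i \<in> N"
  using single P_zero N_or_P by (force simp: laces_def)

lemma laces_not_2: "i \<in> {1..n} \<Longrightarrow> laces A 0 i \<noteq> 2"
  using N_or_P N_data(5) P_zero by (force simp: laces_def)

lemma braided_single_iff:
  "braided {..n} (T(0 := z)) \<longleftrightarrow> braided {1..n} T \<and> (\<forall>p\<in>P. commutes z (T p)) \<and> (\<forall>i\<in>N. braids z (T i))"
proof
  assume br: "braided {..n} (T(0 := z))"
  have "commutes z (T p)" if "p \<in> P" for p
    using braided_commutes[OF br that] that P_letters by force
  moreover have "braids z (T i)" if "i \<in> N" for i
    using br[unfolded braided_def, rule_format, of 0 i 3] braid_length_N[OF that] that
    by (auto simp: N_def alt_prod_3 braids_def)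
  ultimately show "braided {1..n} T \<and> (\<forall>p\<in>P. commutes z (T p)) \<and> (\<forall>i\<in>N. braids z (T i))"
    using braided_finite[OF br] by blast
next
  assume *: "braided {1..n} T \<and> (\<forall>p\<in>P. commutes z (T p)) \<and> (\<forall>i\<in>N. braids z (T i))"
  show "braided {..n} (T(0 := z))"
  proof (rule braided_updateI)
    fix i m assume i: "i \<in> {1..n}" and m: "braid_length A 0 i = Some m"
    show "alt_prod m z (T i) = alt_prod m (T i) z"
    proof (cases "i \<in> N")
      case True
      then show ?thesis using m * braid_length_N by (auto simp: alt_prod_3 braids_def)
    next
      case False
      then have "i \<in> P" using N_or_P i by blast
      then show ?thesis using m * braid_length_P by (auto simp: alt_prod_2 commutes_def)
    qed
  qed (use * in blast)
qed

text \<open>Vectors of norm 2 and level 1 play the role of the short roots \<open>\<beta>\<close> with \<open>(\<beta>, \<theta>) = 1\<close>.\<close>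

definition level_one :: "ivec set" where
  "level_one = {b \<in> lat. B b b = 2 \<and> pr 0 b = -1}"

text \<open>The root condition holds with c = 1. A vector with only nonpositive coordinates in the
  lattice has nonnegative pairing with node 0.\<close>

lemma level_one_pos:
  assumes "b \<in> level_one" shows "b \<in> roots" "pos b"
proof -
  show r: "b \<in> roots" using assms e_pos unfolding level_one_def roots_def lat_def
    by (auto intro!: exI[of _ 1])
  have "\<not> pos (- b)"
  proof
    assume "pos (- b)"
    then have le: "b j \<le> 0" for j by (auto simp: pos_def)
    have "A 0 j * b j \<ge> 0" if "j \<le> n" for j
      using assms offdiag[of 0 j] that le[of j]
      by (cases "j = 0") (auto simp: level_one_def lat_def mult_nonpos_nonpos)
    then have "pr 0 b \<ge> 0" unfolding pr_def by (intro sum_nonneg) auto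
    then show False using assms by (simp add: level_one_def)
  qed
  then show "pos b" using root_pos_or_neg[OF r] by blast
qed

lemma lat_zero_if_norm: "x \<in> lat \<Longrightarrow> B x x \<le> 0 \<Longrightarrow> x = 0"
  using B_zero_if_coordinate_zero[of x 0] B_semidefinite(1)[of x] by (auto simp: lat_def)

text \<open>If \<open>pr p b > 0\<close> for some p in \<open>P\<close>, norm 2 forces
  \<open>pr p b = 1\<close>, since otherwise \<open>b - al p\<close> would have norm at most 0;
  reflecting at p lowers the height. If there is no such p, the level forces a single neighbour i of
  node 0 to occur in b, with coefficient 1, and then \<open>b - al i\<close> has norm at most
  0.\<close>

lemma level_one_descent:
  assumes "b \<in> level_one"
  shows "\<exists>i\<in>N. \<exists>y. set y \<subseteq> P \<and> up i y b"
  using assms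
proof (induction "nat (psi b)" arbitrary: b rule: less_induct)
  case less
  have b: "b \<in> lat" "B b b = 2" "pr 0 b = -1" "pos b"
    using less.prems level_one_pos by (auto simp: level_one_def)
  have nonneg: "b j \<ge> 0" for j using b(4) by (simp add: pos_def)
  show ?case
  proof (cases "\<exists>p\<in>P. pr p b > 0")
    case True
    then obtain p where p: "p \<in> P" "pr p b > 0" by blast
    have p': "p \<in> {1..n}" "p \<le> n" using p P_letters by auto
    have "pr p b = 1"
    proof (rule ccontr)
      assume "pr p b \<noteq> 1"
      then have "e p * 2 \<le> e p * pr p b" using p e_pos[OF p'(2)] by (intro mult_left_mono) auto
      moreover have "B (b - al p) (b - al p) = 2 - 2 * (e p * pr p b) + 2 * e p"
        using b p' by (simp add: B_simps pr_simps diag)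
      ultimately have "B (b - al p) (b - al p) \<le> 0" using e_pos[OF p'(2)] by linarith
      then have "b = al p" using lat_zero_if_norm[OF lat_diff[OF b(1) lat_al[OF p'(1)]]] by simp
      then show False using b(3) pr0_al_P[OF p(1)] by simp
    qed
    define b' where "b' = srefl p b"
    have "b' = b - al p" using \<open>pr p b = 1\<close> by (simp add: b'_def srefl_def fun_eq_iff)
    then have psi: "psi b' < psi b" using psi_al[OF p'(1)] by (simp add: psi_simps)
    have "b' \<in> level_one"
      using b p' P_zero[OF p(1)] lat_srefl by (simp add: level_one_def b'_def B_refl pr_srefl)
    moreover have "psi b' > 0" using lat_psi_sign level_one_pos calculation by (simp add: level_one_def)
    ultimately obtain i y where iy: "i \<in> N" "set y \<subseteq> P" "up i y b'"
      using less.hyps[of b'] psi by auto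
    have "pr p b' = -1" using p' \<open>pr p b = 1\<close> by (simp add: b'_def pr_srefl diag)
    then have "up i (p # y) (srefl p b')" using iy p' up.step by blast
    then show ?thesis using iy p p' by (intro bexI[of _ i] exI[of _ "p # y"]) (auto simp: b'_def refl_refl)
  next
    case False
    have split: "{..n} = insert 0 (N \<union> P)" using N_or_P by force
    have fin: "finite N" "finite P" by (simp_all add: N_def P_def)
    have disj: "0 \<notin> N \<union> P" "N \<inter> P = {}" by (auto simp: N_def P_def)
    have "pr 0 b = (\<Sum>j\<in>insert 0 (N \<union> P). A 0 j * b j)" unfolding pr_def split ..
    also have "\<dots> = (\<Sum>j\<in>N. A 0 j * b j) + (\<Sum>j\<in>P. A 0 j * b j)"
      using fin disj b(1) by (simp add: sum.union_disjoint lat_def)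
    also have "(\<Sum>j\<in>P. A 0 j * b j) = 0" by (intro sum.neutral) (auto simp: P_def)
    also have "(\<Sum>j\<in>N. A 0 j * b j) = - (\<Sum>j\<in>N. b j)"
      unfolding sum_negf[symmetric] by (intro sum.cong) (auto simp: N_def)
    finally have one: "(\<Sum>j\<in>N. b j) = 1" using b(3) by simp
    then obtain i where i: "i \<in> N" "b i \<noteq> 0" by (metis sum.neutral zero_neq_one)
    have rest: "(\<Sum>j\<in>N - {i}. b j) = 1 - b i" using one fin i by (simp add: sum_diff1)
    moreover have "(\<Sum>j\<in>N - {i}. b j) \<ge> 0" using nonneg by (intro sum_nonneg) auto
    ultimately have bi: "b i = 1" using i nonneg[of i] by simp
    then have "b j = 0" if "j \<in> N - {i}" for j
      using rest nonneg that fin sum_nonneg_eq_0_iff[of "N - {i}" b] by auto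
    then have zero: "e j * b j * pr j b = 0" if "j \<in> N - {i}" for j using that by simp
    have "B b b = (\<Sum>j\<in>insert 0 (N \<union> P). e j * b j * pr j b)" unfolding B_def split ..
    also have "\<dots> = (\<Sum>j\<in>N. e j * b j * pr j b) + (\<Sum>j\<in>P. e j * b j * pr j b)"
      using fin disj b(1) by (simp add: sum.union_disjoint lat_def)
    also have "(\<Sum>j\<in>N. e j * b j * pr j b) = e i * b i * pr i b"
      using sum.remove[OF fin(1) i(1), of "\<lambda>j. e j * b j * pr j b"] zero by simp
    finally have "2 = pr i b + (\<Sum>j\<in>P. e j * b j * pr j b)" using b bi N_data[OF i(1)] by simp
    moreover have "(\<Sum>j\<in>P. e j * b j * pr j b) \<le> 0"
    proof (intro sum_nonpos)
      fix j assume "j \<in> P"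
      then have "pr j b \<le> 0" "e j * b j \<ge> 0"
        using False nonneg[of j] e_pos[of j] by (auto simp: P_def not_less)
      then show "e j * b j * pr j b \<le> 0" by (simp add: mult_nonneg_nonpos)
    qed
    ultimately have "pr i b \<ge> 2" by simp
    then have "B (b - al i) (b - al i) \<le> 0"
      using b N_data[OF i(1)] N_letters[OF i(1)] by (simp add: B_simps pr_simps diag B_sym[of "al i" b])
    then have "b = al i"
      using lat_zero_if_norm[OF lat_diff[OF b(1) lat_al[OF N_letters[OF i(1)]]]] by simp
    then show ?thesis using i up.base[of i] by (intro bexI[of _ i] exI[of _ "[]"]) auto
  qed
qed

lemma al_level_one: "i \<in> N \<Longrightarrow> al i \<in> level_one"
  using N_data[of i] N_letters[of i] lat_al by (auto simp: level_one_def B_simps pr_simps diag)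

lemma level_one_complement: "b \<in> level_one \<Longrightarrow> th - b \<in> level_one"
  by (auto simp: level_one_def lat_diff lat_th B_simps norm_th B_th B_sym[of th] pr_simps pr0_th)

lemma th_descent:
  assumes "i \<in> N"
  obtains k y where "k \<in> N" "set y \<subseteq> P" "up k y (th - al i)"
  using level_one_descent[OF level_one_complement[OF al_level_one[OF assms]]] by blast

lemma N_nonempty: "\<exists>i. i \<in> N"
proof (rule ccontr)
  assume "\<not> ?thesis"
  then have "A 0 j * a j = (if j = 0 then 2 else 0)" if "j \<le> n" for j
    using that N_or_P[of j] diag[of 0] a_0 by (cases "j = 0") (auto simp: P_def)
  then have "pr 0 a = (\<Sum>j\<le>n. if j = 0 then 2 else 0)" unfolding pr_def by (intro sum.cong) auto
  then show False using pr_a[of 0] by simp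
qed

text \<open>Carries what is known for vectors of level one to all of \<open>lat\<close>.\<close>

inductive_set level_one_span :: "ivec set" where
  gen: "b \<in> level_one \<Longrightarrow> b \<in> level_one_span"
| add: "x \<in> level_one_span \<Longrightarrow> y \<in> level_one_span \<Longrightarrow> x + y \<in> level_one_span"
| minus: "x \<in> level_one_span \<Longrightarrow> - x \<in> level_one_span"

lemma level_one_srefl: "p \<in> P \<Longrightarrow> b \<in> level_one \<Longrightarrow> srefl p b \<in> level_one"
  using P_zero P_letters lat_srefl by (auto simp: level_one_def B_refl pr_srefl)

lemma level_one_span_srefl:
  "x \<in> level_one_span \<Longrightarrow> p \<in> P \<Longrightarrow> srefl p x \<in> level_one_span"
  by (induction rule: level_one_span.induct)
     (auto simp only: refl_add refl_minus intro: level_one_span.intros level_one_srefl)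

lemma level_one_span: "x \<in> lat \<Longrightarrow> x \<in> level_one_span"
proof (induction rule: lat_induct)
  case th
  obtain i where "i \<in> N" using N_nonempty by blast
  then have "(th - al i) + al i \<in> level_one_span"
    using al_level_one level_one_complement level_one_span.gen by (intro level_one_span.add) metis+
  then show ?case by simp
next
  case (srefl x i)
  show ?case
  proof (cases "i \<in> P")
    case True
    then show ?thesis using level_one_span_srefl srefl by blast
  next
    case False
    then have i: "al i \<in> level_one_span" using srefl N_or_P al_level_one level_one_span.gen by blast
    have "pr i x = 1 \<Longrightarrow> srefl i x = x + - al i" "pr i x = -1 \<Longrightarrow> srefl i x = x + al i"
      by (simp_all add: srefl_def fun_eq_iff)
    then show ?thesis using i srefl level_one_span.intros by metis
  qed
next
  case (add x y)
  then show ?case by (metis level_one_span.add)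
next
  case (minus x)
  then show ?case by (metis level_one_span.minus)
qed

theorem daa_if_triple:
  fixes T :: "nat \<Rightarrow> 'a :: mgroup"
  assumes tr: "triple_relations T Z"
  shows "daa_relations (T(0 := Z 1)) (\<lambda>x. ev (T(0 := Z 3)) (xword x)) (Z 1 * Z 2 * Z 3 * wprod T js)"
proof -
  define X where "X x = ev (T(0 := Z 3)) (xword x)" for x
  define C where "C = Z 1 * Z 2 * Z 3 * wprod T js"
  have br: "braided {..n} (T(0 := Z 1))" "braided {..n} (T(0 := Z 3))"
    using tr by (auto simp: triple_relations_def)
  have "bernstein (T(0 := Z 3)) X" using bernstein_xword[OF br(2)] by (simp add: X_def[abs_def])
  then have bern: "bernstein T X" using bernstein_cong[of T "T(0 := Z 3)"] by auto
  note X = X_add[OF bern] X_diff[OF bern] X_commutes[OF bern]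
  have Xth: "X th = Z 3 * wprod T js" using triple_X_th[OF tr] by (simp add: X_def)
  have C_T: "commutes C (T i)" if "i \<in> {1..n}" for i
    using tr that by (auto simp: triple_relations_def C_def)
  have C_Z: "commutes C (Z k)" if "k \<in> {1, 2, 3}" for k
    using tr that by (auto simp: triple_relations_def C_def)
  have C_X: "commutes C (X x)" if "x \<in> lat" for x
    unfolding X_def using C_T C_Z[of 3] that by (intro commutes_ev_word) auto
  have Z1: "braids (Z 1) (T i)" if "i \<in> N" for i using br(1) that by (simp add: braided_single_iff)
  have Z1P: "commutes (Z 1) (T p)" if "p \<in> P" for p using br(1) that by (simp add: braided_single_iff)
  define good where "good b \<longleftrightarrow> Z 1 * X b * Z 1 = X (b - th) * C" for b
  have base: "good (al i)" if i: "i \<in> N" for i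
  proof -
    \<comment> \<open>As C stands for \<open>X\<close> of \<delta>, this is \<open>X\<close> of
      \<open>al 0\<close>.\<close>
    define U where "U = C * inverse (X th)"
    have U: "U = Z 1 * Z 2" by (simp add: U_def C_def Xth group_simps)
    have i1: "i \<in> {1..n}" and lat: "al i \<in> lat" "th \<in> lat" using i N_letters lat_al lat_th by auto
    have c: "C * inverse (X th) = inverse (X th) * C" "T i * C = C * T i"
      using commutes_inverse[OF C_X[OF lat(2)]] C_T[OF i1] by (auto simp: commutes_def)
    have "X (th - al i) = inverse (T i) * X th * inverse (T i)"
      using X_srefl[OF bern i1 lat(2)] N_data(4)[OF i]
      by (simp add: srefl_def) (metis (no_types, lifting) smul_def ext mult_1_left)
    then have "inverse (X (th - al i)) = T i * (inverse (X th) * T i)"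
      by (simp add: inverse_mult' inverse_inverse' mult.assoc)
    moreover have "X (th - al i) = X th * inverse (X (al i))" using X lat by simp
    ultimately have 1: "T i * (inverse (X th) * T i) = X (al i) * inverse (X th)"
      by (simp add: inverse_mult' inverse_inverse')
    have comm: "X (al i) * inverse (X th) = inverse (X th) * X (al i)"
      using commutes_inverse[OF X(3)[OF lat]] by (simp add: commutes_def)
    have "T i * U * T i = C * (T i * (inverse (X th) * T i))"
      using c by (simp add: U_def mult.assoc) (metis mult.assoc)
    also have "\<dots> = U * X (al i)" unfolding 1 comm by (simp add: U_def mult.assoc)
    finally have b: "T i * U * T i = U * X (al i)" .
    have UX: "U * X (al i) = X (al i) * U"
      using C_X[OF lat(1)] comm by (simp add: U_def commutes_def) (metis mult.assoc)
    have "\<forall>k. braids (Z 1 * Z 2 * inverse (Z 1))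
        (zpow (Z 1 * Z 2 * Z 3) k * T i * inverse (zpow (Z 1 * Z 2 * Z 3) k))"
      using tr i1 N_data(5)[OF i] unfolding triple_relations_def by blast
    then have "braids (U * inverse (Z 1)) (T i)"
      unfolding U by (metis inverse_one' mult.left_neutral mult.right_neutral zpow_0)
    then have "Z 1 * X (al i) * Z 1 = U * X (al i)"
      using rank2_braids_converse[OF b] Z1[OF i] by (simp add: braids_def)
    also have "\<dots> = X (al i - th) * C"
      using X(2)[OF lat] UX c(1) by (simp add: U_def mult.assoc)
    finally show ?thesis by (simp add: good_def)
  qed
  have level: "good b" if b: "b \<in> level_one" for b
  proof -
    obtain i y where i: "i \<in> N" and y: "set y \<subseteq> P" "up i y b" using level_one_descent[OF b] by blast
    from y(2,1) show ?thesis
    proof induction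
      case base
      then show ?case using \<open>\<And>i. i \<in> N \<Longrightarrow> good (al i)\<close> i by blast
    next
      case (step y b p)
      have p: "p \<in> P" "p \<in> {1..n}" using step by auto
      have lat: "b \<in> lat" "b - th \<in> lat" using up_facts(3)[OF step(1) N_letters[OF i]] lat_th lat_diff by auto
      have pr: "pr p (b - th) = -1" using step(3) pr_th_P[OF p(1)] by (simp add: pr_simps)
      have "srefl p th = th" using pr_th_P[OF p(1)] by (simp add: srefl_def fun_eq_iff)
      then have eq: "srefl p b - th = srefl p (b - th)" by (simp add: refl_diff)
      have c: "Z 1 * T p = T p * Z 1" "T p * C = C * T p"
        using Z1P[OF p(1)] C_T[OF p(2)] by (auto simp: commutes_def)
      have "Z 1 * X (srefl p b) * Z 1 = (Z 1 * T p) * X b * (T p * Z 1)"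
        using X_srefl'[OF bern p(2) lat(1) step(3)] by (simp add: mult.assoc)
      also have "\<dots> = (T p * Z 1) * X b * (Z 1 * T p)" by (simp only: c(1))
      also have "\<dots> = T p * (Z 1 * X b * Z 1) * T p" by (simp only: mult.assoc)
      also have "\<dots> = T p * X (b - th) * (C * T p)" using step by (simp add: good_def mult.assoc)
      also have "\<dots> = X (srefl p b - th) * C"
        unfolding eq X_srefl'[OF bern p(2) lat(2) pr] c(2)[symmetric] by (simp add: mult.assoc)
      finally show ?case by (simp add: good_def)
    qed
  qed
  obtain i0 where i0: "i0 \<in> N" using N_nonempty by blast
  define r where "r = al i0"
  have r: "r \<in> level_one" "r \<in> lat" "pr 0 r = -1"
    using al_level_one[OF i0] by (auto simp: r_def level_one_def)
  \<comment> \<open>\<open>x + smul (pr 0 x) r\<close> is the projection of x to level zero along r.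
    For a generator b it is \<open>b - r\<close>, where the relations for b and for r combine to
    commutation; the projection is additive in x.\<close>
  have span: "x \<in> lat \<and> commutes (Z 1) (X (x + smul (pr 0 x) r))" if "x \<in> level_one_span" for x
    using that
  proof induction
    case (gen b)
    have b: "b \<in> lat" "pr 0 b = -1" using gen by (auto simp: level_one_def)
    have "Z 1 * X (b - r) = Z 1 * X b * Z 1 * inverse (Z 1 * X r * Z 1) * Z 1"
      using X(2)[OF b(1) r(2)] by (simp add: group_simps)
    also have "\<dots> = X (b - th) * inverse (X (r - th)) * Z 1"
      using level[OF gen] level[OF r(1)] by (simp add: good_def group_simps)
    also have "X (b - th) * inverse (X (r - th)) = X (b - r)"
      using X(2)[of "b - th" "r - th"] b r lat_th lat_diff by simp
    finally have "Z 1 * X (b - r) = X (b - r) * Z 1" .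
    then have "commutes (Z 1) (X (b - r))" unfolding commutes_def .
    moreover have "b + smul (pr 0 b) r = b - r" using b by (simp add: fun_eq_iff)
    ultimately show ?case using b(1) by (simp only: simp_thms)
  next
    case (add x y)
    have "(x + y) + smul (pr 0 (x + y)) r = (x + smul (pr 0 x) r) + (y + smul (pr 0 y) r)"
      by (simp add: fun_eq_iff pr_simps algebra_simps)
    then show ?case
      using add X(1)[of "x + smul (pr 0 x) r" "y + smul (pr 0 y) r"] r lat_add lat_smul
      by (auto simp only: intro: commutes_mult)
  next
    case (minus x)
    have "- x + smul (pr 0 (- x)) r = - (x + smul (pr 0 x) r)"
      by (simp add: fun_eq_iff pr_simps)
    then show ?case
      using minus X_minus[OF bern, of "x + smul (pr 0 x) r"] r lat_add lat_smul lat_minus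
      by (auto simp only: intro: commutes_inverse)
  qed
  have zero: "commutes (Z 1) (X x)" if "x \<in> lat" "pr 0 x = 0" for x
  proof -
    have "x + smul (pr 0 x) r = x" using that(2) by (simp add: fun_eq_iff)
    then show ?thesis using span[OF level_one_span[OF that(1)]] by metis
  qed
  have one: "Z 1 * X x * Z 1 = X (x - th) * C" if "x \<in> lat" "pr 0 x = -1" for x
  proof -
    have lat: "x - r \<in> lat" "r - th \<in> lat" "th \<in> lat" using that r lat_diff lat_th by auto
    have "Z 1 * X (x - r) = X (x - r) * Z 1"
      using zero[OF lat(1)] that r by (simp add: pr_simps commutes_def)
    moreover have "X x = X (x - r) * X r" using X(1)[OF lat(1) r(2)] by simp
    ultimately have "Z 1 * X x * Z 1 = X (x - r) * (Z 1 * X r * Z 1)"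
      by (simp add: mult.assoc) (metis mult.assoc)
    also have "\<dots> = X (x - r) * X (r - th) * C" using level[OF r(1)] by (simp add: good_def mult.assoc)
    also have "X (x - r) * X (r - th) = X (x - th)" using X(1)[OF lat(1,2)] by simp
    finally show ?thesis .
  qed
  show ?thesis
    using triple_imp_daa[OF tr, folded X_def C_def] zero one by (simp add: X_def[abs_def] C_def)
qed

end

section \<open>From the double affine relations to the triple relations\<close>

context affine_datum
begin

definition triple_of :: "(nat \<Rightarrow> 'a :: mgroup) \<Rightarrow> (ivec \<Rightarrow> 'a) \<Rightarrow> 'a \<Rightarrow> nat \<Rightarrow> 'a" where
  "triple_of T X d k = (if k = 1 then T 0 else if k = 2 then inverse (T 0) * d * inverse (X th)
    else X th * inverse (wprod T js))"

lemma triple_of_simps [simp]: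
  "triple_of T X d 1 = T 0" "triple_of T X d (Suc 0) = T 0"
  "triple_of T X d 2 = inverse (T 0) * d * inverse (X th)"
  "triple_of T X d 3 = X th * inverse (wprod T js)"
  by (simp_all add: triple_of_def)

context
  fixes T :: "nat \<Rightarrow> 'a :: mgroup" and X d
  assumes daa: "daa_relations T X d"
begin

lemma daa_facts:
  shows "braided {..n} T" "bernstein T X" "i \<le> n \<Longrightarrow> commutes d (T i)" "x \<in> lat \<Longrightarrow> commutes d (X x)"
    "x \<in> lat \<Longrightarrow> pr 0 x = 0 \<Longrightarrow> commutes (T 0) (X x)"
    "x \<in> lat \<Longrightarrow> pr 0 x = -1 \<Longrightarrow> T 0 * X x * T 0 = X (x - th) * d"
  using daa by (auto simp: daa_relations_def)

lemma braided_finite_daa: "braided {1..n} T"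
  using braided_mono[OF daa_facts(1)] by auto

lemma d_wprod: "set w \<subseteq> {..n} \<Longrightarrow> commutes d (wprod T w)"
  using daa_facts(3) by (intro commutes_prod_list) auto

lemma triple_product:
  "triple_of T X d 1 * triple_of T X d 2 * triple_of T X d 3 = d * inverse (wprod T js)"
  by (simp add: group_simps)

lemma triple_center:
  "triple_of T X d 1 * triple_of T X d 2 * triple_of T X d 3 * wprod T js = d"
  unfolding triple_product by (simp add: group_simps)

lemma d_triple: "commutes d (triple_of T X d k)"
proof -
  have "commutes d (T 0)" "commutes d (X th)" "commutes d (wprod T js)"
    using daa_facts(3)[of 0] daa_facts(4)[OF lat_th] d_wprod[OF js_letters_n] by auto
  then show ?thesis
    unfolding triple_of_def by (auto intro!: commutes_mult commutes_inverse)
qed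

lemma P_triple: "p \<in> P \<Longrightarrow> commutes (T p) (triple_of T X d k)"
proof -
  assume p: "p \<in> P"
  have "commutes (T p) (T 0)" using braided_commutes[OF daa_facts(1) p] by (rule commutes_sym)
  moreover have "commutes (T p) d" using daa_facts(3)[of p] p P_letters commutes_sym by force
  moreover have "commutes (T p) (X th)"
    using T_commutes_X[OF daa_facts(2) _ lat_th pr_th_P[OF p]] p P_letters by auto
  moreover have "commutes (T p) (wprod T js)" using T_P_commutes_js[OF braided_finite_daa p] .
  ultimately show ?thesis
    unfolding triple_of_def by (auto intro!: commutes_mult commutes_inverse)
qed

text \<open>The product of the three affine generators with \<open>wprod T js\<close> is d, which
  yields the centrality clauses. Accordingly conjugation by powers of \<open>D\<close> is written
  with \<open>d * inverse (wprod T js)\<close>.\<close>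

lemma triple_relationsI:
  assumes "\<And>k. k \<in> {1, 2, 3} \<Longrightarrow> braided {..n} (T(0 := triple_of T X d k))"
    and "\<And>i x k. i \<in> {1..n} \<Longrightarrow> laces A 0 i = 1 \<Longrightarrow>
      x \<in> {T 0, inverse (T 0) * d * inverse (X th), X th * inverse (wprod T js),
        d * inverse (X th) * inverse (T 0), wprod T js * (d * inverse (X th) * inverse (T 0)) * inverse (wprod T js)} \<Longrightarrow>
      braids x (zpow (d * inverse (wprod T js)) k * T i * inverse (zpow (d * inverse (wprod T js)) k))"
    and "\<And>i j k. i \<in> {1..n} \<Longrightarrow> laces A 0 i = 2 \<Longrightarrow> (j, k) \<in> {(1, 2), (1, 3), (2, 3)} \<Longrightarrow>
      commutes (triple_of T X d j) (inverse (T i) * triple_of T X d k * T i)"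
  shows "triple_relations T (triple_of T X d)"
proof -
  let ?Z = "triple_of T X d"
  have d: "commutes d (X th)" "commutes d (wprod T js)" "commutes d (T 0)"
    using daa_facts(3)[of 0] daa_facts(4)[OF lat_th] d_wprod[OF js_letters_n] by auto
  have 4: "?Z 1 * ?Z 2 * inverse (?Z 1) = d * inverse (X th) * inverse (T 0)" by (simp add: group_simps)
  have dz: "d * z = z * d" if "commutes d z" for z using that by (simp add: commutes_def)
  have "inverse (?Z 3) * ?Z 2 * ?Z 3 = wprod T js * (inverse (X th) * inverse (T 0) * d) * inverse (wprod T js)"
    by (simp add: group_simps)
  also have "inverse (X th) * inverse (T 0) * d = d * inverse (X th) * inverse (T 0)"
    using dz[of "inverse (X th) * inverse (T 0)"] d commutes_inverse commutes_mult
    by (metis mult.assoc)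
  finally have 5: "inverse (?Z 3) * ?Z 2 * ?Z 3
      = wprod T js * (d * inverse (X th) * inverse (T 0)) * inverse (wprod T js)" .
  show ?thesis
    unfolding triple_relations_def triple_center 4 5
  proof (intro conjI ballI impI allI)
    fix i assume "i \<in> {1..n}" "laces A 0 i = 1"
    fix x k assume "x \<in> {?Z 1, ?Z 2, ?Z 3, d * inverse (X th) * inverse (T 0),
        wprod T js * (d * inverse (X th) * inverse (T 0)) * inverse (wprod T js)}"
    then show "braids x (zpow (?Z 1 * ?Z 2 * ?Z 3) k * T i * inverse (zpow (?Z 1 * ?Z 2 * ?Z 3) k))"
      unfolding triple_product using \<open>i \<in> {1..n}\<close> \<open>laces A 0 i = 1\<close> by (intro assms(2)) simp_all
  next
    fix i j k :: nat assume *: "i \<in> {1..n}" "laces A 0 i = 2" "1 \<le> j" "j < k" "k \<le> 3"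
    then have "(j, k) \<in> {(1, 2), (1, 3), (2, 3)}" by auto
    then show "commutes (?Z j) (inverse (T i) * ?Z k * T i)" using assms(3) * by blast
  qed (use assms(1) daa_facts(3) d_triple in auto)
qed

end

end

context single_laced_datum
begin

text \<open>Conjugation by \<open>D\<close> acts as conjugation by the inverse of \<Theta>, because
  d is central. It preserves the set \<open>Orb\<close> of conjugates of the \<open>T j\<close>, j
  in \<open>N\<close>, by elements commuting with \<open>T 0\<close>, \<open>X th\<close>, d and
  \<Theta>. So four of the five elements have to be tested only against the \<open>T j\<close>
  themselves, and the fifth is a \<Theta>-conjugate of one of these four.\<close>

theorem triple_if_daa:
  fixes T :: "nat \<Rightarrow> 'a :: mgroup"
  assumes daa: "daa_relations T X d"
  shows "triple_relations T (triple_of T X d)"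
proof (rule triple_relationsI[OF daa])
  note facts = daa_facts[OF daa]
  note bern = facts(2)
  note fin = braided_finite_daa[OF daa]
  define \<Theta> where "\<Theta> = wprod T js"
  define U where "U = d * inverse (X th)"
  let ?Z = "triple_of T X d"
  have d\<Theta>: "commutes d \<Theta>" using d_wprod[OF daa js_letters_n] by (simp add: \<Theta>_def)
  have T0N: "braids (T 0) (T i)" if "i \<in> N" for i
    using facts(1) that braided_single_iff[of T "T 0"] by simp
  \<comment> \<open>\<open>th - al i\<close> is reached from some \<open>al k\<close>, k in
    \<open>N\<close>, along nodes of \<open>P\<close>. The same word y factors its Bernstein
    element, the element \<Theta>, and both conjugates of \<open>T i\<close> by \<Theta>.\<close>
  have factors: "\<exists>k\<in>N. \<exists>y. set y \<subseteq> P \<and>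
      X (th - al i) = wprod T y * X (al k) * wprod T (rev y) \<and>
      \<Theta> = T i * wprod T y * T k * wprod T (rev y) * T i \<and>
      inverse \<Theta> * T i * \<Theta> = wprod T y * T k * inverse (wprod T y) \<and>
      \<Theta> * T i * inverse \<Theta> = inverse (wprod T (rev y)) * T k * wprod T (rev y)" if i: "i \<in> N" for i
  proof -
    obtain k y where k: "k \<in> N" and y: "set y \<subseteq> P" and u: "up k y (th - al i)"
      using th_descent[OF i] by blast
    note ky = N_letters[OF k] N_data(1)[OF k] and i' = N_letters[OF i] N_data(3,4)[OF i]
    let ?Y = "wprod T y" and ?Y' = "wprod T (rev y)"
    have 1: "T i * (\<Theta> * ?Y) = \<Theta> * ?Y * T k" "T k * (?Y' * \<Theta>) = ?Y' * \<Theta> * T i"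
      using theta_conjugation[OF fin u y ky i'(1,2)] by (simp_all add: \<Theta>_def)
    have 2: "?Y * \<Theta> = \<Theta> * ?Y" "?Y' * \<Theta> = \<Theta> * ?Y'"
      using wprod_P_commutes_js[OF fin] y by (simp_all add: \<Theta>_def commutes_def)
    have "T i * \<Theta> = \<Theta> * ?Y * T k * inverse ?Y"
      unfolding eq_mult_inverse using 1(1) by (simp add: mult.assoc)
    then have 3: "inverse \<Theta> * T i * \<Theta> = ?Y * T k * inverse ?Y"
      by (simp add: group_simps)
    have "inverse ?Y' * T k * ?Y' * \<Theta> = \<Theta> * T i"
      using arg_cong[OF 1(2), of "\<lambda>z. inverse ?Y' * z"] by (simp add: group_simps)
    then have "inverse ?Y' * T k * ?Y' = \<Theta> * T i * inverse \<Theta>"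
      by (simp only: eq_mult_inverse)
    then have 4: "\<Theta> * T i * inverse \<Theta> = inverse ?Y' * T k * ?Y'" by (rule HOL.sym)
    have "\<Theta> = T i * ?Y * T k * ?Y' * T i"
      using theta_factorization[OF fin u ky i'(1,3)] by (simp add: \<Theta>_def mult.assoc)
    then show ?thesis using k y bernstein_up[OF bern u ky(1)] 3 4 by blast
  qed
  have XP: "commutes (X th) (T p)" if "p \<in> P" for p
    using T_commutes_X[OF bern _ lat_th pr_th_P[OF that]] that P_letters commutes_sym by blast
  have X_swap: "X (th - al i) = inverse (T i) * X th * inverse (T i)" if "i \<in> N" for i
  proof -
    have "srefl i th = th - al i" using N_data(4)[OF that] by (simp add: srefl_def fun_eq_iff)
    then show ?thesis
      using X_srefl[OF bern N_letters[OF that] lat_th N_data(4)[OF that]] by metis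
  qed
  have rank2: "braids (U * inverse (T 0)) (T i)" "braids (inverse (T 0) * U) (T i)" if i: "i \<in> N" for i
  proof -
    have lat: "al i \<in> lat" "th \<in> lat" using N_letters[OF i] lat_al lat_th by auto
    have dX: "commutes d (X x)" if "x \<in> lat" for x using facts(4) that by blast
    have di: "commutes d (T i)" using facts(3) N_letters[OF i] by simp
    have XX: "commutes (X (al i)) (X th)" using X_commutes[OF bern] lat by blast
    have UV: "U * X (al i) = X (al i) * U"
      unfolding U_def commutes_def[symmetric]
      by (intro commutes_mult' commutes_inverse' dX lat XX[THEN commutes_sym])
    have diff: "X (th - al i) = X th * inverse (X (al i))" using X_diff[OF bern] lat by blast
    have "X th * inverse (X (al i)) = inverse (T i) * X th * inverse (T i)"
      using X_swap[OF i] diff by simp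
    from arg_cong[OF this, of inverse]
    have XT: "X (al i) * inverse (X th) = T i * (inverse (X th) * T i)"
      by (simp add: group_simps)
    have "T i * U * T i = d * (T i * (inverse (X th) * T i))"
      using di by (simp add: U_def commutes_def mult.assoc[symmetric])
    then have "T i * U * T i = d * (X (al i) * inverse (X th))" unfolding XT .
    also have "\<dots> = U * X (al i)"
      using commutes_inverse[OF XX] by (simp add: U_def commutes_def mult.assoc)
    finally have b: "T i * U * T i = U * X (al i)" .
    have "T 0 * X (al i) * T 0 = X (al i - th) * d"
      using facts(6)[OF lat(1) N_data(3)[OF i]] .
    also have "X (al i - th) = inverse (X th) * X (al i)"
      using X_diff[OF bern lat] commutes_inverse[OF XX] by (simp add: commutes_def)
    also have "inverse (X th) * X (al i) * d = U * X (al i)"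
      using commutes_mult[OF commutes_inverse[OF dX[OF lat(2)]] dX[OF lat(1)]]
      by (simp add: U_def commutes_def mult.assoc)
    finally have a: "T 0 * X (al i) * T 0 = U * X (al i)" .
    from rank2_braids[OF UV b a] T0N[OF i]
    show "braids (U * inverse (T 0)) (T i)" "braids (inverse (T 0) * U) (T i)"
      by (simp_all add: braids_def)
  qed
  \<comment> \<open>The braid relation is proved in the form of \<open>braids_conj_eq\<close>: the
    conjugate of \<open>T i\<close> is computed with the factorizations of
    \<open>X (th - al i)\<close> and of \<Theta> along the same word y.\<close>
  have Z3: "braids (X th * inverse \<Theta>) (T i)" if i: "i \<in> N" for i
  proof -
    obtain k y where k: "k \<in> N" and y: "set y \<subseteq> P"
      and Xy: "X (th - al i) = wprod T y * X (al k) * wprod T (rev y)"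
      and \<Theta>: "\<Theta> = T i * wprod T y * T k * wprod T (rev y) * T i"
      and conj: "inverse \<Theta> * T i * \<Theta> = wprod T y * T k * inverse (wprod T y)"
      using factors[OF i] by blast
    let ?Y = "wprod T y" and ?Y' = "wprod T (rev y)"
    have latk: "al k \<in> lat" "th \<in> lat" using N_letters[OF k] lat_al lat_th by auto
    have "commutes (X th) ?Y"
      using y XP by (intro commutes_prod_list) auto
    then have YX: "?Y * X th = X th * ?Y" by (simp add: commutes_def)
    have "X th = X (al k) * X (th - al k)" using X_add[OF bern latk(1) lat_diff[OF latk(2,1)]] by simp
    then have "X th = X (al k) * inverse (T k) * X th * inverse (T k)"
      unfolding X_swap[OF k] by (simp only: mult.assoc)
    then have XTX: "X th * T k = X (al k) * inverse (T k) * X th"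
      by (simp only: eq_mult_inverse)
    have XTX: "X th * T k * inverse (X th) = X (al k) * inverse (T k)"
      unfolding XTX by (simp add: group_simps)
    have "X th * inverse \<Theta> * T i * inverse (X th * inverse \<Theta>)
        = X th * (inverse \<Theta> * T i * \<Theta>) * inverse (X th)"
      by (simp add: group_simps)
    also have "\<dots> = ?Y * (X th * T k * inverse (X th)) * inverse ?Y"
    proof -
      have "X th * (?Y * T k * inverse ?Y) * inverse (X th)
          = (X th * ?Y) * T k * inverse (X th * ?Y)"
        by (simp add: group_simps)
      also have "\<dots> = ?Y * (X th * T k * inverse (X th)) * inverse ?Y"
        unfolding YX[symmetric] by (simp add: group_simps)
      finally show ?thesis unfolding conj .
    qed
    also have "\<dots> = ?Y * X (al k) * inverse (T k) * inverse ?Y"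
      unfolding XTX by (simp add: mult.assoc)
    also have "\<dots> = X (th - al i) * (inverse ?Y' * inverse (T k) * inverse ?Y)"
      unfolding Xy by (simp add: group_simps)
    also have "inverse ?Y' * inverse (T k) * inverse ?Y = T i * inverse \<Theta> * T i"
      unfolding \<Theta> by (simp add: group_simps)
    also have "X (th - al i) * (T i * inverse \<Theta> * T i) = inverse (T i) * (X th * inverse \<Theta>) * T i"
      unfolding X_swap[OF i] by (simp add: group_simps)
    finally show ?thesis unfolding braids_conj_eq .
  qed
  have Z_def: "?Z 1 = T 0" "?Z 2 = inverse (T 0) * U" "?Z 3 = X th * inverse \<Theta>"
    by (simp_all add: U_def \<Theta>_def mult.assoc)
  show "braided {..n} (T(0 := ?Z k))" if "k \<in> {1, 2, 3}" for k
    unfolding braided_single_iff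
    using fin P_triple[OF daa] commutes_sym T0N rank2(2) Z3 that Z_def by (metis empty_iff insert_iff)
  define x4 where "x4 = U * inverse (T 0)"
  \<comment> \<open>Elements commuting with everything from which the tested elements are built;
    products of generators at nodes of \<open>P\<close> are of this kind.\<close>
  define H where "H g \<longleftrightarrow> commutes (T 0) g \<and> commutes (X th) g \<and> commutes d g \<and> commutes \<Theta> g" for g
  have H_mult: "H (g * h)" if "H g" "H h" for g h using that by (auto simp: H_def intro: commutes_mult)
  have H_inv: "H (inverse g)" if "H g" for g using that by (auto simp: H_def intro: commutes_inverse)
  have H_P: "H (wprod T y)" if "set y \<subseteq> P" for y
  proof -
    have p: "commutes (T 0) (T p)" "commutes (X th) (T p)" "commutes d (T p)" "commutes \<Theta> (T p)" if "p \<in> P" for p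
    proof -
      have "p \<in> {1..n}" using that P_letters by blast
      then show "commutes (T 0) (T p)" "commutes (X th) (T p)" "commutes d (T p)" "commutes \<Theta> (T p)"
        using braided_commutes[OF facts(1) that] XP[OF that]
          facts(3)[of p] commutes_sym[OF T_P_commutes_js[OF fin that]] by (simp_all add: \<Theta>_def)
    qed
    then show ?thesis unfolding H_def using that by (intro conjI commutes_prod_list) auto
  qed
  \<comment> \<open>The conjugators must lie in \<open>H\<close>, so that a Coxeter relation with
    \<open>T j\<close> passes to the conjugate by \<open>braids_commuting_conj\<close>.\<close>
  define Orb where "Orb s \<longleftrightarrow> (\<exists>g j. H g \<and> j \<in> N \<and> s = g * T j * inverse g)" for s
  have conj1: "Orb (inverse \<Theta> * s * \<Theta>)" and conj2: "Orb (\<Theta> * s * inverse \<Theta>)" if orb: "Orb s" for s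
  proof -
    obtain g j where g: "H g" and j: "j \<in> N" and s: "s = g * T j * inverse g" using orb by (auto simp: Orb_def)
    obtain k y where k: "k \<in> N" and y: "set y \<subseteq> P"
      and c1: "inverse \<Theta> * T j * \<Theta> = wprod T y * T k * inverse (wprod T y)"
      and c2: "\<Theta> * T j * inverse \<Theta> = inverse (wprod T (rev y)) * T k * wprod T (rev y)"
      using factors[OF j] by blast
    have Hy: "H (wprod T y)" "H (wprod T (rev y))" using H_P y by auto
    have g\<Theta>: "g * \<Theta> = \<Theta> * g" using g by (simp add: H_def commutes_def)
    have "commutes g \<Theta>" using g\<Theta> by (simp add: commutes_def)
    then have g\<Theta>': "inverse \<Theta> * g = g * inverse \<Theta>" and ig: "inverse g * \<Theta> = \<Theta> * inverse g"
      and ig': "inverse \<Theta> * inverse g = inverse g * inverse \<Theta>"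
      using commutes_inverse commutes_inverse' commutes_def by metis+
    have "inverse \<Theta> * s * \<Theta> = (inverse \<Theta> * g) * T j * (inverse g * \<Theta>)" by (simp add: s mult.assoc)
    also have "\<dots> = g * (inverse \<Theta> * T j * \<Theta>) * inverse g" unfolding g\<Theta>' ig by (simp add: mult.assoc)
    also have "\<dots> = (g * wprod T y) * T k * inverse (g * wprod T y)"
      unfolding c1 by (simp add: inverse_mult' mult.assoc)
    finally show "Orb (inverse \<Theta> * s * \<Theta>)" unfolding Orb_def using H_mult[OF g Hy(1)] k by blast
    have "\<Theta> * s * inverse \<Theta> = (\<Theta> * g) * T j * (inverse g * inverse \<Theta>)" by (simp add: s mult.assoc)
    also have "\<dots> = g * (\<Theta> * T j * inverse \<Theta>) * inverse g"
      unfolding g\<Theta>[symmetric] ig'[symmetric] by (simp add: mult.assoc)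
    also have "\<dots> = (g * inverse (wprod T (rev y))) * T k * inverse (g * inverse (wprod T (rev y)))"
      unfolding c2 by (simp add: inverse_mult' inverse_inverse' mult.assoc)
    finally show "Orb (\<Theta> * s * inverse \<Theta>)" unfolding Orb_def using H_mult[OF g H_inv[OF Hy(2)]] k by blast
  qed
  have d_Orb: "commutes d s" if "Orb s" for s
  proof -
    obtain g j where "H g" "j \<in> N" "s = g * T j * inverse g" using \<open>Orb s\<close> by (auto simp: Orb_def)
    moreover have "commutes d (T j)" using facts(3) N_letters[OF \<open>j \<in> N\<close>] by simp
    ultimately show ?thesis by (auto simp: H_def intro!: commutes_mult commutes_inverse)
  qed
  have D_conj: "Orb (zpow (d * inverse \<Theta>) k * s * inverse (zpow (d * inverse \<Theta>) k))" if "Orb s" for s k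
  proof (rule zpow_conj_closed[where Q = Orb, OF _ _ that])
    fix s assume s: "Orb s"
    have "d * (inverse \<Theta> * s * \<Theta>) * inverse d = inverse \<Theta> * s * \<Theta>"
      using d_Orb[OF conj1[OF s]] unfolding commutes_def by (simp add: group_simps)
    then have "d * inverse \<Theta> * s * inverse (d * inverse \<Theta>) = inverse \<Theta> * s * \<Theta>"
      by (simp add: group_simps)
    then show "Orb (d * inverse \<Theta> * s * inverse (d * inverse \<Theta>))" using conj1[OF s] by simp
    have ds: "s * d = d * s" using d_Orb[OF s] by (simp add: commutes_def)
    have "inverse (d * inverse \<Theta>) * s * (d * inverse \<Theta>) = \<Theta> * inverse d * (s * d) * inverse \<Theta>"
      by (simp add: group_simps)
    also have "\<dots> = \<Theta> * s * inverse \<Theta>" unfolding ds by (simp add: group_simps)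
    finally have "inverse (d * inverse \<Theta>) * s * (d * inverse \<Theta>) = \<Theta> * s * inverse \<Theta>" .
    then show "Orb (inverse (d * inverse \<Theta>) * s * (d * inverse \<Theta>))" using conj2[OF s] by simp
  qed
  fix i x k
  assume i: "i \<in> {1..n}" "laces A 0 i = 1"
    and x: "x \<in> {T 0, inverse (T 0) * d * inverse (X th), X th * inverse (wprod T js),
        d * inverse (X th) * inverse (T 0), wprod T js * (d * inverse (X th) * inverse (T 0)) * inverse (wprod T js)}"
  have xs: "x \<in> {T 0, inverse (T 0) * U, X th * inverse \<Theta>, x4, \<Theta> * x4 * inverse \<Theta>}"
    using x by (simp add: U_def \<Theta>_def x4_def mult.assoc)
  have "H 1" by (simp add: H_def)
  then have "Orb (T i)" using laces_N[OF i] unfolding Orb_def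
    by (metis inverse_one' mult.left_neutral mult.right_neutral)
  from D_conj[OF this]
  have Orb: "Orb (zpow (d * inverse \<Theta>) k * T i * inverse (zpow (d * inverse \<Theta>) k))" .
  have orbit: "braids z s" if z: "z \<in> {T 0, inverse (T 0) * U, X th * inverse \<Theta>, x4}" and s: "Orb s" for z s
  proof -
    obtain g j where g: "H g" and j: "j \<in> N" and s: "s = g * T j * inverse g" using s by (auto simp: Orb_def)
    have "commutes z g" using g z
      by (auto simp: H_def U_def x4_def intro!: commutes_mult' commutes_inverse')
    moreover have "braids z (T j)" using z T0N rank2 Z3 j by (auto simp: x4_def)
    ultimately show ?thesis unfolding s by (intro braids_commuting_conj) (rule commutes_sym)
  qed
  show "braids x (zpow (d * inverse (wprod T js)) k * T i * inverse (zpow (d * inverse (wprod T js)) k))"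
    unfolding \<Theta>_def[symmetric]
  proof (cases "x = \<Theta> * x4 * inverse \<Theta>")
    case True
    let ?s = "zpow (d * inverse \<Theta>) k * T i * inverse (zpow (d * inverse \<Theta>) k)"
    have "braids x4 (inverse \<Theta> * ?s * \<Theta>)" using orbit conj1[OF Orb] by blast
    then have "braids (\<Theta> * x4 * inverse \<Theta>) (\<Theta> * (inverse \<Theta> * ?s * \<Theta>) * inverse \<Theta>)"
      by (simp only: braids_conj)
    moreover have "\<Theta> * (inverse \<Theta> * ?s * \<Theta>) * inverse \<Theta> = ?s" by (simp add: group_simps)
    ultimately show "braids x ?s" unfolding True by (simp only:)
  next
    case False
    then show "braids x (zpow (d * inverse \<Theta>) k * T i * inverse (zpow (d * inverse \<Theta>) k))"
      using orbit[OF _ Orb] xs by blast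
  qed
qed (use laces_not_2 in blast)

end

section \<open>The affine node joined by a double lace\<close>

context mgroup
begin

lemma alt_prod_4_iff: "alt_prod 4 a b = alt_prod 4 b a \<longleftrightarrow> commutes a (b * a * b)"
  by (simp add: alt_prod_4 commutes_def mult_assoc)

text \<open>Here \<open>a, b, g, x, G, d\<close> stand for \<open>T\<^sub>0\<close>, \<open>T\<^sub>1\<close>, \<open>T\<close> of \<open>s\<^sub>\<gamma>\<close>, \<open>X\<^sub>\<theta>\<close>, \<open>X\<^sub>\<gamma>\<close>
  and \<open>X\<^sub>\<delta>\<close>, where \<open>\<gamma> = \<theta> - \<alpha>\<^sub>1\<close>.\<close>

lemma double_lace_braids:
  assumes G: "G = inverse b * x * inverse b" and ag: "commutes a g" and xg: "commutes x g"
    and ab: "commutes a (b * a * b)" and gb: "commutes g (b * g * b)"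
    and xG: "commutes x G" and xGb: "commutes b (x * G)" and aG: "commutes a G"
    and d: "commutes d a" "commutes d b" "commutes d x" "commutes d g"
  defines "z3 \<equiv> x * inverse (b * g * b)" and "z2 \<equiv> inverse a * d * inverse x"
  shows "commutes a (inverse b * z2 * b)" "commutes a (inverse b * z3 * b)"
    "commutes z2 (inverse b * z3 * b)" "commutes z2 (b * z2 * b)" "commutes z3 (b * z3 * b)"
proof -
  have dG: "commutes d G" unfolding G using d by (intro commutes_mult commutes_inverse)
  have z3b: "inverse b * z3 * b = G * inverse g" by (simp add: z3_def G group_simps)
  show "commutes a (inverse b * z3 * b)"
    unfolding z3b using aG ag by (intro commutes_mult commutes_inverse)
  show 23: "commutes z2 (inverse b * z3 * b)"
    unfolding z3b z2_def using aG ag xG xg d dG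
    by (intro commutes_mult commutes_mult' commutes_inverse commutes_inverse')
  have bxb: "b * (inverse x * b) = inverse G" by (simp add: G group_simps)
  have db: "d * b = b * d" "d * inverse x = inverse x * d" using d commutes_inverse by (auto simp: commutes_def)
  have "inverse b * z2 * b = inverse b * inverse a * (d * inverse x * b)" by (simp add: z2_def mult_assoc)
  also have "d * inverse x * b = inverse x * b * d" unfolding db mult_assoc using db by (metis mult_assoc)
  also have "inverse b * inverse a * (inverse x * b * d)
      = inverse (b * a * b) * (b * (inverse x * b)) * d" by (simp add: group_simps)
  finally have z2b: "inverse b * z2 * b = inverse (b * a * b) * inverse G * d" unfolding bxb .
  show "commutes a (inverse b * z2 * b)"
    unfolding z2b
    by (rule commutes_mult[OF commutes_mult[OF commutes_inverse[OF ab] commutes_inverse[OF aG]]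
          commutes_sym[OF d(1)]])
  show "commutes z2 (b * z2 * b)"
  proof -
    \<comment> \<open>Up to the central d, \<open>z2\<close> is the product of the inverses of a and
      x. Both sides are brought to the form b s t s y Y.\<close>
    define y where "y = inverse x"
    define Y where "Y = inverse G"
    have bYb: "b * (y * b) = Y" by (simp add: y_def Y_def bxb)
    define s where "s = inverse a"
    define t where "t = inverse b"
    have "inverse (a * (b * a * b)) = inverse (b * a * b * a)" using ab by (simp only: commutes_def)
    then have st: "t * (s * (t * s)) = s * (t * (s * t))"
      by (simp only: s_def t_def inverse_mult' mult_assoc)
    have yb: "y * (b * z) = t * (Y * z)" and b_y: "b * (y * z) = Y * (t * z)" for z
      unfolding bYb[symmetric] t_def by (simp_all add: group_simps)
    have "commutes s Y" using aG by (simp add: s_def Y_def commutes_inverse commutes_inverse')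
    then have Ys: "Y * (s * z) = s * (Y * z)" for z unfolding commutes_def by (metis mult_assoc)
    have "commutes y Y" using xG by (simp add: y_def Y_def commutes_inverse commutes_inverse')
    then have Yy: "Y * (y * z) = y * (Y * z)" for z unfolding commutes_def by (metis mult_assoc)
    have Yt: "Y * (t * z) = b * (y * z)" and bt: "b * (t * z) = z" "t * (b * z) = z" for z
      unfolding b_y t_def by (simp_all add: group_simps)
    have st': "s * (t * (s * (b * z))) = b * (s * (t * (s * z)))" for z
    proof -
      have "t * (s * (t * (s * (b * z)))) = s * (t * (s * z))"
        using st by (metis (no_types, opaque_lifting) bt(2) mult_assoc)
      then show ?thesis by (metis bt(1))
    qed
    have "(s * y) * (b * (s * y) * b) = s * (y * (b * (s * (y * (b * 1)))))" by (simp add: mult_assoc)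
    also have "\<dots> = s * (t * (Y * (s * (t * (Y * 1)))))" by (simp only: yb)
    also have "\<dots> = s * (t * (s * (b * (y * Y))))" by (simp only: Ys Yt mult_1_right)
    also have "\<dots> = b * (s * (t * (s * (y * Y))))" by (simp only: st')
    also have "\<dots> = b * (s * (t * (Y * (s * (y * 1)))))"
      using \<open>commutes y Y\<close> by (simp only: Ys Yy mult_1_right commutes_def)
    also have "\<dots> = b * (s * y) * b * (s * y)" by (simp only: yb[symmetric] mult_assoc mult_1_right)
    finally have "commutes (s * y) (b * (s * y) * b)" by (simp add: commutes_def mult_assoc)
    moreover have ds: "commutes d s" "commutes d y" "commutes d b"
      using d commutes_inverse by (auto simp: s_def y_def)
    have z2: "z2 = (s * y) * d" using ds by (simp add: z2_def s_def[symmetric] y_def[symmetric] commutes_def mult_assoc)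
    moreover have "b * z2 * b = (b * (s * y) * b) * d"
      using ds(3) by (simp add: z2 commutes_def mult_assoc)
    moreover have "commutes d (s * y)" "commutes d (b * (s * y) * b)" using ds by (auto intro: commutes_mult)
    ultimately show ?thesis by (metis commutes_mult commutes_mult' commutes_refl commutes_sym)
  qed
  show "commutes z3 (b * z3 * b)"
  proof -
    \<comment> \<open>Both sides are brought to the form x G b h t h, using that b commutes with x G
      and the braid relation of g and b.\<close>
    define h where "h = inverse g"
    define t where "t = inverse b"
    have bt: "b * (t * z) = z" "t * (b * z) = z" for z by (simp_all add: t_def group_simps)
    have "inverse (g * (b * g * b)) = inverse (b * g * b * g)" using gb by (simp only: commutes_def)
    then have ht: "h * (t * (h * t)) = t * (h * (t * h))"
      by (simp only: h_def t_def inverse_mult' mult_assoc)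
    have z3: "z3 = x * (t * (h * t))" by (simp add: z3_def h_def t_def inverse_mult' mult_assoc)
    have "commutes h x" using commutes_inverse'[OF commutes_sym[OF xg]] by (simp add: h_def)
    then have hx: "h * (x * z) = x * (h * z)" for z unfolding commutes_def by (metis mult_assoc)
    have tx: "t * (x * z) = G * (b * z)" for z by (simp add: G t_def group_simps)
    have bxG: "b * (x * (G * z)) = x * (G * (b * z))" for z using xGb unfolding commutes_def by (metis mult_assoc)
    have ht': "b * (h * (t * (h * (t * z)))) = h * (t * (h * z))" for z
    proof -
      have "h * (t * (h * (t * z))) = t * (h * (t * (h * z)))" using ht by (metis mult_assoc)
      then show ?thesis by (simp add: bt)
    qed
    have "z3 * (b * z3 * b) = x * (t * (h * (t * (b * (x * (t * (h * (t * (b * 1)))))))))"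
      by (simp add: z3 mult_assoc)
    also have "\<dots> = x * (t * (x * (h * (t * (h * 1)))))" by (simp only: bt hx)
    also have "\<dots> = x * (G * (b * (h * (t * (h * 1)))))" by (simp only: tx)
    finally have 1: "z3 * (b * z3 * b) = x * (G * (b * (h * (t * (h * 1)))))" .
    have "b * z3 * b * z3 = b * (x * (t * (h * (t * (b * (x * (t * (h * (t * 1)))))))))"
      by (simp add: z3 mult_assoc)
    also have "\<dots> = b * (x * (t * (x * (h * (t * (h * (t * 1)))))))" by (simp only: bt hx)
    also have "\<dots> = b * (x * (G * (b * (h * (t * (h * (t * 1)))))))" by (simp only: tx)
    also have "\<dots> = x * (G * (b * (b * (h * (t * (h * (t * 1)))))))" by (simp only: bxG)
    also have "\<dots> = x * (G * (b * (h * (t * (h * 1)))))" by (simp only: ht')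
    finally show ?thesis using 1 by (simp add: commutes_def mult_assoc)
  qed
qed

end

text \<open>\<open>th - al 1\<close> is orthogonal to \<open>al 0\<close> and replaces \<theta> for
  the nodes 2 to n: \<open>y0\<close> and \<open>i0\<close> describe a chain up to it, and
  \<open>generated'\<close> is the analogue of \<open>generated\<close>.\<close>

locale double_laced_datum = affine_datum +
  fixes y0 :: "nat list" and i0 :: nat
  assumes n2: "n \<ge> 2" and A01: "A 0 1 = -2" and A10: "A 1 0 = -1"
    and A0: "i \<in> {2..n} \<Longrightarrow> A 0 i = 0"
    and i0: "i0 \<in> {2..n}" "e i0 = 1" and y0: "set y0 \<subseteq> {2..n}" "up i0 y0 (th - al 1)"
    and generated': "\<lbrakk>th - al 1 \<in> M; \<And>x y. x \<in> M \<Longrightarrow> y \<in> M \<Longrightarrow> x + y \<in> M; \<And>x. x \<in> M \<Longrightarrow> - x \<in> M;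
      \<And>x i. x \<in> M \<Longrightarrow> i \<in> {2..n} \<Longrightarrow> pr i x = 1 \<or> pr i x = -1 \<Longrightarrow> srefl i x \<in> M;
      j \<in> {2..n}\<rbrakk> \<Longrightarrow> al j \<in> M"
begin

lemma P_eq: "P = {2..n}"
proof -
  have "j \<noteq> 1" if "A 0 j = 0" for j using that A01 by auto
  then show ?thesis using A0 by (fastforce simp: P_def)
qed

lemma letters: "{1..n} = insert 1 P"
  using n2 by (auto simp: P_eq)

lemma braid_length_01: "braid_length A 0 1 = Some 4"
  using A01 A10 by (simp add: braid_length_def laces_def)

lemma laces_double:
  assumes "i \<in> {1..n}" shows "laces A 0 i = (if i = 1 then 2 else 0)"
proof (cases "i = 1")
  case True
  then show ?thesis using A01 A10 by (simp add: laces_def)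
next
  case False
  then have "i \<in> P" using assms letters by blast
  then show ?thesis using False P_zero[of i] by (simp add: laces_def)
qed

lemma pr_1_th: "pr 1 th = 1"
  using n2 A10 by (simp add: th_def pr_simps)

lemma gamma_lat: "th - al 1 \<in> lat"
  using n2 by (intro lat_diff lat_th lat_al) auto

lemma pr_gamma: "pr 0 (th - al 1) = 0" "pr 1 (th + (th - al 1)) = 0"
  using n2 A01 diag[of 1] by (simp_all only: pr_simps pr0_th pr_1_th)

lemma srefl_1_th: "srefl 1 th = th - al 1"
  using pr_1_th by (simp add: srefl_def fun_eq_iff)

text \<open>By \<open>reflection_word\<close>, a reduced word for the reflection in
  \<open>th - al 1\<close>.\<close>

definition gamma_word :: "nat list" where
  "gamma_word = y0 @ [i0] @ rev y0"

lemma gamma_word_P: "set gamma_word \<subseteq> P"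
  using y0 i0 by (auto simp: gamma_word_def P_eq)

lemma theta_eq:
  assumes "braided {1..n} T"
  shows "wprod T js = T 1 * wprod T gamma_word * T 1"
  unfolding gamma_word_def using theta_factorization[OF assms y0(2) _ i0(2) _ pr_1_th] i0 n2 by auto

lemma braided_double_iff:
  "braided {..n} (T(0 := z)) \<longleftrightarrow>
    braided {1..n} T \<and> (\<forall>p\<in>P. commutes z (T p)) \<and> commutes z (T 1 * z * T 1)"
proof
  assume br: "braided {..n} (T(0 := z))"
  have "commutes z (T p)" if "p \<in> P" for p
    using braided_commutes[OF br that] that P_letters by force
  moreover have "alt_prod 4 z (T 1) = alt_prod 4 (T 1) z"
    using br[unfolded braided_def, rule_format, of 0 1 4] braid_length_01 n2 by simp
  ultimately show "braided {1..n} T \<and> (\<forall>p\<in>P. commutes z (T p)) \<and> commutes z (T 1 * z * T 1)"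
    using braided_finite[OF br] by (simp add: alt_prod_4_iff)
next
  assume *: "braided {1..n} T \<and> (\<forall>p\<in>P. commutes z (T p)) \<and> commutes z (T 1 * z * T 1)"
  show "braided {..n} (T(0 := z))"
  proof (rule braided_updateI)
    fix i m assume i: "i \<in> {1..n}" and m: "braid_length A 0 i = Some m"
    show "alt_prod m z (T i) = alt_prod m (T i) z"
    proof (cases "i = 1")
      case True
      then show ?thesis using m * braid_length_01 by (simp add: alt_prod_4_iff)
    next
      case False
      then have "i \<in> P" using letters i by blast
      then show ?thesis using m * braid_length_P by (auto simp: alt_prod_2 commutes_def)
    qed
  qed (use * in blast)
qed

text \<open>\<open>A 0 1 = -2\<close> makes \<open>pr 0 x\<close> even on the lattice, so the
  reflection relation at node 0 does not occur and only commutation has to be shown. The vectors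
  concerned are spanned by \<open>al 2\<close> to \<open>al n\<close>. The starting point is
  \<open>th - al 1\<close>, where the double lace relation between \<open>Z 1\<close> and
  \<open>Z 3\<close> gives commutation.\<close>

theorem daa_if_triple_double:
  fixes T :: "nat \<Rightarrow> 'a :: mgroup"
  assumes tr: "triple_relations T Z"
  shows "daa_relations (T(0 := Z 1)) (\<lambda>x. ev (T(0 := Z 3)) (xword x)) (Z 1 * Z 2 * Z 3 * wprod T js)"
proof (rule triple_imp_daa[OF tr])
  define X where "X x = ev (T(0 := Z 3)) (xword x)" for x
  have br: "braided {..n} (T(0 := Z 1))" "braided {..n} (T(0 := Z 3))"
    using tr by (auto simp: triple_relations_def)
  have "bernstein (T(0 := Z 3)) X" using bernstein_xword[OF br(2)] by (simp add: X_def[abs_def])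
  then have bern: "bernstein T X" using bernstein_cong[of T "T(0 := Z 3)"] by auto
  have Xth: "X th = Z 3 * wprod T js" using triple_X_th[OF tr] by (simp add: X_def)
  have Z1P: "commutes (Z 1) (T p)" if "p \<in> P" for p using br(1) that by (simp add: braided_double_iff)
  have fin: "braided {1..n} T" using br(1) braided_finite by blast
  have one: "(1::nat) \<in> {1..n}" using n2 by simp
  have "X (th - al 1) = inverse (T 1) * X th * inverse (T 1)"
    using X_srefl[OF bern one lat_th pr_1_th] unfolding srefl_1_th .
  also have "\<dots> = inverse (T 1) * Z 3 * T 1 * wprod T gamma_word"
    unfolding Xth theta_eq[OF fin] by (simp add: group_simps)
  finally have Xg: "X (th - al 1) = inverse (T 1) * Z 3 * T 1 * wprod T gamma_word" .
  have "laces A 0 1 = 2" using A01 A10 by (simp add: laces_def)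
  then have "\<forall>j k. 1 \<le> j \<longrightarrow> j < k \<longrightarrow> k \<le> 3 \<longrightarrow> commutes (Z j) (inverse (T 1) * Z k * T 1)"
    using tr one unfolding triple_relations_def by blast
  from this[rule_format, of 1 3] have "commutes (Z 1) (inverse (T 1) * Z 3 * T 1)" by simp
  moreover have "commutes (Z 1) (wprod T gamma_word)"
    using gamma_word_P Z1P by (intro commutes_prod_list) auto
  ultimately have base: "commutes (Z 1) (X (th - al 1))" unfolding Xg by (rule commutes_mult)
  define M where "M = {x \<in> lat. commutes (Z 1) (X x)}"
  have M_add: "x + y \<in> M" if "x \<in> M" "y \<in> M" for x y
    using that X_add[OF bern, of x y] lat_add by (simp only: M_def mem_Collect_eq) (metis commutes_mult)
  have M_minus: "- x \<in> M" if "x \<in> M" for x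
    using that X_minus[OF bern, of x] lat_minus by (simp only: M_def mem_Collect_eq) (metis commutes_inverse)
  have al: "al j \<in> M" if "j \<in> {2..n}" for j
  proof (rule generated'[OF _ M_add M_minus _ that])
    show "th - al 1 \<in> M" using base gamma_lat unfolding M_def by blast
    fix x i assume x: "x \<in> M" and i: "i \<in> {2..n}" and pr: "pr i x = 1 \<or> pr i x = -1"
    have i': "i \<in> {1..n}" "commutes (Z 1) (T i)" using i Z1P[of i] by (auto simp: P_eq)
    have x': "x \<in> lat" "commutes (Z 1) (X x)" using x by (auto simp: M_def)
    have "X (srefl i x) = inverse (T i) * X x * inverse (T i) \<or> X (srefl i x) = T i * X x * T i"
      using pr X_srefl[OF bern i'(1) x'(1)] X_srefl'[OF bern i'(1) x'(1)] by blast
    then have "commutes (Z 1) (X (srefl i x))"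
      using i' x' by (auto intro!: commutes_mult commutes_inverse)
    then show "srefl i x \<in> M" using lat_srefl[OF x'(1) i'(1)] by (simp add: M_def)
  qed
  have pr0: "pr 0 x = -2 * x 1" if "x \<in> lat" for x
  proof -
    have "A 0 j * x j = 0" if "j \<in> {..n} - {1}" for j
      using that A0[of j] \<open>x \<in> lat\<close> by (cases "j = 0") (auto simp: lat_def)
    then have "pr 0 x = (\<Sum>j\<in>{1}. A 0 j * x j)"
      unfolding pr_def using n2 by (intro sum.mono_neutral_right) auto
    then show ?thesis using A01 by simp
  qed
  fix x assume x: "x \<in> lat"
  show "commutes (Z 1) (ev (T(0 := Z 3)) (xword x))" if "pr 0 x = 0"
  proof -
    have "x \<in> M"
    proof (rule lat_sum[OF M_add M_minus _ _ x])
      have "(th - al 1) + - (th - al 1) \<in> M" using base gamma_lat by (intro M_add M_minus) (simp_all add: M_def)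
      then show "0 \<in> M" by simp
      fix j assume "j \<in> {1..n}" "x j \<noteq> 0"
      then have "j \<in> {2..n}" using pr0[OF x] that by (cases "j = 1") auto
      then show "al j \<in> M" by (rule al)
    qed
    then show ?thesis by (simp add: M_def X_def)
  qed
  show "Z 1 * ev (T(0 := Z 3)) (xword x) * Z 1 = ev (T(0 := Z 3)) (xword (x - th)) * (Z 1 * Z 2 * Z 3 * wprod T js)"
    if "pr 0 x = -1"
    using pr0[OF x] that by presburger
qed

theorem triple_if_daa_double:
  fixes T :: "nat \<Rightarrow> 'a :: mgroup"
  assumes daa: "daa_relations T X d"
  shows "triple_relations T (triple_of T X d)"
proof -
  note facts = daa_facts[OF daa]
  note bern = facts(2)
  note fin = braided_finite_daa[OF daa]
  let ?Z = "triple_of T X d"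
  have one: "(1::nat) \<in> {1..n}" using n2 by simp
  have G: "X (th - al 1) = inverse (T 1) * X th * inverse (T 1)"
    using X_srefl[OF bern one lat_th pr_1_th] unfolding srefl_1_th .
  have P_T: "commutes z (wprod T gamma_word)" if "\<And>p. p \<in> P \<Longrightarrow> commutes z (T p)" for z
    using gamma_word_P that by (intro commutes_prod_list) auto
  have ag: "commutes (T 0) (wprod T gamma_word)" using braided_commutes[OF facts(1)] by (rule P_T)
  have "commutes (X th) (T p)" if "p \<in> P" for p
    using T_commutes_X[OF bern _ lat_th pr_th_P[OF that]] that P_letters commutes_sym by blast
  then have xg: "commutes (X th) (wprod T gamma_word)" by (rule P_T)
  have "braided {..n} (T(0 := T 0))" using facts(1) by simp
  then have ab: "commutes (T 0) (T 1 * T 0 * T 1)" unfolding braided_double_iff by blast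
  have gb: "commutes (wprod T gamma_word) (T 1 * wprod T gamma_word * T 1)"
    using wprod_P_commutes_js[OF fin gamma_word_P] unfolding theta_eq[OF fin] .
  have xG: "commutes (X th) (X (th - al 1))" using X_commutes[OF bern lat_th gamma_lat] .
  have "X (th + (th - al 1)) = X th * X (th - al 1)" using X_add[OF bern lat_th gamma_lat] .
  then have xGb: "commutes (T 1) (X th * X (th - al 1))"
    using T_commutes_X[OF bern one lat_add[OF lat_th gamma_lat] pr_gamma(2)] by metis
  have aG: "commutes (T 0) (X (th - al 1))" using facts(5)[OF gamma_lat pr_gamma(1)] .
  have d: "commutes d (T 0)" "commutes d (T 1)" "commutes d (X th)" "commutes d (wprod T gamma_word)"
    using facts(3)[of 0] facts(3)[of 1] n2 facts(4)[OF lat_th] d_wprod[OF daa, of gamma_word] gamma_word_P P_letters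
    by force+
  note rels = double_lace_braids[OF G ag xg ab gb xG xGb aG d, folded theta_eq[OF fin]]
  show ?thesis
  proof (rule triple_relationsI[OF daa])
    show "braided {..n} (T(0 := ?Z k))" if "k \<in> {1, 2, 3}" for k
      unfolding braided_double_iff using fin P_triple[OF daa] commutes_sym ab rels(4,5) that
      by auto
  next
    fix i assume i: "i \<in> {1..n}" "laces A 0 i = 2"
    then have "i = 1" using laces_double[OF i(1)] by (simp split: if_splits)
    fix j k :: nat assume "(j, k) \<in> {(1, 2), (1, 3), (2, 3)}"
    then show "commutes (?Z j) (inverse (T i) * ?Z k * T i)"
      unfolding \<open>i = 1\<close> using rels(1-3) by auto
  next
    fix i assume i: "i \<in> {1..n}" "laces A 0 i = 1"
    then show "braids x y" for x y :: 'a
      using laces_double[OF i(1)] by (simp split: if_splits)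
  qed
qed

end

section \<open>The affine node joined by four laces\<close>

locale rank_one_datum = affine_datum +
  assumes n1: "n = 1" and A01': "A 0 1 = -2" and A10': "A 1 0 = -2"
begin

lemma braid_length_rank_one: "braid_length A 0 1 = None" "braid_length A 1 0 = None"
  using A01' A10' by (auto simp: braid_length_def laces_def)

lemma braided_rank_one: "braided {..n} T"
  unfolding braided_def
proof (intro ballI allI impI)
  fix i j m assume "i \<in> {..n}" "j \<in> {..n}" "i \<noteq> j" "braid_length A i j = Some m"
  then show "alt_prod m (T i) (T j) = alt_prod m (T j) (T i)"
    using braid_length_rank_one n1 by (cases "i = 0"; cases "j = 0") (auto simp: le_Suc_eq)
qed

lemma lat_rank_one: "x \<in> lat \<Longrightarrow> x 0 = 0" "x \<in> lat \<Longrightarrow> j > 1 \<Longrightarrow> x j = 0"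
  unfolding lat_def using n1 by auto

lemma pr0_rank_one: "x \<in> lat \<Longrightarrow> pr 0 x = -2 * x 1"
proof -
  assume "x \<in> lat"
  moreover have "{..n} = {0, 1}" using n1 by auto
  ultimately show ?thesis using A01' lat_rank_one(1) by (simp add: pr_def)
qed

text \<open>Here \<open>pr 0 x\<close> is even for every lattice vector, so it is never -1, and it
  vanishes only for x = 0.\<close>

theorem daa_if_triple_rank_one:
  fixes T :: "nat \<Rightarrow> 'a :: mgroup"
  assumes tr: "triple_relations T Z"
  shows "daa_relations (T(0 := Z 1)) (\<lambda>x. ev (T(0 := Z 3)) (xword x)) (Z 1 * Z 2 * Z 3 * wprod T js)"
proof (rule triple_imp_daa[OF tr])
  fix x assume x: "x \<in> lat"
  show "commutes (Z 1) (ev (T(0 := Z 3)) (xword x))" if "pr 0 x = 0"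
  proof -
    have "x 1 = 0" "x 0 = 0" "\<And>j. j > 1 \<Longrightarrow> x j = 0"
      using lat_rank_one[OF x] that pr0_rank_one[OF x] by simp_all
    then have "x j = 0" for j by (cases "j = 0"; cases "j = 1") auto
    then have "x = 0" by (simp add: fun_eq_iff)
    then show ?thesis using X_0[OF bernstein_xword[OF braided_rank_one[of "T(0 := Z 3)"]]] by simp
  qed
  show "Z 1 * ev (T(0 := Z 3)) (xword x) * Z 1 = ev (T(0 := Z 3)) (xword (x - th)) * (Z 1 * Z 2 * Z 3 * wprod T js)"
    if "pr 0 x = -1"
    using pr0_rank_one[OF x] that by presburger
qed

theorem triple_if_daa_rank_one:
  fixes T :: "nat \<Rightarrow> 'a :: mgroup"
  assumes daa: "daa_relations T X d"
  shows "triple_relations T (triple_of T X d)"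
proof (rule triple_relationsI[OF daa])
  fix i assume "i \<in> {1..n}"
  then have "laces A 0 i = 4" using n1 A01' A10' by (auto simp: laces_def le_Suc_eq)
  then show "laces A 0 i = 1 \<Longrightarrow> braids x y" "laces A 0 i = 2 \<Longrightarrow> commutes x y" for x y :: 'a by auto
qed (rule braided_rank_one)

end

section \<open>Comparison with the real root data\<close>

text \<open>The finite lattice has the basis \<open>\<alpha>\<^sub>j / ci j\<close>; in this basis the Cartan matrix becomes
  \<open>A'\<close> and the coroots become the \<open>hat_coroot\<close>s. For type \<open>A\<^sub>2\<^sub>n\<^sup>(\<^sup>2\<^sup>)\<close> this turns \<open>A\<close> into the
  Cartan matrix of type \<open>D\<^sub>n\<^sub>+\<^sub>1\<^sup>(\<^sup>2\<^sup>)\<close> (of type \<open>A\<^sub>1\<^sup>(\<^sup>1\<^sup>)\<close> if \<open>n = 1\<close>).\<close>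

locale root_data_comparison = affine_root_datum n A' e a
  for n :: nat and A' :: "nat \<Rightarrow> nat \<Rightarrow> int" and e a :: "nat \<Rightarrow> int" +
  fixes A :: "nat \<Rightarrow> nat \<Rightarrow> int" and \<kappa> :: int
  assumes n_ge_1: "n \<ge> 1"
    and \<kappa>_pos: "\<kappa> > 0"
    and A'_A: "i \<le> n \<Longrightarrow> j \<le> n \<Longrightarrow> A' i j * (if is_A2_even n A \<and> j = n then 2 else 1)
      = A i j * (if is_A2_even n A \<and> i = n then 2 else 1)"
    and labels: "j \<le> n \<Longrightarrow> int (numerical_labels n A j) * (if is_A2_even n A \<and> j = n then 2 else 1) = \<kappa> * a j"
    and dual: "j \<le> n \<Longrightarrow> int (dual_labels n A j) = e j * a j * (if is_A2_even n A \<and> j = n then 2 else 1)"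
begin

definition ci :: "nat \<Rightarrow> int" where
  "ci j = (if is_A2_even n A \<and> j = n then 2 else 1)"

lemma ci_pos: "ci j > 0" and ci_0: "ci 0 = 1"
  using n_ge_1 by (auto simp: ci_def)

lemma A_eq: "i \<le> n \<Longrightarrow> j \<le> n \<Longrightarrow> real_of_int (A i j) = of_int (A' i j) * of_int (ci j) / of_int (ci i)"
  using A'_A[of i j, folded ci_def] ci_pos[of i]
  by (simp add: field_simps) (metis of_int_mult)

lemma label_eq: "j \<le> n \<Longrightarrow> real (numerical_labels n A j) = of_int \<kappa> * of_int (a j) / of_int (ci j)"
  using arg_cong[OF labels[of j, folded ci_def], of real_of_int] ci_pos[of j] by (simp add: field_simps)

lemma dual_eq: "j \<le> n \<Longrightarrow> real (dual_labels n A j) = of_int (e j) * of_int (a j) * of_int (ci j)"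
  using arg_cong[OF dual[of j, folded ci_def], of real_of_int] by simp

lemma d_eq: "j \<le> n \<Longrightarrow> d_coeff n A j = of_int \<kappa> / (of_int (e j) * (of_int (ci j))^2)"
  using a_pos[of j] by (simp add: d_coeff_def label_eq dual_eq power2_eq_square)

lemma laces_eq: "i \<le> n \<Longrightarrow> j \<le> n \<Longrightarrow> laces A i j = laces A' i j"
proof -
  assume ij: "i \<le> n" "j \<le> n"
  have "real_of_int (A i j * A j i) = real_of_int (A' i j * A' j i)"
    using ci_pos[of i] ci_pos[of j] by (simp add: A_eq ij)
  then show ?thesis unfolding laces_def of_int_eq_iff .
qed

lemma braid_length_eq: "i \<le> n \<Longrightarrow> j \<le> n \<Longrightarrow> braid_length A i j = braid_length A' i j"
  by (simp add: braid_length_def laces_eq)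

definition rv :: "ivec \<Rightarrow> rvec" where
  "rv z = (\<lambda>j. of_int (z j) / of_int (ci j))"

lemma rv_inject [simp]: "rv x = rv y \<longleftrightarrow> x = y"
proof -
  have "real_of_int (ci j) \<noteq> 0" for j using ci_pos[of j] by simp
  then show ?thesis by (simp add: rv_def fun_eq_iff)
qed

lemma vadd_rv: "vadd (rv x) (rv y) = rv (x + y)"
  by (simp add: vadd_def rv_def fun_eq_iff add_divide_distrib)

lemma vscale_rv: "vscale (of_int k) (rv x) = rv (smul k x)"
  by (simp add: vscale_def rv_def fun_eq_iff)

lemma root_form_rv: "root_form n A (rv x) (rv y) = of_int (B x y) / of_int \<kappa>"
proof -
  have "rv x j * rv y k * (inverse (d_coeff n A j) * of_int (A j k))
      = of_int (e j * A' j k * x j * y k) / of_int \<kappa>" if "j \<le> n" "k \<le> n" for j k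
    using ci_pos[of j] ci_pos[of k] e_pos[OF that(1)] \<kappa>_pos
    by (simp add: rv_def d_eq A_eq that power2_eq_square field_simps)
  then have "root_form n A (rv x) (rv y) = (\<Sum>j\<le>n. \<Sum>k\<le>n. of_int (e j * A' j k * x j * y k) / of_int \<kappa>)"
    unfolding root_form_def by (intro sum.cong HOL.refl) auto
  also have "\<dots> = of_int (B x y) / of_int \<kappa>"
    by (simp add: B_expand sum_divide_distrib)
  finally show ?thesis .
qed

lemma root_form_vscale_right: "root_form n A x (vscale c y) = c * root_form n A x y"
  and root_form_vscale_left: "root_form n A (vscale c x) y = c * root_form n A x y"
  and root_form_vadd_left: "root_form n A (vadd x x') y = root_form n A x y + root_form n A x' y"
  by (simp_all add: root_form_def vscale_def vadd_def sum_distrib_left sum.distrib algebra_simps)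

lemma simple_root_rv: "simple_root i = vscale (of_int (ci i)) (rv (al i))"
  using ci_pos[of i] by (auto simp: simple_root_def vscale_def rv_def al_apply fun_eq_iff)

lemma root_form_coroot: "i \<le> n \<Longrightarrow> root_form n A (rv z) (simple_coroot n A i) = of_int (pr i z) / of_int (ci i)"
  using ci_pos[of i] e_pos[of i] \<kappa>_pos
  by (simp add: simple_coroot_def simple_root_rv root_form_vscale_right root_form_rv B_simps d_eq
      power2_eq_square)

lemma root_form_hat_coroot:
  assumes "i \<le> n" shows "root_form n A (rv z) (hat_coroot n A i) = of_int (pr i z)"
proof -
  have "root_form n A (rv z) (hat_coroot n A i) = of_int (ci i) * root_form n A (rv z) (simple_coroot n A i)"
    by (auto simp: hat_coroot_def ci_def root_form_vscale_right)
  then show ?thesis using root_form_coroot[OF assms] ci_pos[of i] by simp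
qed

lemma simple_refl_rv:
  assumes "i \<le> n" shows "simple_refl n A i (rv z) = rv (srefl i z)"
proof -
  have "vscale (- root_form n A (rv z) (simple_coroot n A i)) (simple_root i)
      = vscale (of_int (- pr i z)) (rv (al i))"
    using ci_pos[of i] assms
    by (simp add: root_form_coroot simple_root_rv vscale_def fun_eq_iff)
  then have "simple_refl n A i (rv z) = rv (z + smul (- pr i z) (al i))"
    unfolding simple_refl_def vscale_rv by (simp only: vadd_rv)
  also have "z + smul (- pr i z) (al i) = srefl i z" by (simp add: srefl_def fun_eq_iff)
  finally show ?thesis .
qed

lemma foldr_simple_refl_rv: "set w \<subseteq> {..n} \<Longrightarrow> foldr (simple_refl n A) w (rv z) = rv (act w z)"
  by (induction w) (auto simp: simple_refl_rv)

text \<open>Thus \<open>\<kappa>\<close> is the numerical label of the affine node.\<close>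

lemma label_0: "real (numerical_labels n A 0) = of_int \<kappa>"
  by (simp add: label_eq a_0 ci_0)

lemma delta_rv: "delta_vec n A = vscale (of_int \<kappa>) (rv a)"
  by (auto simp: delta_vec_def vscale_def rv_def fun_eq_iff label_eq a_supp)

lemma reduced_delta_rv: "reduced_delta n A = rv a"
  using \<kappa>_pos by (simp add: reduced_delta_def label_0 delta_rv vscale_def fun_eq_iff)

lemma theta_rv: "theta_vec n A = vscale (of_int \<kappa>) (rv th)"
  by (simp add: theta_vec_def label_0 delta_rv simple_root_rv ci_0 th_def)
     (auto simp: vadd_def vscale_def rv_def fun_eq_iff al_apply ci_0 algebra_simps diff_divide_distrib)

lemma theta_refl_rv: "theta_refl n A (rv z) = rv (z - smul (B z th) th)"
proof -
  have "theta_refl n A (rv z) = vadd (rv z) (vscale (of_int (- B z th)) (rv th))"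
    using \<kappa>_pos
    by (simp add: theta_refl_def theta_rv root_form_vscale_left root_form_vscale_right root_form_rv norm_th)
       (simp add: vscale_def fun_eq_iff)
  also have "\<dots> = rv (z + smul (- B z th) th)" by (simp only: vscale_rv vadd_rv)
  also have "z + smul (- B z th) th = z - smul (B z th) th" by (simp add: fun_eq_iff)
  finally show ?thesis .
qed

lemma foldr_simple_refl_linear:
  "foldr (simple_refl n A) w (vadd x y) = vadd (foldr (simple_refl n A) w x) (foldr (simple_refl n A) w y)"
  "foldr (simple_refl n A) w (vscale c x) = vscale c (foldr (simple_refl n A) w x)"
proof (induction w)
  case (Cons i w)
  { case 1 show ?case using Cons
      by (simp add: simple_refl_def root_form_vadd_left) (simp add: vadd_def vscale_def fun_eq_iff algebra_simps)
  next
    case 2 show ?case using Cons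
      by (simp add: simple_refl_def root_form_vscale_left) (simp add: vadd_def vscale_def fun_eq_iff algebra_simps) }
qed simp_all

lemma theta_refl_linear:
  "theta_refl n A (vadd x y) = vadd (theta_refl n A x) (theta_refl n A y)"
  "theta_refl n A (vscale c x) = vscale c (theta_refl n A x)"
  by (simp_all add: theta_refl_def root_form_vadd_left root_form_vscale_left)
     (simp_all add: vadd_def vscale_def fun_eq_iff add_divide_distrib algebra_simps)

lemma linear_maps_eq:
  fixes f g :: "rvec \<Rightarrow> rvec"
  assumes f: "\<And>x y. f (vadd x y) = vadd (f x) (f y)" "\<And>c x. f (vscale c x) = vscale c (f x)"
    and g: "\<And>x y. g (vadd x y) = vadd (g x) (g y)" "\<And>c x. g (vscale c x) = vscale c (g x)"
    and eq: "\<And>j. f (rv (al j)) = g (rv (al j))" and x: "x \<in> root_space n"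
  shows "f x = g x"
proof -
  have "f (\<lambda>j. if j < k then x j else 0) = g (\<lambda>j. if j < k then x j else 0)" for k
  proof (induction k)
    case 0
    have "(\<lambda>j. if j < 0 then x j else 0) = vscale 0 x" by (simp add: vscale_def fun_eq_iff)
    then show ?case using f(2)[of 0 x] g(2)[of 0 x] by (simp add: vscale_def)
  next
    case (Suc k)
    have *: "(\<lambda>j. if j < Suc k then x j else 0)
        = vadd (\<lambda>j. if j < k then x j else 0) (vscale (x k * of_int (ci k)) (rv (al k)))"
      using ci_pos[of k] by (auto simp: vadd_def vscale_def rv_def al_apply fun_eq_iff less_Suc_eq)
    show ?case unfolding * f g Suc eq ..
  qed
  moreover have "(\<lambda>j. if j < Suc n then x j else 0) = x"
    using x by (auto simp: root_space_def fun_eq_iff)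
  ultimately show ?thesis by metis
qed

lemma theta_decomposition_iff:
  assumes "set w \<subseteq> {1..n}"
  shows "theta_decomposition n A w \<longleftrightarrow> (\<forall>z. act w z = z - smul (B z th) th)"
proof
  have wn: "set w \<subseteq> {..n}" using assms by auto
  assume td: "theta_decomposition n A w"
  show "\<forall>z. act w z = z - smul (B z th) th"
  proof
    fix z :: ivec
    \<comment> \<open>\<open>theta_decomposition\<close> speaks only of vectors supported on 0 to n.
      The remaining part r is fixed by all reflections.\<close>
    define y where "y = (\<lambda>j. if j \<le> n then z j else 0)"
    define r where "r = z - y"
    have "r j = 0" if "j \<le> n" for j using that by (simp add: r_def y_def)
    then have pr: "pr i r = 0" for i by (simp add: pr_def)
    then have "srefl i r = r" for i by (simp add: srefl_def fun_eq_iff)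
    then have fix_r: "act w r = r" by (induction w) auto
    have "rv y \<in> root_space n" by (simp add: root_space_def rv_def y_def)
    then have "foldr (simple_refl n A) w (rv y) = theta_refl n A (rv y)"
      using td by (simp add: theta_decomposition_def)
    then have "act w y = y - smul (B y th) th"
      by (simp add: foldr_simple_refl_rv[OF wn] theta_refl_rv)
    moreover have "B z th = B y th" using pr[of 0] by (simp add: B_th r_def pr_diff)
    moreover have "z = y + r" by (simp add: r_def)
    ultimately have "act w z = (y - smul (B z th) th) + r" using fix_r by (metis act_add)
    then show "act w z = z - smul (B z th) th" by (simp add: r_def fun_eq_iff)
  qed
next
  have wn: "set w \<subseteq> {..n}" using assms by auto
  assume *: "\<forall>z. act w z = z - smul (B z th) th"
  have "foldr (simple_refl n A) w (rv z) = theta_refl n A (rv z)" for z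
    using * by (simp only: foldr_simple_refl_rv[OF wn] theta_refl_rv)
  then have "foldr (simple_refl n A) w x = theta_refl n A x" if "x \<in> root_space n" for x
    by (intro linear_maps_eq[OF foldr_simple_refl_linear theta_refl_linear _ that])
  then show "theta_decomposition n A w" using assms by (simp add: theta_decomposition_def)
qed

lemma reduced_theta:
  assumes "reduced_theta_decomposition n A js"
  shows "set js \<subseteq> {1..n}" "reduced js" "act js z = z - smul (B z th) th"
proof -
  show js: "set js \<subseteq> {1..n}"
    using assms by (simp add: reduced_theta_decomposition_def theta_decomposition_def)
  show act: "act js z = z - smul (B z th) th" for z
    using assms theta_decomposition_iff[OF js] by (simp add: reduced_theta_decomposition_def)
  show "reduced js"
  proof (rule ccontr)
    assume "\<not> reduced js"
    moreover have "set js \<subseteq> {..n}" using js by auto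
    ultimately obtain w where w: "length w + 2 = length js" "set w \<subseteq> set js" "act w = act js"
      using deletion by blast
    then have "theta_decomposition n A w"
      using theta_decomposition_iff[of w] js act by auto
    then show False using assms w(1) by (auto simp: reduced_theta_decomposition_def)
  qed
qed

text \<open>A left inverse of \<open>rv\<close>; the floor makes it total.\<close>

definition iv :: "rvec \<Rightarrow> ivec" where
  "iv \<beta> = (\<lambda>j. \<lfloor>\<beta> j * of_int (ci j)\<rfloor>)"

lemma iv_rv [simp]: "iv (rv z) = z"
proof -
  have "real_of_int (ci j) \<noteq> 0" for j using ci_pos[of j] by simp
  then show ?thesis by (simp add: iv_def rv_def fun_eq_iff)
qed

end

section \<open>Relations of the presented groups\<close>

lemma words_over_gen [simp]: "word_gen g \<in> words_over S \<longleftrightarrow> g \<in> S"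
  by (simp add: word_gen_def words_over_def)

lemma words_over_alternating:
  "u \<in> words_over S \<Longrightarrow> v \<in> words_over S \<Longrightarrow> alternating m u v \<in> words_over S"
  by (induction m u v rule: alternating.induct) auto

lemma words_over_pow: "w \<in> words_over S \<Longrightarrow> word_pow w k \<in> words_over S"
proof -
  assume w: "w \<in> words_over S"
  have "concat (replicate m v) \<in> words_over S" if "v \<in> words_over S" for m v
    using that by (induction m) auto
  then show ?thesis using w word_inv_words by (auto simp: word_pow_def)
qed

lemma satisfiesI: "(\<And>u v. (u, v) \<in> R \<Longrightarrow> ev f u = ev f v) \<Longrightarrow> satisfies S R f"
  unfolding satisfies_def by blast

lemma satisfiesD:
  "satisfies S R f \<Longrightarrow> (u, v) \<in> R \<Longrightarrow> u \<in> words_over S \<Longrightarrow> v \<in> words_over S \<Longrightarrow> ev f u = ev f v"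
  unfolding satisfies_def by blast

lemma satisfies_Un: "satisfies S (R \<union> R') f \<longleftrightarrow> satisfies S R f \<and> satisfies S R' f"
  by (auto simp: satisfies_def)

lemma satisfies_central:
  assumes "c \<in> words_over S"
  shows "satisfies S (central_rels S c) f \<longleftrightarrow> (\<forall>g\<in>S. commutes (ev f c) (f g))"
proof
  assume *: "satisfies S (central_rels S c) f"
  show "\<forall>g\<in>S. commutes (ev f c) (f g)"
  proof
    fix g assume g: "g \<in> S"
    then have "(c @ word_gen g, word_gen g @ c) \<in> central_rels S c" by (force simp: central_rels_def)
    then have "ev f (c @ word_gen g) = ev f (word_gen g @ c)"
      using * g assms unfolding satisfies_def by fastforce
    then show "commutes (ev f c) (f g)" by (simp add: commutes_def)
  qed
next
  assume "\<forall>g\<in>S. commutes (ev f c) (f g)"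
  then have "commutes (ev f c) (ev f w)" if "w \<in> words_over S" for w
    using commutes_ev[of S] that by blast
  then show "satisfies S (central_rels S c) f"
    by (auto simp: satisfies_def central_rels_def commutes_def)
qed

lemma satisfies_braid:
  "satisfies S (braid_rels A node S) f \<longleftrightarrow>
    (\<forall>g\<in>S. \<forall>h\<in>S. \<forall>m. node g \<noteq> node h \<longrightarrow> braid_length A (node g) (node h) = Some m \<longrightarrow>
      alt_prod m (f g) (f h) = alt_prod m (f h) (f g))"
proof
  assume *: "satisfies S (braid_rels A node S) f"
  show "\<forall>g\<in>S. \<forall>h\<in>S. \<forall>m. node g \<noteq> node h \<longrightarrow> braid_length A (node g) (node h) = Some m \<longrightarrow>
      alt_prod m (f g) (f h) = alt_prod m (f h) (f g)"
  proof (intro ballI allI impI)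
    fix g h m assume gh: "g \<in> S" "h \<in> S" "node g \<noteq> node h" "braid_length A (node g) (node h) = Some m"
    then have "(alternating m (word_gen g) (word_gen h), alternating m (word_gen h) (word_gen g)) \<in> braid_rels A node S"
      unfolding braid_rels_def by blast
    then have "ev f (alternating m (word_gen g) (word_gen h)) = ev f (alternating m (word_gen h) (word_gen g))"
      using * gh words_over_alternating[of "word_gen g" S "word_gen h" m]
        words_over_alternating[of "word_gen h" S "word_gen g" m] unfolding satisfies_def by fastforce
    then show "alt_prod m (f g) (f h) = alt_prod m (f h) (f g)" by simp
  qed
qed (auto simp: satisfies_def braid_rels_def)

lemma ev_map: "ev f (map (\<lambda>(i, b). (r i, b)) w) = ev (\<lambda>i. f (r i)) w"
  by (induction w) (auto simp: ev_Cons)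

lemma ev_concat_gens: "ev f (concat (map (\<lambda>i. word_gen (g i)) js)) = prod_list (map (\<lambda>i. f (g i)) js)"
  by (induction js) auto

locale presentation_data = root_data_comparison n A' e a A \<kappa> + affine_datum n A' e a js
  for n A' e a A \<kappa> js
begin

lemma finite_lattice_eq: "finite_lattice n A = rv ` lat"
proof
  show "finite_lattice n A \<subseteq> rv ` lat"
  proof
    fix \<beta> assume \<beta>: "\<beta> \<in> finite_lattice n A"
    have int: "\<beta> j * of_int (ci j) \<in> \<int>" for j
    proof (cases "j \<in> {1..n}")
      case True
      then have "if is_A2_even n A \<and> j = n then 2 * \<beta> j \<in> \<int> else \<beta> j \<in> \<int>"
        using \<beta> unfolding finite_lattice_def by blast
      then show ?thesis by (auto simp: ci_def mult.commute split: if_splits)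
    next
      case False
      then have "j = 0 \<or> j > n" by auto
      then have "\<beta> j = 0" using \<beta> unfolding finite_lattice_def by blast
      then show ?thesis by simp
    qed
    have "\<beta> = rv (iv \<beta>)"
    proof
      fix j show "\<beta> j = rv (iv \<beta>) j"
        using int[of j] ci_pos[of j] by (auto simp: rv_def iv_def elim!: Ints_cases simp: field_simps)
    qed
    moreover have "iv \<beta> \<in> lat" using \<beta> by (auto simp: lat_def iv_def finite_lattice_def)
    ultimately show "\<beta> \<in> rv ` lat" by blast
  qed
  show "rv ` lat \<subseteq> finite_lattice n A"
  proof
    fix \<beta> assume "\<beta> \<in> rv ` lat"
    then obtain z where z: "z \<in> lat" "\<beta> = rv z" by blast
    then show "\<beta> \<in> finite_lattice n A"
      by (auto simp: finite_lattice_def rv_def lat_def ci_def)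
  qed
qed

text \<open>At node 0 the reflection adds \<open>al 0\<close>, which is \<open>a - th\<close>; at
  the other nodes the coordinate at 0 stays zero. Comparing this coordinate determines k, as
  \<open>a 0 = 1\<close>.\<close>

lemma reflect_components:
  assumes "i \<le> n" "z \<in> lat" "pr i z = -1" "g \<in> lat"
  shows "simple_refl n A i (rv z) = vadd (rv g) (vscale (of_int k) (reduced_delta n A)) \<longleftrightarrow>
    (if i = 0 then k = 1 \<and> g = z - th else k = 0 \<and> g = srefl i z)"
proof -
  have "simple_refl n A i (rv z) = vadd (rv g) (vscale (of_int k) (reduced_delta n A))
      \<longleftrightarrow> srefl i z = g + smul k a"
    by (simp only: simple_refl_rv[OF assms(1)] reduced_delta_rv vscale_rv vadd_rv rv_inject)
  also have "\<dots> \<longleftrightarrow> (if i = 0 then k = 1 \<and> g = z - th else k = 0 \<and> g = srefl i z)"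
  proof (cases "i = 0")
    case True
    have s: "srefl 0 z = z + al 0" using assms(3) True by (simp add: srefl_def fun_eq_iff)
    show ?thesis
    proof
      assume eq: "srefl i z = g + smul k a"
      have "k = 1" using fun_cong[OF eq, of 0] True assms(2,4) by (simp add: s lat_def al_apply a_0)
      moreover have "g = z - th"
        using eq True \<open>k = 1\<close> unfolding th_def by (simp only: s) (simp add: fun_eq_iff algebra_simps)
      ultimately show "if i = 0 then k = 1 \<and> g = z - th else k = 0 \<and> g = srefl i z" using True by simp
    next
      assume "if i = 0 then k = 1 \<and> g = z - th else k = 0 \<and> g = srefl i z"
      then show "srefl i z = g + smul k a" using True by (simp add: s th_def fun_eq_iff)
    qed
  next
    case False
    show ?thesis
    proof
      assume eq: "srefl i z = g + smul k a"
      have "k = 0" using fun_cong[OF eq, of 0] False assms(2,4) by (simp add: srefl_def lat_def al_apply a_0)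
      then show "if i = 0 then k = 1 \<and> g = z - th else k = 0 \<and> g = srefl i z"
        using False eq by (simp add: fun_eq_iff)
    next
      assume "if i = 0 then k = 1 \<and> g = z - th else k = 0 \<and> g = srefl i z"
      then show "srefl i z = g + smul k a" using False by (simp add: fun_eq_iff)
    qed
  qed
  finally show ?thesis .
qed

definition daa_rels :: "(daa_gen gword \<times> daa_gen gword) set" where
  "daa_rels = affine_artin_rels n A \<union> lattice_rels n A
       \<union> central_rels (daa_gens n A) (word_gen DXdelta)
       \<union> daa_commute_rels n A \<union> daa_reflect_rels n A"

lemma daa_gens_mem: "DT i \<in> daa_gens n A \<longleftrightarrow> i \<le> n" "DX \<beta> \<in> daa_gens n A \<longleftrightarrow> \<beta> \<in> rv ` lat"
  "DXdelta \<in> daa_gens n A"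
  by (auto simp: daa_gens_def affine_artin_gens_def finite_lattice_eq)

lemma satisfies_affine_artin:
  "satisfies (daa_gens n A) (affine_artin_rels n A) f \<longleftrightarrow> braided {..n} (\<lambda>i. f (DT i))"
proof -
  have "satisfies (daa_gens n A) (affine_artin_rels n A) f
      \<longleftrightarrow> satisfies (affine_artin_gens n) (affine_artin_rels n A) f"
  proof -
    have "u \<in> words_over (affine_artin_gens n)" "v \<in> words_over (affine_artin_gens n)"
        "u \<in> words_over (daa_gens n A)" "v \<in> words_over (daa_gens n A)"
      if uv: "(u, v) \<in> affine_artin_rels n A" for u v
    proof -
      obtain g h m where gh: "g \<in> affine_artin_gens n" "h \<in> affine_artin_gens n"
        and "u = alternating m (word_gen g) (word_gen h)" "v = alternating m (word_gen h) (word_gen g)"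
        using uv unfolding affine_artin_rels_def braid_rels_def by blast
      moreover have "g \<in> daa_gens n A" "h \<in> daa_gens n A" using gh by (auto simp: daa_gens_def)
      ultimately show "u \<in> words_over (affine_artin_gens n)" "v \<in> words_over (affine_artin_gens n)"
          "u \<in> words_over (daa_gens n A)" "v \<in> words_over (daa_gens n A)"
        by (simp_all add: words_over_alternating)
    qed
    then show ?thesis unfolding satisfies_def by blast
  qed
  also have "\<dots> \<longleftrightarrow> braided {..n} (\<lambda>i. f (DT i))"
    unfolding affine_artin_rels_def satisfies_braid braided_def affine_artin_gens_def
    using braid_length_eq by auto
  finally show ?thesis .
qed

lemma satisfies_lattice:
  "satisfies (daa_gens n A) (lattice_rels n A) f \<longleftrightarrow>
    (\<forall>x\<in>lat. \<forall>y\<in>lat. f (DX (rv (x + y))) = f (DX (rv x)) * f (DX (rv y)))"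
proof -
  have "satisfies (daa_gens n A) (lattice_rels n A) f \<longleftrightarrow>
    (\<forall>x\<in>lat. \<forall>y\<in>lat. DX (rv (x + y)) \<in> daa_gens n A \<longrightarrow>
      f (DX (rv x)) * f (DX (rv y)) = f (DX (rv (x + y))))"
    (is "?L \<longleftrightarrow> ?M")
  proof
    assume L: ?L
    show ?M
    proof (intro ballI impI)
      fix x y assume xy: "x \<in> lat" "y \<in> lat" and "DX (rv (x + y)) \<in> daa_gens n A"
      have "(word_gen (DX (rv x)) @ word_gen (DX (rv y)), word_gen (DX (rv (x + y)))) \<in> lattice_rels n A"
        unfolding lattice_rels_def finite_lattice_eq mem_Collect_eq
        by (rule exI[of _ "rv x"], rule exI[of _ "rv y"]) (use xy in \<open>simp add: vadd_rv\<close>)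
      then have "ev f (word_gen (DX (rv x)) @ word_gen (DX (rv y))) = ev f (word_gen (DX (rv (x + y))))"
        using xy lat_add by (intro satisfiesD[OF L]) (simp_all add: daa_gens_mem)
      then show "f (DX (rv x)) * f (DX (rv y)) = f (DX (rv (x + y)))" by simp
    qed
  next
    assume R: ?M
    show ?L
    proof (rule satisfiesI)
      fix u v assume "(u, v) \<in> lattice_rels n A"
      then obtain x y where xy: "x \<in> lat" "y \<in> lat"
        and uv: "u = word_gen (DX (rv x)) @ word_gen (DX (rv y))" "v = word_gen (DX (vadd (rv x) (rv y)))"
        unfolding lattice_rels_def finite_lattice_eq by blast
      have "DX (rv (x + y)) \<in> daa_gens n A" using xy lat_add by (simp add: daa_gens_mem)
      then show "ev f u = ev f v" unfolding uv vadd_rv using R xy by simp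
    qed
  qed
  also have "\<dots> \<longleftrightarrow> (\<forall>x\<in>lat. \<forall>y\<in>lat. f (DX (rv (x + y))) = f (DX (rv x)) * f (DX (rv y)))"
    using lat_add unfolding daa_gens_mem by (metis imageI)
  finally show ?thesis .
qed

lemma satisfies_commute:
  "satisfies (daa_gens n A) (daa_commute_rels n A) f \<longleftrightarrow>
    (\<forall>i\<le>n. \<forall>x\<in>lat. pr i x = 0 \<longrightarrow> commutes (f (DT i)) (f (DX (rv x))))"
  (is "?L \<longleftrightarrow> ?R")
proof
  assume L: ?L
  show ?R
  proof (intro allI ballI impI)
    fix i x assume i: "i \<le> n" and x: "x \<in> lat" "pr i x = 0"
    have "(word_gen (DT i) @ word_gen (DX (rv x)), word_gen (DX (rv x)) @ word_gen (DT i)) \<in> daa_commute_rels n A"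
      unfolding daa_commute_rels_def finite_lattice_eq mem_Collect_eq
      by (rule exI[of _ i], rule exI[of _ "rv x"]) (use i x root_form_hat_coroot in simp)
    from satisfiesD[OF L this] i x show "commutes (f (DT i)) (f (DX (rv x)))"
      by (simp add: daa_gens_mem commutes_def)
  qed
next
  assume R: ?R
  show ?L
  proof (rule satisfiesI)
    fix u v assume "(u, v) \<in> daa_commute_rels n A"
    then obtain i x where i: "i \<le> n" and x: "x \<in> lat" "root_form n A (rv x) (hat_coroot n A i) = 0"
      and uv: "u = word_gen (DT i) @ word_gen (DX (rv x))" "v = word_gen (DX (rv x)) @ word_gen (DT i)"
      unfolding daa_commute_rels_def finite_lattice_eq by blast
    have "pr i x = 0" using x(2) root_form_hat_coroot[OF i] by simp
    then show "ev f u = ev f v" unfolding uv using R i x(1) by (simp add: commutes_def)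
  qed
qed

lemma satisfies_reflect:
  "satisfies (daa_gens n A) (daa_reflect_rels n A) f \<longleftrightarrow>
    (\<forall>i\<le>n. \<forall>x\<in>lat. pr i x = -1 \<longrightarrow> f (DT i) * f (DX (rv x)) * f (DT i)
      = (if i = 0 then f (DX (rv (x - th))) * f DXdelta else f (DX (rv (srefl i x)))))"
  (is "?L \<longleftrightarrow> ?R")
proof -
  have pm1: "real_of_int k = -1 \<longleftrightarrow> k = -1" for k by linarith
  have pw: "word_pow (word_gen DXdelta) k \<in> words_over (daa_gens n A)" for k
    by (intro words_over_pow) (simp add: daa_gens_mem)
  have "?L \<longleftrightarrow> (\<forall>i\<le>n. \<forall>x\<in>lat. \<forall>g\<in>lat. \<forall>k. pr i x = -1 \<longrightarrow>
      simple_refl n A i (rv x) = vadd (rv g) (vscale (of_int k) (reduced_delta n A)) \<longrightarrow>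
      f (DT i) * f (DX (rv x)) * f (DT i) = f (DX (rv g)) * zpow (f DXdelta) k)"
    (is "_ \<longleftrightarrow> ?M")
  proof
    assume L: ?L
    show ?M
    proof (intro allI ballI impI)
      fix i x g k assume i: "i \<le> n" and x: "x \<in> lat" and g: "g \<in> lat" and pr: "pr i x = -1"
        and eq: "simple_refl n A i (rv x) = vadd (rv g) (vscale (of_int k) (reduced_delta n A))"
      have "(word_gen (DT i) @ word_gen (DX (rv x)) @ word_gen (DT i), X_word (rv g) k) \<in> daa_reflect_rels n A"
        unfolding daa_reflect_rels_def finite_lattice_eq mem_Collect_eq
        by (rule exI[of _ i], rule exI[of _ "rv x"], rule exI[of _ "rv g"], rule exI[of _ k])
          (use i x g pr eq root_form_hat_coroot[OF i, of x] in simp)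
      from satisfiesD[OF L this] i x g
      show "f (DT i) * f (DX (rv x)) * f (DT i) = f (DX (rv g)) * zpow (f DXdelta) k"
        by (simp add: daa_gens_mem X_word_def pw mult.assoc)
    qed
  next
    assume R: ?M
    show ?L
    proof (rule satisfiesI)
      fix u v assume "(u, v) \<in> daa_reflect_rels n A"
      then obtain i x g k where i: "i \<le> n" and x: "x \<in> lat" "root_form n A (rv x) (hat_coroot n A i) = -1"
        and g: "g \<in> lat" and eq: "simple_refl n A i (rv x) = vadd (rv g) (vscale (of_int k) (reduced_delta n A))"
        and uv: "u = word_gen (DT i) @ word_gen (DX (rv x)) @ word_gen (DT i)" "v = X_word (rv g) k"
        unfolding daa_reflect_rels_def finite_lattice_eq by blast
      have "pr i x = -1" using x(2) root_form_hat_coroot[OF i] pm1 by simp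
      from R[rule_format, OF i x(1) g this eq]
      show "ev f u = ev f v" unfolding uv by (simp add: X_word_def mult.assoc)
    qed
  qed
  also have "\<dots> \<longleftrightarrow> ?R"
  proof
    assume L: "\<forall>i\<le>n. \<forall>x\<in>lat. \<forall>g\<in>lat. \<forall>k. pr i x = -1 \<longrightarrow>
      simple_refl n A i (rv x) = vadd (rv g) (vscale (of_int k) (reduced_delta n A)) \<longrightarrow>
      f (DT i) * f (DX (rv x)) * f (DT i) = f (DX (rv g)) * zpow (f DXdelta) k"
    show ?R
    proof (intro allI ballI impI)
      fix i x assume i: "i \<le> n" and x: "x \<in> lat" "pr i x = -1"
      show "f (DT i) * f (DX (rv x)) * f (DT i)
        = (if i = 0 then f (DX (rv (x - th))) * f DXdelta else f (DX (rv (srefl i x))))"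
      proof (cases "i = 0")
        case True
        have g: "x - th \<in> lat" using x lat_th lat_diff by blast
        show ?thesis using L[rule_format, OF i x(1) g x(2), of 1] reflect_components[OF i x g, of 1] True by simp
      next
        case False
        have g: "srefl i x \<in> lat" using x lat_srefl i False by simp
        show ?thesis using L[rule_format, OF i x(1) g x(2), of 0] reflect_components[OF i x g, of 0] False by simp
      qed
    qed
  next
    assume R: ?R
    show "\<forall>i\<le>n. \<forall>x\<in>lat. \<forall>g\<in>lat. \<forall>k. pr i x = -1 \<longrightarrow>
      simple_refl n A i (rv x) = vadd (rv g) (vscale (of_int k) (reduced_delta n A)) \<longrightarrow>
      f (DT i) * f (DX (rv x)) * f (DT i) = f (DX (rv g)) * zpow (f DXdelta) k"
    proof (intro allI ballI impI)
      fix i x g k assume i: "i \<le> n" and x: "x \<in> lat" "pr i x = -1" and g: "g \<in> lat"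
        and eq: "simple_refl n A i (rv x) = vadd (rv g) (vscale (of_int k) (reduced_delta n A))"
      show "f (DT i) * f (DX (rv x)) * f (DT i) = f (DX (rv g)) * zpow (f DXdelta) k"
        using R[rule_format, OF i x] reflect_components[OF i x g, of k] eq by (simp split: if_splits)
    qed
  qed
  finally show ?thesis .
qed

lemma satisfies_daa:
  "satisfies (daa_gens n A) daa_rels f \<longleftrightarrow> daa_relations (\<lambda>i. f (DT i)) (\<lambda>x. f (DX (rv x))) (f DXdelta)"
  (is "_ \<longleftrightarrow> daa_relations ?T ?X ?d")
proof -
  have central: "satisfies (daa_gens n A) (central_rels (daa_gens n A) (word_gen DXdelta)) f \<longleftrightarrow>
      (\<forall>i\<le>n. commutes ?d (?T i)) \<and> (\<forall>x\<in>lat. commutes ?d (?X x))"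
  proof -
    have "(\<forall>g\<in>daa_gens n A. commutes ?d (f g)) \<longleftrightarrow>
        (\<forall>i\<le>n. commutes ?d (?T i)) \<and> (\<forall>x\<in>lat. commutes ?d (?X x))"
      by (auto simp: daa_gens_def affine_artin_gens_def finite_lattice_eq)
    then show ?thesis by (simp add: satisfies_central daa_gens_mem)
  qed
  \<comment> \<open>Relation (iii) is stated at pairing -1 and \<open>bernstein\<close> at pairing
    1; replacing x by \<open>srefl i x\<close> exchanges the two.\<close>
  have swap: "(\<forall>i\<in>{1..n}. \<forall>x\<in>lat. pr i x = 1 \<longrightarrow> ?X (srefl i x) = inverse (?T i) * ?X x * inverse (?T i)) \<longleftrightarrow>
      (\<forall>i\<in>{1..n}. \<forall>x\<in>lat. pr i x = -1 \<longrightarrow> ?T i * ?X x * ?T i = ?X (srefl i x))" (is "?L \<longleftrightarrow> ?R")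
  proof
    assume L: ?L
    show ?R
    proof (intro ballI impI)
      fix i x assume i: "i \<in> {1..n}" and x: "x \<in> lat" "pr i x = -1"
      have "pr i (srefl i x) = 1" using i x by (simp add: pr_srefl diag)
      from L[rule_format, OF i lat_srefl[OF x(1) i] this] i
      have "?X x = inverse (?T i) * ?X (srefl i x) * inverse (?T i)" by (simp add: refl_refl)
      then show "?T i * ?X x * ?T i = ?X (srefl i x)" by (simp add: group_simps)
    qed
  next
    assume R: ?R
    show ?L
    proof (intro ballI impI)
      fix i x assume i: "i \<in> {1..n}" and x: "x \<in> lat" "pr i x = 1"
      have "pr i (srefl i x) = -1" using i x by (simp add: pr_srefl diag)
      from R[rule_format, OF i lat_srefl[OF x(1) i] this] i
      have *: "?X x = ?T i * ?X (srefl i x) * ?T i" by (simp add: refl_refl)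
      show "?X (srefl i x) = inverse (?T i) * ?X x * inverse (?T i)"
        unfolding * by (simp add: group_simps)
    qed
  qed
  have zero: "i \<le> n \<longleftrightarrow> i = 0 \<or> i \<in> {1..n}" for i by auto
  have split: "(\<forall>i\<le>n. Q i) \<longleftrightarrow> Q 0 \<and> (\<forall>i\<in>{1..n}. Q i)" for Q unfolding zero by blast
  have commute: "(\<forall>i\<le>n. \<forall>x\<in>lat. pr i x = 0 \<longrightarrow> commutes (?T i) (?X x)) \<longleftrightarrow>
      (\<forall>x\<in>lat. pr 0 x = 0 \<longrightarrow> commutes (?T 0) (?X x)) \<and>
      (\<forall>i\<in>{1..n}. \<forall>x\<in>lat. pr i x = 0 \<longrightarrow> commutes (?T i) (?X x))"
    by (rule split)
  have reflect: "(\<forall>i\<le>n. \<forall>x\<in>lat. pr i x = -1 \<longrightarrow> ?T i * ?X x * ?T i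
      = (if i = 0 then ?X (x - th) * ?d else ?X (srefl i x))) \<longleftrightarrow>
      (\<forall>x\<in>lat. pr 0 x = -1 \<longrightarrow> ?T 0 * ?X x * ?T 0 = ?X (x - th) * ?d) \<and>
      (\<forall>i\<in>{1..n}. \<forall>x\<in>lat. pr i x = -1 \<longrightarrow> ?T i * ?X x * ?T i = ?X (srefl i x))"
    by (subst split) auto
  show ?thesis
    unfolding daa_rels_def satisfies_Un satisfies_affine_artin satisfies_lattice central
      satisfies_commute satisfies_reflect commute reflect daa_relations_def bernstein_def
      swap[symmetric]
    by blast
qed

section \<open>The relations of the quotient of the triple group\<close>

definition quotient_rels :: "(triple_gen gword \<times> triple_gen gword) set" where
  "quotient_rels = triple_rels n A \<union> central_rels (triple_gens n) (C_word js)"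

lemma triple_gens_mem: "TN i \<in> triple_gens n \<longleftrightarrow> i \<in> {1..n}" "TZ k \<in> triple_gens n \<longleftrightarrow> k \<in> {1, 2, 3}"
  by (auto simp: triple_gens_def)

lemma C_word_words: "C_word js \<in> words_over (triple_gens n)"
proof -
  have "concat (map tn w) \<in> words_over (triple_gens n)" if "set w \<subseteq> {1..n}" for w
    using that by (induction w) (auto simp: triple_gens_mem)
  then show ?thesis using js_letters by (simp add: C_word_def triple_gens_mem)
qed

lemma satisfies_triple_braid:
  "satisfies (triple_gens n) (braid_rels A triple_node (triple_gens n)) f \<longleftrightarrow>
    (\<forall>k\<in>{1,2,3}. braided {..n} ((\<lambda>i. f (TN i))(0 := f (TZ k))))"
  (is "?L \<longleftrightarrow> ?R")
proof
  assume L: ?L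
  show ?R
    unfolding braided_def
  proof (intro ballI allI impI)
    fix k i j m assume k: "k \<in> {1, 2, 3::nat}" and ij: "i \<in> {..n}" "j \<in> {..n}" "i \<noteq> j"
      and m: "braid_length A' i j = Some m"
    let ?g = "\<lambda>i. if i = 0 then TZ k else TN i"
    have g: "?g i \<in> triple_gens n" "triple_node (?g i) = i" if "i \<le> n" for i
      using that k by (auto simp: triple_gens_mem)
    have f: "((\<lambda>i. f (TN i))(0 := f (TZ k))) i = f (?g i)" for i by simp
    have "braid_length A i j = Some m" using m ij braid_length_eq by simp
    then have "alt_prod m (f (?g i)) (f (?g j)) = alt_prod m (f (?g j)) (f (?g i))"
      using L[unfolded satisfies_braid, rule_format, of "?g i" "?g j" m] g[of i] g[of j] ij by simp
    then show "alt_prod m (((\<lambda>i. f (TN i))(0 := f (TZ k))) i) (((\<lambda>i. f (TN i))(0 := f (TZ k))) j)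
      = alt_prod m (((\<lambda>i. f (TN i))(0 := f (TZ k))) j) (((\<lambda>i. f (TN i))(0 := f (TZ k))) i)"
      unfolding f .
  qed
next
  assume R: ?R
  show ?L
    unfolding satisfies_braid
  proof (intro ballI allI impI)
    fix g h m assume gh: "g \<in> triple_gens n" "h \<in> triple_gens n" "triple_node g \<noteq> triple_node h"
      and m: "braid_length A (triple_node g) (triple_node h) = Some m"
    \<comment> \<open>Generators attached to distinct nodes include at most one affine generator,
      whose index is chosen as k; if there is none, k = 1 serves.\<close>
    have "\<exists>k\<in>{1, 2, 3}. \<forall>x\<in>{g, h}. f x = ((\<lambda>i. f (TN i))(0 := f (TZ k))) (triple_node x)"
    proof (cases g)
      case (TZ k)
      then show ?thesis using gh by (cases h) (auto simp: triple_gens_mem intro!: bexI[of _ k])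
    next
      case g: (TN i)
      show ?thesis
      proof (cases h)
        case (TZ k)
        then show ?thesis using gh g by (auto simp: triple_gens_mem intro!: bexI[of _ k])
      next
        case (TN j)
        then show ?thesis using gh g by (auto simp: triple_gens_mem intro!: bexI[of _ 1])
      qed
    qed
    then obtain k where k: "k \<in> {1, 2, 3}"
      "\<And>x. x \<in> {g, h} \<Longrightarrow> f x = ((\<lambda>i. f (TN i))(0 := f (TZ k))) (triple_node x)" by blast
    have nodes: "triple_node g \<le> n" "triple_node h \<le> n"
      using gh by (auto simp: triple_gens_def)
    then have "braid_length A' (triple_node g) (triple_node h) = Some m" using m braid_length_eq by simp
    then show "alt_prod m (f g) (f h) = alt_prod m (f h) (f g)"
      using R[rule_format, OF k(1), unfolded braided_def, rule_format, of "triple_node g" "triple_node h" m]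
        nodes gh(3) k(2)[of g] k(2)[of h] by simp
  qed
qed

lemma satisfies_single_lace:
  "satisfies (triple_gens n) (single_lace_rels n A) f \<longleftrightarrow>
    (\<forall>i\<in>{1..n}. laces A' 0 i = 1 \<longrightarrow>
      (\<forall>x\<in>{f (TZ 1), f (TZ 2), f (TZ 3), f (TZ 1) * f (TZ 2) * inverse (f (TZ 1)),
          inverse (f (TZ 3)) * f (TZ 2) * f (TZ 3)}. \<forall>k.
        braids x (zpow (f (TZ 1) * f (TZ 2) * f (TZ 3)) k * f (TN i)
          * inverse (zpow (f (TZ 1) * f (TZ 2) * f (TZ 3)) k))))"
proof -
  have D: "D_word \<in> words_over (triple_gens n)" "ev f D_word = f (TZ 1) * f (TZ 2) * f (TZ 3)"
    by (simp_all add: D_word_def triple_gens_mem mult.assoc)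
  have elems: "u \<in> words_over (triple_gens n)" if "u \<in> single_lace_elements" for u
    using that by (auto simp: single_lace_elements_def triple_gens_mem word_inv_words)
  have ev_elems: "ev f ` single_lace_elements = {f (TZ 1), f (TZ 2), f (TZ 3), f (TZ 1) * f (TZ 2) * inverse (f (TZ 1)),
          inverse (f (TZ 3)) * f (TZ 2) * f (TZ 3)}"
    by (auto simp: single_lace_elements_def mult.assoc)
  have "satisfies (triple_gens n) (single_lace_rels n A) f \<longleftrightarrow>
    (\<forall>i\<in>{1..n}. laces A' 0 i = 1 \<longrightarrow> (\<forall>u\<in>single_lace_elements. \<forall>k.
        braids (ev f u) (zpow (ev f D_word) k * f (TN i) * inverse (zpow (ev f D_word) k))))"
    (is "_ \<longleftrightarrow> ?R")
  proof
    assume L: "satisfies (triple_gens n) (single_lace_rels n A) f"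
    show ?R
    proof (intro ballI allI impI)
      fix i u k assume i: "i \<in> {1..n}" "laces A' 0 i = 1" and u: "u \<in> single_lace_elements"
      let ?y = "word_pow D_word k @ tn i @ word_pow D_word (- k)"
      have "laces A 0 i = 1" using i laces_eq by simp
      then have "(u @ ?y @ u, ?y @ u @ ?y) \<in> single_lace_rels n A"
        unfolding single_lace_rels_def using i u by blast
      moreover have "?y \<in> words_over (triple_gens n)"
        using words_over_pow[OF D(1)] i by (simp add: triple_gens_mem)
      ultimately have "ev f (u @ ?y @ u) = ev f (?y @ u @ ?y)"
        using elems[OF u] by (intro satisfiesD[OF L]) simp_all
      then show "braids (ev f u) (zpow (ev f D_word) k * f (TN i) * inverse (zpow (ev f D_word) k))"
        by (simp add: braids_def zpow_minus mult.assoc)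
    qed
  next
    assume R: ?R
    show "satisfies (triple_gens n) (single_lace_rels n A) f"
      unfolding satisfies_def
    proof (intro ballI, clarify)
      fix u v assume "(u, v) \<in> single_lace_rels n A"
      then obtain w i k where i: "i \<in> {1..n}" "laces A 0 i = 1" and w: "w \<in> single_lace_elements"
        and u: "u = w @ (word_pow D_word k @ tn i @ word_pow D_word (- k)) @ w"
        and v: "v = (word_pow D_word k @ tn i @ word_pow D_word (- k)) @ w @ (word_pow D_word k @ tn i @ word_pow D_word (- k))"
        unfolding single_lace_rels_def by blast
      have "laces A' 0 i = 1" using i laces_eq by simp
      from R[rule_format, OF i(1) this w, of k]
      show "ev f u = ev f v" unfolding u v by (simp add: braids_def zpow_minus mult.assoc)
    qed
  qed
  then show ?thesis unfolding D(2) ev_elems[symmetric] by simp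
qed

lemma satisfies_double_lace:
  "satisfies (triple_gens n) (double_lace_rels n A) f \<longleftrightarrow>
    (\<forall>i\<in>{1..n}. laces A' 0 i = 2 \<longrightarrow> (\<forall>j k. 1 \<le> j \<longrightarrow> j < k \<longrightarrow> k \<le> 3 \<longrightarrow>
      commutes (f (TZ j)) (inverse (f (TN i)) * f (TZ k) * f (TN i))))"
  (is "?L \<longleftrightarrow> ?R")
proof
  assume L: ?L
  show ?R
  proof (intro ballI allI impI)
    fix i j k assume i: "i \<in> {1..n}" "laces A' 0 i = 2" and jk: "1 \<le> j" "j < k" "k \<le> (3::nat)"
    let ?v = "word_inv (tn i) @ tz k @ tn i"
    have "laces A 0 i = 2" using i laces_eq by simp
    then have "(tz j @ ?v, ?v @ tz j) \<in> double_lace_rels n A"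
      unfolding double_lace_rels_def using i jk by auto
    moreover have "?v \<in> words_over (triple_gens n)" "tz j \<in> words_over (triple_gens n)"
      using i jk by (auto simp: triple_gens_mem word_inv_words)
    ultimately have "ev f (tz j @ ?v) = ev f (?v @ tz j)"
      by (intro satisfiesD[OF L]) simp_all
    then show "commutes (f (TZ j)) (inverse (f (TN i)) * f (TZ k) * f (TN i))"
      by (simp add: commutes_def mult.assoc)
  qed
next
  assume R: ?R
  show ?L
    unfolding satisfies_def
  proof (intro ballI, clarify)
    fix u v assume "(u, v) \<in> double_lace_rels n A"
    then obtain j k i where i: "i \<in> {1..n}" "laces A 0 i = 2" and jk: "1 \<le> j" "j < k" "k \<le> 3"
      and u: "u = tz j @ word_inv (tn i) @ tz k @ tn i" and v: "v = word_inv (tn i) @ tz k @ tn i @ tz j"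
      unfolding double_lace_rels_def by blast
    have "laces A' 0 i = 2" using i laces_eq by simp
    from R[rule_format, OF i(1) this jk]
    show "ev f u = ev f v" unfolding u v by (simp add: commutes_def mult.assoc)
  qed
qed

lemma satisfies_triple:
  "satisfies (triple_gens n) quotient_rels f \<longleftrightarrow> triple_relations (\<lambda>i. f (TN i)) (\<lambda>k. f (TZ k))"
proof -
  have C: "ev f (C_word js) = f (TZ 1) * f (TZ 2) * f (TZ 3) * wprod (\<lambda>i. f (TN i)) js"
    by (simp add: C_word_def ev_concat_gens mult.assoc)
  have "(\<forall>g\<in>triple_gens n. commutes (ev f (C_word js)) (f g)) \<longleftrightarrow>
      (\<forall>i\<in>{1..n}. commutes (ev f (C_word js)) (f (TN i))) \<and>
      (\<forall>k\<in>{1, 2, 3}. commutes (ev f (C_word js)) (f (TZ k)))"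
    by (auto simp: triple_gens_def) (metis One_nat_def atLeastAtMost_iff le_SucE numeral_2_eq_2 numeral_3_eq_3 le_antisym not_less_eq_eq)
  then show ?thesis
    unfolding quotient_rels_def triple_rels_def satisfies_Un satisfies_triple_braid satisfies_single_lace
      satisfies_double_lace satisfies_central[OF C_word_words] triple_relations_def C
    by blast
qed

text \<open>Inside the words \<open>xword\<close> the affine letter becomes \<open>TZ 3\<close>,
  while \<open>DT 0\<close> itself becomes \<open>TZ 1\<close>: the lattice is built from
  \<open>TZ 3\<close> and the \<open>TN i\<close>.\<close>

definition to_triple :: "daa_gen \<Rightarrow> triple_gen gword" where
  "to_triple g = (case g of DT i \<Rightarrow> (if i = 0 then tz 1 else tn i)
    | DX \<beta> \<Rightarrow> map (\<lambda>(i, b). (if i = 0 then TZ 3 else TN i, b)) (xword (iv \<beta>))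
    | DXdelta \<Rightarrow> C_word js)"

definition to_daa :: "triple_gen \<Rightarrow> daa_gen gword" where
  "to_daa h = (case h of TN i \<Rightarrow> word_gen (DT i)
    | TZ k \<Rightarrow> (if k = 1 then word_gen (DT 0)
        else if k = 2 then word_inv (word_gen (DT 0)) @ word_gen DXdelta @ word_inv (word_gen (DX (rv th)))
        else word_gen (DX (rv th)) @ word_inv (concat (map (\<lambda>i. word_gen (DT i)) js))))"

lemma to_triple_words: "g \<in> daa_gens n A \<Longrightarrow> to_triple g \<in> words_over (triple_gens n)"
proof (cases g)
  case (DX \<beta>)
  assume "g \<in> daa_gens n A"
  then obtain z where z: "z \<in> lat" "\<beta> = rv z" using DX daa_gens_mem by auto
  have "fst ` set (xword z) \<subseteq> {..n}"
    using translation(2)[OF z(1)] by (simp add: xword_def tau_letters)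
  then have "i \<le> n" if "(i, b) \<in> set (xword z)" for i b using that by force
  then show ?thesis
    by (auto simp: to_triple_def DX z words_over_def triple_gens_def)
qed (auto simp: to_triple_def triple_gens_mem daa_gens_mem C_word_words)

lemma to_daa_words: "h \<in> triple_gens n \<Longrightarrow> to_daa h \<in> words_over (daa_gens n A)"
proof -
  have "concat (map (\<lambda>i. word_gen (DT i)) w) \<in> words_over (daa_gens n A)" if "set w \<subseteq> {1..n}" for w
    using that by (induction w) (auto simp: daa_gens_mem)
  then show "h \<in> triple_gens n \<Longrightarrow> to_daa h \<in> words_over (daa_gens n A)"
    using js_letters lat_th word_inv_words
    by (cases h) (auto simp: to_daa_def triple_gens_mem daa_gens_mem)
qed

lemma ev_to_triple:
  "ev f (to_triple (DT i)) = ((\<lambda>i. f (TN i))(0 := f (TZ 1))) i"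
  "ev f (to_triple (DX (rv z))) = ev ((\<lambda>i. f (TN i))(0 := f (TZ 3))) (xword z)"
  "ev f (to_triple DXdelta) = f (TZ 1) * f (TZ 2) * f (TZ 3) * wprod (\<lambda>i. f (TN i)) js"
proof -
  have "(\<lambda>i. f (if i = 0 then TZ 3 else TN i)) = (\<lambda>i. f (TN i))(0 := f (TZ 3))" by auto
  then show "ev f (to_triple (DX (rv z))) = ev ((\<lambda>i. f (TN i))(0 := f (TZ 3))) (xword z)"
    by (simp add: to_triple_def ev_map[where r = "\<lambda>i. if i = 0 then TZ 3 else TN i"])
qed (simp_all add: to_triple_def C_word_def ev_concat_gens mult.assoc)

lemma ev_to_daa:
  "ev f (to_daa (TN i)) = f (DT i)"
  "ev f (to_daa (TZ k)) = triple_of (\<lambda>i. f (DT i)) (\<lambda>x. f (DX (rv x))) (f DXdelta) k"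
  by (simp_all add: to_daa_def triple_of_def ev_concat_gens mult.assoc)

text \<open>Both composites fix the generators. The lattice generators come back by
  \<open>daa_xword\<close>, hence by uniqueness of the Bernstein elements, \<open>DXdelta\<close> by
  \<open>triple_center\<close>, and the three affine generators by cancellation.\<close>

theorem presentations_isomorphic:
  assumes A: "\<And>(T :: nat \<Rightarrow> triple_gen gword set bijection) Z. triple_relations T Z \<Longrightarrow>
      daa_relations (T(0 := Z 1)) (\<lambda>x. ev (T(0 := Z 3)) (xword x)) (Z 1 * Z 2 * Z 3 * wprod T js)"
    and B: "\<And>(T :: nat \<Rightarrow> daa_gen gword set bijection) X d. daa_relations T X d \<Longrightarrow>
      triple_relations T (triple_of T X d)"
  shows "double_affine_Artin_group n A \<cong> triple_group_quotient n A js"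
proof -
  let ?S = "daa_gens n A" and ?S' = "triple_gens n"
  let ?f = "canonical ?S daa_rels" and ?f' = "canonical ?S' quotient_rels"
  let ?T = "\<lambda>i. ?f (DT i)" and ?X = "\<lambda>x. ?f (DX (rv x))" and ?d = "?f DXdelta"
  let ?T' = "\<lambda>i. ?f' (TN i)" and ?Z' = "\<lambda>k. ?f' (TZ k)"
  have daa: "daa_relations ?T ?X ?d" using satisfies_canonical satisfies_daa by blast
  have triple: "triple_relations ?T' ?Z'" using satisfies_canonical satisfies_triple by blast
  have "presented_group ?S daa_rels \<cong> presented_group ?S' quotient_rels"
  proof (rule presented_group_isoI[of _ to_triple _ to_daa])
    show "satisfies ?S daa_rels (\<lambda>g. ev ?f' (to_triple g))"
      unfolding satisfies_daa ev_to_triple using A[OF triple] by (simp only: fun_upd_def)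
    show "satisfies ?S' quotient_rels (\<lambda>h. ev ?f (to_daa h))"
      unfolding satisfies_triple ev_to_daa using B[OF daa] by simp
    have psi3: "triple_of ?T ?X ?d 3 = ?X th * inverse (wprod ?T js)" by simp
    show "ev (\<lambda>h. ev ?f (to_daa h)) (to_triple g) = ?f g" if g: "g \<in> ?S" for g
    proof (cases g)
      case (DT i)
      then show ?thesis unfolding DT ev_to_triple ev_to_daa by simp
    next
      case (DX \<beta>)
      then obtain z where z: "z \<in> lat" "\<beta> = rv z" using g daa_gens_mem by auto
      have "braided {..n} (?T(0 := triple_of ?T ?X ?d 3))"
        using B[OF daa] unfolding triple_relations_def by blast
      then show ?thesis
        unfolding DX z ev_to_triple ev_to_daa psi3 using daa_xword[OF daa _ z(1)] by simp
    next
      case DXdelta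
      show ?thesis unfolding DXdelta ev_to_triple ev_to_daa using triple_center[OF daa] by simp
    qed
    have Xth: "ev (?T'(0 := ?Z' 3)) (xword th) = ?Z' 3 * wprod ?T' js" by (rule triple_X_th[OF triple])
    have js: "wprod (?T'(0 := ?Z' 1)) js = wprod ?T' js"
      using js_letters by (intro arg_cong[where f = prod_list] map_cong) auto
    show "ev (\<lambda>g. ev ?f' (to_triple g)) (to_daa h) = ?f' h" if h: "h \<in> ?S'" for h
    proof (cases h)
      case (TN i)
      then have "i \<noteq> 0" using h by (auto simp: triple_gens_mem)
      then show ?thesis unfolding TN ev_to_triple ev_to_daa by simp
    next
      case (TZ k)
      then have "k \<in> {1, 2, 3}" using h by (auto simp: triple_gens_mem)
      then show ?thesis
        unfolding TZ ev_to_triple ev_to_daa triple_of_def Xth fun_upd_def[symmetric] js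
        by (auto simp: group_simps)
    qed
  qed (use to_triple_words to_daa_words in auto)
  then show ?thesis
    unfolding double_affine_Artin_group_def triple_group_quotient_def daa_rels_def quotient_rels_def .
qed

end

section \<open>Numerical labels\<close>

text \<open>Taking greatest common divisors in \<open>g 0\<close> times f = \<open>f 0\<close> times
  g gives \<open>f 0 = g 0\<close>.\<close>

lemma proportional_coprime_eq:
  fixes f g :: "nat \<Rightarrow> nat"
  assumes "Gcd (f ` {..n}) = 1" "Gcd (g ` {..n}) = 1" "\<And>j. f j > 0 \<longleftrightarrow> j \<le> n" "\<And>j. g j > 0 \<longleftrightarrow> j \<le> n"
    and proportional: "\<And>j k. j \<le> n \<Longrightarrow> k \<le> n \<Longrightarrow> f j * g k = f k * g j"
  shows "f = g"
proof -
  have "g 0 * Gcd (f ` {..n}) = Gcd ((*) (g 0) ` f ` {..n})" by (simp add: Gcd_mult)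
  also have "(*) (g 0) ` f ` {..n} = (*) (f 0) ` g ` {..n}"
    unfolding image_image using proportional[of _ 0] by (intro image_cong) (auto simp: mult.commute)
  also have "Gcd ((*) (f 0) ` g ` {..n}) = f 0 * Gcd (g ` {..n})" by (simp add: Gcd_mult)
  finally have 0: "f 0 = g 0" using assms by simp
  show ?thesis
  proof
    fix j
    show "f j = g j"
    proof (cases "j \<le> n")
      case True
      then show ?thesis using proportional[of j 0] 0 assms(4)[of 0] by simp
    next
      case False
      then show ?thesis using assms(3)[of j] assms(4)[of j] by simp
    qed
  qed
qed

definition kernel_spanned :: "nat \<Rightarrow> (nat \<Rightarrow> nat \<Rightarrow> int) \<Rightarrow> (nat \<Rightarrow> real) \<Rightarrow> bool" where
  "kernel_spanned n M u \<longleftrightarrow>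
    (\<forall>v. (\<forall>i\<le>n. (\<Sum>j\<le>n. of_int (M i j) * v j) = 0) \<longrightarrow> (\<exists>c. \<forall>j\<le>n. v j = c * u j))"

lemma kernel_spannedD:
  assumes "kernel_spanned n M u" "\<And>i. i \<le> n \<Longrightarrow> (\<Sum>j\<le>n. real_of_int (M i j) * v j) = 0"
  shows "\<exists>c. \<forall>j\<le>n. v j = c * u j"
  using assms unfolding kernel_spanned_def by blast

lemma numerical_labels_eqI:
  assumes kernel: "kernel_spanned n M u"
    and f: "\<And>j. f j > 0 \<longleftrightarrow> j \<le> n" "Gcd (f ` {..n}) = 1" "\<And>i. i \<le> n \<Longrightarrow> (\<Sum>j\<le>n. M i j * int (f j)) = 0"
  shows "numerical_labels n M = f"
  unfolding numerical_labels_def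
proof (rule the_equality)
  show "(\<forall>j. (f j > 0) = (j \<le> n)) \<and> Gcd (f ` {..n}) = 1 \<and> (\<forall>i\<le>n. (\<Sum>j\<le>n. M i j * int (f j)) = 0)"
    using f by blast
  fix g assume g: "(\<forall>j. (g j > 0) = (j \<le> n)) \<and> Gcd (g ` {..n}) = 1 \<and> (\<forall>i\<le>n. (\<Sum>j\<le>n. M i j * int (g j)) = 0)"
  have in_kernel: "\<exists>c. \<forall>j\<le>n. real (h j) = c * u j" if "\<And>i. i \<le> n \<Longrightarrow> (\<Sum>j\<le>n. M i j * int (h j)) = 0" for h
  proof (rule kernel_spannedD[OF kernel])
    fix i assume "i \<le> n"
    from arg_cong[OF that[OF this], of real_of_int]
    show "(\<Sum>j\<le>n. real_of_int (M i j) * real (h j)) = 0" by simp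
  qed
  have g1: "\<And>j. g j > 0 \<longleftrightarrow> j \<le> n" "Gcd (g ` {..n}) = 1" "\<And>i. i \<le> n \<Longrightarrow> (\<Sum>j\<le>n. M i j * int (g j)) = 0"
    using g by blast+
  obtain c where c: "\<And>j. j \<le> n \<Longrightarrow> real (f j) = c * u j" using in_kernel[OF f(3)] by blast
  obtain d where d: "\<And>j. j \<le> n \<Longrightarrow> real (g j) = d * u j" using in_kernel[OF g1(3)] by blast
  have "g j * f k = g k * f j" if "j \<le> n" "k \<le> n" for j k
  proof -
    have "real (g j * f k) = real (g k * f j)" using c d that by simp
    then show ?thesis by (simp only: of_nat_eq_iff)
  qed
  then show "g = f" by (rule proportional_coprime_eq[OF g1(2) f(2) g1(1) f(1)])
qed

lemma affine_kernel: "affine_matrix n A \<Longrightarrow> \<exists>u. kernel_spanned n A u"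
  unfolding affine_matrix_def kernel_spanned_def mat_vec_def by (elim conjE exE) (rule exI)

lemma Gcd_eq_1_if: "(1::nat) \<in> S \<Longrightarrow> Gcd S = 1"
  by (metis Gcd_dvd nat_dvd_1_iff_1)

text \<open>Both label vectors are guessed and verified: each lies in the kernel and has an entry 1,
  hence is coprime. The kernel of the transpose is the kernel of A rescaled by a
  symmetrizer.\<close>

lemma root_data_comparisonI:
  fixes n :: nat and A A' :: "nat \<Rightarrow> nat \<Rightarrow> int" and e a :: "nat \<Rightarrow> int"
  defines "ci \<equiv> \<lambda>j. if is_A2_even n A \<and> j = n then 2 else (1::int)"
  assumes A: "irreducible_affine_Cartan_matrix n A" and n: "n \<ge> 1"
    and A': "\<And>i j. i \<le> n \<Longrightarrow> j \<le> n \<Longrightarrow> A' i j * ci j = A i j * ci i"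
    and e: "\<And>j. j \<le> n \<Longrightarrow> e j > 0" "e 0 = 1" and a: "\<And>j. j \<le> n \<Longrightarrow> a j > 0" "a 0 = 1" "\<And>j. j > n \<Longrightarrow> a j = 0"
    and symm: "\<And>i j. i \<le> n \<Longrightarrow> j \<le> n \<Longrightarrow> e i * A' i j = e j * A' j i"
    and null: "\<And>i. i \<le> n \<Longrightarrow> (\<Sum>j\<le>n. A' i j * a j) = 0"
    and even: "is_A2_even n A \<Longrightarrow> a n = 1"
  shows "root_data_comparison n A' e a A (if is_A2_even n A then 2 else 1)"
proof -
  let ?\<kappa> = "if is_A2_even n A then 2 else (1::int)"
  have ci: "ci j > 0" for j by (simp add: ci_def)
  have ci0: "ci 0 = 1" using n by (simp add: ci_def)
  have gcm: "A i i = 2" "i \<noteq> j \<Longrightarrow> A i j \<le> 0" if "i \<le> n" "j \<le> n" for i j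
    using A that unfolding irreducible_affine_Cartan_matrix_def generalized_Cartan_matrix_def by auto
  have zero: "A' i j = 0 \<longleftrightarrow> A i j = 0" if "i \<le> n" "j \<le> n" for i j
    using A'[OF that] ci[of i] ci[of j] by auto
  have root: "affine_root_datum n A' e a"
  proof
    show "A' i i = 2" if "i \<le> n" for i using A'[OF that that] gcm(1)[OF that that] ci[of i] by simp
    show "A' i j \<le> 0" if "i \<le> n" "j \<le> n" "i \<noteq> j" for i j
    proof -
      have "A' i j * ci j \<le> 0" using A' gcm(2) that ci[of i] by (simp add: mult_nonpos_nonneg)
      then show ?thesis using ci[of j] by (simp add: mult_le_0_iff)
    qed
    show "irreducible_matrix n A'"
      unfolding irreducible_matrix_def
    proof (rule notI, elim exE conjE)
      fix I assume I: "I \<noteq> {}" "I \<subset> {..n}" "\<forall>i\<in>I. \<forall>j\<in>{..n} - I. A' i j = 0 \<and> A' j i = 0"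
      have "A i j = 0 \<and> A j i = 0" if ij: "i \<in> I" "j \<in> {..n} - I" for i j
      proof -
        have "i \<le> n" "j \<le> n" using ij I(2) by auto
        then show ?thesis using zero[of i j] zero[of j i] I(3) ij by blast
      qed
      then have "\<exists>I. I \<noteq> {} \<and> I \<subset> {..n} \<and> (\<forall>i\<in>I. \<forall>j\<in>{..n} - I. A i j = 0 \<and> A j i = 0)"
        using I(1,2) by (intro exI[of _ I] conjI ballI) simp_all
      then show False using A by (simp add: irreducible_affine_Cartan_matrix_def irreducible_matrix_def)
    qed
  qed (use e a symm null in auto)
  have "affine_matrix n A" using A by (simp add: irreducible_affine_Cartan_matrix_def)
  from affine_kernel[OF this] obtain u where u: "kernel_spanned n A u" by (elim exE)
  \<comment> \<open>This is \<open>\<kappa>\<close> times a divided by ci. In type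
    \<open>A2_even\<close> the entries before n are doubled, and the entry 1 sits at n, which is why
    \<open>a n = 1\<close> is assumed there.\<close>
  define l where "l j = (if is_A2_even n A \<and> j < n then 2 * a j else a j)" for j
  have l_ci: "l j * ci j = ?\<kappa> * a j" if "j \<le> n" for j using that by (simp add: l_def ci_def)
  have l_pos: "l j > 0 \<longleftrightarrow> j \<le> n" for j using a(1)[of j] a(3)[of j] by (cases "j \<le> n") (auto simp: l_def)
  have l_one: "\<exists>j\<le>n. l j = 1"
  proof (cases "is_A2_even n A")
    case True
    then show ?thesis using even by (intro exI[of _ n]) (simp add: l_def)
  next
    case False
    then show ?thesis using a(2) by (intro exI[of _ 0]) (simp add: l_def)
  qed
  have labels: "numerical_labels n A = (\<lambda>j. nat (l j))"
  proof (rule numerical_labels_eqI[OF u])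
    show "Gcd ((\<lambda>j. nat (l j)) ` {..n}) = 1" using l_one by (intro Gcd_eq_1_if) force
    fix i assume i: "i \<le> n"
    have "ci i * (\<Sum>j\<le>n. A i j * int (nat (l j))) = (\<Sum>j\<le>n. ?\<kappa> * (A' i j * a j))"
      unfolding sum_distrib_left
    proof (rule sum.cong)
      fix j assume "j \<in> {..n}"
      then have j: "j \<le> n" by simp
      have "ci i * (A i j * int (nat (l j))) = (A' i j * ci j) * l j"
        using A'[OF i j] l_pos[of j] j by simp
      also have "\<dots> = A' i j * (l j * ci j)" by simp
      finally show "ci i * (A i j * int (nat (l j))) = ?\<kappa> * (A' i j * a j)" unfolding l_ci[OF j] by simp
    qed simp
    also have "\<dots> = 0" unfolding sum_distrib_left[symmetric] using null[OF i] by simp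
    finally show "(\<Sum>j\<le>n. A i j * int (nat (l j))) = 0" using ci[of i] by simp
  qed (use l_pos in auto)
  define m where "m j = e j * a j * ci j" for j
  have m_pos: "m j > 0 \<longleftrightarrow> j \<le> n" for j
    using a(1)[of j] a(3)[of j] e(1)[of j] ci[of j] by (cases "j \<le> n") (auto simp: m_def)
  \<comment> \<open>A symmetrizer of A itself, obtained from the symmetrizer \<open>e\<close> of the
    rescaled matrix \<open>A'\<close>.\<close>
  define w where "w j = real_of_int (e j * ci j * ci j)" for j
  have w_pos: "w j > 0" if "j \<le> n" for j
    using e(1)[OF that] ci[of j] unfolding w_def by simp
  have w_symm: "w i * A i j = w j * A j i" if "i \<le> n" "j \<le> n" for i j
  proof -
    have "e i * ci i * ci i * A i j = e i * ci i * (A' i j * ci j)" using A'[OF that] by simp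
    also have "\<dots> = (e i * A' i j) * ci i * ci j" by simp
    also have "\<dots> = e j * ci j * (A' j i * ci i)" using symm[OF that] by simp
    also have "\<dots> = e j * ci j * ci j * A j i" using A'[OF that(2,1)] by simp
    finally show ?thesis unfolding w_def by (metis of_int_mult)
  qed
  have dual: "dual_labels n A = (\<lambda>j. nat (m j))"
    unfolding dual_labels_def
  proof (rule numerical_labels_eqI[of n _ "\<lambda>j. w j * u j"])
    show "kernel_spanned n (\<lambda>i j. A j i) (\<lambda>j. w j * u j)"
      unfolding kernel_spanned_def
    proof (intro allI impI)
    fix v assume "\<forall>i\<le>n. (\<Sum>j\<le>n. real_of_int (A j i) * v j) = 0"
    then have v: "\<And>i. i \<le> n \<Longrightarrow> (\<Sum>j\<le>n. real_of_int (A j i) * v j) = 0" by blast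
    have "\<exists>c. \<forall>j\<le>n. v j / w j = c * u j"
    proof (rule kernel_spannedD[OF u])
      fix i assume i: "i \<le> n"
      have "w i * (\<Sum>j\<le>n. real_of_int (A i j) * (v j / w j)) = (\<Sum>j\<le>n. real_of_int (A j i) * v j)"
        unfolding sum_distrib_left
      proof (rule sum.cong)
        fix j assume "j \<in> {..n}"
        then have j: "j \<le> n" by simp
        have "w i * (real_of_int (A i j) * (v j / w j)) = (w i * A i j) * (v j / w j)" by simp
        also have "\<dots> = real_of_int (A j i) * v j" unfolding w_symm[OF i j] using w_pos[OF j] by simp
        finally show "w i * (real_of_int (A i j) * (v j / w j)) = real_of_int (A j i) * v j" .
      qed simp
      then show "(\<Sum>j\<le>n. real_of_int (A i j) * (v j / w j)) = 0" using v[OF i] w_pos[OF i] by simp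
    qed
    then obtain c where c: "\<And>j. j \<le> n \<Longrightarrow> v j / w j = c * u j" by blast
    have "v j = c * (w j * u j)" if "j \<le> n" for j
      using c[OF that] w_pos[OF that] by (simp add: field_simps)
    then show "\<exists>c. \<forall>j\<le>n. v j = c * (w j * u j)" by blast
    qed
  next
    have "nat (m 0) = 1" using e a ci0 by (simp add: m_def)
    then show "Gcd ((\<lambda>j. nat (m j)) ` {..n}) = 1" by (intro Gcd_eq_1_if) force
    fix i assume i: "i \<le> n"
    have "(\<Sum>j\<le>n. A j i * int (nat (m j))) = (\<Sum>j\<le>n. ci i * e i * (A' i j * a j))"
    proof (rule sum.cong)
      fix j assume "j \<in> {..n}"
      then have j: "j \<le> n" by simp
      have "A j i * int (nat (m j)) = (A j i * ci j) * (e j * a j)" using m_pos[of j] j by (simp add: m_def)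
      also have "A j i * ci j = A' j i * ci i" using A'[OF j i] by simp
      also have "A' j i * ci i * (e j * a j) = ci i * (e j * A' j i) * a j" by simp
      also have "\<dots> = ci i * e i * (A' i j * a j)" unfolding symm[OF j i] by simp
      finally show "A j i * int (nat (m j)) = ci i * e i * (A' i j * a j)" .
    qed simp
    also have "\<dots> = 0" unfolding sum_distrib_left[symmetric] using null[OF i] by simp
    finally show "(\<Sum>j\<le>n. A j i * int (nat (m j))) = 0" .
  qed (use m_pos in auto)
  interpret affine_root_datum n A' e a by (rule root)
  show ?thesis
  proof
    show "int (numerical_labels n A j) * (if is_A2_even n A \<and> j = n then 2 else 1) = ?\<kappa> * a j" if "j \<le> n" for j
      using l_ci[OF that] l_pos[of j] that by (simp add: labels ci_def)
    show "int (dual_labels n A j) = e j * a j * (if is_A2_even n A \<and> j = n then 2 else 1)" if "j \<le> n" for j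
      using m_pos[of j] that by (simp add: dual m_def ci_def)
  qed (use n A' in \<open>auto simp: ci_def\<close>)
qed

section \<open>The three kinds of affine Cartan matrices\<close>

lemma not_A2_even:
  assumes "is_A2_even n A" "n \<ge> 2"
  shows "A 0 1 = -2" "A (n - 1) n = -2"
  using assms unfolding is_A2_even_def has_kac_type_def by auto

context affine_root_datum
begin

text \<open>If \<open>A l l' = -1\<close>, reflecting \<open>al l'\<close> at l adds
  \<open>al l\<close>, so M passes from l' to l. At the affine node \<theta> is used instead: since
  it is minus \<open>al 0\<close> modulo \<delta>, its pairing with l is 1.\<close>

lemma generated_by_steps:
  assumes reach: "\<And>S. (\<And>l l'. l \<in> {1..n} \<Longrightarrow> l' = 0 \<or> l' \<in> S \<Longrightarrow> A l l' = -1 \<Longrightarrow> l \<in> S) \<Longrightarrow> {1..n} \<subseteq> S"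
    and M: "th \<in> M" "\<And>x y. x \<in> M \<Longrightarrow> y \<in> M \<Longrightarrow> x + y \<in> M" "\<And>x. x \<in> M \<Longrightarrow> - x \<in> M"
      "\<And>x i. x \<in> M \<Longrightarrow> i \<in> {1..n} \<Longrightarrow> pr i x = 1 \<or> pr i x = -1 \<Longrightarrow> srefl i x \<in> M"
    and j: "j \<in> {1..n}"
  shows "al j \<in> M"
proof -
  have "{1..n} \<subseteq> {l \<in> {1..n}. al l \<in> M}"
  proof (rule reach)
    fix l l' assume l: "l \<in> {1..n}" and l': "l' = 0 \<or> l' \<in> {l \<in> {1..n}. al l \<in> M}" and A: "A l l' = -1"
    have "al l \<in> M"
    proof (cases "l' = 0")
      case True
      then have pr: "pr l th = 1" using A l by (simp add: th_def pr_simps)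
      have "th + - srefl l th \<in> M" by (rule M(2)[OF M(1) M(3)[OF M(4)[OF M(1) l]]]) (simp add: pr)
      moreover have "th + - srefl l th = al l" using pr by (simp add: srefl_def fun_eq_iff)
      ultimately show ?thesis by metis
    next
      case False
      then have *: "al l' \<in> M" "l' \<le> n" using l' by auto
      have pr: "pr l (al l') = -1" using A * by (simp add: pr_al)
      have "srefl l (al l') + - al l' \<in> M" by (rule M(2)[OF M(4)[OF *(1) l] M(3)[OF *(1)]]) (simp add: pr)
      moreover have "srefl l (al l') + - al l' = al l" using pr by (simp add: srefl_def fun_eq_iff)
      ultimately show ?thesis by metis
    qed
    then show "l \<in> {l \<in> {1..n}. al l \<in> M}" using l by simp
  qed
  then show ?thesis using j by blast
qed

end

lemma single_laced_iso:
  fixes e a :: "nat \<Rightarrow> int"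
  assumes A: "irreducible_affine_Cartan_matrix n A" and n: "n \<ge> 2"
    and e: "\<And>j. j \<le> n \<Longrightarrow> e j > 0" "e 0 = 1" and a: "\<And>j. j \<le> n \<Longrightarrow> a j > 0" "a 0 = 1" "\<And>j. j > n \<Longrightarrow> a j = 0"
    and symm: "\<And>i j. i \<le> n \<Longrightarrow> j \<le> n \<Longrightarrow> e i * A i j = e j * A j i"
    and null: "\<And>i. i \<le> n \<Longrightarrow> (\<Sum>j\<le>n. A i j * a j) = 0"
    and few: "\<And>i j. i \<le> n \<Longrightarrow> j \<le> n \<Longrightarrow> i \<noteq> j \<Longrightarrow> A i j * A j i \<le> 3"
    and single: "\<And>i. i \<in> {1..n} \<Longrightarrow> A 0 i = 0 \<or> A 0 i = -1"
    and reach: "\<And>S. (\<And>l l'. l \<in> {1..n} \<Longrightarrow> l' = 0 \<or> l' \<in> S \<Longrightarrow> A l l' = -1 \<Longrightarrow> l \<in> S) \<Longrightarrow> {1..n} \<subseteq> S"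
    and js: "reduced_theta_decomposition n A js"
  shows "double_affine_Artin_group n A \<cong> triple_group_quotient n A js"
proof -
  have odd: "\<not> is_A2_even n A" using not_A2_even(1)[of n A] single[of 1] n by auto
  have "root_data_comparison n A e a A (if is_A2_even n A then 2 else 1)"
    by (rule root_data_comparisonI[OF A]) (use n e a symm null odd in auto)
  then interpret root_data_comparison n A e a A 1 using odd by simp
  interpret single_laced_datum n A e a js
  proof
    show "act js x = x - smul (B x th) th" for x by (rule reduced_theta(3)[OF js])
    show "al j \<in> M" if "th \<in> M" "\<And>x y. x \<in> M \<Longrightarrow> y \<in> M \<Longrightarrow> x + y \<in> M" "\<And>x. x \<in> M \<Longrightarrow> - x \<in> M"
      "\<And>x i. x \<in> M \<Longrightarrow> i \<in> {1..n} \<Longrightarrow> pr i x = 1 \<or> pr i x = -1 \<Longrightarrow> srefl i x \<in> M" "j \<in> {1..n}" for M j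
      by (rule generated_by_steps[OF reach that])
  qed (use reduced_theta[OF js] few n single in auto)
  interpret presentation_data n A e a A 1 js ..
  show ?thesis using presentations_isomorphic daa_if_triple triple_if_daa by blast
qed

definition D2_entry :: "nat \<Rightarrow> nat \<Rightarrow> nat \<Rightarrow> int" where
  "D2_entry n i j = (if i = j then 2 else if i = 0 \<and> j = 1 \<or> i = n \<and> Suc j = n then -2
    else if j = Suc i \<or> i = Suc j then -1 else 0)"

lemma row_sum:
  fixes M :: "nat \<Rightarrow> nat \<Rightarrow> int"
  assumes "distinct xs" "set xs \<subseteq> {..n}" "\<And>j. j \<le> n \<Longrightarrow> j \<notin> set xs \<Longrightarrow> M i j = 0"
  shows "(\<Sum>j\<le>n. M i j * f j) = (\<Sum>j\<leftarrow>xs. M i j * f j)"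
proof -
  have "(\<Sum>j\<le>n. M i j * f j) = (\<Sum>j\<in>set xs. M i j * f j)"
    using assms(2,3) by (intro sum.mono_neutral_right) auto
  then show ?thesis using assms(1) by (simp add: sum_list_distinct_conv_sum_set)
qed

lemma double_laced_iso:
  assumes A: "irreducible_affine_Cartan_matrix n A" and n: "n \<ge> 2"
    and A': "\<And>i j. i \<le> n \<Longrightarrow> j \<le> n \<Longrightarrow> D2_entry n i j * (if is_A2_even n A \<and> j = n then 2 else 1)
      = A i j * (if is_A2_even n A \<and> i = n then 2 else 1)"
    and js: "reduced_theta_decomposition n A js"
  shows "double_affine_Artin_group n A \<cong> triple_group_quotient n A js"
proof -
  let ?A = "D2_entry n" and ?e = "\<lambda>j. if j = 0 \<or> j = n then 1 else (2::int)"
    and ?a = "\<lambda>j. if j \<le> n then 1 else (0::int)"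
  have null: "(\<Sum>j\<le>n. ?A i j * ?a j) = 0" if i: "i \<le> n" for i
  proof -
    consider "i = 0" | "i = n" | "0 < i" "i < n" using i by linarith
    then show ?thesis
    proof cases
      case 1
      have "(\<Sum>j\<le>n. ?A i j * ?a j) = (\<Sum>j\<leftarrow>[0, 1]. ?A i j * ?a j)"
        by (rule row_sum) (use 1 n in \<open>auto simp: D2_entry_def\<close>)
      then show ?thesis using 1 n by (simp add: D2_entry_def)
    next
      case 2
      have "(\<Sum>j\<le>n. ?A i j * ?a j) = (\<Sum>j\<leftarrow>[n - 1, n]. ?A i j * ?a j)"
        by (rule row_sum) (use 2 n in \<open>auto simp: D2_entry_def\<close>)
      then show ?thesis using 2 n by (simp add: D2_entry_def)
    next
      case 3
      then obtain k where k: "i = Suc k" using gr0_implies_Suc by blast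
      have "(\<Sum>j\<le>n. ?A i j * ?a j) = (\<Sum>j\<leftarrow>[k, Suc k, Suc (Suc k)]. ?A i j * ?a j)"
        by (rule row_sum) (use 3 k n in \<open>auto simp: D2_entry_def\<close>)
      then show ?thesis using 3 k n by (simp add: D2_entry_def)
    qed
  qed
  define \<kappa> where "\<kappa> = (if is_A2_even n A then 2 else (1::int))"
  have "root_data_comparison n ?A ?e ?a A \<kappa>"
    unfolding \<kappa>_def
    by (rule root_data_comparisonI[OF A]) (use n null A' in \<open>auto simp: D2_entry_def\<close>)
  then interpret root_data_comparison n ?A ?e ?a A \<kappa> .
  \<comment> \<open>The partial sums of simple roots from k to n. Then \<theta> is
    \<open>eps 1\<close>, \<open>th - al 1\<close> is \<open>eps 2\<close>, and the reflection at k
    exchanges \<open>eps k\<close> and \<open>eps (Suc k)\<close> for 1 \<le> k < n.\<close>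
  define eps :: "nat \<Rightarrow> ivec" where "eps k = (\<lambda>j. if k \<le> j \<and> j \<le> n then 1 else 0)" for k
  have eps_step: "eps k = eps (Suc k) + al k" if "k \<le> n" for k
    using that by (auto simp: eps_def al_apply fun_eq_iff)
  have eps_n: "eps n = al n" by (auto simp: eps_def al_apply fun_eq_iff)
  have pr_eps: "pr k (eps (Suc k)) = -1" if k: "k \<in> {1..<n}" for k
  proof -
    have "pr k (eps (Suc k)) = (\<Sum>j\<leftarrow>[k - 1, k, k + 1]. ?A k j * eps (Suc k) j)"
      unfolding pr_def by (rule row_sum) (use k in \<open>auto simp: D2_entry_def\<close>)
    then show ?thesis using k by (simp add: eps_def D2_entry_def)
  qed
  have srefl_eps: "srefl k (eps (Suc k)) = eps k" if "k \<in> {1..<n}" for k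
    using pr_eps[OF that] eps_step[of k] that by (simp add: srefl_def fun_eq_iff)
  have srefl_eps': "srefl k (eps k) = eps (Suc k)" "pr k (eps k) = 1" if k: "k \<in> {1..<n}" for k
  proof -
    have "k \<le> n" using k by simp
    then show "srefl k (eps k) = eps (Suc k)" using srefl_eps[OF k] refl_refl by metis
    show "pr k (eps k) = 1" using eps_step[OF \<open>k \<le> n\<close>] pr_eps[OF k] \<open>k \<le> n\<close> by (simp add: pr_simps diag)
  qed
  have th: "th = eps 1" using n by (auto simp: th_def eps_def al_apply fun_eq_iff)
  \<comment> \<open>Stated for every k, as k = 1 gives \<open>generated\<close> and k = 2 gives
    \<open>generated'\<close>.\<close>
  have gen: "al j \<in> M" if M: "eps k \<in> M" "\<And>x y. x \<in> M \<Longrightarrow> y \<in> M \<Longrightarrow> x + y \<in> M" "\<And>x. x \<in> M \<Longrightarrow> - x \<in> M"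
      "\<And>x i. x \<in> M \<Longrightarrow> i \<in> {k..n} \<Longrightarrow> pr i x = 1 \<or> pr i x = -1 \<Longrightarrow> srefl i x \<in> M"
      and j: "j \<in> {k..n}" and k: "k \<ge> 1" for M j k
  proof -
    have eps: "eps i \<in> M" if "k \<le> i" "i \<le> n" for i
      using that
    proof (induction i rule: dec_induct)
      case (step i)
      then have "srefl i (eps i) \<in> M" using M(4)[of "eps i" i] srefl_eps'(2)[of i] k by auto
      then show ?case using srefl_eps'(1)[of i] step k by auto
    qed (rule M(1))
    show ?thesis
    proof (cases "j = n")
      case True
      then show ?thesis using eps[of n] eps_n j by simp
    next
      case False
      then have "eps j \<in> M" "eps (Suc j) \<in> M" using eps[of j] eps[of "Suc j"] j by auto
      then have "eps j + - eps (Suc j) \<in> M" using M(2,3) by metis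
      moreover have "eps j + - eps (Suc j) = al j" using eps_step[of j] j by simp
      ultimately show ?thesis by metis
    qed
  qed
  interpret affine_datum n ?A ?e ?a js
  proof
    show "act js x = x - smul (B x th) th" for x by (rule reduced_theta(3)[OF js])
    show "al j \<in> M" if "th \<in> M" "\<And>x y. x \<in> M \<Longrightarrow> y \<in> M \<Longrightarrow> x + y \<in> M" "\<And>x. x \<in> M \<Longrightarrow> - x \<in> M"
      "\<And>x i. x \<in> M \<Longrightarrow> i \<in> {1..n} \<Longrightarrow> pr i x = 1 \<or> pr i x = -1 \<Longrightarrow> srefl i x \<in> M" "j \<in> {1..n}" for M j
      by (rule gen[OF that(1)[unfolded th] that(2-5)]) simp_all
    show "?A i j * ?A j i \<le> 3 \<or> n = 1" if "i \<noteq> j" for i j using n that by (auto simp: D2_entry_def)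
  qed (use reduced_theta[OF js] n in auto)
  have up: "up n [k..<n] (eps k)" if "1 \<le> k" "k \<le> n" for k
    using that(2,1)
  proof (induction k rule: inc_induct)
    case base
    then show ?case using up.base eps_n by simp
  next
    case (step k)
    then have k: "k \<in> {1..<n}" "k \<in> {1..n}" by auto
    have "up n (k # [Suc k..<n]) (srefl k (eps (Suc k)))"
      using step k pr_eps[OF k(1)] by (intro up.step) auto
    then show ?case using srefl_eps[OF k(1)] k by (simp add: upt_conv_Cons)
  qed
  have th2: "th - al 1 = eps 2" using eps_step[of 1] n by (simp add: th numeral_2_eq_2)
  interpret double_laced_datum n ?A ?e ?a js "[2..<n]" n
  proof
    show "up n [2..<n] (th - al 1)" unfolding th2 using up[of 2] n by simp
    show "al j \<in> M" if "th - al 1 \<in> M" "\<And>x y. x \<in> M \<Longrightarrow> y \<in> M \<Longrightarrow> x + y \<in> M" "\<And>x. x \<in> M \<Longrightarrow> - x \<in> M"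
      "\<And>x i. x \<in> M \<Longrightarrow> i \<in> {2..n} \<Longrightarrow> pr i x = 1 \<or> pr i x = -1 \<Longrightarrow> srefl i x \<in> M" "j \<in> {2..n}" for M j
      by (rule gen[OF that(1)[unfolded th2] that(2-5)]) simp_all
  qed (use n in \<open>auto simp: D2_entry_def\<close>)
  interpret presentation_data n ?A ?e ?a A \<kappa> js ..
  show ?thesis using presentations_isomorphic daa_if_triple_double triple_if_daa_double by blast
qed

lemma rank_one_iso:
  assumes A: "irreducible_affine_Cartan_matrix 1 A"
    and type: "has_kac_type 1 A (A1 1) \<or> has_kac_type 1 A (A2_even 1)"
    and js: "reduced_theta_decomposition 1 A js"
  shows "double_affine_Artin_group 1 A \<cong> triple_group_quotient 1 A js"
proof -
  let ?A = "\<lambda>i j. if i = j then 2 else (-2::int)" and ?e = "\<lambda>j. 1 :: int"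
    and ?a = "\<lambda>j. if j \<le> (1::nat) then 1 else (0::int)"
  have le1: "i \<le> 1 \<longleftrightarrow> i = 0 \<or> i = 1" for i :: nat by auto
  have A': "?A i j * (if is_A2_even 1 A \<and> j = 1 then 2 else 1) = A i j * (if is_A2_even 1 A \<and> i = 1 then 2 else 1)"
    if "i \<le> 1" "j \<le> 1" for i j
    using type that unfolding le1 is_A2_even_def has_kac_type_def by auto
  define \<kappa> where "\<kappa> = (if is_A2_even 1 A then 2 else (1::int))"
  have "root_data_comparison 1 ?A ?e ?a A \<kappa>"
    unfolding \<kappa>_def
    by (rule root_data_comparisonI[OF A]) (use A' in auto)
  then interpret root_data_comparison 1 ?A ?e ?a A \<kappa> .
  interpret rank_one_datum 1 ?A ?e ?a js
  proof
    show "act js x = x - smul (B x th) th" for x by (rule reduced_theta(3)[OF js])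
    fix M j assume "th \<in> M" "j \<in> {1..1::nat}"
    moreover have "th = al 1" unfolding th_def by (auto simp: al_apply fun_eq_iff)
    ultimately show "al j \<in> M" by simp
  qed (use reduced_theta[OF js] in auto)
  interpret presentation_data 1 ?A ?e ?a A \<kappa> js ..
  show ?thesis using presentations_isomorphic daa_if_triple_rank_one triple_if_daa_rank_one by blast
qed

section \<open>The affine types\<close>

lemma kac_edge: "has_kac_type n A X \<Longrightarrow> (i, j, p, q) \<in> kac_diagram X \<Longrightarrow> A i j = - int p \<and> A j i = - int q"
  unfolding has_kac_type_def by fast

lemma kac_diag: "has_kac_type n A X \<Longrightarrow> i \<le> n \<Longrightarrow> A i i = 2"
  unfolding has_kac_type_def by blast

lemma kac_none:
  "has_kac_type n A X \<Longrightarrow> i \<le> n \<Longrightarrow> j \<le> n \<Longrightarrow> i \<noteq> j \<Longrightarrow> \<forall>p q. (i, j, p, q) \<notin> kac_diagram X \<Longrightarrow>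
    \<forall>p q. (j, i, p, q) \<notin> kac_diagram X \<Longrightarrow> A i j = 0"
  unfolding has_kac_type_def by blast

lemma mem_diagram_path: "(i, j, p, q) \<in> diagram_path k l \<longleftrightarrow> j = Suc i \<and> p = 1 \<and> q = 1 \<and> k \<le> i \<and> i < l"
  by (auto simp: diagram_path_def)

section \<open>Types of fixed rank, checked by evaluation\<close>

fun edge_matrix :: "(nat \<times> nat \<times> nat \<times> nat) list \<Rightarrow> nat \<Rightarrow> nat \<Rightarrow> int" where
  "edge_matrix [] i j = (if i = j then 2 else 0)"
| "edge_matrix ((k, l, p, q) # D) i j =
    (if i = k \<and> j = l then - int p else if i = l \<and> j = k then - int q else edge_matrix D i j)"

lemma edge_matrix_eq:
  assumes "has_kac_type n A X" "kac_diagram X = set D" "i \<le> n" "j \<le> n"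
    and "\<And>i p q. (i, i, p, q) \<notin> set D"
  shows "A i j = edge_matrix D i j"
proof -
  \<comment> \<open>Generalised to parts of the list that still contain every edge between i and
    j.\<close>
  have "A i j = edge_matrix D' i j" if "set D' \<subseteq> set D" "\<forall>p q. (i, j, p, q) \<in> set D \<longrightarrow> (i, j, p, q) \<in> set D'"
    "\<forall>p q. (j, i, p, q) \<in> set D \<longrightarrow> (j, i, p, q) \<in> set D'" for D'
    using that
  proof (induction D')
    case Nil
    then show ?case using kac_diag[OF assms(1,3)] kac_none[OF assms(1,3,4)] assms(2) by auto
  next
    case (Cons d D')
    obtain k l p q where d: "d = (k, l, p, q)" by (cases d)
    have kl: "A k l = - int p \<and> A l k = - int q" using kac_edge[OF assms(1)] Cons.prems(1) d assms(2) by auto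
    show ?case
    proof (cases "i = k \<and> j = l \<or> i = l \<and> j = k")
      case True
      then show ?thesis using kl d by auto
    next
      case False
      have "A i j = edge_matrix D' i j"
      proof (rule Cons.IH)
        show "set D' \<subseteq> set D" using Cons.prems(1) by simp
        show "\<forall>p q. (i, j, p, q) \<in> set D \<longrightarrow> (i, j, p, q) \<in> set D'"
          and "\<forall>p q. (j, i, p, q) \<in> set D \<longrightarrow> (j, i, p, q) \<in> set D'"
          using Cons.prems(2,3) False unfolding d by fastforce+
      qed
      moreover have "\<not> (i = k \<and> j = l)" "\<not> (i = l \<and> j = k)" using False by blast+
      ultimately show ?thesis unfolding d edge_matrix.simps by (simp only: if_False)
    qed
  qed
  from this[of D] show ?thesis by simp
qed

lemma diagram_path_eq: "diagram_path i j = set (map (\<lambda>k. (k, Suc k, 1, 1)) [i..<j])"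
  by (auto simp: diagram_path_def)

text \<open>Read from its end, the list is an order in which the nodes are reached from 0 by the
  steps of \<open>generated_by_steps\<close>.\<close>

fun connected_order :: "(nat \<Rightarrow> nat \<Rightarrow> int) \<Rightarrow> nat list \<Rightarrow> bool" where
  "connected_order M [] \<longleftrightarrow> True"
| "connected_order M (l # ls) \<longleftrightarrow> connected_order M ls \<and> (\<exists>l'\<in>set (0 # ls). M l l' = -1)"

text \<open>The hypotheses of \<open>single_laced_iso\<close> in executable form: \<open>es\<close>
  and \<open>as\<close> list the values of \<open>e\<close> and \<open>a\<close>, and
  \<open>ls\<close> witnesses reachability.\<close>

definition valid_data :: "nat \<Rightarrow> (nat \<times> nat \<times> nat \<times> nat) list \<Rightarrow> int list \<Rightarrow> int list \<Rightarrow> nat list \<Rightarrow> bool" where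
  "valid_data n D es as ls \<longleftrightarrow> n \<ge> 2 \<and> es ! 0 = 1 \<and> as ! 0 = 1 \<and> list_all (\<lambda>(i, j, p, q). i \<noteq> j) D \<and>
    set ls = set [1..<Suc n] \<and> connected_order (edge_matrix D) ls \<and>
    list_all (\<lambda>i. es ! i > 0 \<and> as ! i > 0 \<and>
      (\<Sum>j\<leftarrow>[0..<Suc n]. edge_matrix D i j * as ! j) = 0 \<and>
      (i = 0 \<or> edge_matrix D 0 i = 0 \<or> edge_matrix D 0 i = -1) \<and>
      list_all (\<lambda>j. es ! i * edge_matrix D i j = es ! j * edge_matrix D j i \<and>
        (i = j \<or> edge_matrix D i j * edge_matrix D j i \<le> 3)) [0..<Suc n]) [0..<Suc n]"

lemma valid_data_iso:
  assumes A: "irreducible_affine_Cartan_matrix n A" and type: "has_kac_type n A X"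
    and js: "reduced_theta_decomposition n A js"
    and D: "kac_diagram X = set D" and valid: "valid_data (type_rank X) D es as ls"
  shows "double_affine_Artin_group n A \<cong> triple_group_quotient n A js"
proof -
  have rank: "type_rank X = n" using type by (simp add: has_kac_type_def)
  have upto: "set [0..<Suc n] = {..n}" "set [1..<Suc n] = {1..n}" by auto
  note v = valid[unfolded rank valid_data_def list_all_iff upto]
  have n: "n \<ge> 2" using v by blast
  have entry: "A i j = edge_matrix D i j" if "i \<le> n" "j \<le> n" for i j
    using v by (intro edge_matrix_eq[OF type D that]) auto
  show ?thesis
  proof (rule single_laced_iso[OF A n, of "\<lambda>j. es ! j" "\<lambda>j. if j \<le> n then as ! j else 0"])
    fix S assume S: "\<And>l l'. l \<in> {1..n} \<Longrightarrow> l' = 0 \<or> l' \<in> S \<Longrightarrow> A l l' = -1 \<Longrightarrow> l \<in> S"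
    have reach: "set ks \<subseteq> S" if "connected_order (edge_matrix D) ks" "set ks \<subseteq> {1..n}" for ks
      using that
    proof (induction ks)
      case (Cons l ks)
      then obtain l' where l': "l' \<in> set (0 # ks)" "edge_matrix D l l' = -1" by auto
      have "l' \<le> n" "l \<in> {1..n}" using l'(1) Cons.prems(2) by auto
      then have "A l l' = -1" using l'(2) entry[of l l'] by simp
      moreover have ks: "set ks \<subseteq> S" using Cons by simp
      moreover from ks have "l' = 0 \<or> l' \<in> S" using l'(1) by auto
      ultimately show ?case using S[OF \<open>l \<in> {1..n}\<close>] by simp
    qed simp
    have "set ls = {1..n}" "connected_order (edge_matrix D) ls" using v by blast+
    then show "{1..n} \<subseteq> S" using reach[of ls] by simp
  next
    fix i assume i: "i \<le> n"
    have "(\<Sum>j\<le>n. A i j * (if j \<le> n then as ! j else 0)) = (\<Sum>j\<in>{..n}. edge_matrix D i j * as ! j)"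
      using entry[OF i] by (intro sum.cong) auto
    also have "\<dots> = (\<Sum>j\<leftarrow>[0..<Suc n]. edge_matrix D i j * as ! j)"
      by (simp only: sum_list_distinct_conv_sum_set[OF distinct_upt] upto(1))
    finally show "(\<Sum>j\<le>n. A i j * (if j \<le> n then as ! j else 0)) = 0" using v i by simp
  next
    fix i j assume "i \<le> n" "j \<le> n"
    then show "es ! i * A i j = es ! j * A j i" "i \<noteq> j \<Longrightarrow> A i j * A j i \<le> 3"
      using v entry by auto
  next
    fix i assume i: "i \<in> {1..n}"
    then have "i \<noteq> 0" "i \<in> {..n}" by simp_all
    moreover from this have "i = 0 \<or> edge_matrix D 0 i = 0 \<or> edge_matrix D 0 i = -1" using v by blast
    ultimately show "A 0 i = 0 \<or> A 0 i = -1" using entry[of 0 i] by simp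
  qed (use entry v js in auto)
qed

lemma E6_iso:
  assumes "irreducible_affine_Cartan_matrix n A" "has_kac_type n A E6_1" "reduced_theta_decomposition n A js"
  shows "double_affine_Artin_group n A \<cong> triple_group_quotient n A js"
proof (rule valid_data_iso[OF assms])
  let ?D = "[(1, 2, 1, 1), (2, 3, 1, 1), (3, 4, 1, 1), (4, 5, 1, 1), (3, 6, 1, 1), (6, 0, 1, 1)]"
  show "kac_diagram E6_1 = set ?D"
    by (simp add: diagram_path_eq upt_rec numeral_eq_Suc insert_commute)
  show "valid_data (type_rank E6_1) ?D [1, 1, 1, 1, 1, 1, 1] [1, 1, 2, 3, 2, 1, 2] [1, 5, 2, 4, 3, 6]"
    by code_simp
qed

lemma E7_iso:
  assumes "irreducible_affine_Cartan_matrix n A" "has_kac_type n A E7_1" "reduced_theta_decomposition n A js"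
  shows "double_affine_Artin_group n A \<cong> triple_group_quotient n A js"
proof (rule valid_data_iso[OF assms])
  let ?D = "[(0, 1, 1, 1), (1, 2, 1, 1), (2, 3, 1, 1), (3, 4, 1, 1), (4, 5, 1, 1), (5, 6, 1, 1), (3, 7, 1, 1)]"
  show "kac_diagram E7_1 = set ?D"
    by (simp add: diagram_path_eq upt_rec numeral_eq_Suc insert_commute)
  show "valid_data (type_rank E7_1) ?D [1, 1, 1, 1, 1, 1, 1, 1] [1, 2, 3, 4, 3, 2, 1, 2] [7, 6, 5, 4, 3, 2, 1]"
    by code_simp
qed

lemma E8_iso:
  assumes "irreducible_affine_Cartan_matrix n A" "has_kac_type n A E8_1" "reduced_theta_decomposition n A js"
  shows "double_affine_Artin_group n A \<cong> triple_group_quotient n A js"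
proof (rule valid_data_iso[OF assms])
  let ?D = "[(0, 1, 1, 1), (1, 2, 1, 1), (2, 3, 1, 1), (3, 4, 1, 1), (4, 5, 1, 1), (5, 6, 1, 1), (6, 7, 1, 1), (5, 8, 1, 1)]"
  show "kac_diagram E8_1 = set ?D"
    by (simp add: diagram_path_eq upt_rec numeral_eq_Suc insert_commute)
  show "valid_data (type_rank E8_1) ?D [1, 1, 1, 1, 1, 1, 1, 1, 1] [1, 2, 3, 4, 5, 6, 4, 2, 3] [8, 7, 6, 5, 4, 3, 2, 1]"
    by code_simp
qed

lemma E2_iso:
  assumes "irreducible_affine_Cartan_matrix n A" "has_kac_type n A E2" "reduced_theta_decomposition n A js"
  shows "double_affine_Artin_group n A \<cong> triple_group_quotient n A js"
proof (rule valid_data_iso[OF assms])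
  let ?D = "[(0, 1, 1, 1), (1, 2, 1, 1), (2, 3, 2, 1), (3, 4, 1, 1)]"
  show "kac_diagram E2 = set ?D"
    by (simp add: diagram_path_eq upt_rec numeral_eq_Suc insert_commute)
  show "valid_data (type_rank E2) ?D [1, 1, 1, 2, 2] [1, 2, 3, 2, 1] [4, 3, 2, 1]"
    by code_simp
qed

lemma D3_iso:
  assumes "irreducible_affine_Cartan_matrix n A" "has_kac_type n A D3" "reduced_theta_decomposition n A js"
  shows "double_affine_Artin_group n A \<cong> triple_group_quotient n A js"
proof (rule valid_data_iso[OF assms])
  let ?D = "[(0, 1, 1, 1), (1, 2, 3, 1)]"
  show "kac_diagram D3 = set ?D"
    by (simp add: diagram_path_eq upt_rec numeral_eq_Suc insert_commute)
  show "valid_data (type_rank D3) ?D [1, 1, 3] [1, 2, 1] [2, 1]"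
    by code_simp
qed

section \<open>Series of types with arbitrary rank\<close>

lemma A1_iso:
  assumes A: "irreducible_affine_Cartan_matrix n A" and type: "has_kac_type n A (A1 n)" and n: "n \<ge> 2"
    and js: "reduced_theta_decomposition n A js"
  shows "double_affine_Artin_group n A \<cong> triple_group_quotient n A js"
proof -
  have D: "kac_diagram (A1 n) = diagram_path 0 n \<union> {(n, 0, 1, 1)}" using n by simp
  have entry: "A i j = (if i = j then 2 else if j = Suc i \<or> i = Suc j \<or> i = 0 \<and> j = n \<or> i = n \<and> j = 0
      then -1 else 0)" (is "_ = ?M i j") if ij: "i \<le> n" "j \<le> n" for i j
  proof -
    consider "i = j" | "i \<noteq> j" "j = Suc i" | "i \<noteq> j" "i = Suc j" | "i \<noteq> j" "i = 0" "j = n" | "i \<noteq> j" "i = n" "j = 0"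
      | "i \<noteq> j" "j \<noteq> Suc i" "i \<noteq> Suc j" "\<not> (i = 0 \<and> j = n)" "\<not> (i = n \<and> j = 0)" by blast
    then show ?thesis
    proof cases
      case 1
      then show ?thesis using kac_diag[OF type] ij by simp
    next
      case 2
      then show ?thesis using kac_edge[OF type, of i j 1 1] ij unfolding D by (simp add: mem_diagram_path)
    next
      case 3
      then show ?thesis using kac_edge[OF type, of j i 1 1] ij unfolding D by (simp add: mem_diagram_path)
    next
      case 4
      then show ?thesis using kac_edge[OF type, of j i 1 1] unfolding D by simp
    next
      case 5
      then show ?thesis using kac_edge[OF type, of i j 1 1] unfolding D by simp
    next
      case 6
      then have "A i j = 0" unfolding D by (intro kac_none[OF type ij]) (auto simp: mem_diagram_path D)
      then show ?thesis using 6 by simp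
    qed
  qed
  show ?thesis
  proof (rule single_laced_iso[OF A n, of "\<lambda>j. 1" "\<lambda>j. if j \<le> n then 1 else 0"])
    fix i assume i: "i \<le> n"
    consider "i = 0" | "i = n" | k where "i = Suc k" "i < n" using i not0_implies_Suc by (cases "i = n"; cases "i = 0") auto
    then show "(\<Sum>j\<le>n. A i j * (if j \<le> n then 1 else 0)) = 0"
    proof cases
      case 1
      have "(\<Sum>j\<le>n. A i j * (if j \<le> n then 1 else 0)) = (\<Sum>j\<leftarrow>[0, 1, n]. A i j * (if j \<le> n then 1 else 0))"
        by (rule row_sum) (use 1 n entry in auto)
      then show ?thesis using 1 n by (simp add: entry)
    next
      case 2
      have "(\<Sum>j\<le>n. A i j * (if j \<le> n then 1 else 0)) = (\<Sum>j\<leftarrow>[0, n - 1, n]. A i j * (if j \<le> n then 1 else 0))"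
        by (rule row_sum) (use 2 n entry in auto)
      then show ?thesis using 2 n by (simp add: entry)
    next
      case 3
      have "(\<Sum>j\<le>n. A i j * (if j \<le> n then 1 else 0)) = (\<Sum>j\<leftarrow>[k, Suc k, Suc (Suc k)]. A i j * (if j \<le> n then 1 else 0))"
        by (rule row_sum) (use 3 n entry in auto)
      then show ?thesis using 3 n by (simp add: entry)
    qed
  next
    fix S assume S: "\<And>l l'. l \<in> {1..n} \<Longrightarrow> l' = 0 \<or> l' \<in> S \<Longrightarrow> A l l' = -1 \<Longrightarrow> l \<in> S"
    have "l \<in> S" if "1 \<le> l" "l \<le> n" for l
      using that
    proof (induction l rule: dec_induct)
      case base
      then show ?case using S[of 1 0] n by (simp add: entry)
    next
      case (step l)
      then show ?case using S[of "Suc l" l] by (simp add: entry)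
    qed
    then show "{1..n} \<subseteq> S" by auto
  qed (use entry n js in auto)
qed

lemma D1_iso:
  assumes A: "irreducible_affine_Cartan_matrix n A" and type: "has_kac_type n A (D1 n)"
    and js: "reduced_theta_decomposition n A js"
  shows "double_affine_Artin_group n A \<cong> triple_group_quotient n A js"
proof -
  have n4: "n \<ge> 4" using type by (simp add: has_kac_type_def)
  \<comment> \<open>The branch node at the far end, joined to both n - 1 and n.\<close>
  define m where "m = n - 2"
  have m: "n = Suc (Suc m)" "m \<ge> 2" using n4 by (simp_all add: m_def)
  have D: "kac_diagram (D1 n) = {(0, 2, 1, 1)} \<union> diagram_path 1 (Suc m) \<union> {(m, n, 1, 1)}"
    using m by simp
  define E where "E i j \<longleftrightarrow> i = 0 \<and> j = 2 \<or> j = Suc i \<and> 1 \<le> i \<and> i \<le> m \<or> i = m \<and> j = n" for i j :: nat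
  have entry: "A i j = (if i = j then 2 else if E i j \<or> E j i then -1 else 0)" if ij: "i \<le> n" "j \<le> n" for i j
  proof -
    have edge: "(i, j, 1, 1) \<in> kac_diagram (D1 n)" if "E i j" for i j
      using that unfolding E_def D by (auto simp: mem_diagram_path)
    have "E i j" if "(i, j, p, q) \<in> kac_diagram (D1 n)" for i j p q
      using that unfolding E_def D by (auto simp: mem_diagram_path)
    then have "A i j = 0" if "i \<noteq> j" "\<not> E i j" "\<not> E j i"
      using that by (intro kac_none[OF type ij]) blast+
    then show ?thesis
      using kac_diag[OF type ij(1)] kac_edge[OF type edge, of i j] kac_edge[OF type edge, of j i] by auto
  qed
  let ?a = "\<lambda>j. if j > n then 0 else if j \<le> 1 \<or> j > m then 1 else (2::int)"
  have n2: "n \<ge> 2" using m by simp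
  show ?thesis
  proof (rule single_laced_iso[OF A n2, of "\<lambda>j. 1" ?a])
    fix i assume i: "i \<le> n"
    \<comment> \<open>m = 2 means n = 4, where both branch nodes coincide and node 2 has four
      neighbours.\<close>
    consider "i = 0" | "i = 1" | "i = 2" "m = 2" | "i = 2" "m > 2" | k where "i = Suc k" "k \<ge> 2" "i < m"
      | k where "i = Suc k" "k \<ge> 2" "i = m" | "i = Suc m" | "i = n"
    proof -
      assume *: "i = 0 \<Longrightarrow> thesis" "i = 1 \<Longrightarrow> thesis" "i = 2 \<Longrightarrow> m = 2 \<Longrightarrow> thesis" "i = 2 \<Longrightarrow> m > 2 \<Longrightarrow> thesis"
        "\<And>k. i = Suc k \<Longrightarrow> k \<ge> 2 \<Longrightarrow> i < m \<Longrightarrow> thesis" "\<And>k. i = Suc k \<Longrightarrow> k \<ge> 2 \<Longrightarrow> i = m \<Longrightarrow> thesis"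
        "i = Suc m \<Longrightarrow> thesis" "i = n \<Longrightarrow> thesis"
      show thesis
      proof (cases "i \<le> 2")
        case True
        then have "i = 0 \<or> i = 1 \<or> i = 2" by linarith
        then show thesis using * m by (metis le_neq_implies_less)
      next
        case False
        obtain k where k: "i = Suc k" using False by (cases i) auto
        then have k: "i = Suc k" "k \<ge> 2" using False by simp_all
        have "i < m \<or> i = m \<or> i = Suc m \<or> i = n" using i m by linarith
        then show thesis using * k by blast
      qed
    qed
    then show "(\<Sum>j\<le>n. A i j * ?a j) = 0"
    proof cases
      case 1
      have "(\<Sum>j\<le>n. A i j * ?a j) = (\<Sum>j\<leftarrow>[0, 2]. A i j * ?a j)"
        by (rule row_sum) (use 1 m entry in \<open>auto simp: E_def\<close>)
      then show ?thesis using 1 m by (simp add: entry E_def)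
    next
      case 2
      have "(\<Sum>j\<le>n. A i j * ?a j) = (\<Sum>j\<leftarrow>[1, 2]. A i j * ?a j)"
        by (rule row_sum) (use 2 m entry in \<open>auto simp: E_def\<close>)
      then show ?thesis using 2 m by (simp add: entry E_def)
    next
      case 3
      have "(\<Sum>j\<le>n. A i j * ?a j) = (\<Sum>j\<leftarrow>[0, 1, 2, 3, 4]. A i j * ?a j)"
        by (rule row_sum) (use 3 m entry in \<open>auto simp: E_def\<close>)
      then show ?thesis using 3 m by (simp add: entry E_def)
    next
      case 4
      have "(\<Sum>j\<le>n. A i j * ?a j) = (\<Sum>j\<leftarrow>[0, 1, 2, 3]. A i j * ?a j)"
        by (rule row_sum) (use 4 m entry in \<open>auto simp: E_def\<close>)
      then show ?thesis using 4 m by (simp add: entry E_def)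
    next
      case 5
      have "(\<Sum>j\<le>n. A i j * ?a j) = (\<Sum>j\<leftarrow>[k, Suc k, Suc (Suc k)]. A i j * ?a j)"
        by (rule row_sum) (use 5 m entry in \<open>auto simp: E_def\<close>)
      then show ?thesis using 5 m by (simp add: entry E_def)
    next
      case 6
      have "(\<Sum>j\<le>n. A i j * ?a j) = (\<Sum>j\<leftarrow>[k, Suc k, Suc (Suc k), Suc (Suc (Suc k))]. A i j * ?a j)"
        by (rule row_sum) (use 6 m entry in \<open>auto simp: E_def\<close>)
      then show ?thesis using 6 m by (simp add: entry E_def)
    next
      case 7
      have "(\<Sum>j\<le>n. A i j * ?a j) = (\<Sum>j\<leftarrow>[m, Suc m]. A i j * ?a j)"
        by (rule row_sum) (use 7 m entry in \<open>auto simp: E_def\<close>)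
      then show ?thesis using 7 m by (simp add: entry E_def)
    next
      case 8
      have "(\<Sum>j\<le>n. A i j * ?a j) = (\<Sum>j\<leftarrow>[m, n]. A i j * ?a j)"
        by (rule row_sum) (use 8 m entry in \<open>auto simp: E_def\<close>)
      then show ?thesis using 8 m by (simp add: entry E_def)
    qed
  next
    fix S assume S: "\<And>l l'. l \<in> {1..n} \<Longrightarrow> l' = 0 \<or> l' \<in> S \<Longrightarrow> A l l' = -1 \<Longrightarrow> l \<in> S"
    have 2: "2 \<in> S" using S[of 2 0] m by (simp add: entry E_def)
    have step: "l \<in> S" if "2 \<le> l" "l \<le> Suc m" for l
      using that
    proof (induction l rule: dec_induct)
      case (step l)
      then show ?case using S[of "Suc l" l] m by (simp add: entry E_def)
    qed (rule 2)
    have "1 \<in> S" using S[of 1 2] 2 m by (simp add: entry E_def)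
    moreover have "n \<in> S" using S[of n m] step[of m] m by (simp add: entry E_def)
    moreover have "l = 1 \<or> l = n \<or> 2 \<le> l \<and> l \<le> Suc m" if "l \<in> {1..n}" for l using that m by auto
    ultimately show "{1..n} \<subseteq> S" using step by blast
  qed (use entry m js in \<open>auto simp: E_def\<close>)
qed

lemma A2_odd_iso:
  assumes A: "irreducible_affine_Cartan_matrix n A" and type: "has_kac_type n A (A2_odd n)"
    and js: "reduced_theta_decomposition n A js"
  shows "double_affine_Artin_group n A \<cong> triple_group_quotient n A js"
proof -
  have n3: "n \<ge> 3" using type by (simp add: has_kac_type_def)
  define m where "m = n - 1"
  have m: "n = Suc m" "m \<ge> 2" using n3 by (simp_all add: m_def)
  have D: "kac_diagram (A2_odd n) = {(0, 2, 1, 1)} \<union> diagram_path 1 m \<union> {(m, n, 2, 1)}"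
    using m by simp
  define E where "E i j \<longleftrightarrow> i = 0 \<and> j = 2 \<or> j = Suc i \<and> 1 \<le> i \<and> i \<le> m" for i j :: nat
  have entry: "A i j = (if i = j then 2 else if i = m \<and> j = n then -2 else if E i j \<or> E j i then -1 else 0)"
    if ij: "i \<le> n" "j \<le> n" for i j
  proof -
    have edge: "(i, j, 1, 1) \<in> kac_diagram (A2_odd n)" if "E i j" "i \<noteq> m" for i j
      using that unfolding E_def D by (auto simp: mem_diagram_path)
    have "(m, n, 2, 1) \<in> kac_diagram (A2_odd n)" unfolding D by simp
    from kac_edge[OF type this] have last: "A m n = -2" "A n m = -1" by simp_all
    have "E i j" if "(i, j, p, q) \<in> kac_diagram (A2_odd n)" for i j p q
      using that m unfolding E_def D by (auto simp: mem_diagram_path)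
    then have none: "A i j = 0" if "i \<noteq> j" "\<not> E i j" "\<not> E j i"
      using that by (intro kac_none[OF type ij]) blast+
    have Em: "E m k \<longleftrightarrow> k = n" for k using m by (auto simp: E_def)
    show ?thesis
    proof (cases "i = m \<and> j = n \<or> i = n \<and> j = m")
      case True
      have "E m n" "n \<noteq> m" using Em m by simp_all
      then show ?thesis using last True by (elim disjE conjE) simp_all
    next
      case False
      then show ?thesis
        using none kac_diag[OF type ij(1)] kac_edge[OF type edge, of i j] kac_edge[OF type edge, of j i] Em by auto
    qed
  qed
  let ?a = "\<lambda>j. if j > n then 0 else if j \<le> 1 \<or> j > m then 1 else (2::int)"
  have n2: "n \<ge> 2" using m by simp
  show ?thesis
  proof (rule single_laced_iso[OF A n2, of "\<lambda>j. if j = n then 2 else 1" ?a])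
    fix i assume i: "i \<le> n"
    consider "i = 0" | "i = 1" | "i = 2" | k where "i = Suc k" "k \<ge> 2" "i \<le> m" | "i = n" "n > 2"
    proof -
      assume *: "i = 0 \<Longrightarrow> thesis" "i = 1 \<Longrightarrow> thesis" "i = 2 \<Longrightarrow> thesis"
        "\<And>k. i = Suc k \<Longrightarrow> k \<ge> 2 \<Longrightarrow> i \<le> m \<Longrightarrow> thesis" "i = n \<Longrightarrow> n > 2 \<Longrightarrow> thesis"
      show thesis
      proof (cases "i \<le> 2")
        case True
        then have "i = 0 \<or> i = 1 \<or> i = 2" by linarith
        then show thesis using * by blast
      next
        case False
        obtain k where k: "i = Suc k" using False by (cases i) auto
        then have k: "i = Suc k" "k \<ge> 2" using False by simp_all
        have "i \<le> m \<or> i = n" using i m by linarith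
        then show thesis using * k False by auto
      qed
    qed
    then show "(\<Sum>j\<le>n. A i j * ?a j) = 0"
    proof cases
      case 1
      have "(\<Sum>j\<le>n. A i j * ?a j) = (\<Sum>j\<leftarrow>[0, 2]. A i j * ?a j)"
        by (rule row_sum) (use 1 m entry in \<open>auto simp: E_def\<close>)
      then show ?thesis using 1 m by (simp add: entry E_def)
    next
      case 2
      have "(\<Sum>j\<le>n. A i j * ?a j) = (\<Sum>j\<leftarrow>[1, 2]. A i j * ?a j)"
        by (rule row_sum) (use 2 m entry in \<open>auto simp: E_def\<close>)
      then show ?thesis using 2 m by (simp add: entry E_def)
    next
      case 3
      have "(\<Sum>j\<le>n. A i j * ?a j) = (\<Sum>j\<leftarrow>[0, 1, 2, 3]. A i j * ?a j)"
        by (rule row_sum) (use 3 m entry in \<open>auto simp: E_def\<close>)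
      then show ?thesis using 3 m by (simp add: entry E_def)
    next
      case 4
      have "(\<Sum>j\<le>n. A i j * ?a j) = (\<Sum>j\<leftarrow>[k, Suc k, Suc (Suc k)]. A i j * ?a j)"
        by (rule row_sum) (use 4 m entry in \<open>auto simp: E_def\<close>)
      then show ?thesis using 4 m by (simp add: entry E_def)
    next
      case 5
      have "(\<Sum>j\<le>n. A i j * ?a j) = (\<Sum>j\<leftarrow>[m, n]. A i j * ?a j)"
        by (rule row_sum) (use 5 m entry in \<open>auto simp: E_def\<close>)
      then show ?thesis using 5 m by (simp add: entry E_def)
    qed
  next
    fix S assume S: "\<And>l l'. l \<in> {1..n} \<Longrightarrow> l' = 0 \<or> l' \<in> S \<Longrightarrow> A l l' = -1 \<Longrightarrow> l \<in> S"
    have 2: "2 \<in> S" using S[of 2 0] m by (simp add: entry E_def)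
    have step: "l \<in> S" if "2 \<le> l" "l \<le> n" for l
      using that
    proof (induction l rule: dec_induct)
      case (step l)
      then show ?case using S[of "Suc l" l] m by (simp add: entry E_def)
    qed (rule 2)
    moreover have "1 \<in> S" using S[of 1 2] 2 m by (simp add: entry E_def)
    moreover have "l = 1 \<or> 2 \<le> l \<and> l \<le> n" if "l \<in> {1..n}" for l using that by auto
    ultimately show "{1..n} \<subseteq> S" by blast
  qed (use entry m js in \<open>auto simp: E_def\<close>)
qed

lemma D2_A2_even_iso:
  assumes A: "irreducible_affine_Cartan_matrix n A" and n: "n \<ge> 2"
    and type: "has_kac_type n A X" "X = D2 n \<or> X = A2_even n"
    and js: "reduced_theta_decomposition n A js"
  shows "double_affine_Artin_group n A \<cong> triple_group_quotient n A js"
proof (rule double_laced_iso[OF A n _ js])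
  \<comment> \<open>The two diagrams differ only in the direction of the last edge, recorded by p
    and q; the rescaling at n in the goal compensates for it.\<close>
  define p q :: nat where "p = (if X = D2 n then 1 else 2)" and "q = (if X = D2 n then 2 else 1)"
  have pq: "kac_diagram X = {(0, 1, 2, 1)} \<union> diagram_path 1 (n - 1) \<union> {(n - 1, n, p, q)}"
    "X = D2 n \<and> p = 1 \<and> q = 2 \<or> X = A2_even n \<and> p = 2 \<and> q = 1"
    using type(2) n by (auto simp: p_def q_def)
  have "(n - 1, n, p, q) \<in> kac_diagram X" "(0, 1, 2, 1) \<in> kac_diagram X" unfolding pq(1) by simp_all
  from this[THEN kac_edge[OF type(1)]]
  have last: "A (n - 1) n = - int p" "A n (n - 1) = - int q" and first: "A 0 1 = -2" "A 1 0 = -1" by simp_all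
  have even: "is_A2_even n A \<longleftrightarrow> p = 2 \<and> q = 1"
  proof
    assume "p = 2 \<and> q = 1"
    then have "X = A2_even n" using pq(2) by linarith
    then show "is_A2_even n A" using type(1) unfolding is_A2_even_def by (simp only:)
  next
    assume "is_A2_even n A"
    then have "has_kac_type n A (A2_even n)" unfolding is_A2_even_def .
    moreover have "(n - 1, n, 2, 1) \<in> kac_diagram (A2_even n)" using n by simp
    ultimately have "A (n - 1) n = - int 2" using kac_edge by blast
    then have "p = 2" using last(1) by simp
    then show "p = 2 \<and> q = 1" using pq(2) by linarith
  qed
  fix i j assume ij: "i \<le> n" "j \<le> n"
  consider (diag) "i = j" | (up) "j = Suc i" | (down) "i = Suc j" | (far) "i \<noteq> j" "j \<noteq> Suc i" "i \<noteq> Suc j" by blast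
  then consider "i = j" | "i = 0" "j = 1" | "i = 1" "j = 0" | "i = n - 1" "j = n" | "i = n" "j = n - 1"
    | "j = Suc i" "1 \<le> i" "j < n" | "i = Suc j" "1 \<le> j" "i < n" | "i \<noteq> j" "j \<noteq> Suc i" "i \<noteq> Suc j"
  proof cases
    case up
    then have "i = 0 \<or> j = n \<or> 1 \<le> i \<and> j < n" using ij by linarith
    then show ?thesis using up that(2,4,6) by auto
  next
    case down
    then have "j = 0 \<or> i = n \<or> 1 \<le> j \<and> i < n" using ij by linarith
    then show ?thesis using down that(3,5,7) by auto
  qed (use that(1,8) in blast)+
  then show "D2_entry n i j * (if is_A2_even n A \<and> j = n then 2 else 1)
      = A i j * (if is_A2_even n A \<and> i = n then 2 else 1)"
  proof cases
    case 1
    then show ?thesis using kac_diag[OF type(1)] ij by (simp add: D2_entry_def)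
  next
    case 2
    then show ?thesis using first n by (simp add: D2_entry_def)
  next
    case 3
    then show ?thesis using first n by (simp add: D2_entry_def)
  next
    case 4
    have "D2_entry n (n - 1) n = -1" "n - 1 \<noteq> n" using n by (auto simp: D2_entry_def)
    moreover have "int p = (if is_A2_even n A then 2 else 1)" using pq(2) unfolding even by (elim disjE) simp_all
    ultimately show ?thesis unfolding 4 last by (simp only: HOL.simp_thms if_False)
  next
    case 5
    have "D2_entry n n (n - 1) = -2" "n - 1 \<noteq> n" using n by (auto simp: D2_entry_def)
    moreover have "int q * (if is_A2_even n A then 2 else 1) = 2" using pq(2) unfolding even by (elim disjE) simp_all
    ultimately show ?thesis unfolding 5 last by (simp only: HOL.simp_thms if_False)
  next
    case 6
    then have "(i, j, 1, 1) \<in> kac_diagram X" unfolding pq(1) by (simp add: mem_diagram_path)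
    then have "A i j = -1" using kac_edge[OF type(1)] by fastforce
    then show ?thesis using 6 by (simp add: D2_entry_def)
  next
    case 7
    then have "(j, i, 1, 1) \<in> kac_diagram X" unfolding pq(1) by (simp add: mem_diagram_path)
    then have "A i j = -1" using kac_edge[OF type(1)] by fastforce
    then show ?thesis using 7 by (simp add: D2_entry_def)
  next
    case 8
    then have "A i j = 0" using n by (intro kac_none[OF type(1) ij]) (auto simp: mem_diagram_path pq(1))
    then show ?thesis using 8 n by (auto simp: D2_entry_def)
  qed
qed

theorem theorem3p10:
  fixes n :: nat and A :: "nat \<Rightarrow> nat \<Rightarrow> int" and js :: "nat list"
  assumes "irreducible_affine_Cartan_matrix n A"
    and "kac_labelled n A"
    and "\<not> has_kac_type n A (B1 n)"
    and "\<not> has_kac_type n A (C1 n)"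
    and "\<not> has_kac_type n A F4_1"
    and "\<not> has_kac_type n A G2_1"
    and "reduced_theta_decomposition n A js"
  shows "double_affine_Artin_group n A \<cong> triple_group_quotient n A js"
proof -
  note A = assms(1) and js = assms(7)
  obtain X where X: "has_kac_type n A X" using assms(2) by (auto simp: kac_labelled_def)
  then have rank: "n = type_rank X" "valid_type X" by (auto simp: has_kac_type_def)
  have one: ?thesis if "n = 1" "X = A1 n \<or> X = A2_even n"
    using rank_one_iso[of A js] A js X that by auto
  show ?thesis
  proof (cases X)
    case (A1 m)
    then show ?thesis using one A1_iso[OF A _ _ js] X rank by (cases "n = 1") auto
  next
    case (D1 m)
    then show ?thesis using D1_iso[OF A _ js] X rank by simp
  next
    case (A2_odd m)
    then show ?thesis using A2_odd_iso[OF A _ js] X rank by simp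
  next
    case (A2_even m)
    then show ?thesis using one D2_A2_even_iso[OF A _ X _ js] rank by (cases "n = 1") auto
  next
    case (D2 m)
    then show ?thesis using D2_A2_even_iso[OF A _ X _ js] rank by auto
  qed (use X rank assms E6_iso[OF A _ js] E7_iso[OF A _ js] E8_iso[OF A _ js] E2_iso[OF A _ js] D3_iso[OF A _ js] in auto)
qed

end
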